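(* Let $\mathbb{G}$ be a homogeneous group of homogeneous dimension $Q\ge5$, let $|\cdot|$ be a homogeneous quasi-norm on $\mathbb{G}$, and let $\mathcal{R}$ be the associated radial derivative operator. Then for all complex-valued functions $f\in C_0^\infty(\mathbb{G}\setminus\{0\})$, $$\left\|\frac{f}{|x|^2}\right\|_{L^2(\mathbb{G})}\le\frac{4}{Q(Q-4)}\left\|\mathcal{R}^2f+\frac{Q-1}{|x|}\mathcal{R}f\right\|_{L^2(\mathbb{G})}.$$ The constant $\frac{4}{Q(Q-4)}$ is sharp (it is the smallest constant for which the inequality holds for all such $f$), and it is attained (i.e. equality holds) if and only if $f=0$.
   Context: A homogeneous group $\mathbb{G}$ is a connected, simply connected Lie group whose Lie algebra $\mathfrak{g}$ is equipped with a family of dilations $D_\lambda=\mathrm{Exp}(A\ln\lambda)=\sum_{k\ge0}\frac{1}{k!}(\ln(\lambda)A)^k$, $\lambda>0$, where $A$ is a diagonalisable linear operator on $\mathfrak{g}$ with positive eigenvalues and each $D_\lambda$ is a Lie algebra morphism. Such a group is nilpotent and the exponential map $\exp_{\mathbb{G}}:\mathfrak{g}\to\mathbb{G}$ is a global diffeomorphism; it transports the dilations to $\mathbb{G}$, where they are written $D_\lambda x$ or $\lambda x$, i.e. $D_\lambda(\exp_{\mathbb{G}}X)=\exp_{\mathbb{G}}(D_\lambda X)$. The homogeneous dimension is $Q=\mathrm{Tr}\,A$. The identity element of $\mathbb{G}$ is denoted $0$, $dx$ denotes Haar measure on $\mathbb{G}$, and $L^2(\mathbb{G})$ is taken with respect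 to $dx$. A homogeneous quasi-norm is a continuous function $|\cdot|:\mathbb{G}\to[0,\infty)$ with $|x^{-1}|=|x|$ for all $x\in\mathbb{G}$, $|\lambda x|=\lambda|x|$ for all $x\in\mathbb{G}$, $\lambda>0$, and $|x|=0$ if and only if $x=0$. The operator $\mathcal{R}=\frac{d}{d|x|}$ is the radial derivative: for $x\neq 0$, writing $x=D_{\rho}y$ with $\rho=|x|$ and $|y|=1$, $\mathcal{R}f(x)=\frac{d}{dr}f(D_r y)\big|_{r=\rho}$. $\mathcal{R}^2f=\mathcal{R}(\mathcal{R}f)$. $C_0^\infty(\mathbb{G}\setminus\{0\})$ is the space of smooth functions with compact support in $\mathbb{G}\setminus\{0\}$. *)

theory Defs
  imports "HOL-Analysis.Analysis"
begin

text \<open>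
  Groups are written additively but are not assumed commutative (class \<^class>\<open>group_add\<close>):
  \<open>x + y\<close> is the group product, \<open>- x\<close> the inverse and \<open>0\<close> the identity element.
\<close>

section \<open>Smooth maps and Lie groups\<close>

text \<open>
  On an open set of a Euclidean space, \<open>f\<close> is \<open>C\<^sup>k\<^sup>+\<^sup>1\<close> iff it is differentiable and each of its
  directional derivatives is \<open>C\<^sup>k\<close>.  Only open sets \<open>S\<close> are used below.
\<close>

primrec Ck_on ::
  "nat \<Rightarrow> ('a::euclidean_space \<Rightarrow> 'b::real_normed_vector) \<Rightarrow> 'a set \<Rightarrow> bool" where
  "Ck_on 0 f S \<longleftrightarrow> continuous_on S f"
| "Ck_on (Suc k) f S \<longleftrightarrow>
     (\<forall>x\<in>S. f differentiable (at x)) \<and>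
     (\<forall>v. Ck_on k (\<lambda>x. frechet_derivative f (at x) v) S)"

definition smooth_on ::
  "'a::euclidean_space set \<Rightarrow> ('a \<Rightarrow> 'b::real_normed_vector) \<Rightarrow> bool" where
  "smooth_on S f \<longleftrightarrow> (\<forall>k. Ck_on k f S)"

text \<open>A chart is a pair of its domain and its coordinate map.\<close>

type_synonym ('g, 'a) chart = "'g set \<times> ('g \<Rightarrow> 'a)"

abbreviation chart_dom :: "('g, 'a) chart \<Rightarrow> 'g set" where
  "chart_dom c \<equiv> fst c"

abbreviation chart_map :: "('g, 'a) chart \<Rightarrow> 'g \<Rightarrow> 'a" where
  "chart_map c \<equiv> snd c"

definition chart_im :: "('g, 'a) chart \<Rightarrow> 'a set" where
  "chart_im c = chart_map c ` chart_dom c"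

definition chart_inv :: "('g, 'a) chart \<Rightarrow> 'a \<Rightarrow> 'g" where
  "chart_inv c = inv_into (chart_dom c) (chart_map c)"

definition is_chart :: "('g::topological_space, 'a::euclidean_space) chart \<Rightarrow> bool" where
  "is_chart c \<longleftrightarrow>
     open (chart_dom c) \<and> open (chart_im c) \<and>
     homeomorphism (chart_dom c) (chart_im c) (chart_map c) (chart_inv c)"

definition smooth_atlas ::
  "('g::topological_space, 'a::euclidean_space) chart set \<Rightarrow> bool" where
  "smooth_atlas \<A> \<longleftrightarrow>
     (\<forall>c\<in>\<A>. is_chart c) \<and> (\<Union>c\<in>\<A>. chart_dom c) = UNIV \<and>
     (\<forall>c\<in>\<A>. \<forall>d\<in>\<A>.
        smooth_on (chart_map c ` (chart_dom c \<inter> chart_dom d)) (chart_map d \<circ> chart_inv c))"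

definition smooth_fun ::
  "('g, 'a::euclidean_space) chart set \<Rightarrow> ('g \<Rightarrow> 'b::real_normed_vector) \<Rightarrow> bool" where
  "smooth_fun \<A> f \<longleftrightarrow> (\<forall>c\<in>\<A>. smooth_on (chart_im c) (f \<circ> chart_inv c))"

text \<open>
  Hausdorff and second countable are part of the type of the underlying space; multiplication
  and inversion are required to be smooth in all charts.
\<close>

definition lie_group ::
  "('g::{topological_group_add, t2_space, second_countable_topology}, 'a::euclidean_space)
     chart set \<Rightarrow> bool" where
  "lie_group \<A> \<longleftrightarrow>
     smooth_atlas \<A> \<and>
     (\<forall>c\<in>\<A>. \<forall>d\<in>\<A>. \<forall>e\<in>\<A>.
        smooth_on
          {p \<in> chart_im c \<times> chart_im d. chart_inv c (fst p) + chart_inv d (snd p) \<in> chart_dom e}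
          (\<lambda>p. chart_map e (chart_inv c (fst p) + chart_inv d (snd p)))) \<and>
     (\<forall>c\<in>\<A>. \<forall>e\<in>\<A>.
        smooth_on {p \<in> chart_im c. - chart_inv c p \<in> chart_dom e}
          (\<lambda>p. chart_map e (- chart_inv c p)))"


section \<open>Lie algebra and exponential map\<close>

text \<open>
  Let \<open>c\<close> be a chart around the identity.  Through \<open>c\<close> the tangent space at the identity, i.e. the
  Lie algebra as a vector space, is the model space \<open>'a\<close>: the vector \<open>v\<close> is the velocity at
  \<open>t = 0\<close> of the curve \<open>t \<mapsto> c\<^sup>-\<^sup>1(c(0) + t v)\<close>.  The operator below is the left-invariant vector
  field with value \<open>v\<close> at the identity, acting on functions as a derivation.
\<close>

definition left_inv_field ::
  "('g::group_add, 'a::real_normed_vector) chart \<Rightarrow> 'a \<Rightarrow> ('g \<Rightarrow> real) \<Rightarrow> 'g \<Rightarrow> real" where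
  "left_inv_field c v f x =
     vector_derivative (\<lambda>t. f (x + chart_inv c (chart_map c 0 + t *\<^sub>R v))) (at 0)"

definition lie_bracket ::
  "('g::group_add, 'a::euclidean_space) chart set \<Rightarrow> ('g, 'a) chart \<Rightarrow> 'a \<Rightarrow> 'a \<Rightarrow> 'a" where
  "lie_bracket \<A> c v w =
     (THE u. \<forall>f. smooth_fun \<A> f \<longrightarrow>
        (\<forall>x. left_inv_field c u f x =
               left_inv_field c v (left_inv_field c w f) x
               - left_inv_field c w (left_inv_field c v f) x))"

text \<open>\<open>exp v\<close> is the time-one point of the one-parameter subgroup with initial velocity \<open>v\<close>.\<close>

definition lie_exp ::
  "('g::{topological_space, group_add}, 'a::real_normed_vector) chart \<Rightarrow> 'a \<Rightarrow> 'g" where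
  "lie_exp c v =
     (THE x. \<exists>\<gamma>. continuous_on UNIV \<gamma> \<and> (\<forall>s t. \<gamma> (s + t) = \<gamma> s + \<gamma> t) \<and>
        ((\<lambda>t. chart_map c (\<gamma> t)) has_vector_derivative v) (at 0) \<and> x = \<gamma> 1)"


section \<open>Homogeneous groups\<close>

definition diagonalisable_pos :: "('a::euclidean_space \<Rightarrow> 'a) \<Rightarrow> bool" where
  "diagonalisable_pos A \<longleftrightarrow>
     linear A \<and>
     (\<exists>B. independent B \<and> span B = UNIV \<and> (\<forall>b\<in>B. \<exists>\<nu>>0. A b = \<nu> *\<^sub>R b))"

definition dilation_alg :: "('a::euclidean_space \<Rightarrow> 'a) \<Rightarrow> real \<Rightarrow> 'a \<Rightarrow> 'a" where
  "dilation_alg A r v = (\<Sum>k. (ln r ^ k / fact k) *\<^sub>R (A ^^ k) v)"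

definition lie_algebra_morphism ::
  "('g::group_add, 'a::euclidean_space) chart set \<Rightarrow> ('g, 'a) chart \<Rightarrow> ('a \<Rightarrow> 'a) \<Rightarrow> bool" where
  "lie_algebra_morphism \<A> c L \<longleftrightarrow>
     linear L \<and> (\<forall>v w. L (lie_bracket \<A> c v w) = lie_bracket \<A> c (L v) (L w))"

definition homogeneous_group ::
  "('g::{topological_group_add, t2_space, second_countable_topology}, 'a::euclidean_space)
     chart set \<Rightarrow> ('g, 'a) chart \<Rightarrow> ('a \<Rightarrow> 'a) \<Rightarrow> bool" where
  "homogeneous_group \<A> c A \<longleftrightarrow>
     lie_group \<A> \<and> connected (UNIV :: 'g set) \<and> simply_connected (UNIV :: 'g set) \<and>
     c \<in> \<A> \<and> 0 \<in> chart_dom c \<and>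
     diagonalisable_pos A \<and>
     (\<forall>r>0. lie_algebra_morphism \<A> c (dilation_alg A r))"

text \<open>The trace of \<open>A\<close>, computed in the orthonormal basis of the model space.\<close>

definition homogeneous_dim :: "('a::euclidean_space \<Rightarrow> 'a) \<Rightarrow> real" where
  "homogeneous_dim A = (\<Sum>b\<in>Basis. A b \<bullet> b)"

text \<open>
  On a homogeneous group the exponential map is a bijection, so this is the map determined by
  \<open>D\<^sub>r (exp v) = exp (D\<^sub>r v)\<close>.
\<close>

definition dilation ::
  "('g::{topological_space, group_add}, 'a::euclidean_space) chart \<Rightarrow> ('a \<Rightarrow> 'a)
     \<Rightarrow> real \<Rightarrow> 'g \<Rightarrow> 'g" where
  "dilation c A r x = lie_exp c (dilation_alg A r (inv (lie_exp c) x))"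

definition homogeneous_quasi_norm ::
  "('g::{topological_space, group_add}, 'a::euclidean_space) chart \<Rightarrow> ('a \<Rightarrow> 'a)
     \<Rightarrow> ('g \<Rightarrow> real) \<Rightarrow> bool" where
  "homogeneous_quasi_norm c A N \<longleftrightarrow>
     continuous_on UNIV N \<and> (\<forall>x. 0 \<le> N x) \<and> (\<forall>x. N (- x) = N x) \<and>
     (\<forall>r>0. \<forall>x. N (dilation c A r x) = r * N x) \<and>
     (\<forall>x. N x = 0 \<longleftrightarrow> x = 0)"

text \<open>
  For \<open>x \<noteq> 0\<close> the point \<open>y\<close> is the one with \<open>x = D\<^sub>\<rho> y\<close>, \<open>\<rho> = |x|\<close> and \<open>|y| = 1\<close>.  The value at
  \<open>x = 0\<close> carries no meaning.
\<close>

definition radial_deriv ::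
  "('g::{topological_space, group_add}, 'a::euclidean_space) chart \<Rightarrow> ('a \<Rightarrow> 'a)
     \<Rightarrow> ('g \<Rightarrow> real) \<Rightarrow> ('g \<Rightarrow> complex) \<Rightarrow> 'g \<Rightarrow> complex" where
  "radial_deriv c A N f x =
     (let y = (THE y. x = dilation c A (N x) y \<and> N y = 1)
      in vector_derivative (\<lambda>r. f (dilation c A r y)) (at (N x)))"

text \<open>
  A nonzero left-invariant Borel measure that is finite on compact sets; on a second countable
  locally compact group regularity is automatic.
\<close>

definition haar_measure :: "'g::topological_group_add measure \<Rightarrow> bool" where
  "haar_measure M \<longleftrightarrow>
     sets M = sets borel \<and> emeasure M UNIV \<noteq> 0 \<and>
     (\<forall>K. compact K \<longrightarrow> emeasure M K < \<infinity>) \<and>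
     (\<forall>a. \<forall>E\<in>sets borel. emeasure M ((\<lambda>x. a + x) ` E) = emeasure M E)"

text \<open>
  Used below only for functions that are square integrable (otherwise the Bochner integral,
  and hence this expression, would be \<open>0\<close>).
\<close>

definition L2_norm :: "'g measure \<Rightarrow> ('g \<Rightarrow> complex) \<Rightarrow> real" where
  "L2_norm M f = sqrt (LINT x|M. (cmod (f x))\<^sup>2)"

definition test_functions ::
  "('g::{topological_space, zero}, 'a::euclidean_space) chart set \<Rightarrow> ('g \<Rightarrow> complex) set" where
  "test_functions \<A> =
     {f. smooth_fun \<A> f \<and> compact (closure {x. f x \<noteq> 0}) \<and> 0 \<notin> closure {x. f x \<noteq> 0}}"

definition rellich_lhs :: "('g \<Rightarrow> real) \<Rightarrow> ('g \<Rightarrow> complex) \<Rightarrow> 'g \<Rightarrow> complex" where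
  "rellich_lhs N f x = f x / of_real ((N x)\<^sup>2)"

definition rellich_rhs ::
  "('g::{topological_space, group_add}, 'a::euclidean_space) chart \<Rightarrow> ('a \<Rightarrow> 'a)
     \<Rightarrow> ('g \<Rightarrow> real) \<Rightarrow> ('g \<Rightarrow> complex) \<Rightarrow> 'g \<Rightarrow> complex" where
  "rellich_rhs c A N f x =
     radial_deriv c A N (radial_deriv c A N f) x
     + of_real ((homogeneous_dim A - 1) / N x) * radial_deriv c A N f x"

end

theory Submission
  imports Defs
begin

text \<open>
  The exponential map turns the group into its Lie algebra with a new product, and Haar
  measure into a multiple of Lebesgue measure.  Let \<open>E\<close> be the generator of the dilations,
  \<open>u = f / |x|\<^sup>2\<close> and \<open>T = E + Q / 2\<close>.  Since the dilations scale volume by \<open>r\<^sup>Q\<close>, \<open>T\<close> is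
  skew-adjoint, and the function on the right-hand side equals \<open>(T - (Q / 2 - 2)) g\<close> with
  \<open>g = (T + Q / 2) u\<close>.  Expanding twice, its squared norm is
  \<open>\<parallel>T g\<parallel>\<^sup>2 + (Q / 2 - 2)\<^sup>2 \<parallel>T u\<parallel>\<^sup>2 + (Q (Q - 4) / 4)\<^sup>2 \<parallel>u\<parallel>\<^sup>2\<close>, which gives the inequality.
  Equality forces \<open>T u = 0\<close>, so that \<open>u\<close> is homogeneous of degree \<open>- Q / 2\<close>, which is impossible for
  a nonzero function with compact support away from \<open>0\<close>; functions that are homogeneous of this
  degree up to a slowly varying cut-off show that the constant is sharp.

  For the global exponential map, the dilations make the Lie algebra nilpotent and extend the local
  product read in exponential coordinates to the whole Lie algebra.  The exponential map is then a
  homomorphism, onto because the group is connected; a null homotopy of the image of a segment that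
  ends in the kernel lifts to the Lie algebra, so it is injective because the group is simply connected.
\<close>


section \<open>Calculus of smooth maps\<close>

text \<open>Since \<open>N\<close> is merely continuous, f / |x|^2 need not be differentiable;
  differentiation and integration by parts therefore run along single dilation orbits, on which
  \<open>N\<close> is exponential in time. All that the inequality sees of the group is this flow,
  its effect on volume, and \<open>N\<close>. The origin of the constant is spectral: a skew T has
  imaginary spectrum, so T + a is bounded below by |a| for real a, and the two shifts Q / 2 and 2 -
  Q / 2 multiply to Q (Q - 4) / 4 in absolute value. The length of the proof has another cause.
  \<open>dilation\<close> is phrased with an inverse of \<open>lie_exp\<close>, and Haar measure
  through all left translations, so nothing can be computed before exp is known to be bijective and
  the measure is identified; both start from one chart at the identity. The Baker-Campbell-Hausdorff
  series is never written down: the product in exponential coordinates is reached through the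
  differential equations of left-invariant fields, and volumes under translations are compared
  without a Jacobian.\<close>

lemma Ck_on_subset: "Ck_on k f S \<Longrightarrow> T \<subseteq> S \<Longrightarrow> Ck_on k f T"
  by (induction k arbitrary: f) (auto intro: continuous_on_subset)

text \<open>Derivatives at points of an open set are unique, so an explicit derivative may replace
  the chosen \<open>frechet_derivative\<close>. The two agree on S only, and \<open>Ck_on\<close>
  differentiates them again; hence the congruence \<open>cong\<close>, which is proved by its own
  induction inside.\<close>

lemma Ck_on_SucI:
  assumes "\<And>x. x \<in> S \<Longrightarrow> (f has_derivative f' x) (at x)"
    and "\<And>v. Ck_on k (\<lambda>x. f' x v) S"
    and "open S"
  shows "Ck_on (Suc k) f S"
proof -
  have cong: "Ck_on k g S \<Longrightarrow> (\<And>x. x \<in> S \<Longrightarrow> g x = h x) \<Longrightarrow> Ck_on k h S"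
    for k and g h :: "'a \<Rightarrow> 'b"
  proof (induction k arbitrary: g h)
    case 0
    then show ?case using continuous_on_cong[of S S g h] by simp
  next
    case (Suc k)
    have *: "h differentiable (at x)" "frechet_derivative g (at x) = frechet_derivative h (at x)"
      if "x \<in> S" for x
    proof -
      have g: "g differentiable (at x)" using Suc.prems that by simp
      then have "(g has_derivative frechet_derivative g (at x)) (at x)"
        using frechet_derivative_works by blast
      then have "(h has_derivative frechet_derivative g (at x)) (at x)"
        using has_derivative_transform_within_open[OF _ assms(3) that] Suc.prems(2) by blast
      then show "h differentiable (at x)"
        "frechet_derivative g (at x) = frechet_derivative h (at x)"
        using differentiable_def frechet_derivative_at by blast+
    qed
    have "Ck_on k (\<lambda>x. frechet_derivative h (at x) v) S" for v
      by (rule Suc.IH[of "\<lambda>x. frechet_derivative g (at x) v"]) (use Suc.prems * in auto)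
    then show ?case using * by simp
  qed
  have "f differentiable (at x)" "f' x = frechet_derivative f (at x)" if "x \<in> S" for x
    using assms(1)[OF that] differentiable_def frechet_derivative_at by blast+
  then show ?thesis
    using cong[OF assms(2)] by auto
qed

lemma Ck_on_SucD:
  assumes "Ck_on (Suc k) f S"
  shows "x \<in> S \<Longrightarrow> (f has_derivative frechet_derivative f (at x)) (at x)"
    and "Ck_on k (\<lambda>x. frechet_derivative f (at x) v) S"
  using assms frechet_derivative_works by auto

lemma Ck_on_cong:
  assumes "Ck_on k f S" "open S" "\<And>x. x \<in> S \<Longrightarrow> f x = g x"
  shows "Ck_on k g S"
proof (cases k)
  case 0
  then show ?thesis using assms continuous_on_cong[of S S f g] by simp
next
  case (Suc j)
  have "(g has_derivative frechet_derivative f (at x)) (at x)" if "x \<in> S" for x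
    using has_derivative_transform_within_open[OF _ assms(2) that] assms Ck_on_SucD(1) that Suc
    by blast
  then show ?thesis
    unfolding Suc by (rule Ck_on_SucI) (use assms Suc in auto)
qed

lemma Ck_on_imp_continuous_on: "Ck_on k f S \<Longrightarrow> continuous_on S f"
  by (cases k)
    (auto intro!: continuous_at_imp_continuous_on differentiable_imp_continuous_within)

lemma Ck_on_Suc_imp: "Ck_on (Suc k) f S \<Longrightarrow> Ck_on k f S"
proof (induction k arbitrary: f)
  case 0
  then show ?case using Ck_on_imp_continuous_on[of "Suc 0"] by (simp del: Ck_on.simps(2))
next
  case (Suc k)
  then show ?case by (meson Ck_on.simps(2))
qed

lemma Ck_on_local:
  assumes "\<And>x. x \<in> S \<Longrightarrow> \<exists>T. open T \<and> x \<in> T \<and> Ck_on k f T"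
  shows "Ck_on k f S"
  using assms
proof (induction k arbitrary: f)
  case 0
  have "isCont f x" if "x \<in> S" for x
    using 0[OF that] continuous_on_eq_continuous_at by auto
  then show ?case by (simp add: continuous_at_imp_continuous_on)
next
  case (Suc k)
  have "f differentiable (at x)" if "x \<in> S" for x
    using Suc.prems[OF that] by auto
  moreover have "Ck_on k (\<lambda>x. frechet_derivative f (at x) v) S" for v
    by (rule Suc.IH) (use Suc.prems in fastforce)
  ultimately show ?case by simp
qed

lemma Ck_on_const: "open S \<Longrightarrow> Ck_on k (\<lambda>x. a) S"
proof (induction k arbitrary: a)
  case (Suc k)
  show ?case by (rule Ck_on_SucI[where f' = "\<lambda>x v. 0"]) (use Suc in auto)
qed simp

lemma Ck_on_bounded_linear:
  assumes "bounded_linear L" "open S"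
  shows "Ck_on k L S"
proof (cases k)
  case 0
  then show ?thesis using assms by (simp add: linear_continuous_on)
next
  case (Suc j)
  show ?thesis unfolding Suc
    by (rule Ck_on_SucI[where f' = "\<lambda>x. L"])
      (use assms Ck_on_const bounded_linear_imp_has_derivative in auto)
qed

lemma Ck_on_add: "open S \<Longrightarrow> Ck_on k f S \<Longrightarrow> Ck_on k g S \<Longrightarrow> Ck_on k (\<lambda>x. f x + g x) S"
proof (induction k arbitrary: f g)
  case (Suc k)
  show ?case
    by (rule Ck_on_SucI[where
          f' = "\<lambda>x v. frechet_derivative f (at x) v + frechet_derivative g (at x) v"])
      (use Suc in \<open>auto intro!: has_derivative_add Ck_on_SucD Suc.IH simp del: Ck_on.simps\<close>)
qed (auto intro: continuous_on_add)

lemma Ck_on_sum: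
  assumes "open S" "\<And>i. i \<in> I \<Longrightarrow> Ck_on k (f i) S"
  shows "Ck_on k (\<lambda>x. \<Sum>i\<in>I. f i x) S"
  using assms(2)
  by (induction I rule: infinite_finite_induct) (auto intro: Ck_on_const Ck_on_add assms(1))

lemma Ck_on_bilinear:
  assumes "bounded_bilinear pr" "open S"
  shows "Ck_on k f S \<Longrightarrow> Ck_on k g S \<Longrightarrow> Ck_on k (\<lambda>x. pr (f x) (g x)) S"
proof (induction k arbitrary: f g)
  case 0
  then show ?case using bounded_bilinear.continuous_on[OF assms(1)] by simp
next
  case (Suc k)
  show ?case
  proof (rule Ck_on_SucI[where f' = "\<lambda>x v. pr (f x) (frechet_derivative g (at x) v)
                + pr (frechet_derivative f (at x) v) (g x)"])
    fix x assume "x \<in> S"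
    then show "((\<lambda>x. pr (f x) (g x)) has_derivative
        (\<lambda>v. pr (f x) (frechet_derivative g (at x) v) + pr (frechet_derivative f (at x) v) (g x))) (at x)"
      using Suc.prems by (intro bounded_bilinear.FDERIV[OF assms(1)]) (auto dest: Ck_on_SucD(1) simp del: Ck_on.simps)
  next
    show "Ck_on k (\<lambda>x. pr (f x) (frechet_derivative g (at x) v)
                + pr (frechet_derivative f (at x) v) (g x)) S" for v
      by (intro Ck_on_add assms Suc.IH) (use Suc.prems Ck_on_SucD(2) Ck_on_Suc_imp in blast)+
  qed (use assms in auto)
qed

lemma Ck_on_linear_comp:
  assumes "bounded_linear L" "open S" "Ck_on k f S"
  shows "Ck_on k (\<lambda>x. L (f x)) S"
  using assms(3)
proof (induction k arbitrary: f)
  case 0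
  then show ?case using assms by (simp add: bounded_linear.continuous_on)
next
  case (Suc k)
  show ?case
    by (rule Ck_on_SucI[where f' = "\<lambda>x v. L (frechet_derivative f (at x) v)"])
      (use Suc assms in \<open>auto intro: bounded_linear.has_derivative Ck_on_SucD simp del: Ck_on.simps\<close>)
qed

lemma linear_basis_expansion:
  fixes L :: "'a::euclidean_space \<Rightarrow> 'b::real_normed_vector"
  assumes "linear L"
  shows "L v = (\<Sum>b\<in>Basis. (v \<bullet> b) *\<^sub>R L b)"
proof -
  have "L v = L (\<Sum>b\<in>Basis. (v \<bullet> b) *\<^sub>R b)" by (simp add: euclidean_representation)
  also have "\<dots> = (\<Sum>b\<in>Basis. (v \<bullet> b) *\<^sub>R L b)"
    using assms by (simp add: linear_sum linear_scale)
  finally show ?thesis .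
qed

text \<open>The chain rule applies the derivative of f at g x to a vector that itself depends on x.
  Expanding this vector in the basis leaves derivatives in fixed directions, the only ones that
  \<open>Ck_on\<close> speaks about.\<close>

lemma Ck_on_compose:
  fixes f :: "'b::euclidean_space \<Rightarrow> 'c::real_normed_vector"
    and g :: "'a::euclidean_space \<Rightarrow> 'b"
  assumes "open S" "\<And>x. x \<in> S \<Longrightarrow> g x \<in> T"
  shows "Ck_on k f T \<Longrightarrow> Ck_on k g S \<Longrightarrow> Ck_on k (\<lambda>x. f (g x)) S"
proof (induction k arbitrary: f)
  case 0
  then show ?case using continuous_on_compose2[of T f S g] assms by auto
next
  case (Suc k)
  note df = Ck_on_SucD[OF Suc.prems(1)] and dg = Ck_on_SucD[OF Suc.prems(2)]
  show ?case
  proof (rule Ck_on_SucI)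
    fix x assume x: "x \<in> S"
    have "(f \<circ> g has_derivative
        frechet_derivative f (at (g x)) \<circ> frechet_derivative g (at x)) (at x)"
      by (rule diff_chain_at) (use df dg assms x in auto)
    moreover have "frechet_derivative f (at (g x)) (frechet_derivative g (at x) v)
        = (\<Sum>b\<in>Basis. (frechet_derivative g (at x) v \<bullet> b) *\<^sub>R frechet_derivative f (at (g x)) b)" for v
      by (rule linear_basis_expansion)
        (use df(1)[OF assms(2)[OF x]] has_derivative_linear in auto)
    ultimately show "((\<lambda>x. f (g x)) has_derivative
        (\<lambda>v. \<Sum>b\<in>Basis. (frechet_derivative g (at x) v \<bullet> b) *\<^sub>R frechet_derivative f (at (g x)) b)) (at x)"
      by (simp add: o_def)
  next
    show "Ck_on k (\<lambda>x. \<Sum>b\<in>Basis. (frechet_derivative g (at x) v \<bullet> b) *\<^sub>R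
        frechet_derivative f (at (g x)) b) S" for v
      by (intro Ck_on_sum assms Ck_on_bilinear[OF bounded_bilinear_scaleR] Suc.IH
          Ck_on_linear_comp[OF bounded_linear_inner_left] dg(2) df(2) Ck_on_Suc_imp[OF Suc.prems(2)])
  qed (use assms in auto)
qed

lemma smooth_on_subset: "smooth_on S f \<Longrightarrow> T \<subseteq> S \<Longrightarrow> smooth_on T f"
  by (auto simp: smooth_on_def intro: Ck_on_subset)

lemma smooth_on_cong:
  "smooth_on S f \<Longrightarrow> open S \<Longrightarrow> (\<And>x. x \<in> S \<Longrightarrow> f x = g x) \<Longrightarrow> smooth_on S g"
  by (meson smooth_on_def Ck_on_cong)

lemma smooth_on_imp_continuous_on: "smooth_on S f \<Longrightarrow> continuous_on S f"
  by (meson smooth_on_def Ck_on_imp_continuous_on)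

lemma smooth_on_has_derivative:
  "smooth_on S f \<Longrightarrow> x \<in> S \<Longrightarrow> (f has_derivative frechet_derivative f (at x)) (at x)"
  by (meson smooth_on_def Ck_on_SucD(1))

lemma smooth_on_frechet_derivative:
  "smooth_on S f \<Longrightarrow> smooth_on S (\<lambda>x. frechet_derivative f (at x) v)"
  unfolding smooth_on_def using Ck_on_SucD(2) by blast

lemma smooth_on_local:
  "(\<And>x. x \<in> S \<Longrightarrow> \<exists>T. open T \<and> x \<in> T \<and> smooth_on T f) \<Longrightarrow> smooth_on S f"
  unfolding smooth_on_def by (meson Ck_on_local)

lemma smooth_on_const: "open S \<Longrightarrow> smooth_on S (\<lambda>x. a)"
  by (simp add: smooth_on_def Ck_on_const)

lemma smooth_on_bounded_linear: "bounded_linear L \<Longrightarrow> open S \<Longrightarrow> smooth_on S L"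
  by (simp add: smooth_on_def Ck_on_bounded_linear)

lemma smooth_on_id: "open S \<Longrightarrow> smooth_on S (\<lambda>x. x)"
  by (rule smooth_on_bounded_linear) (auto intro: bounded_linear_ident)

lemma smooth_on_add:
  "open S \<Longrightarrow> smooth_on S f \<Longrightarrow> smooth_on S g \<Longrightarrow> smooth_on S (\<lambda>x. f x + g x)"
  by (simp add: smooth_on_def Ck_on_add)

lemma smooth_on_sum:
  "open S \<Longrightarrow> (\<And>i. i \<in> I \<Longrightarrow> smooth_on S (f i)) \<Longrightarrow> smooth_on S (\<lambda>x. \<Sum>i\<in>I. f i x)"
  by (simp add: smooth_on_def Ck_on_sum)

lemma smooth_on_bilinear:
  "bounded_bilinear pr \<Longrightarrow> open S \<Longrightarrow> smooth_on S f \<Longrightarrow> smooth_on S g \<Longrightarrow>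
    smooth_on S (\<lambda>x. pr (f x) (g x))"
  by (simp add: smooth_on_def Ck_on_bilinear)

lemma smooth_on_linear_comp:
  "bounded_linear L \<Longrightarrow> open S \<Longrightarrow> smooth_on S f \<Longrightarrow> smooth_on S (\<lambda>x. L (f x))"
  by (simp add: smooth_on_def Ck_on_linear_comp)

lemma smooth_on_compose:
  fixes f :: "'b::euclidean_space \<Rightarrow> 'c::real_normed_vector"
    and g :: "'a::euclidean_space \<Rightarrow> 'b"
  shows "smooth_on T f \<Longrightarrow> smooth_on S g \<Longrightarrow> open S \<Longrightarrow> (\<And>x. x \<in> S \<Longrightarrow> g x \<in> T) \<Longrightarrow>
    smooth_on S (\<lambda>x. f (g x))"
  unfolding smooth_on_def using Ck_on_compose[of S g T] by blast

lemma smooth_on_minus: "open S \<Longrightarrow> smooth_on S f \<Longrightarrow> smooth_on S (\<lambda>x. - f x)"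
  by (rule smooth_on_linear_comp) (auto intro: bounded_linear_minus bounded_linear_ident)

lemma smooth_on_diff:
  "open S \<Longrightarrow> smooth_on S f \<Longrightarrow> smooth_on S g \<Longrightarrow> smooth_on S (\<lambda>x. f x - g x)"
  using smooth_on_add[of S f "\<lambda>x. - g x"] smooth_on_minus[of S g] by simp

lemma Ck_on_Pair:
  assumes "open S" "Ck_on k f S" "Ck_on k g S"
  shows "Ck_on k (\<lambda>x. (f x, g x)) S"
proof -
  have "Ck_on k (\<lambda>x. (f x, 0) + (0, g x)) S"
    by (intro Ck_on_add assms Ck_on_linear_comp[where L = "\<lambda>a. (a, 0)"]
        Ck_on_linear_comp[where L = "\<lambda>b. (0, b)"] bounded_linear_Pair
        bounded_linear_ident bounded_linear_zero)
  then show ?thesis by simp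
qed

lemma smooth_on_Pair:
  "open S \<Longrightarrow> smooth_on S f \<Longrightarrow> smooth_on S g \<Longrightarrow> smooth_on S (\<lambda>x. (f x, g x))"
  by (simp add: smooth_on_def Ck_on_Pair)

lemma smooth_on_real_derivI:
  fixes f :: "real \<Rightarrow> real"
  assumes "open S" "\<And>x. x \<in> S \<Longrightarrow> (f has_real_derivative f' x) (at x)" "smooth_on S f'"
  shows "smooth_on S f"
proof -
  have "Ck_on k f S" for k
  proof (cases k)
    case 0
    have "isCont f x" if "x \<in> S" for x using assms(2)[OF that] DERIV_isCont by blast
    then show ?thesis using 0 continuous_at_imp_continuous_on by auto
  next
    case (Suc j)
    show ?thesis unfolding Suc
    proof (rule Ck_on_SucI)
      show "(f has_derivative (\<lambda>v. f' x * v)) (at x)" if "x \<in> S" for x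
        using assms(2)[OF that] by (simp add: has_field_derivative_def)
      show "Ck_on j (\<lambda>x. f' x * v) S" for v
        using assms(1,3) Ck_on_linear_comp[OF bounded_linear_mult_left] smooth_on_def by blast
    qed (use assms in auto)
  qed
  then show ?thesis by (simp add: smooth_on_def)
qed

lemma smooth_on_exp: "smooth_on UNIV (exp :: real \<Rightarrow> real)"
proof -
  have "Ck_on k (exp :: real \<Rightarrow> real) UNIV" for k
  proof (induction k)
    case 0 show ?case by (simp add: continuous_on_exp)
  next
    case (Suc k)
    show ?case
      by (rule Ck_on_SucI[where f' = "\<lambda>x v. exp x * v"])
        (use Suc DERIV_exp in \<open>auto simp: has_field_derivative_def simp del: Ck_on.simps
           intro: Ck_on_linear_comp[OF bounded_linear_mult_left]\<close>)
  qed
  then show ?thesis by (simp add: smooth_on_def)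
qed

lemma smooth_on_inverse: "smooth_on (-{0}) (inverse :: real \<Rightarrow> real)"
proof -
  have o: "open (-{0::real})" by auto
  have "Ck_on k (inverse :: real \<Rightarrow> real) (-{0})" for k
  proof (induction k)
    case 0 show ?case by (auto intro!: continuous_intros)
  next
    case (Suc k)
    have "Ck_on k (\<lambda>x::real. (inverse x * inverse x) * (- v)) (-{0})" for v
      by (intro Ck_on_linear_comp[OF bounded_linear_mult_left] o
          Ck_on_bilinear[OF bounded_bilinear_mult] Suc)
    moreover have "(inverse has_derivative (\<lambda>v. inverse x * inverse x * (- v))) (at x)"
      if "x \<in> -{0}" for x :: real
      using DERIV_inverse[of x UNIV] that
      by (auto simp: has_field_derivative_def power2_eq_square elim!: has_derivative_eq_rhs)
    ultimately show ?case
      using Ck_on_SucI[OF _ _ o, where f' = "\<lambda>x v. inverse x * inverse x * (- v)"] by blast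
  qed
  then show ?thesis by (simp add: smooth_on_def)
qed

lemma smooth_on_ln: "smooth_on {0<..} (ln :: real \<Rightarrow> real)"
  by (rule smooth_on_real_derivI[where f' = inverse])
    (auto intro: smooth_on_subset[OF smooth_on_inverse] simp: divide_inverse
      intro!: derivative_eq_intros)

section \<open>Bump functions\<close>

text \<open>The classical exp (- 1 / t), extended by 0. The extra powers make the family closed
  under differentiation, so that smoothness of all members follows by one induction on the
  order.\<close>

definition flat_fun :: "nat \<Rightarrow> real \<Rightarrow> real" where
  "flat_fun n t = (if 0 < t then exp (- inverse t) * inverse t ^ n else 0)"

lemma flat_fun_limit: "(flat_fun n \<longlongrightarrow> 0) (at 0)"
proof -
  have l: "((\<lambda>s::real. s ^ n / exp s) \<longlongrightarrow> 0) at_top"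
    by (rule tendsto_power_div_exp_0)
  have "((\<lambda>t::real. inverse t ^ n / exp (inverse t)) \<longlongrightarrow> 0) (at_right 0)"
    by (rule filterlim_compose[OF l filterlim_inverse_at_top_right])
  then have "(flat_fun n \<longlongrightarrow> 0) (at_right 0)"
    by (rule Lim_transform_eventually)
      (auto simp: eventually_at_filter flat_fun_def exp_minus divide_inverse mult.commute)
  moreover have "(flat_fun n \<longlongrightarrow> 0) (at_left 0)"
    by (rule Lim_transform_eventually[where f = "\<lambda>_. 0"])
      (auto simp: eventually_at_filter flat_fun_def)
  ultimately show ?thesis using filterlim_split_at by blast
qed

lemma flat_fun_deriv:
  "(flat_fun n has_real_derivative flat_fun (n + 2) t - real n * flat_fun (n + 1) t) (at t)"
proof -
  consider "t > 0" | "t = 0" | "t < 0" by linarith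
  then show ?thesis
  proof cases
    case 1
    have "((\<lambda>t. exp (- inverse t) * inverse t ^ n) has_real_derivative
        flat_fun (n + 2) t - real n * flat_fun (n + 1) t) (at t)"
      using 1 by (auto intro!: derivative_eq_intros
          simp: flat_fun_def divide_simps power_inverse algebra_simps)
        (cases n; simp add: algebra_simps power2_eq_square)
    then show ?thesis
      by (rule has_field_derivative_transform_within_open[where S = "{0<..}"])
        (use 1 in \<open>auto simp: flat_fun_def\<close>)
  next
    case 2
    \<comment> \<open>The difference quotient of \<open>flat_fun n\<close> at 0 is
      \<open>flat_fun (Suc n)\<close>, which tends to 0.\<close>
    have "(flat_fun n has_real_derivative 0) (at 0)"
      unfolding has_field_derivative_iff
      by (rule Lim_transform_eventually[OF flat_fun_limit[of "Suc n"]])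
        (auto simp: eventually_at_filter flat_fun_def divide_inverse)
    then show ?thesis using 2 by (simp add: flat_fun_def)
  next
    case 3
    have "((\<lambda>t. 0) has_real_derivative 0) (at t)" by simp
    then have "(flat_fun n has_real_derivative 0) (at t)"
      by (rule has_field_derivative_transform_within_open[where S = "{..<0}"])
        (use 3 in \<open>auto simp: flat_fun_def\<close>)
    then show ?thesis using 3 by (simp add: flat_fun_def)
  qed
qed

lemma smooth_on_flat_fun: "smooth_on UNIV (flat_fun n)"
proof -
  have "Ck_on k (flat_fun n) UNIV" for k n
  proof (induction k arbitrary: n)
    case 0
    show ?case using flat_fun_deriv DERIV_isCont continuous_at_imp_continuous_on
      by (metis Ck_on.simps(1))
  next
    case (Suc k)
    show ?case
    proof (rule Ck_on_SucI)
      show "(flat_fun n has_derivative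
          (\<lambda>v. (flat_fun (n + 2) t + (- real n) * flat_fun (n + 1) t) * v)) (at t)" for t
        using flat_fun_deriv[of n t] by (simp add: has_field_derivative_def)
      show "Ck_on k (\<lambda>t. (flat_fun (n + 2) t + (- real n) * flat_fun (n + 1) t) * v) UNIV" for v
        by (intro Ck_on_linear_comp[OF bounded_linear_mult_left]
            Ck_on_linear_comp[OF bounded_linear_mult_right] Ck_on_add Suc open_UNIV)
    qed auto
  qed
  then show ?thesis by (simp add: smooth_on_def)
qed

definition smooth_step :: "real \<Rightarrow> real" where
  "smooth_step t = flat_fun 0 t * inverse (flat_fun 0 t + flat_fun 0 (1 - t))"

lemma smooth_step_simps:
  "t \<le> 0 \<Longrightarrow> smooth_step t = 0" "1 \<le> t \<Longrightarrow> smooth_step t = 1"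
  "0 \<le> smooth_step t" "smooth_step t \<le> 1"
proof -
  have nn: "0 \<le> flat_fun 0 t" for t by (simp add: flat_fun_def)
  show "t \<le> 0 \<Longrightarrow> smooth_step t = 0" "1 \<le> t \<Longrightarrow> smooth_step t = 1"
    by (simp_all add: smooth_step_def flat_fun_def)
  show "0 \<le> smooth_step t" by (simp add: smooth_step_def nn)
  show "smooth_step t \<le> 1"
    using nn[of t] nn[of "1 - t"] unfolding smooth_step_def
    by (cases "flat_fun 0 t + flat_fun 0 (1 - t) = 0") (auto simp: divide_inverse[symmetric] field_simps)
qed

lemma smooth_on_smooth_step: "smooth_on UNIV smooth_step"
proof -
  have pos: "flat_fun 0 t + flat_fun 0 (1 - t) \<noteq> 0" for t
  proof (cases "0 < t")
    case True
    then show ?thesis by (simp add: flat_fun_def add_pos_pos less_imp_neq[symmetric])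
  qed (simp add: flat_fun_def)
  have l: "smooth_on UNIV (\<lambda>t::real. 1 - t)"
    by (intro smooth_on_diff smooth_on_const smooth_on_id open_UNIV)
  have "smooth_on UNIV (\<lambda>t. flat_fun 0 (1 - t))"
    by (rule smooth_on_compose[OF smooth_on_flat_fun l]) auto
  then have "smooth_on UNIV (\<lambda>t. flat_fun 0 t + flat_fun 0 (1 - t))"
    by (intro smooth_on_add smooth_on_flat_fun) auto
  then have "smooth_on UNIV (\<lambda>t. inverse (flat_fun 0 t + flat_fun 0 (1 - t)))"
    by (rule smooth_on_compose[OF smooth_on_inverse]) (use pos in auto)
  then show ?thesis
    unfolding smooth_step_def[abs_def]
    by (intro smooth_on_bilinear[OF bounded_bilinear_mult] smooth_on_flat_fun) auto
qed

lemma bump_function_exists: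
  fixes p :: "'a::euclidean_space"
  assumes "0 < r"
  obtains \<psi> :: "'a \<Rightarrow> real" where "smooth_on UNIV \<psi>" "\<And>x. 0 \<le> \<psi> x"
    "\<And>x. x \<in> ball p (r / 2) \<Longrightarrow> \<psi> x = 1" "\<And>x. x \<notin> ball p r \<Longrightarrow> \<psi> x = 0"
proof
  \<comment> \<open>The argument of the step is at least 1 on the half ball and at most 0 off the
    ball. It uses the squared distance because the distance is not smooth at p.\<close>
  define \<psi> where "\<psi> x = smooth_step (2 - (2 / r\<^sup>2) * ((x - p) \<bullet> (x - p)))" for x
  have l: "smooth_on UNIV (\<lambda>x::'a. x - p)"
    by (intro smooth_on_diff smooth_on_const smooth_on_id open_UNIV)
  have "smooth_on UNIV (\<lambda>x. 2 - (2 / r\<^sup>2) * ((x - p) \<bullet> (x - p)))"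
    by (intro smooth_on_diff smooth_on_const smooth_on_linear_comp[OF bounded_linear_mult_right]
        smooth_on_bilinear[OF bounded_bilinear_inner] l open_UNIV)
  then show "smooth_on UNIV \<psi>"
    unfolding \<psi>_def[abs_def] by (rule smooth_on_compose[OF smooth_on_smooth_step]) auto
  show "0 \<le> \<psi> x" for x by (simp add: \<psi>_def smooth_step_simps)
  have d: "(x - p) \<bullet> (x - p) = (dist p x)\<^sup>2" for x
    by (simp add: dist_norm norm_minus_commute flip: power2_norm_eq_inner)
  show "\<psi> x = 1" if "x \<in> ball p (r / 2)" for x
  proof -
    have "(dist p x)\<^sup>2 \<le> (r / 2)\<^sup>2" using that by (intro power_mono) auto
    then have "(2 / r\<^sup>2) * (dist p x)\<^sup>2 \<le> (2 / r\<^sup>2) * (r / 2)\<^sup>2"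
      by (intro mult_left_mono) auto
    also have "\<dots> \<le> 1" using assms by (simp add: power2_eq_square)
    finally show ?thesis unfolding \<psi>_def d by (intro smooth_step_simps) simp
  qed
  show "\<psi> x = 0" if "x \<notin> ball p r" for x
  proof -
    have "r\<^sup>2 \<le> (dist p x)\<^sup>2" using that assms by (intro power_mono) auto
    then show ?thesis using assms
      unfolding \<psi>_def d by (intro smooth_step_simps) (simp add: field_simps power2_eq_square)
  qed
qed

section \<open>Second order estimates\<close>

lemma smooth_on_Lipschitz:
  fixes f :: "'a::euclidean_space \<Rightarrow> 'b::real_normed_vector"
  assumes "smooth_on S f" "compact C" "convex C" "C \<subseteq> S"
  obtains K where "0 \<le> K" "\<And>x y. x \<in> C \<Longrightarrow> y \<in> C \<Longrightarrow> norm (f x - f y) \<le> K * norm (x - y)"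
    "\<And>x v. x \<in> C \<Longrightarrow> norm (frechet_derivative f (at x) v) \<le> K * norm v"
proof -
  let ?D = "\<lambda>x. frechet_derivative f (at x)"
  have "\<exists>K\<ge>0. \<forall>x\<in>C. norm (?D x b) \<le> K" for b
  proof -
    have "continuous_on C (\<lambda>x. ?D x b)"
      using smooth_on_imp_continuous_on[OF smooth_on_frechet_derivative[OF assms(1)]]
        continuous_on_subset assms(4) by blast
    then have "bounded ((\<lambda>x. ?D x b) ` C)"
      using assms(2) compact_continuous_image compact_imp_bounded by blast
    then obtain K where "\<forall>x\<in>C. norm (?D x b) \<le> K" by (auto simp: bounded_iff)
    then show ?thesis by (intro exI[of _ "max K 0"]) auto
  qed
  then obtain K where K: "\<And>b. 0 \<le> K b" "\<And>b x. x \<in> C \<Longrightarrow> norm (?D x b) \<le> K b" by metis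
  let ?K = "\<Sum>b\<in>Basis. K b"
  have D: "(f has_derivative ?D x) (at x)" if "x \<in> C" for x
    using smooth_on_has_derivative[OF assms(1)] that assms(4) by blast
  have bd: "norm (?D x v) \<le> ?K * norm v" if "x \<in> C" for x v
  proof -
    have "?D x v = (\<Sum>b\<in>Basis. (v \<bullet> b) *\<^sub>R ?D x b)"
      by (rule linear_basis_expansion) (use D[OF that] has_derivative_linear in blast)
    also have "norm \<dots> \<le> (\<Sum>b\<in>Basis. norm v * K b)"
      by (intro sum_norm_le) (auto intro!: mult_mono K that Basis_le_norm)
    finally show ?thesis by (simp add: sum_distrib_left mult.commute)
  qed
  have "norm (f x - f y) \<le> ?K * norm (x - y)" if "x \<in> C" "y \<in> C" for x y
    by (rule differentiable_bound[OF assms(3) _ _ that(1,2), where f' = ?D])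
      (auto intro: has_derivative_at_withinI D onorm_le bd)
  then show ?thesis using bd K by (intro that[of ?K]) (auto intro: sum_nonneg)
qed

text \<open>The Lipschitz bound of the first derivative stands in for a second one: f minus its
  linear part at 0 has a derivative of size K |x| on the ball of radius |x|, and one mean value step
  gives the square.\<close>

lemma smooth_on_second_order:
  fixes f :: "'a::euclidean_space \<Rightarrow> 'b::real_normed_vector"
  assumes "smooth_on S f" "cball 0 r \<subseteq> S"
  obtains K where "0 \<le> K"
    "\<And>x. x \<in> cball 0 r \<Longrightarrow> norm (f x - f 0 - frechet_derivative f (at 0) x) \<le> K * (norm x)\<^sup>2"
proof -
  let ?D = "\<lambda>x. frechet_derivative f (at x)"
  have "\<exists>K\<ge>0. \<forall>x\<in>cball 0 r. norm (?D x b - ?D 0 b) \<le> K * norm x" for b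
  proof (cases "0 \<le> r")
    case True
    obtain K where "0 \<le> K" "\<And>x y. x \<in> cball 0 r \<Longrightarrow> y \<in> cball 0 r \<Longrightarrow>
        norm (?D x b - ?D y b) \<le> K * norm (x - y)"
      by (rule smooth_on_Lipschitz[OF smooth_on_frechet_derivative[OF assms(1)]
          compact_cball convex_cball assms(2), of b]) blast
    from this(1) this(2)[of _ 0] show ?thesis using True by (intro exI[of _ K]) auto
  qed auto
  then obtain K where K: "\<And>b. 0 \<le> K b"
    "\<And>b x. x \<in> cball 0 r \<Longrightarrow> norm (?D x b - ?D 0 b) \<le> K b * norm x"
    using choice[of "\<lambda>b K. K \<ge> 0 \<and> (\<forall>x\<in>cball 0 r. norm (?D x b - ?D 0 b) \<le> K * norm x)"]
    by blast
  let ?K = "\<Sum>b\<in>Basis. K b"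
  have "norm (f x - f 0 - ?D 0 x) \<le> ?K * (norm x)\<^sup>2" if x: "x \<in> cball 0 r" for x
  proof -
    have sub: "cball 0 (norm x) \<subseteq> cball 0 r" using x by auto
    have D: "(f has_derivative ?D y) (at y)" if "y \<in> cball 0 r" for y
      using smooth_on_has_derivative[OF assms(1)] that assms(2) by blast
    have 0: "0 \<in> cball (0::'a) r" using x order_trans[OF norm_ge_zero] by simp
    have l0: "bounded_linear (?D 0)" using D[OF 0] has_derivative_bounded_linear by blast
    have bd: "norm (?D y v - ?D 0 v) \<le> ?K * norm x * norm v" if y: "y \<in> cball 0 (norm x)" for y v
    proof -
      have "y \<in> cball 0 r" using y sub by blast
      have "?D y v - ?D 0 v = (\<Sum>b\<in>Basis. (v \<bullet> b) *\<^sub>R (?D y b - ?D 0 b))"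
        by (rule linear_basis_expansion)
          (intro linear_compose_sub has_derivative_linear[OF D] \<open>y \<in> cball 0 r\<close> 0)
      also have "norm \<dots> \<le> (\<Sum>b\<in>Basis. norm v * (K b * norm x))"
      proof (intro sum_norm_le)
        fix b :: 'a assume b: "b \<in> Basis"
        have "norm (?D y b - ?D 0 b) \<le> K b * norm y" by (rule K) fact
        also have "\<dots> \<le> K b * norm x" using y by (intro mult_left_mono K) auto
        finally show "norm ((v \<bullet> b) *\<^sub>R (?D y b - ?D 0 b)) \<le> norm v * (K b * norm x)"
          using b by (auto intro!: mult_mono Basis_le_norm)
      qed
      finally show ?thesis by (simp add: sum_distrib_left sum_distrib_right mult_ac)
    qed
    have "norm ((f x - ?D 0 x) - (f 0 - ?D 0 0)) \<le> ?K * norm x * norm (x - 0)"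
    proof (rule differentiable_bound[OF convex_cball[of 0 "norm x"], where f' = "\<lambda>y v. ?D y v - ?D 0 v"])
      fix y :: 'a assume y: "y \<in> cball 0 (norm x)"
      show "((\<lambda>x. f x - ?D 0 x) has_derivative (\<lambda>v. ?D y v - ?D 0 v)) (at y within cball 0 (norm x))"
        using has_derivative_diff[OF has_derivative_at_withinI[OF D]
            bounded_linear_imp_has_derivative[OF l0]] y sub by blast
      show "onorm (\<lambda>v. ?D y v - ?D 0 v) \<le> ?K * norm x"
        by (intro onorm_le bd y)
    qed auto
    moreover have "(f x - ?D 0 x) - (f 0 - ?D 0 0) = f x - f 0 - ?D 0 x"
      using linear_0[OF bounded_linear.linear[OF l0]] by simp
    ultimately show ?thesis by (simp add: power2_eq_square mult.assoc)
  qed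
  then show ?thesis using K by (intro that[of ?K]) (auto intro: sum_nonneg)
qed

text \<open>The second difference is the increment over [0, h] of t \<mapsto> f (x + h v + t w) - f
  (x + t w). The derivative of this function is the increment of the w-derivative of f across h v,
  which differentiability of that w-derivative at the point x controls to order h.\<close>

lemma second_difference_estimate:
  fixes f :: "'a::euclidean_space \<Rightarrow> 'b::real_normed_vector"
  assumes "smooth_on S f" "open S" "x \<in> S" "0 < \<epsilon>"
  shows "\<exists>d>0. \<forall>h. 0 < h \<and> h < d \<longrightarrow>
    norm (f (x + h *\<^sub>R v + h *\<^sub>R w) - f (x + h *\<^sub>R v) - f (x + h *\<^sub>R w) + f x
      - (h\<^sup>2) *\<^sub>R frechet_derivative (\<lambda>y. frechet_derivative f (at y) w) (at x) v)
    \<le> \<epsilon> * h\<^sup>2"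
proof -
  let ?g = "\<lambda>y. frechet_derivative f (at y) w"
  let ?D = "frechet_derivative ?g (at x)"
  define M where "M = 2 * (norm v + norm w) + 1"
  have M: "M > 0" by (simp add: M_def add_nonneg_pos)
  have dg: "(?g has_derivative ?D) (at x)"
    by (rule smooth_on_has_derivative[OF smooth_on_frechet_derivative[OF assms(1)] assms(3)])
  obtain d0 where d0: "d0 > 0" "ball x d0 \<subseteq> S" using assms openE by blast
  have "\<epsilon> / M > 0" using assms M by simp
  then obtain d1 where d1: "d1 > 0" "\<And>y. norm (y - x) < d1 \<Longrightarrow>
      norm (?g y - ?g x - ?D (y - x)) \<le> \<epsilon> / M * norm (y - x)"
    using dg unfolding has_derivative_at_alt by blast
  define d where "d = min d0 d1 / M"
  have d: "d > 0" using d0 d1 M by (simp add: d_def)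
  have lin: "linear ?D" using dg has_derivative_linear by blast
  show ?thesis
  proof (intro exI[of _ d] conjI d allI impI)
    fix h assume h: "0 < h \<and> h < d"
    have hM: "h * M < d0" "h * M < d1" using h M by (auto simp: d_def field_simps)
    have small: "norm (a *\<^sub>R v + t *\<^sub>R w) \<le> h * (norm v + norm w)" if "0 \<le> a" "a \<le> h" "0 \<le> t" "t \<le> h" for a t
    proof -
      have "norm (a *\<^sub>R v + t *\<^sub>R w) \<le> a * norm v + t * norm w"
        using that norm_triangle_ineq[of "a *\<^sub>R v" "t *\<^sub>R w"] by simp
      also have "\<dots> \<le> h * norm v + h * norm w" using that by (intro add_mono mult_right_mono) auto
      finally show ?thesis by (simp add: algebra_simps)
    qed
    have lt: "h * (norm v + norm w) < h * M" using h by (simp add: M_def add_nonneg_pos)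
    have inS: "x + a *\<^sub>R v + t *\<^sub>R w \<in> S" if "0 \<le> a" "a \<le> h" "0 \<le> t" "t \<le> h" for a t
      using small[OF that] lt hM d0(2) by (auto simp: dist_norm subset_iff add.assoc norm_minus_commute[of x])
    \<comment> \<open>Subtracting the expected linear growth leaves a function whose derivative is
      at most \<open>\<epsilon> * h\<close>; the mean value inequality adds the second factor
      h.\<close>
    define \<phi> where "\<phi> t = f (x + h *\<^sub>R v + t *\<^sub>R w) - f (x + t *\<^sub>R w) - (t * h) *\<^sub>R ?D v" for t
    define \<phi>' where "\<phi>' t = ?g (x + h *\<^sub>R v + t *\<^sub>R w) - ?g (x + t *\<^sub>R w) - h *\<^sub>R ?D v" for t
    have fd: "((\<lambda>t. f (y + t *\<^sub>R w)) has_vector_derivative ?g (y + t *\<^sub>R w)) (at t within T)"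
      if "y + t *\<^sub>R w \<in> S" for y t T
    proof -
      have "(f has_derivative frechet_derivative f (at (y + t *\<^sub>R w))) (at (y + t *\<^sub>R w))"
        by (rule smooth_on_has_derivative[OF assms(1) that])
      moreover have "((\<lambda>t. y + t *\<^sub>R w) has_vector_derivative w) (at t within T)"
        by (auto intro!: derivative_eq_intros)
      ultimately show ?thesis
        using vector_derivative_diff_chain_within[of "\<lambda>t. y + t *\<^sub>R w" w t T f]
        by (auto simp: o_def intro: has_derivative_at_withinI)
    qed
    have der: "(\<phi> has_vector_derivative \<phi>' t) (at t within {0..h})" if "t \<in> {0..h}" for t
    proof -
      have "((\<lambda>t. (t * h) *\<^sub>R ?D v) has_vector_derivative h *\<^sub>R ?D v) (at t within {0..h})"
        by (auto intro!: derivative_eq_intros simp: has_vector_derivative_def)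
      then show ?thesis
        unfolding \<phi>_def \<phi>'_def using inS[of h t] inS[of 0 t] that h
        by (intro has_vector_derivative_diff fd) (auto simp: add.assoc)
    qed
    have bd: "norm (\<phi>' t) \<le> \<epsilon> * h" if t: "t \<in> {0..h}" for t
    proof -
      have e: "norm (?g (x + (a *\<^sub>R v + t *\<^sub>R w)) - ?g x - ?D (a *\<^sub>R v + t *\<^sub>R w)) \<le> \<epsilon> / M * (h * (norm v + norm w))"
        if "0 \<le> a" "a \<le> h" for a
      proof -
        have s: "norm (a *\<^sub>R v + t *\<^sub>R w) \<le> h * (norm v + norm w)" using small that t by auto
        have "norm (?g (x + (a *\<^sub>R v + t *\<^sub>R w)) - ?g x - ?D ((x + (a *\<^sub>R v + t *\<^sub>R w)) - x))
            \<le> \<epsilon> / M * norm ((x + (a *\<^sub>R v + t *\<^sub>R w)) - x)"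
          by (rule d1(2)) (use s lt hM in simp)
        also have "\<dots> \<le> \<epsilon> / M * (h * (norm v + norm w))"
          using s assms M by (intro mult_left_mono) auto
        finally show ?thesis by simp
      qed
      have "\<phi>' t = (?g (x + (h *\<^sub>R v + t *\<^sub>R w)) - ?g x - ?D (h *\<^sub>R v + t *\<^sub>R w))
          - (?g (x + (0 *\<^sub>R v + t *\<^sub>R w)) - ?g x - ?D (0 *\<^sub>R v + t *\<^sub>R w))"
        using lin by (simp add: \<phi>'_def linear_add linear_scale add.assoc)
      also have "norm \<dots> \<le> \<epsilon> / M * (h * (norm v + norm w)) + \<epsilon> / M * (h * (norm v + norm w))"
        using h by (intro order_trans[OF norm_triangle_ineq4] add_mono e) auto
      also have "\<dots> = \<epsilon> * h * (2 * (norm v + norm w) / M)" by (simp add: field_simps)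
      also have "\<dots> \<le> \<epsilon> * h * 1"
        using assms h M by (intro mult_left_mono) (auto simp: M_def)
      finally show ?thesis by simp
    qed
    have "norm (\<phi> h - \<phi> 0) \<le> \<epsilon> * h * norm (h - 0)"
    proof (rule differentiable_bound[where S = "{0..h}" and f' = "\<lambda>t s. s *\<^sub>R \<phi>' t"])
      show "(\<phi> has_derivative (\<lambda>s. s *\<^sub>R \<phi>' t)) (at t within {0..h})" if "t \<in> {0..h}" for t
        using der[OF that] by (simp add: has_vector_derivative_def)
      show "onorm (\<lambda>s. s *\<^sub>R \<phi>' t) \<le> \<epsilon> * h" if "t \<in> {0..h}" for t
        by (rule onorm_le)
          (use mult_right_mono[OF bd[OF that] abs_ge_zero] in \<open>simp add: mult.commute\<close>)
    qed (use h in auto)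
    then show "norm (f (x + h *\<^sub>R v + h *\<^sub>R w) - f (x + h *\<^sub>R v) - f (x + h *\<^sub>R w) + f x
      - (h\<^sup>2) *\<^sub>R ?D v) \<le> \<epsilon> * h\<^sup>2"
      using h by (simp add: \<phi>_def power2_eq_square algebra_simps)
  qed
qed

text \<open>The second difference is symmetric in v and w and, divided by h^2, tends to either mixed
  derivative.\<close>

lemma second_derivative_symmetric:
  fixes f :: "'a::euclidean_space \<Rightarrow> 'b::real_normed_vector"
  assumes "smooth_on S f" "open S" "x \<in> S"
  shows "frechet_derivative (\<lambda>y. frechet_derivative f (at y) w) (at x) v
       = frechet_derivative (\<lambda>y. frechet_derivative f (at y) v) (at x) w" (is "?a = ?b")
proof -
  have "norm (?a - ?b) \<le> 2 * \<epsilon>" if "0 < \<epsilon>" for \<epsilon>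
  proof -
    obtain d where d: "d > 0" "\<forall>h. 0 < h \<and> h < d \<longrightarrow>
        norm (f (x + h *\<^sub>R v + h *\<^sub>R w) - f (x + h *\<^sub>R v) - f (x + h *\<^sub>R w) + f x - (h\<^sup>2) *\<^sub>R ?a) \<le> \<epsilon> * h\<^sup>2"
      using second_difference_estimate[OF assms \<open>0 < \<epsilon>\<close>] by blast
    obtain d' where d': "d' > 0" "\<forall>h. 0 < h \<and> h < d' \<longrightarrow>
        norm (f (x + h *\<^sub>R w + h *\<^sub>R v) - f (x + h *\<^sub>R w) - f (x + h *\<^sub>R v) + f x - (h\<^sup>2) *\<^sub>R ?b) \<le> \<epsilon> * h\<^sup>2"
      using second_difference_estimate[OF assms \<open>0 < \<epsilon>\<close>] by blast
    define h where "h = min d d' / 2"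
    have h: "0 < h" "h < d" "h < d'" using d d' by (auto simp: h_def)
    let ?X = "f (x + h *\<^sub>R v + h *\<^sub>R w) - f (x + h *\<^sub>R v) - f (x + h *\<^sub>R w) + f x"
    have 1: "norm (?X - (h\<^sup>2) *\<^sub>R ?a) \<le> \<epsilon> * h\<^sup>2" using d h by blast
    have "f (x + h *\<^sub>R w + h *\<^sub>R v) - f (x + h *\<^sub>R w) - f (x + h *\<^sub>R v) + f x = ?X"
      by (simp add: algebra_simps)
    then have 2: "norm (?X - (h\<^sup>2) *\<^sub>R ?b) \<le> \<epsilon> * h\<^sup>2" using d' h by metis
    have "(h\<^sup>2) *\<^sub>R (?a - ?b) = (?X - (h\<^sup>2) *\<^sub>R ?b) - (?X - (h\<^sup>2) *\<^sub>R ?a)" by (simp add: algebra_simps)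
    then have "h\<^sup>2 * norm (?a - ?b) \<le> \<epsilon> * h\<^sup>2 + \<epsilon> * h\<^sup>2"
      using order_trans[OF norm_triangle_ineq4[of "?X - (h\<^sup>2) *\<^sub>R ?b" "?X - (h\<^sup>2) *\<^sub>R ?a"]
          add_mono[OF 2 1]] by (metis abs_power2 norm_scaleR)
    then show ?thesis using h by (simp add: field_simps)
  qed
  from this[of "_ / 2"] have "norm (?a - ?b) \<le> 0 + \<epsilon>" if "0 < \<epsilon>" for \<epsilon>
    using that by simp
  then have "norm (?a - ?b) \<le> 0" by (rule field_le_epsilon)
  then show ?thesis by simp
qed


section \<open>Ordinary differential equations\<close>

text \<open>The squared norm stays differentiable where g vanishes, unlike the norm. Carrying
  \<open>\<epsilon>\<^sup>2\<close> along absorbs the mixed term 2 |g| \<epsilon>, which is why the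
  rate is 2 K + 1 and not 2 K.\<close>

lemma gronwall_square:
  fixes g :: "real \<Rightarrow> 'a::euclidean_space"
  assumes der: "\<And>t. t \<in> {0..T} \<Longrightarrow> (g has_vector_derivative g' t) (at t within {0..T})"
    and bd: "\<And>t. t \<in> {0..T} \<Longrightarrow> norm (g' t) \<le> K * norm (g t) + \<epsilon>"
    and K: "0 \<le> K" and \<epsilon>: "0 \<le> \<epsilon>" and t: "t \<in> {0..T}"
  shows "(norm (g t))\<^sup>2 + \<epsilon>\<^sup>2 \<le> exp ((2 * K + 1) * t) * ((norm (g 0))\<^sup>2 + \<epsilon>\<^sup>2)"
proof -
  define c where "c = 2 * K + 1"
  define h where "h s = exp (- (c * s)) * (g s \<bullet> g s + \<epsilon>\<^sup>2)" for s
  define h' where "h' s = exp (- (c * s)) * (2 * (g s \<bullet> g' s) - c * (g s \<bullet> g s + \<epsilon>\<^sup>2))" for s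
  have dh: "(h has_derivative (\<lambda>x. x * h' s)) (at s within {0..t})" if s: "s \<in> {0..t}" for s
  proof -
    have g: "(g has_vector_derivative g' s) (at s within {0..t})"
      by (rule has_vector_derivative_within_subset[OF der]) (use s t in auto)
    have "((\<lambda>s. g s \<bullet> g s) has_vector_derivative (g s \<bullet> g' s + g' s \<bullet> g s)) (at s within {0..t})"
      by (rule bounded_bilinear.has_vector_derivative[OF bounded_bilinear_inner g g])
    then have "((\<lambda>s. g s \<bullet> g s + \<epsilon>\<^sup>2) has_real_derivative (2 * (g s \<bullet> g' s))) (at s within {0..t})"
      by (auto simp: has_real_derivative_iff_has_vector_derivative inner_commute
          intro!: derivative_eq_intros elim!: has_vector_derivative_eq_rhs)
    moreover have "((\<lambda>s. exp (- (c * s))) has_real_derivative (exp (- (c * s)) * - c)) (at s within {0..t})"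
      by (auto intro!: derivative_eq_intros)
    ultimately have "(h has_real_derivative h' s) (at s within {0..t})"
      unfolding h_def h'_def
      using DERIV_mult'[THEN DERIV_cong] by (fastforce simp: algebra_simps)
    then show ?thesis by (simp add: has_field_derivative_def mult.commute[of _ "h' s"])
  qed
  obtain s where s: "s \<in> {0..t}" "h t - h 0 = (t - 0) * h' s"
    using mvt_very_simple[of 0 t h "\<lambda>s x. x * h' s"] dh t by auto
  have "2 * (g s \<bullet> g' s) \<le> c * (g s \<bullet> g s + \<epsilon>\<^sup>2)"
  proof -
    have "g s \<bullet> g' s \<le> norm (g s) * norm (g' s)" by (rule norm_cauchy_schwarz)
    also have "\<dots> \<le> norm (g s) * (K * norm (g s) + \<epsilon>)"
      using bd[of s] s t by (intro mult_left_mono) auto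
    finally have "2 * (g s \<bullet> g' s) \<le> 2 * K * (norm (g s))\<^sup>2 + 2 * norm (g s) * \<epsilon>"
      by (simp add: algebra_simps power2_eq_square)
    also have "2 * norm (g s) * \<epsilon> \<le> (norm (g s))\<^sup>2 + \<epsilon>\<^sup>2"
      by (rule sum_squares_bound)
    finally have "2 * (g s \<bullet> g' s) \<le> c * (norm (g s))\<^sup>2 + \<epsilon>\<^sup>2" by (simp add: c_def algebra_simps)
    also have "\<dots> \<le> c * (norm (g s))\<^sup>2 + c * \<epsilon>\<^sup>2"
      using K by (simp add: c_def algebra_simps)
    finally show ?thesis by (simp add: power2_norm_eq_inner algebra_simps)
  qed
  then have "h' s \<le> 0" by (simp add: h'_def mult_nonneg_nonpos)
  then have "h t \<le> h 0" using s t by (smt (verit) atLeastAtMost_iff mult_nonneg_nonpos)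
  then have "exp (c * t) * h t \<le> exp (c * t) * h 0" by (intro mult_left_mono) auto
  moreover have "exp (c * t) * h t = (norm (g t))\<^sup>2 + \<epsilon>\<^sup>2"
    by (simp add: h_def power2_norm_eq_inner mult.assoc[symmetric] mult_exp_exp)
  moreover have "h 0 = (norm (g 0))\<^sup>2 + \<epsilon>\<^sup>2" by (simp add: h_def power2_norm_eq_inner)
  ultimately show ?thesis by (simp only: c_def)
qed

lemma gronwall:
  fixes g :: "real \<Rightarrow> 'a::euclidean_space"
  assumes der: "\<And>t. t \<in> {0..1} \<Longrightarrow> (g has_vector_derivative g' t) (at t within {0..1})"
    and bd: "\<And>t. t \<in> {0..1} \<Longrightarrow> norm (g' t) \<le> K * norm (g t) + \<epsilon>"
    and K: "0 \<le> K" and \<epsilon>: "0 \<le> \<epsilon>" and t: "t \<in> {0..1}" and g0: "g 0 = 0"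
  shows "norm (g t) \<le> exp (K + 1) * \<epsilon>"
proof (rule power2_le_imp_le)
  have "(norm (g t))\<^sup>2 \<le> (norm (g t))\<^sup>2 + \<epsilon>\<^sup>2" by simp
  also have "\<dots> \<le> exp ((2 * K + 1) * t) * ((norm (g 0))\<^sup>2 + \<epsilon>\<^sup>2)"
    by (rule gronwall_square[OF der bd K \<epsilon> t])
  also have "\<dots> \<le> exp (2 * (K + 1)) * \<epsilon>\<^sup>2"
  proof -
    have "(2 * K + 1) * t \<le> (2 * K + 1) * 1" using t K by (intro mult_left_mono) auto
    then show ?thesis using g0 by (auto intro!: mult_right_mono)
  qed
  also have "\<dots> = (exp (K + 1) * \<epsilon>)\<^sup>2" by (simp add: power_mult_distrib exp_double[symmetric] del: distrib_left_numeral)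
  finally show "(norm (g t))\<^sup>2 \<le> (exp (K + 1) * \<epsilon>)\<^sup>2" .
qed (use \<epsilon> in auto)

text \<open>With a global Lipschitz constant 1 / 2 the iteration contracts on the whole unit time
  interval, so time never has to be shrunk. Fields known on a ball only are truncated first, in
  \<open>solution_exists\<close>.\<close>

lemma picard_existence:
  fixes F :: "'a::euclidean_space \<Rightarrow> 'a"
  assumes lip: "\<And>x y. norm (F x - F y) \<le> norm (x - y) / 2"
  obtains u where "u 0 = 0"
    "\<And>t. t \<in> {0..1} \<Longrightarrow> (u has_vector_derivative F (u t)) (at t within {0..1})"
proof -
  define U :: "nat \<Rightarrow> real \<Rightarrow> 'a"
    where "U n = rec_nat (\<lambda>_. 0) (\<lambda>_ u t. integral {0..t} (\<lambda>s. F (u s))) n" for n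
  have U0: "U 0 = (\<lambda>_. 0)" and US: "U (Suc n) t = integral {0..t} (\<lambda>s. F (U n s))" for n t
    by (simp_all add: U_def)
  have contF: "continuous_on UNIV F"
  proof (rule continuous_onI)
    fix x and e :: real assume "0 < e"
    show "\<exists>d>0. \<forall>x'\<in>UNIV. dist x' x < d \<longrightarrow> dist (F x') (F x) \<le> e"
    proof (intro exI[of _ e] conjI ballI impI)
      fix x' assume "dist x' x < e"
      then show "dist (F x') (F x) \<le> e" using lip[of x' x] \<open>0 < e\<close> by (simp add: dist_norm)
    qed fact
  qed
  have cF: "continuous_on {0..1} (\<lambda>s. F (f s))" if "continuous_on {0..1} f" for f :: "real \<Rightarrow> 'a"
    using continuous_on_compose2[OF contF that] by auto
  have iF: "(\<lambda>s. F (f s)) integrable_on {0..t}"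
    if "continuous_on {0..1} f" "t \<in> {0..1}" for f :: "real \<Rightarrow> 'a" and t
    using continuous_on_subset[OF cF[OF that(1)]] that(2) by (intro integrable_continuous_interval) auto
  have cU: "continuous_on {0..1} (U n)" for n
  proof (induction n)
    case (Suc n)
    have "continuous_on {0..1} (\<lambda>t. integral {0..t} (\<lambda>s. F (U n s)))"
      by (rule indefinite_integral_continuous_1) (use iF[OF Suc, of 1] in auto)
    then show ?case by (simp add: US[abs_def])
  qed (simp add: U0)
  have diff: "norm (integral {0..t} (\<lambda>s. F (f s)) - integral {0..t} (\<lambda>s. F (g s))) \<le> c / 2"
    if "continuous_on {0..1} f" "continuous_on {0..1} g" "t \<in> {0..1}"
      "\<And>s. s \<in> {0..1} \<Longrightarrow> norm (f s - g s) \<le> c" for f g :: "real \<Rightarrow> 'a" and t c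
  proof -
    have c: "0 \<le> c" using order_trans[OF norm_ge_zero that(4)[OF that(3)]] .
    have "norm (integral {0..t} (\<lambda>s. F (f s) - F (g s))) \<le> (c / 2) * (t - 0)"
    proof (rule integral_bound)
      show "continuous_on {0..t} (\<lambda>s. F (f s) - F (g s))"
        using continuous_on_subset[OF continuous_on_diff[OF cF[OF that(1)] cF[OF that(2)]]] that(3) by auto
      show "norm (F (f s) - F (g s)) \<le> c / 2" if "s \<in> {0..t}" for s
        using lip[of "f s" "g s"] that \<open>t \<in> {0..1}\<close>
          \<open>\<And>s. s \<in> {0..1} \<Longrightarrow> norm (f s - g s) \<le> c\<close>[of s] by auto
    qed (use that in auto)
    also have "\<dots> \<le> c / 2 * 1" using that(3) c by (intro mult_left_mono) auto
    finally show ?thesis using iF that by (simp add: integral_diff)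
  qed
  define M where "M = norm (F 0)"
  have step: "norm (U (Suc n) t - U n t) \<le> M * (1 / 2) ^ n" if "t \<in> {0..1}" for n t
    using that
  proof (induction n arbitrary: t)
    case 0
    then have "norm (U (Suc 0) t) = t * M" by (simp add: US U0 M_def)
    also have "\<dots> \<le> 1 * M" using 0 by (intro mult_right_mono) (auto simp: M_def)
    finally show ?case by (simp add: U0)
  next
    case (Suc n)
    then show ?case
      using diff[OF cU[of "Suc n"] cU[of n] Suc.prems Suc.IH] by (simp add: US)
  qed
  have ul: "uniform_limit {0..1} (\<lambda>n t. \<Sum>i<n. U (Suc i) t - U i t)
      (\<lambda>t. \<Sum>i. U (Suc i) t - U i t) sequentially"
    by (rule Weierstrass_m_test[where M = "\<lambda>n. M * (1 / 2) ^ n"])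
      (use step in \<open>auto intro!: summable_mult summable_geometric\<close>)
  define u where "u t = (\<Sum>i. U (Suc i) t - U i t)" for t
  have "(\<Sum>i<n. U (Suc i) t - U i t) = U n t" for n t
    by (induction n) (auto simp: U0)
  then have ul: "uniform_limit {0..1} U u sequentially"
    using ul by (simp add: u_def[abs_def])
  have cu: "continuous_on {0..1} u"
    by (rule uniform_limit_theorem[OF _ ul]) (auto simp: cU)
  have fix_u: "u t = integral {0..t} (\<lambda>s. F (u s))" if t: "t \<in> {0..1}" for t
  proof -
    have "norm (u t - integral {0..t} (\<lambda>s. F (u s))) \<le> 0 + e" if "0 < e" for e
    proof -
      have "e / 2 > 0" using that by simp
      then have "\<forall>\<^sub>F n in sequentially. \<forall>x\<in>{0..1}. dist (U n x) (u x) < e / 2"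
        using ul unfolding uniform_limit_iff by blast
      then obtain N where N: "\<And>n x. n \<ge> N \<Longrightarrow> x \<in> {0..1} \<Longrightarrow> norm (U n x - u x) < e / 2"
        unfolding eventually_sequentially dist_norm by blast
      have 1: "norm (U (Suc N) t - u t) < e / 2" using N t by auto
      have 2: "norm (U (Suc N) t - integral {0..t} (\<lambda>s. F (u s))) \<le> (e / 2) / 2"
        unfolding US by (rule diff[OF cU cu t]) (use N[of N] in \<open>auto intro: less_imp_le\<close>)
      have "norm (u t - integral {0..t} (\<lambda>s. F (u s)))
          = norm ((U (Suc N) t - integral {0..t} (\<lambda>s. F (u s))) - (U (Suc N) t - u t))" by simp
      also have "\<dots> \<le> e / 2 / 2 + e / 2"
        by (rule order_trans[OF norm_triangle_ineq4 add_mono[OF 2 less_imp_le[OF 1]]])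
      finally show ?thesis using that by simp
    qed
    then have "norm (u t - integral {0..t} (\<lambda>s. F (u s))) \<le> 0" by (rule field_le_epsilon)
    then show ?thesis by simp
  qed
  show ?thesis
  proof (rule that)
    show "u 0 = 0" using fix_u[of 0] by simp
    show "(u has_vector_derivative F (u t)) (at t within {0..1})" if "t \<in> {0..1}" for t
      by (rule has_vector_derivative_transform[OF that _ integral_has_vector_derivative[OF cF[OF cu] that]])
        (use fix_u in auto)
  qed
qed


section \<open>Local Lie groups\<close>

lemma norm_le_of_basis:
  fixes T :: "'a::euclidean_space \<Rightarrow> 'b::real_normed_vector"
  assumes "linear T" "\<And>b. b \<in> Basis \<Longrightarrow> norm (T b) \<le> k b * c"
  shows "norm (T w) \<le> (\<Sum>b\<in>Basis. k b) * c * norm w"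
proof -
  have "T w = (\<Sum>b\<in>Basis. (w \<bullet> b) *\<^sub>R T b)" by (rule linear_basis_expansion) fact
  also have "norm \<dots> \<le> (\<Sum>b\<in>Basis. norm w * (k b * c))"
  proof (intro sum_norm_le)
    fix b :: 'a assume b: "b \<in> Basis"
    have "norm ((w \<bullet> b) *\<^sub>R T b) = \<bar>w \<bullet> b\<bar> * norm (T b)" by simp
    also have "\<dots> \<le> norm w * (k b * c)"
      using b by (intro mult_mono assms) (auto intro: Basis_le_norm)
    finally show "norm ((w \<bullet> b) *\<^sub>R T b) \<le> norm w * (k b * c)" .
  qed
  finally show ?thesis by (simp add: sum_distrib_left sum_distrib_right mult_ac)
qed

text \<open>A group multiplication seen in a chart with the identity moved to 0. \<open>m\<close> is
  total, but its laws are known only as long as the products stay in the ball. Inverses are not part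
  of the data; near 0 they come from the exponential map.\<close>

locale local_lie =
  fixes m :: "'a::euclidean_space \<Rightarrow> 'a \<Rightarrow> 'a" and \<rho> :: real
  assumes rho: "0 < \<rho>"
    and m_smooth: "smooth_on (ball 0 \<rho> \<times> ball 0 \<rho>) (\<lambda>p. m (fst p) (snd p))"
    and m_0_right: "x \<in> ball 0 \<rho> \<Longrightarrow> m x 0 = x"
    and m_0_left: "x \<in> ball 0 \<rho> \<Longrightarrow> m 0 x = x"
    and m_assoc: "\<lbrakk>x \<in> ball 0 \<rho>; y \<in> ball 0 \<rho>; z \<in> ball 0 \<rho>; m x y \<in> ball 0 \<rho>; m y z \<in> ball 0 \<rho>\<rbrakk>
      \<Longrightarrow> m (m x y) z = m x (m y z)"
begin

abbreviation "U \<equiv> ball (0::'a) \<rho>"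

definition dm :: "'a \<Rightarrow> 'a \<Rightarrow> 'a \<times> 'a \<Rightarrow> 'a" where
  "dm x y = frechet_derivative (\<lambda>p. m (fst p) (snd p)) (at (x, y))"

text \<open>\<open>V x w\<close> and \<open>VR x w\<close> are the left- and right-invariant vector fields with value \<open>w\<close> at the
  identity; \<open>br\<close> is the bracket given by the second order part of the product.\<close>

definition V :: "'a \<Rightarrow> 'a \<Rightarrow> 'a" where "V x w = dm x 0 (0, w)"
definition VR :: "'a \<Rightarrow> 'a \<Rightarrow> 'a" where "VR x w = dm 0 x (w, 0)"
definition B :: "'a \<Rightarrow> 'a \<Rightarrow> 'a" where "B u w = frechet_derivative (\<lambda>x. V x w) (at 0) u"
definition br :: "'a \<Rightarrow> 'a \<Rightarrow> 'a" where "br z w = B z w - B w z"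

lemmas rho_pos [simp] = rho

lemma zero_in_U: "0 \<in> U" by simp

lemma open_UU [simp]: "open (U \<times> U)" by (simp add: open_Times)

lemma m_derivative:
  "x \<in> U \<Longrightarrow> y \<in> U \<Longrightarrow> ((\<lambda>p. m (fst p) (snd p)) has_derivative dm x y) (at (x, y))"
  unfolding dm_def by (rule smooth_on_has_derivative[OF m_smooth]) simp

lemma linear_dm: "x \<in> U \<Longrightarrow> y \<in> U \<Longrightarrow> linear (dm x y)"
  using m_derivative has_derivative_linear by blast

lemma dm_split: "x \<in> U \<Longrightarrow> y \<in> U \<Longrightarrow> dm x y (a, b) = dm x y (a, 0) + dm x y (0, b)"
  using linear_add[OF linear_dm, of x y "(a, 0)" "(0, b)"] by simp

lemma linear_V: "x \<in> U \<Longrightarrow> linear (V x)"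
  using linear_compose[OF _ linear_dm, of "\<lambda>w. (0, w)" x 0]
  by (auto simp add: V_def[abs_def] o_def linear_iff)

lemma linear_VR: "x \<in> U \<Longrightarrow> linear (VR x)"
  using linear_compose[OF _ linear_dm, of "\<lambda>w. (w, 0)" 0 x]
  by (auto simp: VR_def[abs_def] o_def linear_iff)

lemma m_curve:
  assumes "(f has_vector_derivative f') (at t within S)" "(g has_vector_derivative g') (at t within S)"
    and "f t \<in> U" "g t \<in> U"
  shows "((\<lambda>t. m (f t) (g t)) has_vector_derivative dm (f t) (g t) (f', g')) (at t within S)"
proof -
  have "((\<lambda>t. (f t, g t)) has_vector_derivative (f', g')) (at t within S)"
    by (rule has_vector_derivative_Pair[OF assms(1,2)])
  moreover have "((\<lambda>p. m (fst p) (snd p)) has_derivative dm (f t) (g t))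
      (at (f t, g t) within (\<lambda>t. (f t, g t)) ` S)"
    by (rule has_derivative_at_withinI[OF m_derivative[OF assms(3,4)]])
  ultimately show ?thesis
    using vector_derivative_diff_chain_within[of "\<lambda>t. (f t, g t)" "(f', g')" t S
        "\<lambda>p. m (fst p) (snd p)" "dm (f t) (g t)"]
    by (simp add: o_def)
qed

lemma m_right_derivative:
  assumes "x \<in> U" "y \<in> U"
  shows "((\<lambda>y. m x y) has_derivative (\<lambda>w. dm x y (0, w))) (at y)"
proof -
  have "((\<lambda>p. m (fst p) (snd p)) \<circ> (\<lambda>y. (x, y)) has_derivative dm x y \<circ> (\<lambda>w. (0, w))) (at y)"
    using m_derivative[OF assms] by (intro diff_chain_at) (auto intro!: derivative_eq_intros)
  then show ?thesis by (simp add: o_def)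
qed

lemma m_left_derivative:
  assumes "x \<in> U" "y \<in> U"
  shows "((\<lambda>x. m x y) has_derivative (\<lambda>w. dm x y (w, 0))) (at x)"
proof -
  have "((\<lambda>p. m (fst p) (snd p)) \<circ> (\<lambda>x. (x, y)) has_derivative dm x y \<circ> (\<lambda>w. (w, 0))) (at x)"
    using m_derivative[OF assms] by (intro diff_chain_at) (auto intro!: derivative_eq_intros)
  then show ?thesis by (simp add: o_def)
qed

lemma V_0 [simp]: "V 0 w = w"
proof -
  have "((\<lambda>y. y) has_derivative (\<lambda>w. dm 0 0 (0, w))) (at 0)"
    by (rule has_derivative_transform_within_open[OF m_right_derivative, where s = U])
      (auto simp: m_0_left)
  from has_derivative_unique[OF this has_derivative_ident] show ?thesis
    unfolding V_def by (rule fun_cong)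
qed

lemma VR_0 [simp]: "VR 0 w = w"
proof -
  have "((\<lambda>y. y) has_derivative (\<lambda>w. dm 0 0 (w, 0))) (at 0)"
    by (rule has_derivative_transform_within_open[OF m_left_derivative, where s = U])
      (auto simp: m_0_right)
  from has_derivative_unique[OF this has_derivative_ident] show ?thesis
    unfolding VR_def by (rule fun_cong)
qed

lemma smooth_dm: "smooth_on (U \<times> U) (\<lambda>p. dm (fst p) (snd p) w)"
  using smooth_on_frechet_derivative[OF m_smooth] by (simp add: dm_def)

lemma smooth_Pair_left: "smooth_on U (\<lambda>x::'a. (x, 0::'a))"
  and smooth_Pair_right: "smooth_on U (\<lambda>x::'a. (0::'a, x))"
  by (auto intro!: smooth_on_Pair smooth_on_id smooth_on_const)

lemma smooth_V: "smooth_on U (\<lambda>x. V x w)"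
  using smooth_on_compose[OF smooth_dm smooth_Pair_left, of "(0, w)"] by (simp add: V_def rho)

lemma smooth_VR: "smooth_on U (\<lambda>x. VR x w)"
  using smooth_on_compose[OF smooth_dm smooth_Pair_right, of "(w, 0)"] by (simp add: VR_def rho)

lemma V_derivative: "((\<lambda>x. V x w) has_derivative (\<lambda>u. B u w)) (at 0)"
  unfolding B_def by (rule smooth_on_has_derivative[OF smooth_V]) simp

text \<open>\<open>V\<close> and \<open>VR\<close> are first derivatives of \<open>m\<close> in its
  two slots, so differentiating either once more at 0 gives the same mixed second derivative with
  exchanged arguments. One bilinear form \<open>B\<close> thus governs both kinds of invariant
  fields to first order.\<close>

lemma VR_derivative: "((\<lambda>x. VR x u) has_derivative (\<lambda>w. B u w)) (at 0)"
proof -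
  let ?D = "\<lambda>w. frechet_derivative (\<lambda>p. dm (fst p) (snd p) w) (at (0, 0))"
  have D: "((\<lambda>p. dm (fst p) (snd p) w) has_derivative ?D w) (at (0, 0))" for w
    by (rule smooth_on_has_derivative[OF smooth_dm]) simp
  have "((\<lambda>p. dm (fst p) (snd p) (0, w)) \<circ> (\<lambda>x. (x, 0)) has_derivative ?D (0, w) \<circ> (\<lambda>u. (u, 0))) (at 0)" for w
    using D by (intro diff_chain_at) (auto intro!: derivative_eq_intros)
  then have 1: "B u w = ?D (0, w) (u, 0)" for u w
    using has_derivative_unique[OF V_derivative] by (auto simp: o_def V_def fun_eq_iff)
  have "((\<lambda>p. dm (fst p) (snd p) (u, 0)) \<circ> (\<lambda>x. (0, x)) has_derivative ?D (u, 0) \<circ> (\<lambda>u. (0, u))) (at 0)"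
    using D by (intro diff_chain_at) (auto intro!: derivative_eq_intros)
  moreover have "?D (u, 0) (0, w) = ?D (0, w) (u, 0)" for w
    using second_derivative_symmetric[OF m_smooth open_UU, of "(0, 0)" "(u, 0)" "(0, w)"]
    by (simp add: dm_def)
  ultimately show ?thesis unfolding 1 by (simp add: o_def VR_def)
qed

lemma linear_B_left: "linear (\<lambda>u. B u w)"
  using V_derivative has_derivative_linear by blast

lemma linear_B_right: "linear (\<lambda>w. B u w)"
  using VR_derivative has_derivative_linear by blast

lemma bilinear_B: "bilinear B"
  using linear_B_left linear_B_right by (auto simp: bilinear_def)

lemma bilinear_br: "bilinear br"
  using linear_B_left linear_B_right
  by (auto simp: bilinear_def br_def intro!: linear_compose_sub)

lemma estimates:
  obtains K where "0 < K"
    "\<And>x y w. x \<in> cball 0 (\<rho> / 2) \<Longrightarrow> y \<in> cball 0 (\<rho> / 2) \<Longrightarrow> norm (V x w - V y w) \<le> K * norm (x - y) * norm w"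
    "\<And>x w. x \<in> cball 0 (\<rho> / 2) \<Longrightarrow> norm (VR x w - w) \<le> K * norm x * norm w"
    "\<And>x w. x \<in> cball 0 (\<rho> / 2) \<Longrightarrow> norm (V x w - w - B x w) \<le> K * (norm x)\<^sup>2 * norm w"
    "\<And>x w. x \<in> cball 0 (\<rho> / 2) \<Longrightarrow> norm (VR x w - w - B w x) \<le> K * (norm x)\<^sup>2 * norm w"
    "\<And>u w. norm (B u w) \<le> K * norm u * norm w"
    "\<And>x y. x \<in> cball 0 (\<rho> / 2) \<Longrightarrow> y \<in> cball 0 (\<rho> / 2) \<Longrightarrow> norm (m x y - x) \<le> K * norm y"
proof -
  let ?C = "cball (0::'a) (\<rho> / 2)"
  have C: "?C \<subseteq> U" "0 \<in> ?C" using rho by (auto simp del: rho_pos)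
  note lips = compact_cball convex_cball C(1)
  have "\<exists>K\<ge>0. \<forall>x\<in>?C. \<forall>y\<in>?C. norm (V x b - V y b) \<le> K * norm (x - y)" for b
    by (rule smooth_on_Lipschitz[OF smooth_V lips]) blast
  then obtain k1 where k1: "\<And>b. 0 \<le> k1 b"
    "\<And>b x y. x \<in> ?C \<Longrightarrow> y \<in> ?C \<Longrightarrow> norm (V x b - V y b) \<le> k1 b * norm (x - y)"
    using choice[of "\<lambda>b K. K \<ge> 0 \<and> (\<forall>x\<in>?C. \<forall>y\<in>?C. norm (V x b - V y b) \<le> K * norm (x - y))"] by blast
  have "\<exists>K\<ge>0. \<forall>x\<in>?C. \<forall>y\<in>?C. norm (VR x b - VR y b) \<le> K * norm (x - y)" for b
    by (rule smooth_on_Lipschitz[OF smooth_VR lips]) blast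
  then obtain k2 where k2: "\<And>b. 0 \<le> k2 b"
    "\<And>b x y. x \<in> ?C \<Longrightarrow> y \<in> ?C \<Longrightarrow> norm (VR x b - VR y b) \<le> k2 b * norm (x - y)"
    using choice[of "\<lambda>b K. K \<ge> 0 \<and> (\<forall>x\<in>?C. \<forall>y\<in>?C. norm (VR x b - VR y b) \<le> K * norm (x - y))"] by blast
  have "\<exists>K\<ge>0. \<forall>x\<in>?C. norm (V x b - b - B x b) \<le> K * (norm x)\<^sup>2" for b
    by (rule smooth_on_second_order[OF smooth_V C(1), of b]) (auto simp: B_def)
  then obtain k3 where k3: "\<And>b. 0 \<le> k3 b"
    "\<And>b x. x \<in> ?C \<Longrightarrow> norm (V x b - b - B x b) \<le> k3 b * (norm x)\<^sup>2"
    using choice[of "\<lambda>b K. K \<ge> 0 \<and> (\<forall>x\<in>?C. norm (V x b - b - B x b) \<le> K * (norm x)\<^sup>2)"] by blast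
  have BR: "frechet_derivative (\<lambda>x. VR x b) (at 0) x = B b x" for b x
    using frechet_derivative_at[OF VR_derivative] by metis
  have "\<exists>K\<ge>0. \<forall>x\<in>?C. norm (VR x b - b - B b x) \<le> K * (norm x)\<^sup>2" for b
    by (rule smooth_on_second_order[OF smooth_VR C(1), of b]) (auto simp: BR)
  then obtain k4 where k4: "\<And>b. 0 \<le> k4 b"
    "\<And>b x. x \<in> ?C \<Longrightarrow> norm (VR x b - b - B b x) \<le> k4 b * (norm x)\<^sup>2"
    using choice[of "\<lambda>b K. K \<ge> 0 \<and> (\<forall>x\<in>?C. norm (VR x b - b - B b x) \<le> K * (norm x)\<^sup>2)"] by blast
  obtain k5 where k5: "k5 > 0" "\<And>u w. norm (B u w) \<le> norm u * norm w * k5"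
    using bounded_bilinear.pos_bounded[OF bilinear_conv_bounded_bilinear[THEN iffD1, OF bilinear_B]] by blast
  obtain k6 where k6: "0 \<le> k6" "\<And>p q. p \<in> ?C \<times> ?C \<Longrightarrow> q \<in> ?C \<times> ?C \<Longrightarrow>
      norm (m (fst p) (snd p) - m (fst q) (snd q)) \<le> k6 * norm (p - q)"
    by (rule smooth_on_Lipschitz[OF m_smooth, of "?C \<times> ?C"])
      (use C in \<open>auto intro: compact_Times convex_Times\<close>)
  define K where "K = (\<Sum>b\<in>Basis. k1 b) + (\<Sum>b\<in>Basis. k2 b) + (\<Sum>b\<in>Basis. k3 b) + (\<Sum>b\<in>Basis. k4 b) + k5 + k6"
  have nn: "0 \<le> (\<Sum>b\<in>Basis. k1 b)" "0 \<le> (\<Sum>b\<in>Basis. k2 b)" "0 \<le> (\<Sum>b\<in>Basis. k3 b)" "0 \<le> (\<Sum>b\<in>Basis. k4 b)"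
    using k1 k2 k3 k4 by (auto intro: sum_nonneg)
  have KK: "(\<Sum>b\<in>Basis. k1 b) \<le> K" "(\<Sum>b\<in>Basis. k2 b) \<le> K" "(\<Sum>b\<in>Basis. k3 b) \<le> K"
    "(\<Sum>b\<in>Basis. k4 b) \<le> K" "k5 \<le> K" "k6 \<le> K"
    using nn k5 k6 by (auto simp: K_def)
  have up: "a \<le> k * c * d \<Longrightarrow> k \<le> K \<Longrightarrow> 0 \<le> c \<Longrightarrow> 0 \<le> d \<Longrightarrow> a \<le> K * c * d" for a k c d
    by (meson mult_right_mono order_trans)
  show ?thesis
  proof (rule that[of K])
    show "0 < K" using nn k5 k6 by (simp add: K_def)
  next
    fix x y w :: 'a assume x: "x \<in> ?C" and y: "y \<in> ?C"
    then have "linear (\<lambda>w. V x w - V y w)" using C by (intro linear_compose_sub linear_V) auto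
    from norm_le_of_basis[OF this, of k1 "norm (x - y)" w] show "norm (V x w - V y w) \<le> K * norm (x - y) * norm w"
      using k1(2)[OF x y] by (intro up[OF _ KK(1)]) auto
  next
    fix x w :: 'a assume x: "x \<in> ?C"
    then have "linear (\<lambda>w. VR x w - w)" using C by (intro linear_compose_sub linear_VR linear_ident) auto
    from norm_le_of_basis[OF this, of k2 "norm x" w] show "norm (VR x w - w) \<le> K * norm x * norm w"
      using k2(2)[OF x C(2)] by (intro up[OF _ KK(2)]) auto
  next
    fix x w :: 'a assume x: "x \<in> ?C"
    then have "linear (\<lambda>w. V x w - w - B x w)"
      using C by (intro linear_compose_sub linear_V linear_ident linear_B_right) auto
    from norm_le_of_basis[OF this, of k3 "(norm x)\<^sup>2" w]
    show "norm (V x w - w - B x w) \<le> K * (norm x)\<^sup>2 * norm w"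
      using k3(2)[OF x] by (intro up[OF _ KK(3)]) auto
  next
    fix x w :: 'a assume x: "x \<in> ?C"
    then have "linear (\<lambda>w. VR x w - w - B w x)"
      using C by (intro linear_compose_sub linear_VR linear_ident linear_B_left) auto
    from norm_le_of_basis[OF this, of k4 "(norm x)\<^sup>2" w]
    show "norm (VR x w - w - B w x) \<le> K * (norm x)\<^sup>2 * norm w"
      using k4(2)[OF x] by (intro up[OF _ KK(4)]) auto
  next
    fix u w :: 'a
    show "norm (B u w) \<le> K * norm u * norm w"
      by (rule up[OF _ KK(5)]) (use k5(2)[of u w] in \<open>auto simp: mult_ac\<close>)
  next
    fix x y :: 'a assume x: "x \<in> ?C" and y: "y \<in> ?C"
    have "norm (m x y - x) \<le> k6 * norm y"
      using k6(2)[of "(x, y)" "(x, 0)"] x y C(2) m_0_right[of x] C(1) by (auto simp: norm_Pair)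
    also have "\<dots> \<le> K * norm y" using KK by (intro mult_right_mono) auto
    finally show "norm (m x y - x) \<le> K * norm y" .
  qed
qed

text \<open>The derivative of m x (m y z) = m (m x y) z in z at 0: left translation carries a
  left-invariant field into itself.\<close>

lemma dm_V:
  assumes "x \<in> U" "y \<in> U" "m x y \<in> U"
  shows "dm x y (0, V y w) = V (m x y) w"
proof -
  have cont: "isCont (\<lambda>z. m y z) 0"
    using m_right_derivative[OF assms(2) zero_in_U] has_derivative_continuous by blast
  have "open U \<and> m y 0 \<in> U" using assms m_0_right by auto
  from cont[unfolded continuous_at_open, THEN spec, THEN mp, OF this]
  obtain T where T: "open T" "0 \<in> T" "\<And>z. z \<in> T \<Longrightarrow> m y z \<in> U"
    by metis
  have "((\<lambda>z. m x z) \<circ> (\<lambda>z. m y z) has_derivative (\<lambda>w. dm x y (0, w)) \<circ> (\<lambda>w. dm y 0 (0, w))) (at 0)"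
    using m_right_derivative[OF assms(1,2)]
    by (intro diff_chain_at m_right_derivative[OF assms(2) zero_in_U]) (simp add: m_0_right[OF assms(2)])
  then have "((\<lambda>z. m x (m y z)) has_derivative (\<lambda>w. dm x y (0, V y w))) (at 0)"
    unfolding o_def V_def .
  then have "((\<lambda>z. m (m x y) z) has_derivative (\<lambda>w. dm x y (0, V y w))) (at 0)"
    by (rule has_derivative_transform_within_open[where s = "T \<inter> U"])
      (use T assms m_assoc in auto)
  from fun_cong[OF has_derivative_unique[OF this m_right_derivative[OF assms(3) zero_in_U]], of w]
  show ?thesis unfolding V_def[of "m x y"] .
qed

lemma dm_VR:
  assumes "x \<in> U" "y \<in> U" "m x y \<in> U"
  shows "dm x y (VR x w, 0) = VR (m x y) w"
proof -
  have cont: "isCont (\<lambda>z. m z x) 0"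
    using m_left_derivative[OF zero_in_U assms(1)] has_derivative_continuous by blast
  have "open U \<and> m 0 x \<in> U" using assms m_0_left by auto
  from cont[unfolded continuous_at_open, THEN spec, THEN mp, OF this]
  obtain T where T: "open T" "0 \<in> T" "\<And>z. z \<in> T \<Longrightarrow> m z x \<in> U"
    by metis
  have "((\<lambda>z. m z y) \<circ> (\<lambda>z. m z x) has_derivative (\<lambda>w. dm x y (w, 0)) \<circ> (\<lambda>w. dm 0 x (w, 0))) (at 0)"
    using m_left_derivative[OF assms(1,2)]
    by (intro diff_chain_at m_left_derivative[OF zero_in_U assms(1)]) (simp add: m_0_left[OF assms(1)])
  then have "((\<lambda>z. m (m z x) y) has_derivative (\<lambda>w. dm x y (VR x w, 0))) (at 0)"
    unfolding o_def VR_def .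
  then have "((\<lambda>z. m z (m x y)) has_derivative (\<lambda>w. dm x y (VR x w, 0))) (at 0)"
    by (rule has_derivative_transform_within_open[where s = "T \<inter> U"])
      (use T assms m_assoc in auto)
  from fun_cong[OF has_derivative_unique[OF this m_left_derivative[OF zero_in_U assms(3)]], of w]
  show ?thesis unfolding VR_def[of "m x y"] .
qed

end


lemma has_vector_derivative_Un:
  "(f has_vector_derivative d) (at t within S) \<Longrightarrow> (f has_vector_derivative d) (at t within T) \<Longrightarrow>
    (f has_vector_derivative d) (at t within S \<union> T)"
  unfolding has_vector_derivative_def has_derivative_within
  by (auto simp: at_within_union intro: filterlim_sup)

lemma has_vector_derivative_isolated:
  fixes f :: "real \<Rightarrow> 'a::real_normed_vector"
  assumes "closed S" "t \<notin> S"
  shows "(f has_vector_derivative d) (at t within S)"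
proof -
  have "at t within S = bot" using assms by (simp add: at_within_eq_bot_iff closure_closed)
  then show ?thesis
    unfolding has_vector_derivative_def has_derivative_within
    by (simp add: bounded_linear_scaleR_left)
qed

lemma has_derivative_at_0_quadratic:
  fixes P :: "'a::euclidean_space \<Rightarrow> 'b::real_normed_vector"
  assumes "linear L" "P 0 = 0" "0 < d" "\<And>w. norm w < d \<Longrightarrow> norm (P w - L w) \<le> C * (norm w)\<^sup>2"
  shows "(P has_derivative L) (at 0)"
  unfolding has_derivative_at_alt
proof (intro conjI allI impI)
  show "bounded_linear L" using assms(1) linear_conv_bounded_linear by blast
  fix e :: real assume e: "0 < e"
  define d' where "d' = min d (e / (\<bar>C\<bar> + 1))"
  have "norm (P y - P 0 - L (y - 0)) \<le> e * norm (y - 0)" if "norm (y - 0) < d'" for y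
  proof -
    have "norm (P y - L y) \<le> C * (norm y)\<^sup>2" using that assms(4)[of y] by (simp add: d'_def)
    also have "\<dots> \<le> (\<bar>C\<bar> + 1) * norm y * norm y"
      by (simp add: power2_eq_square mult.assoc mult_right_mono)
    also have "\<dots> \<le> e * norm y"
      using that by (intro mult_right_mono) (auto simp: d'_def field_simps)
    finally show ?thesis by (simp add: assms(2))
  qed
  moreover have "0 < d'" using assms(3) e by (simp add: d'_def)
  ultimately show "\<exists>d>0. \<forall>y. norm (y - 0) < d \<longrightarrow> norm (P y - P 0 - L (y - 0)) \<le> e * norm (y - 0)"
    by blast
qed

section \<open>The local exponential map as the flow of left-invariant fields\<close>

context local_lie
begin

text \<open>A single constant for all the bounds of \<open>estimates\<close>, fixed once so that the
  radii below can be defined from it.\<close>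

definition K :: real where
  "K = (SOME K. 0 < K \<and>
    (\<forall>x\<in>cball 0 (\<rho> / 2). \<forall>y\<in>cball 0 (\<rho> / 2). \<forall>w. norm (V x w - V y w) \<le> K * norm (x - y) * norm w) \<and>
    (\<forall>x\<in>cball 0 (\<rho> / 2). \<forall>w. norm (VR x w - w) \<le> K * norm x * norm w) \<and>
    (\<forall>x\<in>cball 0 (\<rho> / 2). \<forall>w. norm (V x w - w - B x w) \<le> K * (norm x)\<^sup>2 * norm w) \<and>
    (\<forall>x\<in>cball 0 (\<rho> / 2). \<forall>w. norm (VR x w - w - B w x) \<le> K * (norm x)\<^sup>2 * norm w) \<and>
    (\<forall>u w. norm (B u w) \<le> K * norm u * norm w) \<and>
    (\<forall>x\<in>cball 0 (\<rho> / 2). \<forall>y\<in>cball 0 (\<rho> / 2). norm (m x y - x) \<le> K * norm y))"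

lemma K_all: "0 < K \<and>
    (\<forall>x\<in>cball 0 (\<rho> / 2). \<forall>y\<in>cball 0 (\<rho> / 2). \<forall>w. norm (V x w - V y w) \<le> K * norm (x - y) * norm w) \<and>
    (\<forall>x\<in>cball 0 (\<rho> / 2). \<forall>w. norm (VR x w - w) \<le> K * norm x * norm w) \<and>
    (\<forall>x\<in>cball 0 (\<rho> / 2). \<forall>w. norm (V x w - w - B x w) \<le> K * (norm x)\<^sup>2 * norm w) \<and>
    (\<forall>x\<in>cball 0 (\<rho> / 2). \<forall>w. norm (VR x w - w - B w x) \<le> K * (norm x)\<^sup>2 * norm w) \<and>
    (\<forall>u w. norm (B u w) \<le> K * norm u * norm w) \<and>
    (\<forall>x\<in>cball 0 (\<rho> / 2). \<forall>y\<in>cball 0 (\<rho> / 2). norm (m x y - x) \<le> K * norm y)"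
  unfolding K_def by (rule someI_ex, rule estimates) blast

text \<open>Small enough for the bounds to apply and for \<open>V x\<close> to differ from the
  identity by at most 1 in operator norm when |x| \<le> r.\<close>

definition r :: real where "r = min (\<rho> / 2) (1 / K)"
text \<open>Exponentials of vectors of norm at most \<sigma> have norm at most 2 \<sigma>, and
  products of two of them at most 2 (1 + K) \<sigma> \<le> r / 4. Moreover K \<sigma> \<le> 1 / 2,
  as Picard iteration demands.\<close>

definition \<sigma> :: real where "\<sigma> = r / (8 * (1 + K)\<^sup>2)"

lemma K_pos: "0 < K" using K_all by blast
lemma r_pos: "0 < r" using K_pos by (simp add: r_def)
lemma r_le: "r \<le> \<rho> / 2" "K * r \<le> 1" "r < \<rho>"
  using K_pos rho by (auto simp: r_def min_def field_simps)
lemma cball_r: "norm x \<le> r \<Longrightarrow> x \<in> cball 0 (\<rho> / 2)" "norm x \<le> r \<Longrightarrow> x \<in> U" using r_le by auto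

lemma sigma_pos: "0 < \<sigma>" using K_pos r_pos by (simp add: \<sigma>_def)
lemma sigma_le: "8 * (1 + K) * \<sigma> \<le> r" "8 * \<sigma> \<le> r" "2 * K * \<sigma> \<le> 1 / 2"
proof -
  have "8 * (1 + K)\<^sup>2 * \<sigma> = r" using K_pos by (simp add: \<sigma>_def)
  moreover have "(1 + K) * \<sigma> \<le> (1 + K)\<^sup>2 * \<sigma>" "\<sigma> \<le> (1 + K) * \<sigma>"
    using K_pos sigma_pos by (auto simp: power2_eq_square intro!: mult_right_mono)
  ultimately show *: "8 * (1 + K) * \<sigma> \<le> r" "8 * \<sigma> \<le> r" by linarith+
  have "K * (8 * \<sigma>) \<le> K * r" using * K_pos by (intro mult_left_mono) auto
  then show "2 * K * \<sigma> \<le> 1 / 2" using r_le(2) by simp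
qed

lemma V_lip: "norm x \<le> r \<Longrightarrow> norm y \<le> r \<Longrightarrow> norm (V x w - V y w) \<le> K * norm (x - y) * norm w"
  using K_all cball_r by blast
lemma V_near: "norm x \<le> r \<Longrightarrow> norm (V x w - w) \<le> K * norm x * norm w"
  using V_lip[of x 0 w] r_pos by simp
lemma VR_near: "norm x \<le> r \<Longrightarrow> norm (VR x w - w) \<le> K * norm x * norm w"
  using K_all cball_r by blast
lemma V_second: "norm x \<le> r \<Longrightarrow> norm (V x w - w - B x w) \<le> K * (norm x)\<^sup>2 * norm w"
  using K_all cball_r by blast
lemma VR_second: "norm x \<le> r \<Longrightarrow> norm (VR x w - w - B w x) \<le> K * (norm x)\<^sup>2 * norm w"
  using K_all cball_r by blast
lemma B_bound: "norm (B u w) \<le> K * norm u * norm w"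
  using K_all by blast
lemma m_near: "norm x \<le> r \<Longrightarrow> norm y \<le> r \<Longrightarrow> norm (m x y) \<le> norm x + K * norm y"
proof -
  assume "norm x \<le> r" "norm y \<le> r"
  then have "norm (m x y - x) \<le> K * norm y" using K_all cball_r by blast
  then show ?thesis using norm_triangle_sub[of "m x y" x] by simp
qed

text \<open>Gronwall with zero forcing. Most identities for the exponential map are obtained from
  it, by checking that both sides solve the same equation.\<close>

lemma ode_unique:
  assumes f: "\<And>t. t \<in> {0..1} \<Longrightarrow> (f has_vector_derivative V (f t) v) (at t within {0..1})"
    and g: "\<And>t. t \<in> {0..1} \<Longrightarrow> (g has_vector_derivative V (g t) v) (at t within {0..1})"
    and fr: "\<And>t. t \<in> {0..1} \<Longrightarrow> norm (f t) \<le> r" and gr: "\<And>t. t \<in> {0..1} \<Longrightarrow> norm (g t) \<le> r"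
    and "f 0 = g 0" and t: "t \<in> {0..1}"
  shows "f t = g t"
proof -
  have "norm (f t - g t) \<le> exp (K * norm v + 1) * 0"
  proof (rule gronwall[where g = "\<lambda>t. f t - g t" and g' = "\<lambda>t. V (f t) v - V (g t) v"])
    show "norm (V (f t) v - V (g t) v) \<le> K * norm v * norm (f t - g t) + 0" if "t \<in> {0..1}" for t
      using V_lip[OF fr[OF that] gr[OF that], of v] by (simp add: mult_ac)
  qed (use assms K_pos in \<open>auto intro: has_vector_derivative_diff\<close>)
  then show ?thesis by simp
qed

lemma solution_exists:
  assumes v: "norm v \<le> \<sigma>"
  shows "\<exists>u. u 0 = 0 \<and> (\<forall>t\<in>{0..1}. (u has_vector_derivative V (u t) v) (at t within {0..1})) \<and>
    (\<forall>t\<in>{0..1}. norm (u t) \<le> 2 * norm v)"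
proof -
  let ?C = "cball (0::'a) r"
  \<comment> \<open>Projecting to the ball makes the field globally Lipschitz. The solution obeys |u
    t| \<le> 2 |v| \<le> r and so never notices the truncation.\<close>
  define F where "F y = V (closest_point ?C y) v" for y
  have C: "closed ?C" "?C \<noteq> {}" "convex ?C" using r_pos by auto
  have cp: "norm (closest_point ?C y) \<le> r" for y using closest_point_in_set[OF C(1,2)] by auto
  have "norm (F x - F y) \<le> norm (x - y) / 2" for x y
  proof -
    have "norm (F x - F y) \<le> K * norm (closest_point ?C x - closest_point ?C y) * norm v"
      unfolding F_def by (rule V_lip[OF cp cp])
    also have "\<dots> \<le> K * norm (x - y) * \<sigma>"
      using closest_point_lipschitz[OF C(3,1,2), of x y] v K_pos
      by (intro mult_mono mult_left_mono) (auto simp: dist_norm)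
    also have "\<dots> = (K * \<sigma>) * norm (x - y)" by simp
    also have "\<dots> \<le> (1 / 2) * norm (x - y)"
      using sigma_le(3) K_pos sigma_pos by (intro mult_right_mono) auto
    finally show ?thesis by simp
  qed
  then obtain u where u: "u 0 = 0"
    "\<And>t. t \<in> {0..1} \<Longrightarrow> (u has_vector_derivative F (u t)) (at t within {0..1})"
    by (rule picard_existence) blast
  have Fb: "norm (F y) \<le> 2 * norm v" for y
  proof -
    have "norm (F y - v) \<le> K * norm (closest_point ?C y) * norm v" unfolding F_def by (rule V_near[OF cp])
    also have "\<dots> \<le> K * r * norm v" using cp K_pos by (intro mult_right_mono mult_left_mono) auto
    also have "\<dots> \<le> 1 * norm v" using r_le by (intro mult_right_mono) auto
    finally show ?thesis using norm_triangle_sub[of "F y" v] by simp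
  qed
  have ub: "norm (u t) \<le> 2 * norm v" if t: "t \<in> {0..1}" for t
  proof -
    have "norm (u t - u 0) \<le> 2 * norm v * norm (t - 0)"
    proof (rule differentiable_bound[where S = "{0..1}" and f' = "\<lambda>t s. s *\<^sub>R F (u t)"])
      show "(u has_derivative (\<lambda>s. s *\<^sub>R F (u t))) (at t within {0..1})" if "t \<in> {0..1}" for t
        using u(2)[OF that] by (simp add: has_vector_derivative_def)
      show "onorm (\<lambda>s. s *\<^sub>R F (u t)) \<le> 2 * norm v" for t
        by (rule onorm_le) (use mult_right_mono[OF Fb abs_ge_zero] in \<open>simp add: mult.commute\<close>)
    qed (use t in auto)
    also have "\<dots> \<le> 2 * norm v * 1" using t by (intro mult_left_mono) auto
    finally show ?thesis using u(1) by simp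
  qed
  have "F (u t) = V (u t) v" if "t \<in> {0..1}" for t
  proof -
    have "norm (u t) \<le> r" using ub[OF that] v sigma_le(2) sigma_pos by linarith
    then show ?thesis by (simp add: F_def closest_point_self)
  qed
  then show ?thesis using u ub by (intro exI[of _ u]) auto
qed

definition sol :: "'a \<Rightarrow> real \<Rightarrow> 'a" where
  "sol v = (SOME u. u 0 = 0 \<and> (\<forall>t\<in>{0..1}. (u has_vector_derivative V (u t) v) (at t within {0..1})) \<and>
    (\<forall>t\<in>{0..1}. norm (u t) \<le> 2 * norm v))"

text \<open>The exponential map in the chart, meaningful for \<open>norm v \<le> \<sigma>\<close> only.\<close>

definition e :: "'a \<Rightarrow> 'a" where "e v = sol v 1"

lemma sol:
  assumes "norm v \<le> \<sigma>"
  shows "sol v 0 = 0" "t \<in> {0..1} \<Longrightarrow> (sol v has_vector_derivative V (sol v t) v) (at t within {0..1})"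
    "t \<in> {0..1} \<Longrightarrow> norm (sol v t) \<le> 2 * norm v"
  using someI_ex[OF solution_exists[OF assms]] unfolding sol_def by blast+

lemma norm_small: "norm v \<le> \<sigma> \<Longrightarrow> 2 * norm v \<le> r"
  using sigma_le(2) sigma_pos by linarith

text \<open>Rescaling of time: t \<mapsto> sol v (s t) solves the equation of s v. So t \<mapsto> e
  (t v) is the integral curve itself, although \<open>e\<close> was defined by end points.\<close>

lemma e_line:
  assumes v: "norm v \<le> \<sigma>" and s: "s \<in> {0..1}"
  shows "e (s *\<^sub>R v) = sol v s"
proof -
  have sv: "norm (s *\<^sub>R v) \<le> norm v" using s by (simp add: mult_left_le_one_le)
  then have sv': "norm (s *\<^sub>R v) \<le> \<sigma>" using v by simp
  have st: "s * t \<in> {0..1}" if "t \<in> {0..1}" for t using s that by (auto simp: mult_le_one)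
  have "sol (s *\<^sub>R v) 1 = sol v (s * 1)"
  proof (rule ode_unique[where v = "s *\<^sub>R v" and g = "\<lambda>t. sol v (s * t)"])
    fix t :: real assume t: "t \<in> {0..1}"
    show "(sol (s *\<^sub>R v) has_vector_derivative V (sol (s *\<^sub>R v) t) (s *\<^sub>R v)) (at t within {0..1})"
      by (rule sol(2)[OF sv' t])
    show nr: "norm (sol v (s * t)) \<le> r" "norm (sol (s *\<^sub>R v) t) \<le> r"
      using order_trans[OF sol(3)[OF v st[OF t]] norm_small[OF v]]
        order_trans[OF sol(3)[OF sv' t] norm_small[OF sv']] .
    have "((sol v \<circ> (\<lambda>t. s * t)) has_vector_derivative s *\<^sub>R V (sol v (s * t)) v) (at t within {0..1})"
    proof (rule vector_diff_chain_within)
      show "((*) s has_vector_derivative s) (at t within {0..1})"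
        by (auto intro!: derivative_eq_intros)
      show "(sol v has_vector_derivative V (sol v (s * t)) v) (at (s * t) within (*) s ` {0..1})"
        by (rule has_vector_derivative_within_subset[OF sol(2)[OF v st[OF t]]]) (use st in auto)
    qed
    moreover have "V (sol v (s * t)) (s *\<^sub>R v) = s *\<^sub>R V (sol v (s * t)) v"
      using nr(1) cball_r by (intro linear_scale linear_V) auto
    ultimately show "((\<lambda>t. sol v (s * t)) has_vector_derivative V (sol v (s * t)) (s *\<^sub>R v)) (at t within {0..1})"
      by (simp add: o_def)
  qed (use sol(1) v sv' in auto)
  then show ?thesis by (simp add: e_def)
qed

lemma e_0 [simp]: "e 0 = 0" using e_line[of 0 0] sol(1)[of 0] sigma_pos by simp

lemma norm_e: "norm v \<le> \<sigma> \<Longrightarrow> norm (e v) \<le> 2 * norm v"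
  using sol(3)[of v 1] by (simp add: e_def)

lemma norm_e_r: "norm v \<le> \<sigma> \<Longrightarrow> norm (e v) \<le> r"
  using norm_e norm_small order_trans by blast

lemma e_in_U: "norm v \<le> \<sigma> \<Longrightarrow> e v \<in> U"
  using norm_e_r cball_r by blast

lemma e_deriv_01:
  assumes v: "norm v \<le> \<sigma>" and t: "t \<in> {0..1}"
  shows "((\<lambda>t. e (t *\<^sub>R v)) has_vector_derivative V (e (t *\<^sub>R v)) v) (at t within {0..1})"
  unfolding e_line[OF v t]
  by (rule has_vector_derivative_transform[OF t _ sol(2)[OF v t]]) (simp add: e_line[OF v])

text \<open>Integral curves were built for positive times; negative times come from - v, and at 0
  the one-sided derivatives have to be glued.\<close>

lemma e_deriv_11:
  assumes v: "norm v \<le> \<sigma>" and t: "t \<in> {-1..1}"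
  shows "((\<lambda>t. e (t *\<^sub>R v)) has_vector_derivative V (e (t *\<^sub>R v)) v) (at t within {-1..1})"
proof -
  have "((\<lambda>t. e (t *\<^sub>R v)) has_vector_derivative V (e (t *\<^sub>R v)) v) (at t within {0..1})"
    by (cases "t \<in> {0..1}") (use e_deriv_01[OF v] in \<open>auto intro: has_vector_derivative_isolated\<close>)
  moreover have "((\<lambda>t. e (t *\<^sub>R v)) has_vector_derivative V (e (t *\<^sub>R v)) v) (at t within {-1..0})"
  proof (cases "t \<in> {-1..0}")
    case True
    have nv: "norm (- v) \<le> \<sigma>" using v by simp
    have "((\<lambda>t. e (t *\<^sub>R (- v))) \<circ> uminus has_vector_derivative (-1) *\<^sub>R V (e ((- t) *\<^sub>R (- v))) (- v)) (at t within {-1..0})"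
    proof (rule vector_diff_chain_within)
      show "(uminus has_vector_derivative (-1)) (at t within {-1..0})"
        by (auto intro!: derivative_eq_intros)
      have "- t \<in> {0..1}" using True by auto
      from e_deriv_01[OF nv this]
      show "((\<lambda>t. e (t *\<^sub>R - v)) has_vector_derivative V (e (- t *\<^sub>R - v)) (- v))
         (at (- t) within uminus ` {- 1..0})" by simp
    qed
    moreover have "norm (t *\<^sub>R v) \<le> \<sigma>" using True v mult_left_le_one_le[of "norm v" "\<bar>t\<bar>"] by auto
    then have "V (e (t *\<^sub>R v)) (- v) = - V (e (t *\<^sub>R v)) v"
      using e_in_U by (intro linear_neg linear_V)
    ultimately show ?thesis by (simp add: o_def)
  next
    case False
    then show ?thesis by (intro has_vector_derivative_isolated) auto
  qed
  moreover have "{-1..1} = {-1..0} \<union> {0..1::real}" by auto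
  ultimately show ?thesis using has_vector_derivative_Un by metis
qed

lemma e_deriv:
  assumes tv: "norm (t *\<^sub>R v) < \<sigma>"
  shows "((\<lambda>t. e (t *\<^sub>R v)) has_vector_derivative V (e (t *\<^sub>R v)) v) (at t)"
proof (cases "v = 0")
  case True
  then show ?thesis using linear_0[OF linear_V[OF zero_in_U]] by simp
next
  case False
  \<comment> \<open>Stretches v to norm \<sigma>, so that time t becomes t / c in the open interval
    (-1, 1), where the derivative is two-sided.\<close>
  define c where "c = \<sigma> / norm v"
  have c: "c > 0" using False sigma_pos by (simp add: c_def)
  have cv: "norm (c *\<^sub>R v) \<le> \<sigma>" using False sigma_pos by (simp add: c_def)
  have tc: "t / c \<in> {-1<..<1}"
  proof -
    have "\<bar>t / c\<bar> < 1" using tv c False by (simp add: c_def field_simps abs_divide abs_mult)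
    then have "-1 < t / c" "t / c < 1" by linarith+
    then show ?thesis by simp
  qed
  have "((\<lambda>s. e (s *\<^sub>R (c *\<^sub>R v))) has_vector_derivative V (e ((t / c) *\<^sub>R (c *\<^sub>R v))) (c *\<^sub>R v)) (at (t / c) within {-1..1})"
    by (rule e_deriv_11[OF cv]) (use tc in auto)
  then have "((\<lambda>s. e (s *\<^sub>R (c *\<^sub>R v))) has_vector_derivative V (e ((t / c) *\<^sub>R (c *\<^sub>R v))) (c *\<^sub>R v)) (at (t / c))"
    using tc at_within_interior[of "t / c" "{-1..1}"] by (simp add: interior_atLeastAtMost_real)
  moreover have "((\<lambda>t. t / c) has_vector_derivative 1 / c) (at t)"
    using c by (auto intro!: derivative_eq_intros simp: has_real_derivative_iff_has_vector_derivative[symmetric])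
  ultimately have "((\<lambda>s. e (s *\<^sub>R (c *\<^sub>R v))) \<circ> (\<lambda>t. t / c) has_vector_derivative (1 / c) *\<^sub>R V (e ((t / c) *\<^sub>R (c *\<^sub>R v))) (c *\<^sub>R v)) (at t)"
    by (intro vector_diff_chain_at)
  moreover have "V (e (t *\<^sub>R v)) (c *\<^sub>R v) = c *\<^sub>R V (e (t *\<^sub>R v)) v"
    using tv e_in_U by (intro linear_scale linear_V) auto
  ultimately show ?thesis using c by (simp add: o_def)
qed

lemma e_mult_small:
  assumes "norm x \<le> \<sigma>" "norm y \<le> \<sigma>"
  shows "norm (m (e x) (e y)) \<le> r / 4" "m (e x) (e y) \<in> U"
proof -
  have "norm (m (e x) (e y)) \<le> norm (e x) + K * norm (e y)"
    by (intro m_near norm_e_r assms)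
  also have "\<dots> \<le> 2 * \<sigma> + K * (2 * \<sigma>)"
    using norm_e[OF assms(1)] norm_e[OF assms(2)] assms K_pos by (intro add_mono mult_left_mono) auto
  also have "\<dots> \<le> r / 4" using sigma_le(1) by (simp add: algebra_simps)
  finally show *: "norm (m (e x) (e y)) \<le> r / 4" .
  then have "norm (m (e x) (e y)) \<le> r" using r_pos by linarith
  then show "m (e x) (e y) \<in> U" using cball_r by auto
qed

lemma e_right_ode:
  assumes "norm x \<le> \<sigma>" "norm (t *\<^sub>R v) < \<sigma>"
  shows "((\<lambda>t. m (e x) (e (t *\<^sub>R v))) has_vector_derivative V (m (e x) (e (t *\<^sub>R v))) v) (at t)"
proof -
  have U: "e x \<in> U" "e (t *\<^sub>R v) \<in> U" using e_in_U assms by auto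
  have "((\<lambda>t. m (e x) (e (t *\<^sub>R v))) has_vector_derivative dm (e x) (e (t *\<^sub>R v)) (0, V (e (t *\<^sub>R v)) v)) (at t)"
    by (intro m_curve e_deriv assms U) auto
  then show ?thesis using dm_V[OF U e_mult_small(2)] assms by simp
qed

text \<open>As functions of \<tau>, both e (s v) e (\<tau> t v) and e ((s + \<tau> t) v) start at e
  (s v) and solve the left-invariant equation with velocity t v. Convexity of the ball keeps the
  intermediate points in range.\<close>

lemma e_one_parameter:
  assumes "norm (s *\<^sub>R v) < \<sigma>" "norm (t *\<^sub>R v) < \<sigma>" "norm ((s + t) *\<^sub>R v) < \<sigma>"
  shows "m (e (s *\<^sub>R v)) (e (t *\<^sub>R v)) = e ((s + t) *\<^sub>R v)"
proof -
  define w where "w = t *\<^sub>R v"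
  have tw: "norm (\<tau> *\<^sub>R w) < \<sigma>" if "\<tau> \<in> {0..1}" for \<tau>
  proof -
    have "norm (\<tau> *\<^sub>R w) \<le> norm w" using that by (auto intro: mult_left_le_one_le)
    then show ?thesis using assms(2) unfolding w_def by linarith
  qed
  have sw: "norm ((s + \<tau> * t) *\<^sub>R v) < \<sigma>" if "\<tau> \<in> {0..1}" for \<tau>
  proof -
    have "(1 - \<tau>) *\<^sub>R (s *\<^sub>R v) + \<tau> *\<^sub>R ((s + t) *\<^sub>R v) \<in> ball 0 \<sigma>"
      using that assms by (intro convexD[OF convex_ball]) auto
    then show ?thesis by (simp add: algebra_simps)
  qed
  have "m (e (s *\<^sub>R v)) (e (1 *\<^sub>R w)) = e ((s + 1 * t) *\<^sub>R v)"
  proof (rule ode_unique[where v = w and f = "\<lambda>\<tau>. m (e (s *\<^sub>R v)) (e (\<tau> *\<^sub>R w))" and g = "\<lambda>\<tau>. e ((s + \<tau> * t) *\<^sub>R v)"])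
    fix \<tau> :: real assume \<tau>: "\<tau> \<in> {0..1}"
    show "((\<lambda>\<tau>. m (e (s *\<^sub>R v)) (e (\<tau> *\<^sub>R w))) has_vector_derivative V (m (e (s *\<^sub>R v)) (e (\<tau> *\<^sub>R w))) w) (at \<tau> within {0..1})"
      using e_right_ode[of "s *\<^sub>R v" \<tau> w] tw[OF \<tau>] assms by (auto intro: has_vector_derivative_at_within)
    have "((\<lambda>t. e (t *\<^sub>R v)) \<circ> (\<lambda>\<tau>. s + \<tau> * t) has_vector_derivative t *\<^sub>R V (e ((s + \<tau> * t) *\<^sub>R v)) v) (at \<tau>)"
      by (intro vector_diff_chain_at e_deriv sw \<tau>)
        (auto intro!: derivative_eq_intros simp: has_real_derivative_iff_has_vector_derivative[symmetric])
    moreover have "V (e ((s + \<tau> * t) *\<^sub>R v)) w = t *\<^sub>R V (e ((s + \<tau> * t) *\<^sub>R v)) v"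
      unfolding w_def using e_in_U sw[OF \<tau>] by (intro linear_scale linear_V) auto
    ultimately show "((\<lambda>\<tau>. e ((s + \<tau> * t) *\<^sub>R v)) has_vector_derivative V (e ((s + \<tau> * t) *\<^sub>R v)) w) (at \<tau> within {0..1})"
      by (auto simp: o_def intro: has_vector_derivative_at_within)
    show "norm (m (e (s *\<^sub>R v)) (e (\<tau> *\<^sub>R w))) \<le> r"
      using e_mult_small(1)[of "s *\<^sub>R v" "\<tau> *\<^sub>R w"] tw[OF \<tau>] assms r_pos by simp
    show "norm (e ((s + \<tau> * t) *\<^sub>R v)) \<le> r" using norm_e_r sw[OF \<tau>] by simp
  qed (use m_0_right e_in_U assms in auto)
  then show ?thesis by (simp add: w_def)
qed

lemma e_minus: "norm v < \<sigma> \<Longrightarrow> m (e (- v)) (e v) = 0" "norm v < \<sigma> \<Longrightarrow> m (e v) (e (- v)) = 0"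
  using e_one_parameter[of "-1" v 1] e_one_parameter[of 1 v "-1"] sigma_pos by auto

text \<open>Differentiate e (h v) e v = e ((1 + h) v) at h = 0: along the one-parameter subgroup of
  v the left- and right-invariant fields with value v coincide.\<close>

lemma V_eq_VR:
  assumes v: "norm v < \<sigma>"
  shows "V (e v) v = VR (e v) v"
proof -
  let ?S = "{h. norm (h *\<^sub>R v) < \<sigma>} \<inter> {h. norm ((1 + h) *\<^sub>R v) < \<sigma>}"
  have S: "open ?S" by (intro open_Int open_Collect_less continuous_intros)
  have S0: "0 \<in> ?S" using v sigma_pos by simp
  have "((\<lambda>h. m (e (h *\<^sub>R v)) (e v)) has_vector_derivative dm (e (0 *\<^sub>R v)) (e v) (V (e (0 *\<^sub>R v)) v, 0)) (at 0)"
    by (intro m_curve e_deriv e_in_U) (use v sigma_pos in auto)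
  then have "((\<lambda>h. m (e (h *\<^sub>R v)) (e v)) has_vector_derivative VR (e v) v) (at 0)"
    by (simp add: VR_def)
  then have "((\<lambda>h. e ((1 + h) *\<^sub>R v)) has_vector_derivative VR (e v) v) (at 0)"
    by (rule has_vector_derivative_transform_within_open[OF _ S S0])
      (use e_one_parameter[of _ v 1] v in \<open>simp add: add.commute\<close>)
  moreover have "((\<lambda>t. e (t *\<^sub>R v)) \<circ> (\<lambda>h. 1 + h) has_vector_derivative 1 *\<^sub>R V (e ((1 + 0) *\<^sub>R v)) v) (at 0)"
    by (intro vector_diff_chain_at e_deriv)
      (use v in \<open>auto intro!: derivative_eq_intros simp: has_real_derivative_iff_has_vector_derivative[symmetric]\<close>)
  ultimately show ?thesis
    using vector_derivative_unique_at by (fastforce simp: o_def)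
qed

end


section \<open>The derivative of the exponential map in the nilpotent case\<close>

locale nil_local_lie = local_lie m \<rho> for m :: "'a::euclidean_space \<Rightarrow> 'a \<Rightarrow> 'a" and \<rho> +
  fixes n :: nat
  assumes nilpotent: "(br z ^^ n) w = 0"
begin

text \<open>\<open>\<phi> z w\<close> is the power series of \<open>(1 - exp (- ad z)) / ad z\<close> applied to \<open>w\<close>; it is the
  derivative of the exponential map read in the left trivialisation.\<close>

definition \<phi> :: "'a \<Rightarrow> 'a \<Rightarrow> 'a" where
  "\<phi> z w = (\<Sum>k<n. ((-1) ^ k / fact (Suc k)) *\<^sub>R (br z ^^ k) w)"

lemma bounded_bilinear_br: "bounded_bilinear br"
  using bilinear_br bilinear_conv_bounded_bilinear by blast

lemma linear_br: "linear (br z)"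
  using bilinear_br by (simp add: bilinear_def)

lemma linear_ad: "linear (\<lambda>w. (br z ^^ k) w)"
  by (induction k) (auto intro: linear_ident linear_compose[OF _ linear_br, unfolded o_def])

lemma linear_phi: "linear (\<phi> z)"
  unfolding \<phi>_def[abs_def]
  by (intro linear_compose_sum ballI) (auto intro!: linear_compose_scale_right linear_ad)

lemma smooth_ad: "smooth_on UNIV (\<lambda>z. (br z ^^ k) w)"
  by (induction k) (auto intro!: smooth_on_const smooth_on_bilinear[OF bounded_bilinear_br] smooth_on_id)

lemma smooth_phi: "smooth_on UNIV (\<lambda>z. \<phi> z w)"
  unfolding \<phi>_def[abs_def]
  by (intro smooth_on_sum smooth_on_linear_comp[OF bounded_linear_scaleR_right] smooth_ad open_UNIV)

text \<open>The solution of p' = w - [z, p] with p 0 = 0, which reaches \<open>\<phi> z w\<close> at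
  time 1.\<close>

definition phi_path :: "'a \<Rightarrow> 'a \<Rightarrow> real \<Rightarrow> 'a" where
  "phi_path z w s = (\<Sum>k<n. ((-1) ^ k * s ^ Suc k / fact (Suc k)) *\<^sub>R (br z ^^ k) w)"

lemma phi_path_derivative: "(phi_path z w has_vector_derivative w - br z (phi_path z w s)) (at s within S)"
proof -
  have "((\<lambda>s. (-1) ^ k * s ^ Suc k / fact (Suc k)) has_real_derivative (-1) ^ k * s ^ k / fact k) (at s within S)" for k
  proof -
    have "((\<lambda>s. ((-1) ^ k / fact (Suc k)) * s ^ Suc k) has_real_derivative
        ((-1) ^ k / fact (Suc k)) * (real (Suc k) * s ^ k)) (at s within S)"
      using DERIV_cmult[OF DERIV_pow[of "Suc k" s S], of "(-1) ^ k / fact (Suc k)"] by simp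
    moreover have "((-1) ^ k / fact (Suc k)) * (real (Suc k) * s ^ k) = (-1) ^ k * s ^ k / fact k"
      by (simp del: of_nat_Suc)
    ultimately show ?thesis by simp
  qed
  then have "(phi_path z w has_vector_derivative
      (\<Sum>k<n. ((-1) ^ k * s ^ k / fact k) *\<^sub>R (br z ^^ k) w)) (at s within S)"
    unfolding phi_path_def[abs_def]
    by (intro has_vector_derivative_sum)
      (use has_vector_derivative_scaleR[where g = "\<lambda>_. (br z ^^ _) w" and g' = 0] in
        \<open>fastforce intro!: derivative_eq_intros\<close>)
  moreover have "w - br z (phi_path z w s) = (\<Sum>k<n. ((-1) ^ k * s ^ k / fact k) *\<^sub>R (br z ^^ k) w)"
  proof -
    have "br z (phi_path z w s) = (\<Sum>k<n. ((-1) ^ k * s ^ Suc k / fact (Suc k)) *\<^sub>R (br z ^^ Suc k) w)"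
      unfolding phi_path_def using linear_br[of z] by (simp add: linear_sum linear_scale)
    then have "w - br z (phi_path z w s) = w + (\<Sum>k<n. ((-1) ^ Suc k * s ^ Suc k / fact (Suc k)) *\<^sub>R (br z ^^ Suc k) w)"
      by (simp add: sum_negf[symmetric])
    also have "\<dots> = (\<Sum>k<Suc n. ((-1) ^ k * s ^ k / fact k) *\<^sub>R (br z ^^ k) w)"
      by (simp only: sum.lessThan_Suc_shift) simp
    \<comment> \<open>The shifted sum has one term too many; it carries n brackets and vanishes by
      nilpotency.\<close>
    also have "\<dots> = (\<Sum>k<n. ((-1) ^ k * s ^ k / fact k) *\<^sub>R (br z ^^ k) w)"
      by (simp add: nilpotent)
    finally show ?thesis .
  qed
  ultimately show ?thesis by simp
qed

lemma phi_path_0: "phi_path z w 0 = 0" and phi_path_1: "phi_path z w 1 = \<phi> z w"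
  by (simp_all add: phi_path_def \<phi>_def)

text \<open>The curve p s = e (- s z) e (s (z + w)) moves with a right-invariant field for - z plus
  a left-invariant one for z + w. To first order in p this reads p' = w - [z, p], the equation of
  \<open>phi_path\<close>. One use of Gronwall gives p = O(|w|); a second one bounds the distance
  from \<open>phi_path\<close> by O(|w|^2), uniformly in z.\<close>

lemma exp_estimate:
  "\<exists>C. \<forall>z w. norm z < \<sigma> \<longrightarrow> norm (z + w) < \<sigma> \<longrightarrow>
    norm (m (e (- z)) (e (z + w)) - \<phi> z w) \<le> C * (norm w)\<^sup>2"
proof -
  define E where "E = exp (2 * K * \<sigma> + 1)"
  define C1 where "C1 = 2 * K * \<sigma> * E\<^sup>2 + K * E"
  have K0: "0 \<le> K" and s0: "0 \<le> \<sigma>" and E0: "0 \<le> E" and C0: "0 \<le> C1" and Ks: "0 \<le> 2 * K * \<sigma>"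
    using K_pos sigma_pos by (simp_all add: E_def C1_def)
  show ?thesis
  proof (intro exI[of _ "E * C1"] allI impI)
    fix z w :: 'a assume z: "norm z < \<sigma>" and zw: "norm (z + w) < \<sigma>"
    define w' where "w' = z + w"
    have w': "norm w' < \<sigma>" using zw by (simp add: w'_def)
    define p where "p s = m (e (s *\<^sub>R (- z))) (e (s *\<^sub>R w'))" for s
    have sl: "norm (s *\<^sub>R v) < \<sigma>" if "s \<in> {0..1}" "norm v < \<sigma>" for s v
    proof -
      have "norm (s *\<^sub>R v) \<le> norm v" using that by (auto intro: mult_left_le_one_le)
      then show ?thesis using that by linarith
    qed
    have p: "norm (p s) \<le> r" "p s \<in> U"
      "(p has_vector_derivative VR (p s) (- z) + V (p s) w') (at s within {0..1})" if s: "s \<in> {0..1}" for s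
    proof -
      have a: "norm (s *\<^sub>R (- z)) < \<sigma>" "norm (s *\<^sub>R w') < \<sigma>" using sl s z w' norm_minus_cancel by metis+
      note U = e_in_U[OF less_imp_le[OF a(1)]] e_in_U[OF less_imp_le[OF a(2)]]
      have pU: "m (e (s *\<^sub>R (- z))) (e (s *\<^sub>R w')) \<in> U" "norm (p s) \<le> r / 4"
        unfolding p_def using e_mult_small a by auto
      then show "norm (p s) \<le> r" "p s \<in> U" using r_pos by (auto simp: p_def)
      have pd: "(p has_vector_derivative dm (e (s *\<^sub>R (- z))) (e (s *\<^sub>R w')) (V (e (s *\<^sub>R (- z))) (- z), V (e (s *\<^sub>R w')) w')) (at s within {0..1})"
        unfolding p_def by (intro m_curve has_vector_derivative_at_within[OF e_deriv] a U)
      \<comment> \<open>At s = 0 the point is the identity, where both fields have the value - z;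
        otherwise \<open>V_eq_VR\<close> for - s z is divided by s.\<close>
      have VVR: "V (e (s *\<^sub>R (- z))) (- z) = VR (e (s *\<^sub>R (- z))) (- z)"
      proof (cases "s = 0")
        case False
        have "V (e (s *\<^sub>R (- z))) (s *\<^sub>R (- z)) = VR (e (s *\<^sub>R (- z))) (s *\<^sub>R (- z))"
          by (rule V_eq_VR) fact
        then have "s *\<^sub>R V (e (s *\<^sub>R (- z))) (- z) = s *\<^sub>R VR (e (s *\<^sub>R (- z))) (- z)"
          using linear_scale[OF linear_V[OF U(1)]] linear_scale[OF linear_VR[OF U(1)]] by metis
        then show ?thesis using False by simp
      qed simp
      have "dm (e (s *\<^sub>R (- z))) (e (s *\<^sub>R w')) (V (e (s *\<^sub>R (- z))) (- z), V (e (s *\<^sub>R w')) w')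
          = dm (e (s *\<^sub>R (- z))) (e (s *\<^sub>R w')) (V (e (s *\<^sub>R (- z))) (- z), 0)
            + dm (e (s *\<^sub>R (- z))) (e (s *\<^sub>R w')) (0, V (e (s *\<^sub>R w')) w')"
        by (rule dm_split[OF U])
      also have "\<dots> = VR (p s) (- z) + V (p s) w'"
        unfolding VVR dm_VR[OF U pU(1)] dm_V[OF U pU(1)] p_def ..
      finally show "(p has_vector_derivative VR (p s) (- z) + V (p s) w') (at s within {0..1})"
        using pd by metis
    qed
    have p0: "p 0 = 0" using m_0_left[OF zero_in_U] by (simp add: p_def)
    have ww: "w' - z = w" by (simp add: w'_def)
    have nz: "norm z + norm w' \<le> 2 * \<sigma>" using z w' by simp
    have pb: "norm (p s) \<le> E * norm w" if s: "s \<in> {0..1}" for s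
      unfolding E_def
    proof (rule gronwall[where g' = "\<lambda>s. VR (p s) (- z) + V (p s) w'"])
      fix s :: real assume s: "s \<in> {0..1}"
      have "VR (p s) (- z) + V (p s) w' = (VR (p s) (- z) - (- z)) + (V (p s) w' - w') + w"
        by (simp add: w'_def)
      also have "norm \<dots> \<le> K * norm (p s) * norm (- z) + K * norm (p s) * norm w' + norm w"
        by (intro order_trans[OF norm_triangle_ineq] add_mono VR_near V_near p s order_refl)
      also have "\<dots> = K * norm (p s) * (norm z + norm w') + norm w" by (simp add: algebra_simps)
      also have "\<dots> \<le> K * norm (p s) * (2 * \<sigma>) + norm w"
        using nz K0 by (intro add_mono mult_left_mono) auto
      finally show "norm (VR (p s) (- z) + V (p s) w') \<le> 2 * K * \<sigma> * norm (p s) + norm w"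
        by (simp add: mult_ac)
    qed (use p p0 s Ks in auto)
    define q where "q s = p s - phi_path z w s" for s
    have "norm (q 1) \<le> exp (2 * K * \<sigma> + 1) * (C1 * (norm w)\<^sup>2)"
    proof (rule gronwall[where g' = "\<lambda>s. (VR (p s) (- z) + V (p s) w') - (w - br z (phi_path z w s))"])
      fix s :: real assume s: "s \<in> {0..1}"
      show "(q has_vector_derivative (VR (p s) (- z) + V (p s) w') - (w - br z (phi_path z w s))) (at s within {0..1})"
        unfolding q_def by (intro has_vector_derivative_diff p s phi_path_derivative)
      have lin: "B (- z) (p s) = - B z (p s)" "B (p s) w' = B (p s) z + B (p s) w"
        "br z (q s) = br z (p s) - br z (phi_path z w s)"
        using linear_neg[OF linear_B_left] linear_add[OF linear_B_right] linear_diff[OF linear_br]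
        by (auto simp: w'_def q_def)
      \<comment> \<open>Two remainders that are quadratic in p, a product of p and w, and one term
        linear in \<open>q\<close>, which is the term that Gronwall absorbs.\<close>
      have Xeq: "(VR (p s) (- z) + V (p s) w') - (w - br z (phi_path z w s))
          = (VR (p s) (- z) - (- z) - B (- z) (p s)) + (V (p s) w' - w' - B (p s) w') + B (p s) w - br z (q s)"
        unfolding lin by (simp add: w'_def br_def algebra_simps)
      have b1: "norm ((VR (p s) (- z) + V (p s) w') - (w - br z (phi_path z w s)))
          \<le> K * (norm (p s))\<^sup>2 * norm (- z) + K * (norm (p s))\<^sup>2 * norm w'
          + K * norm (p s) * norm w + 2 * K * norm z * norm (q s)"
      proof -
        have "norm (br z (q s)) \<le> K * norm z * norm (q s) + K * norm (q s) * norm z"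
          unfolding br_def by (intro order_trans[OF norm_triangle_ineq4] add_mono B_bound)
        then have "norm (br z (q s)) \<le> 2 * K * norm z * norm (q s)" by (simp add: mult_ac)
        from add_mono[OF add_mono[OF add_mono[OF VR_second V_second] B_bound] this, OF p(1)[OF s] p(1)[OF s]]
        show ?thesis unfolding Xeq
          by (rule order_trans[rotated])
            (intro order_trans[OF norm_triangle_ineq4] order_trans[OF norm_triangle_ineq] add_right_mono order_refl)
      qed
      have b2: "K * (norm (p s))\<^sup>2 * norm (- z) + K * (norm (p s))\<^sup>2 * norm w'
          = K * (norm (p s))\<^sup>2 * (norm z + norm w')"
        unfolding norm_minus_cancel by (rule distrib_left[symmetric])
      have "K * (norm (p s))\<^sup>2 * (norm z + norm w') + K * norm (p s) * norm w + 2 * K * norm z * norm (q s)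
        \<le> K * (E * norm w)\<^sup>2 * (2 * \<sigma>) + K * (E * norm w) * norm w + 2 * K * \<sigma> * norm (q s)"
      proof (intro add_mono)
        show "K * (norm (p s))\<^sup>2 * (norm z + norm w') \<le> K * (E * norm w)\<^sup>2 * (2 * \<sigma>)"
          by (rule mult_mono[OF mult_left_mono[OF power_mono[OF pb[OF s] norm_ge_zero] K0] nz])
            (use K0 in auto)
        show "K * norm (p s) * norm w \<le> K * (E * norm w) * norm w"
          by (rule mult_right_mono[OF mult_left_mono[OF pb[OF s] K0] norm_ge_zero])
        have "2 * K * norm z \<le> 2 * K * \<sigma>" using K0 z by (intro mult_left_mono) auto
        then show "2 * K * norm z * norm (q s) \<le> 2 * K * \<sigma> * norm (q s)"
          by (rule mult_right_mono) simp
      qed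
      also have "\<dots> = 2 * K * \<sigma> * norm (q s) + C1 * (norm w)\<^sup>2"
        by (simp add: C1_def algebra_simps power2_eq_square)
      finally show "norm ((VR (p s) (- z) + V (p s) w') - (w - br z (phi_path z w s)))
          \<le> 2 * K * \<sigma> * norm (q s) + C1 * (norm w)\<^sup>2"
        using b1 b2 by linarith
    qed (use Ks C0 p0 phi_path_0 in \<open>auto simp: q_def\<close>)
    then show "norm (m (e (- z)) (e (z + w)) - \<phi> z w) \<le> E * C1 * (norm w)\<^sup>2"
      by (simp add: q_def p_def phi_path_1 w'_def E_def mult.assoc)
  qed
qed

text \<open>The base point is moved to the identity: e (z + w) = e z P(w) with P(w) = e (- z) e (z +
  w), and the quadratic estimate says that P has derivative \<open>\<phi> z\<close> at 0.\<close>

lemma e_has_derivative: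
  assumes z: "norm z < \<sigma>"
  shows "(e has_derivative (\<lambda>w. V (e z) (\<phi> z w))) (at z)"
proof -
  obtain C where C: "\<And>z w. norm z < \<sigma> \<Longrightarrow> norm (z + w) < \<sigma> \<Longrightarrow>
    norm (m (e (- z)) (e (z + w)) - \<phi> z w) \<le> C * (norm w)\<^sup>2" using exp_estimate by blast
  define P where "P w = m (e (- z)) (e (z + w))" for w
  define d where "d = \<sigma> - norm z"
  have d: "0 < d" using z by (simp add: d_def)
  have zw: "norm (z + w) < \<sigma>" if "norm w < d" for w
    using that norm_triangle_ineq[of z w] by (simp add: d_def)
  have eU: "e (- z) \<in> U" "e z \<in> U" using e_in_U z by auto
  have P0: "P 0 = 0" using e_minus(1)[OF z] by (simp add: P_def)
  have P: "(P has_derivative \<phi> z) (at 0)"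
    by (rule has_derivative_at_0_quadratic[where d = d and C = C])
      (use C z zw linear_phi P0 d in \<open>auto simp: P_def\<close>)
  have "((\<lambda>y. m (e z) y) \<circ> P has_derivative (\<lambda>w. dm (e z) 0 (0, w)) \<circ> \<phi> z) (at 0)"
    using m_right_derivative[OF eU(2) zero_in_U] P0 by (intro diff_chain_at P) simp
  then have "((\<lambda>w. m (e z) (P w)) has_derivative (\<lambda>w. V (e z) (\<phi> z w))) (at 0)"
    by (simp add: o_def V_def)
  moreover have "m (e z) (P w) = e (z + w)" if "w \<in> ball 0 d" for w
  proof -
    have w: "norm (z + w) \<le> \<sigma>" using zw that by (auto intro: less_imp_le)
    have "m (e z) (m (e (- z)) (e (z + w))) = m (m (e z) (e (- z))) (e (z + w))"
      using e_mult_small(2)[of z "- z"] e_mult_small(2)[of "- z" "z + w"] e_in_U w z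
      by (intro m_assoc[symmetric]) auto
    also have "\<dots> = e (z + w)" using e_minus(2)[OF z] m_0_left e_in_U w by simp
    finally show ?thesis by (simp add: P_def)
  qed
  ultimately have "((\<lambda>w. e (z + w)) has_derivative (\<lambda>w. V (e z) (\<phi> z w))) (at 0)"
    by (rule has_derivative_transform_within_open[OF _ open_ball[of 0 d] centre_in_ball[THEN iffD2, OF d]])
  then have "((\<lambda>w. e (z + w)) \<circ> (\<lambda>y. y - z) has_derivative (\<lambda>w. V (e z) (\<phi> z w)) \<circ> (\<lambda>y. y)) (at z)"
    by (intro diff_chain_at) (auto intro!: derivative_eq_intros)
  then show ?thesis by (simp add: o_def)
qed

lemma V_expand: "x \<in> U \<Longrightarrow> V x w = (\<Sum>b\<in>Basis. (w \<bullet> b) *\<^sub>R V x b)"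
  by (rule linear_basis_expansion[OF linear_V])

text \<open>Bootstrapping: the derivative of \<open>e\<close> is an expression in \<open>e\<close>
  itself and smooth data, so C^k implies C^(k+1).\<close>

lemma smooth_e: "smooth_on (ball 0 \<sigma>) e"
proof -
  have "Ck_on k e (ball 0 \<sigma>)" for k
  proof (induction k)
    case 0
    have "isCont e z" if "z \<in> ball 0 \<sigma>" for z
      by (rule has_derivative_continuous[OF e_has_derivative]) (use that in simp)
    then show ?case by (simp add: continuous_at_imp_continuous_on)
  next
    case (Suc k)
    show ?case
    proof (rule Ck_on_SucI)
      show "(e has_derivative (\<lambda>w. V (e z) (\<phi> z w))) (at z)" if "z \<in> ball 0 \<sigma>" for z
        using e_has_derivative that by simp
      fix w
      have "Ck_on k (\<lambda>z. \<Sum>b\<in>Basis. (\<phi> z w \<bullet> b) *\<^sub>R V (e z) b) (ball 0 \<sigma>)"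
      proof -
        have A: "Ck_on k (\<lambda>z. \<phi> z w) (ball 0 \<sigma>)"
          by (rule Ck_on_subset[of k _ UNIV]) (use smooth_phi in \<open>auto simp: smooth_on_def\<close>)
        have "Ck_on k (\<lambda>z. V (e z) b) (ball 0 \<sigma>)" for b
          by (rule Ck_on_compose[OF open_ball _ smooth_V[unfolded smooth_on_def, rule_format] Suc])
            (use e_in_U in auto)
        then show ?thesis
          by (intro Ck_on_sum[OF open_ball] Ck_on_bilinear[OF bounded_bilinear_scaleR open_ball]
            Ck_on_linear_comp[OF bounded_linear_inner_left open_ball A])
      qed
      then show "Ck_on k (\<lambda>z. V (e z) (\<phi> z w)) (ball 0 \<sigma>)"
        by (rule Ck_on_cong) (use V_expand e_in_U in \<open>auto intro: less_imp_le simp del: mem_ball\<close>)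
    qed simp
  qed
  then show ?thesis by (simp add: smooth_on_def)
qed

definition \<nu> :: "'a \<Rightarrow> 'a \<Rightarrow> 'a" where "\<nu> z w = w - \<phi> z w"

text \<open>The Neumann series of \<phi> z = 1 - \<nu> z, finite because every \<nu> z contains a
  factor ad z.\<close>

definition \<phi>inv :: "'a \<Rightarrow> 'a \<Rightarrow> 'a" where "\<phi>inv z w = (\<Sum>j<n. (\<nu> z ^^ j) w)"

lemma linear_nu: "linear (\<nu> z)"
  unfolding \<nu>_def[abs_def] by (intro linear_compose_sub linear_ident linear_phi)

lemma linear_nu_pow: "linear (\<lambda>w. (\<nu> z ^^ k) w)"
  by (induction k) (auto intro: linear_ident linear_compose[OF _ linear_nu, unfolded o_def])

lemma linear_phi_inv: "linear (\<phi>inv z)"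
  unfolding \<phi>inv_def[abs_def] by (intro linear_compose_sum ballI linear_nu_pow)

text \<open>Generalised over leading brackets, so that the induction can trade each \<nu> for at
  least one bracket.\<close>

lemma ad_nu_pow: "n \<le> i + j \<Longrightarrow> (br z ^^ i) ((\<nu> z ^^ j) w) = 0"
proof (induction j arbitrary: i)
  case 0
  then have "(br z ^^ i) w = (br z ^^ (i - n)) ((br z ^^ n) w)"
    by (simp flip: funpow_add comp_apply[of "br z ^^ (i - n)"])
  then show ?case by (simp add: nilpotent linear_0[OF linear_ad])
next
  case (Suc j)
  let ?v = "(\<nu> z ^^ j) w"
  show ?case
  proof (cases "n = 0")
    case True
    then have "w = 0" for w :: 'a using nilpotent[of z w] by simp
    then show ?thesis by blast
  next
    case False
    then obtain n' where n': "n = Suc n'" using not0_implies_Suc by blast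
    have shift: "(\<Sum>k<n. f k) = f 0 + (\<Sum>k<n'. f (Suc k))" for f :: "nat \<Rightarrow> 'a"
      by (simp only: n' sum.lessThan_Suc_shift)
    have "\<phi> z ?v = ?v + (\<Sum>k<n'. ((-1) ^ Suc k / fact (Suc (Suc k))) *\<^sub>R (br z ^^ Suc k) ?v)"
      unfolding \<phi>_def shift by simp
    then have "(\<nu> z ^^ Suc j) w = - (\<Sum>k<n'. ((-1) ^ Suc k / fact (Suc (Suc k))) *\<^sub>R (br z ^^ Suc k) ?v)"
      by (simp add: \<nu>_def)
    then have "(br z ^^ i) ((\<nu> z ^^ Suc j) w)
        = - (\<Sum>k<n'. ((-1) ^ Suc k / fact (Suc (Suc k))) *\<^sub>R (br z ^^ i) ((br z ^^ Suc k) ?v))"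
      by (simp only: linear_neg[OF linear_ad] linear_sum[OF linear_ad] linear_scale[OF linear_ad])
    also have "\<dots> = - (\<Sum>k<n'. ((-1) ^ Suc k / fact (Suc (Suc k))) *\<^sub>R (br z ^^ (i + Suc k)) ?v)"
      by (simp only: funpow_add comp_apply)
    also have "\<dots> = 0"
    proof -
      have "(br z ^^ (i + Suc k)) ?v = 0" for k
        using Suc.prems by (intro Suc.IH) simp
      then show ?thesis by (simp only: scaleR_zero_right sum.neutral_const minus_zero)
    qed
    finally show ?thesis .
  qed
qed

lemma phi_inv: "\<phi>inv z (\<phi> z w) = w"
proof -
  have "\<phi> z w = w - \<nu> z w" by (simp add: \<nu>_def)
  then have "\<phi>inv z (\<phi> z w) = (\<Sum>j<n. (\<nu> z ^^ j) w - (\<nu> z ^^ j) (\<nu> z w))"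
    unfolding \<phi>inv_def by (simp add: linear_diff[OF linear_nu_pow])
  also have "\<dots> = (\<Sum>j<n. (\<nu> z ^^ j) w - (\<nu> z ^^ Suc j) w)"
    by (simp only: funpow_Suc_right comp_apply)
  also have "\<dots> = w - (\<nu> z ^^ n) w"
    using sum_lessThan_telescope'[of "\<lambda>j. (\<nu> z ^^ j) w" n] by simp
  also have "(\<nu> z ^^ n) w = 0" using ad_nu_pow[of 0 n z w] by simp
  finally show ?thesis by simp
qed

lemma smooth_phi_family:
  assumes "smooth_on S g" "open S"
  shows "smooth_on S (\<lambda>z. \<phi> z (g z))" "smooth_on S (\<lambda>z. (\<nu> z ^^ j) (g z))"
proof -
  have phi: "smooth_on S (\<lambda>z. \<phi> z (h z))" if "smooth_on S h" for h
  proof -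
    have "smooth_on S (\<lambda>z. \<Sum>b\<in>Basis. (h z \<bullet> b) *\<^sub>R \<phi> z b)"
      by (intro smooth_on_sum smooth_on_bilinear[OF bounded_bilinear_scaleR]
          smooth_on_linear_comp[OF bounded_linear_inner_left] assms that
          smooth_on_subset[OF smooth_phi]) auto
    then show ?thesis
      unfolding linear_basis_expansion[OF linear_phi, symmetric] .
  qed
  then show "smooth_on S (\<lambda>z. \<phi> z (g z))" using assms by blast
  show "smooth_on S (\<lambda>z. (\<nu> z ^^ j) (g z))"
  proof (induction j)
    case (Suc j)
    have "smooth_on S (\<lambda>z. (\<nu> z ^^ j) (g z) - \<phi> z ((\<nu> z ^^ j) (g z)))"
      by (intro smooth_on_diff phi Suc assms)
    moreover have "(\<nu> z ^^ Suc j) (g z) = (\<nu> z ^^ j) (g z) - \<phi> z ((\<nu> z ^^ j) (g z))" for z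
      by (simp add: \<nu>_def[of z "(\<nu> z ^^ j) (g z)"])
    ultimately show ?case by presburger
  qed (use assms in simp)
qed

lemma smooth_phi_inv: "smooth_on UNIV (\<lambda>z. \<phi>inv z w)"
  unfolding \<phi>inv_def[abs_def]
  by (rule smooth_on_sum[OF open_UNIV])
    (rule smooth_phi_family(2)[OF smooth_on_const[OF open_UNIV] open_UNIV])

end


section \<open>The local logarithm and the product in exponential coordinates\<close>

context nil_local_lie
begin

lemma V_left_inverse:
  assumes z: "norm z < \<sigma>"
  shows "dm (e (- z)) (e z) (0, V (e z) w) = w"
  using dm_V[of "e (- z)" "e z" w] e_in_U[of "- z"] e_in_U[of z] e_minus(1)[OF z] z by simp

lemma frechet_e: "norm z < \<sigma> \<Longrightarrow> frechet_derivative e (at z) w = V (e z) (\<phi> z w)"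
  using frechet_derivative_at[OF e_has_derivative] by metis

lemma phi_0: "\<phi> 0 w = w"
proof -
  have "br 0 v = 0" for v
    by (simp add: br_def linear_0[OF linear_B_left] linear_0[OF linear_B_right])
  moreover have "w = 0" if "n = 0" using nilpotent[of 0 w] that by simp
  ultimately show ?thesis
    unfolding \<phi>_def by (cases n) (auto simp: sum.lessThan_Suc_shift simp del: sum.lessThan_Suc)
qed

text \<open>The inverse function theorem applies because the derivative of \<open>e\<close> at 0 is
  the identity. It yields an inverse that is merely differentiable; smoothness is recovered in
  \<open>smooth_l\<close>.\<close>

lemma log_exists: "\<exists>S. open S \<and> 0 \<in> S \<and> S \<subseteq> ball 0 \<sigma> \<and> open (e ` S) \<and> inj_on e S \<and>
    (\<forall>y\<in>e ` S. inv_into S e differentiable (at y))"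
proof -
  define f' where "f' z = Blinfun (\<lambda>w. V (e z) (\<phi> z w))" for z
  have bl: "bounded_linear (\<lambda>w. V (e z) (\<phi> z w))" if "z \<in> ball 0 \<sigma>" for z
    using e_has_derivative[of z] that has_derivative_bounded_linear by auto
  have f': "blinfun_apply (f' z) = (\<lambda>w. V (e z) (\<phi> z w))" if "z \<in> ball 0 \<sigma>" for z
    unfolding f'_def by (rule bounded_linear_Blinfun_apply[OF bl[OF that]])
  have cont: "continuous_on (ball 0 \<sigma>) f'"
  proof (rule continuous_on_blinfun_componentwise)
    fix b :: 'a
    have "continuous_on (ball 0 \<sigma>) (\<lambda>z. frechet_derivative e (at z) b)"
      by (rule smooth_on_imp_continuous_on[OF smooth_on_frechet_derivative[OF smooth_e]])
    moreover have "frechet_derivative e (at z) b = blinfun_apply (f' z) b" if "z \<in> ball 0 \<sigma>" for z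
      using frechet_e[of z b] f'[OF that] that by simp
    ultimately show "continuous_on (ball 0 \<sigma>) (\<lambda>z. blinfun_apply (f' z) b)"
      using continuous_on_cong by (metis (no_types, lifting))
  qed
  have "f' 0 = id_blinfun"
    by (rule blinfun_eqI) (use f'[of 0] sigma_pos phi_0 in simp)
  then have inv0: "id_blinfun o\<^sub>L f' 0 = id_blinfun" by (intro blinfun_eqI) simp
  have der: "(e has_derivative blinfun_apply (f' z)) (at z)" if "z \<in> ball 0 \<sigma>" for z
    unfolding f'[OF that] by (rule e_has_derivative) (use that in simp)
  have 0: "0 \<in> ball (0::'a) \<sigma>" using sigma_pos by simp
  obtain S W g g' where S: "open S" "S \<subseteq> ball 0 \<sigma>" "0 \<in> S" "open W" "e 0 \<in> W" "homeomorphism S W e g"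
    and g': "\<And>y. y \<in> W \<Longrightarrow> (g has_derivative (g' y)) (at y)"
    using inverse_function_theorem[OF open_ball der cont 0 inv0] by metis
  have W: "e ` S = W" and inj: "inj_on e S" and ge: "\<And>x. x \<in> S \<Longrightarrow> g (e x) = x"
    using S(6) by (auto simp: homeomorphism_def intro: inj_on_inverseI)
  have "inv_into S e differentiable (at y)" if y: "y \<in> W" for y
  proof -
    have "(inv_into S e has_derivative g' y) (at y)"
    proof (rule has_derivative_transform_within_open[OF g'[OF y] S(4) y])
      fix x assume "x \<in> W"
      then show "g x = inv_into S e x" using W inj ge by auto
    qed
    then show ?thesis by (auto simp: differentiable_def)
  qed
  then show ?thesis using S W inj by (intro exI[of _ S]) auto
qed

definition logset :: "'a set" where
  "logset = (SOME S. open S \<and> 0 \<in> S \<and> S \<subseteq> ball 0 \<sigma> \<and> open (e ` S) \<and> inj_on e S \<and>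
    (\<forall>y\<in>e ` S. inv_into S e differentiable (at y)))"

definition l :: "'a \<Rightarrow> 'a" where "l = inv_into logset e"

lemma logset: "open logset" "0 \<in> logset" "logset \<subseteq> ball 0 \<sigma>" "open (e ` logset)" "inj_on e logset"
    "y \<in> e ` logset \<Longrightarrow> l differentiable (at y)"
  using someI_ex[OF log_exists] unfolding logset_def[symmetric] l_def by blast+

lemma l_e: "x \<in> logset \<Longrightarrow> l (e x) = x"
  unfolding l_def by (rule inv_into_f_f[OF logset(5)])

lemma e_l: "y \<in> e ` logset \<Longrightarrow> e (l y) = y" "y \<in> e ` logset \<Longrightarrow> l y \<in> logset"
  unfolding l_def by (auto intro: f_inv_into_f inv_into_into)

lemma logset_norm: "x \<in> logset \<Longrightarrow> norm x < \<sigma>"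
  using logset(3) by auto

text \<open>Differentiating e (l y) = y and undoing \<open>V\<close> and \<open>\<phi>\<close>
  explicitly expresses the derivative of \<open>l\<close> through \<open>l\<close> again, which
  opens the same bootstrap as for \<open>e\<close>.\<close>

lemma l_has_derivative:
  assumes y: "y \<in> e ` logset"
  shows "(l has_derivative (\<lambda>u. \<phi>inv (l y) (dm (e (- l y)) y (0, u)))) (at y)"
proof -
  obtain L where L: "(l has_derivative L) (at y)" using logset(6)[OF y] differentiable_def by blast
  have z: "norm (l y) < \<sigma>" using e_l(2)[OF y] logset_norm by blast
  have "(e \<circ> l has_derivative (\<lambda>w. V (e (l y)) (\<phi> (l y) w)) \<circ> L) (at y)"
    by (rule diff_chain_at[OF L e_has_derivative[OF z]])
  then have "((\<lambda>x. x) has_derivative (\<lambda>u. V y (\<phi> (l y) (L u)))) (at y)"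
    unfolding o_def e_l(1)[OF y]
    by (rule has_derivative_transform_within_open[OF _ logset(4) y]) (rule e_l(1))
  from fun_cong[OF has_derivative_unique[OF this has_derivative_ident]]
  have VL: "V y (\<phi> (l y) (L u)) = u" for u .
  have "L u = \<phi>inv (l y) (dm (e (- l y)) y (0, u))" for u
  proof -
    have "dm (e (- l y)) y (0, u) = dm (e (- l y)) (e (l y)) (0, V (e (l y)) (\<phi> (l y) (L u)))"
      by (simp add: e_l(1)[OF y] VL)
    also have "\<dots> = \<phi> (l y) (L u)" by (rule V_left_inverse[OF z])
    finally show ?thesis by (simp add: phi_inv)
  qed
  then have "L = (\<lambda>u. \<phi>inv (l y) (dm (e (- l y)) y (0, u)))" by (rule ext)
  then show ?thesis using L by simp
qed

lemma smooth_l: "smooth_on (e ` logset) l"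
proof -
  let ?W = "e ` logset"
  have "Ck_on k l ?W" for k
  proof (induction k)
    case 0
    have "isCont l y" if "y \<in> ?W" for y
      by (rule has_derivative_continuous[OF l_has_derivative[OF that]])
    then show ?case by (simp add: continuous_at_imp_continuous_on)
  next
    case (Suc k)
    show ?case
    proof (rule Ck_on_SucI[OF l_has_derivative _ logset(4)])
      fix u :: 'a
      have A: "Ck_on k (\<lambda>y. \<phi>inv (l y) b) ?W" for b
        by (rule Ck_on_compose[OF logset(4) _ smooth_phi_inv[unfolded smooth_on_def, rule_format] Suc]) simp
      have ml: "Ck_on k (\<lambda>y. - l y) ?W"
        by (rule Ck_on_linear_comp[OF bounded_linear_minus[OF bounded_linear_ident] logset(4) Suc])
      have "Ck_on k (\<lambda>y. e (- l y)) ?W"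
        by (rule Ck_on_compose[OF logset(4) _ smooth_e[unfolded smooth_on_def, rule_format] ml])
          (use e_l(2) logset_norm in auto)
      then have "Ck_on k (\<lambda>y. (e (- l y), y)) ?W"
        by (rule Ck_on_Pair[OF logset(4) _ Ck_on_bounded_linear[OF bounded_linear_ident logset(4)]])
      note pr = this
      have Bk: "Ck_on k (\<lambda>y. dm (fst (e (- l y), y)) (snd (e (- l y), y)) (0, u)) ?W"
      proof (rule Ck_on_compose[OF logset(4) _ smooth_dm[unfolded smooth_on_def, rule_format] pr])
        fix y assume y: "y \<in> ?W"
        have "norm (l y) < \<sigma>" using e_l(2)[OF y] logset_norm by blast
        then show "(e (- l y), y) \<in> U \<times> U"
          using e_in_U[of "- l y"] e_in_U[of "l y"] e_l(1)[OF y] by simp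
      qed
      have "Ck_on k (\<lambda>y. \<Sum>b\<in>Basis. (dm (fst (e (- l y), y)) (snd (e (- l y), y)) (0, u) \<bullet> b) *\<^sub>R \<phi>inv (l y) b) ?W"
        by (intro Ck_on_sum[OF logset(4)] Ck_on_bilinear[OF bounded_bilinear_scaleR logset(4)]
            Ck_on_linear_comp[OF bounded_linear_inner_left logset(4) Bk] A)
      then show "Ck_on k (\<lambda>y. \<phi>inv (l y) (dm (e (- l y)) y (0, u))) ?W"
        unfolding linear_basis_expansion[OF linear_phi_inv, symmetric] by simp
    qed
  qed
  then show ?thesis by (simp add: smooth_on_def)
qed

text \<open>The Baker-Campbell-Hausdorff product near 0.\<close>

definition star :: "'a \<Rightarrow> 'a \<Rightarrow> 'a" where "star x y = l (m (e x) (e y))"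

lemma smooth_ee: "smooth_on (ball 0 \<sigma> \<times> ball 0 \<sigma>) (\<lambda>p. m (e (fst p)) (e (snd p)))"
proof -
  let ?S = "ball (0::'a) \<sigma> \<times> ball (0::'a) \<sigma>"
  have o: "open ?S" by (simp add: open_Times)
  have 1: "smooth_on ?S (\<lambda>p. e (fst p))" "smooth_on ?S (\<lambda>p. e (snd p))"
    by (auto intro!: smooth_on_compose[OF smooth_e smooth_on_bounded_linear[OF _ o] o]
        bounded_linear_fst bounded_linear_snd)
  have "smooth_on ?S (\<lambda>p. (\<lambda>q. m (fst q) (snd q)) (e (fst p), e (snd p)))"
    by (rule smooth_on_compose[OF m_smooth smooth_on_Pair[OF o 1] o]) (use e_in_U in auto)
  then show ?thesis by simp
qed

lemma tau_exists: "\<exists>\<tau>>0. \<tau> \<le> \<sigma> \<and> ball 0 \<tau> \<subseteq> logset \<and>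
    (\<forall>x y. norm x < \<tau> \<longrightarrow> norm y < \<tau> \<longrightarrow> m (e x) (e y) \<in> e ` logset)"
proof -
  let ?S = "ball (0::'a) \<sigma> \<times> ball (0::'a) \<sigma>"
  have oS: "open ?S" by (simp add: open_Times)
  have o: "open (?S \<inter> (\<lambda>p. m (e (fst p)) (e (snd p))) -` (e ` logset))"
    by (rule continuous_open_preimage[OF smooth_on_imp_continuous_on[OF smooth_ee] oS logset(4)])
  have "0 \<in> e ` logset" using logset(2) e_0 by (metis imageI)
  then have i: "(0, 0) \<in> ?S \<inter> (\<lambda>p. m (e (fst p)) (e (snd p))) -` (e ` logset)"
    using sigma_pos m_0_left[OF zero_in_U] by simp
  obtain A A' where A: "open A" "open A'" "(0, 0) \<in> A \<times> A'"
    "A \<times> A' \<subseteq> ?S \<inter> (\<lambda>p. m (e (fst p)) (e (snd p))) -` (e ` logset)"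
    by (rule open_prod_elim[OF o i])
  have "open (A \<inter> A' \<inter> logset)" "0 \<in> A \<inter> A' \<inter> logset" using A logset(1,2) by auto
  then obtain d where d: "d > 0" "ball 0 d \<subseteq> A \<inter> A' \<inter> logset" using openE by blast
  show ?thesis
  proof (intro exI[of _ "min d \<sigma>"] conjI allI impI)
    show "0 < min d \<sigma>" "min d \<sigma> \<le> \<sigma>" using d sigma_pos by auto
    show "ball 0 (min d \<sigma>) \<subseteq> logset" using d by auto
    fix x y :: 'a assume "norm x < min d \<sigma>" "norm y < min d \<sigma>"
    then have "x \<in> A" "y \<in> A'" using d by auto
    then show "m (e x) (e y) \<in> e ` logset" using A(4) by auto
  qed
qed

definition \<tau> :: real where
  "\<tau> = (SOME \<tau>. 0 < \<tau> \<and> \<tau> \<le> \<sigma> \<and> ball 0 \<tau> \<subseteq> logset \<and>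
    (\<forall>x y. norm x < \<tau> \<longrightarrow> norm y < \<tau> \<longrightarrow> m (e x) (e y) \<in> e ` logset))"

lemma tau: "0 < \<tau>" "\<tau> \<le> \<sigma>" "norm x < \<tau> \<Longrightarrow> x \<in> logset"
    "norm x < \<tau> \<Longrightarrow> norm y < \<tau> \<Longrightarrow> m (e x) (e y) \<in> e ` logset"
proof -
  have *: "0 < \<tau> \<and> \<tau> \<le> \<sigma> \<and> ball 0 \<tau> \<subseteq> logset \<and>
    (\<forall>x y. norm x < \<tau> \<longrightarrow> norm y < \<tau> \<longrightarrow> m (e x) (e y) \<in> e ` logset)"
    unfolding \<tau>_def by (rule someI_ex[OF tau_exists])
  show "0 < \<tau>" "\<tau> \<le> \<sigma>" "norm x < \<tau> \<Longrightarrow> norm y < \<tau> \<Longrightarrow> m (e x) (e y) \<in> e ` logset" using * by blast+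
  have "ball 0 \<tau> \<subseteq> logset" using * by blast
  then show "norm x < \<tau> \<Longrightarrow> x \<in> logset" by (auto simp: subset_iff)
qed

lemma tau_sigma: "norm x < \<tau> \<Longrightarrow> norm x < \<sigma>" using tau(2) by linarith

lemma e_star: "norm x < \<tau> \<Longrightarrow> norm y < \<tau> \<Longrightarrow> e (star x y) = m (e x) (e y)"
    "norm x < \<tau> \<Longrightarrow> norm y < \<tau> \<Longrightarrow> star x y \<in> logset"
  using e_l tau(4) by (auto simp: star_def)

lemma smooth_star: "smooth_on (ball 0 \<tau> \<times> ball 0 \<tau>) (\<lambda>p. star (fst p) (snd p))"
  unfolding star_def
proof (rule smooth_on_compose[OF smooth_l])
  show "smooth_on (ball 0 \<tau> \<times> ball 0 \<tau>) (\<lambda>p. m (e (fst p)) (e (snd p)))"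
    by (rule smooth_on_subset[OF smooth_ee]) (use tau_sigma in auto)
  show "open (ball (0::'a) \<tau> \<times> ball (0::'a) \<tau>)" by (simp add: open_Times)
qed (use tau(4) in auto)

lemma star_line:
  assumes "norm (s *\<^sub>R v) < \<tau>" "norm (t *\<^sub>R v) < \<tau>" "norm ((s + t) *\<^sub>R v) < \<tau>"
  shows "star (s *\<^sub>R v) (t *\<^sub>R v) = (s + t) *\<^sub>R v"
  using e_one_parameter[OF assms[THEN tau_sigma]] l_e[OF tau(3)[OF assms(3)]] by (simp add: star_def)

lemma star_0: "norm x < \<tau> \<Longrightarrow> star x 0 = x" "norm x < \<tau> \<Longrightarrow> star 0 x = x"
  using star_line[of 1 x 0] star_line[of 0 x 1] tau(1) by auto

lemma star_assoc:
  assumes "norm x < \<tau>" "norm y < \<tau>" "norm z < \<tau>" "norm (star x y) < \<tau>" "norm (star y z) < \<tau>"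
  shows "star (star x y) z = star x (star y z)"
proof -
  note s = less_imp_le[OF tau_sigma]
  have "m (m (e x) (e y)) (e z) = m (e x) (m (e y) (e z))"
    by (intro m_assoc e_in_U e_mult_small(2) s assms)
  then show ?thesis using assms by (simp add: star_def[of "star x y"] star_def[of x "star y z"] e_star(1))
qed

lemma phi_equivariant:
  assumes "linear L" "\<And>v w. br (L v) (L w) = L (br v w)"
  shows "\<phi> (L z) (L w) = L (\<phi> z w)"
proof -
  have "(br (L z) ^^ k) (L w) = L ((br z ^^ k) w)" for k
    by (induction k) (auto simp: assms(2))
  then show ?thesis by (simp add: \<phi>_def linear_sum[OF assms(1)] linear_scale[OF assms(1)])
qed

text \<open>With \<open>z t = star x (t y)\<close> one has \<open>\<phi> (z t) (z' t) = y\<close>, an equation that involves the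
  bracket only and is therefore preserved by \<open>L\<close>.\<close>

lemma star_automorphism:
  assumes L: "linear L" "\<And>v w. br (L v) (L w) = L (br v w)"
    and x: "norm x < \<tau>" and y: "norm y < \<tau>" and Lx: "norm (L x) < \<tau>" and Ly: "norm (L y) < \<tau>"
    and Lz: "\<And>t. t \<in> {0..1} \<Longrightarrow> norm (L (star x (t *\<^sub>R y))) < \<tau>"
  shows "L (star x y) = star (L x) (L y)"
proof -
  define z where "z t = star x (t *\<^sub>R y)" for t
  have sl: "norm (t *\<^sub>R v) < \<tau>" if "t \<in> {0..1}" "norm v < \<tau>" for t v
  proof -
    have "norm (t *\<^sub>R v) \<le> norm v" using that by (auto intro: mult_left_le_one_le)
    then show ?thesis using that by linarith
  qed
  \<comment> \<open>L acts on the Lie algebra only and cannot be moved through \<open>e\<close>.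
    Instead, both curves solve the left-invariant equation with velocity L y; applying the logarithm
    at time 1 gives the claim.\<close>
  have "e (L (z 1)) = m (e (L x)) (e (1 *\<^sub>R L y))"
  proof (rule ode_unique[where v = "L y" and f = "\<lambda>t. e (L (z t))" and g = "\<lambda>t. m (e (L x)) (e (t *\<^sub>R L y))"])
    fix t :: real assume t: "t \<in> {0..1}"
    note ty = sl[OF t y] and tLy = sl[OF t Ly]
    have zl0: "z t \<in> logset" unfolding z_def by (rule e_star(2)[OF x ty])
    have zl3: "e (z t) = m (e x) (e (t *\<^sub>R y))" unfolding z_def by (rule e_star(1)[OF x ty])
    note zl = zl0 logset_norm[OF zl0] zl3
    have mo: "((\<lambda>t. m (e x) (e (t *\<^sub>R y))) has_vector_derivative V (e (z t)) y) (at t)"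
      unfolding zl(3) by (rule e_right_ode[OF less_imp_le[OF tau_sigma[OF x]] tau_sigma[OF ty]])
    have lder: "(l has_derivative (\<lambda>u. \<phi>inv (z t) (dm (e (- z t)) (e (z t)) (0, u)))) (at (m (e x) (e (t *\<^sub>R y))))"
    proof -
      have "l (m (e x) (e (t *\<^sub>R y))) = z t" by (simp add: z_def star_def)
      with l_has_derivative[OF tau(4)[OF x ty]] show ?thesis unfolding zl(3) by metis
    qed
    have "(l \<circ> (\<lambda>t. m (e x) (e (t *\<^sub>R y))) has_vector_derivative \<phi>inv (z t) (dm (e (- z t)) (e (z t)) (0, V (e (z t)) y))) (at t)"
      by (rule vector_derivative_diff_chain_within[OF mo has_derivative_at_withinI[OF lder]])
    then have z': "(z has_vector_derivative \<phi>inv (z t) y) (at t)"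
      unfolding V_left_inverse[OF zl(2)] by (simp add: o_def z_def[abs_def] star_def[abs_def])
    have "(e \<circ> z has_vector_derivative V (e (z t)) (\<phi> (z t) (\<phi>inv (z t) y))) (at t)"
      by (rule vector_derivative_diff_chain_within[OF z' has_derivative_at_withinI[OF e_has_derivative[OF zl(2)]]])
    then have ez: "((\<lambda>t. e (z t)) has_vector_derivative V (e (z t)) (\<phi> (z t) (\<phi>inv (z t) y))) (at t)"
      by (simp add: o_def)
    have "open {t. norm (t *\<^sub>R y) < \<tau>}" by (intro open_Collect_less continuous_intros)
    then have "((\<lambda>t. m (e x) (e (t *\<^sub>R y))) has_vector_derivative V (e (z t)) (\<phi> (z t) (\<phi>inv (z t) y))) (at t)"
      by (rule has_vector_derivative_transform_within_open[OF ez]) (use ty e_star(1)[OF x] in \<open>auto simp: z_def\<close>)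
    then have "V (e (z t)) (\<phi> (z t) (\<phi>inv (z t) y)) = V (e (z t)) y"
      by (rule vector_derivative_unique_at[OF _ mo])
    \<comment> \<open>\<open>\<phi>inv\<close> is so far a left inverse of \<phi>; the other side
      comes from having computed the velocity of e (z t) in two ways.\<close>
    then have py: "\<phi> (z t) (\<phi>inv (z t) y) = y"
      using V_left_inverse[OF zl(2)] by metis
    have Lzt: "norm (L (z t)) < \<sigma>" using Lz[OF t] tau_sigma by (simp add: z_def)
    have "(L \<circ> z has_vector_derivative L (\<phi>inv (z t) y)) (at t)"
      by (rule vector_derivative_diff_chain_within[OF z' has_derivative_at_withinI[OF bounded_linear_imp_has_derivative]])
        (use L(1) linear_conv_bounded_linear in blast)
    then have "(e \<circ> (L \<circ> z) has_vector_derivative V (e (L (z t))) (\<phi> (L (z t)) (L (\<phi>inv (z t) y)))) (at t)"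
      by (rule vector_derivative_diff_chain_within) (use has_derivative_at_withinI[OF e_has_derivative[OF Lzt]] in simp)
    then show "((\<lambda>t. e (L (z t))) has_vector_derivative V (e (L (z t))) (L y)) (at t within {0..1})"
      unfolding phi_equivariant[OF L] py by (auto simp: o_def intro: has_vector_derivative_at_within)
    show "((\<lambda>t. m (e (L x)) (e (t *\<^sub>R L y))) has_vector_derivative
        V (m (e (L x)) (e (t *\<^sub>R L y))) (L y)) (at t within {0..1})"
      by (rule has_vector_derivative_at_within[OF e_right_ode[OF less_imp_le[OF tau_sigma[OF Lx]] tau_sigma[OF tLy]]])
    show "norm (e (L (z t))) \<le> r" using norm_e_r Lzt by simp
    show "norm (m (e (L x)) (e (t *\<^sub>R L y))) \<le> r"
      using e_mult_small(1)[OF less_imp_le[OF tau_sigma[OF Lx]] less_imp_le[OF tau_sigma[OF tLy]]] r_pos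
      by linarith
  qed (use star_0 x m_0_right[OF e_in_U[OF less_imp_le[OF tau_sigma[OF Lx]]]] in \<open>auto simp: z_def\<close>)
  then have "l (e (L (star x y))) = star (L x) (L y)" by (simp add: z_def star_def)
  then show ?thesis using l_e[OF tau(3)] Lz[of 1] by simp
qed

text \<open>The derivative of y \<mapsto> star x y - y vanishes at x = y = 0 and is Lipschitz, so on
  a ball of radius c it has size k c. In this form small translations are later seen to change
  volumes very little.\<close>

lemma star_near_identity:
  "\<exists>k\<ge>0. \<forall>c (x::'a) y y'. c < \<tau> \<longrightarrow> norm x \<le> c \<longrightarrow> norm y \<le> c \<longrightarrow> norm y' \<le> c \<longrightarrow>
     c \<le> \<tau> / 2 \<longrightarrow> norm ((star x y - y) - (star x y' - y')) \<le> k * c * norm (y - y')"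
proof -
  let ?S = "ball (0::'a) \<tau> \<times> ball (0::'a) \<tau>" and ?C = "cball (0::'a) (\<tau> / 2) \<times> cball (0::'a) (\<tau> / 2)"
  define D where "D p = frechet_derivative (\<lambda>p. star (fst p) (snd p)) (at p)" for p
  have C: "?C \<subseteq> ?S" "(0, 0) \<in> ?C" using tau(1) by auto
  have D: "((\<lambda>y. star x y) has_derivative (\<lambda>w. D (x, y) (0, w))) (at y)"
    if "norm x < \<tau>" "norm y < \<tau>" for x y
  proof -
    have "((\<lambda>p. star (fst p) (snd p)) has_derivative D (x, y)) (at (x, y))"
      unfolding D_def by (rule smooth_on_has_derivative[OF smooth_star]) (use that in auto)
    then have "((\<lambda>p. star (fst p) (snd p)) \<circ> (\<lambda>y. (x, y)) has_derivative D (x, y) \<circ> (\<lambda>w. (0, w))) (at y)"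
      by (intro diff_chain_at) (auto intro!: derivative_eq_intros)
    then show ?thesis by (simp add: o_def)
  qed
  have D0: "D (0, 0) (0, w) = w" for w
  proof -
    have "((\<lambda>y. y) has_derivative (\<lambda>w. D (0, 0) (0, w))) (at 0)"
      by (rule has_derivative_transform_within_open[OF D open_ball[of 0 \<tau>]]) (use tau(1) star_0 in auto)
    from fun_cong[OF has_derivative_unique[OF this has_derivative_ident]] show ?thesis .
  qed
  have "\<exists>K\<ge>0. \<forall>p\<in>?C. norm (D p (0, b) - b) \<le> K * norm p" for b
  proof -
    obtain K where "0 \<le> K" "\<And>p q. p \<in> ?C \<Longrightarrow> q \<in> ?C \<Longrightarrow> norm (D p (0, b) - D q (0, b)) \<le> K * norm (p - q)"
      unfolding D_def
      by (rule smooth_on_Lipschitz[OF smooth_on_frechet_derivative[OF smooth_star], of ?C "(0, b)"])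
        (use C in \<open>auto intro: compact_Times convex_Times\<close>)
    from this(1) this(2)[OF _ C(2)] show ?thesis by (intro exI[of _ K]) (auto simp: D0)
  qed
  then obtain k where k: "\<And>b. 0 \<le> k b" "\<And>b p. p \<in> ?C \<Longrightarrow> norm (D p (0, b) - b) \<le> k b * norm p"
    using choice[of "\<lambda>b K. K \<ge> 0 \<and> (\<forall>p\<in>?C. norm (D p (0, b) - b) \<le> K * norm p)"] by blast
  let ?k = "2 * (\<Sum>b\<in>Basis. k b)"
  have k0: "0 \<le> (\<Sum>b\<in>Basis. k b)" using k by (auto intro: sum_nonneg)
  show ?thesis
  proof (intro exI[of _ ?k] conjI allI impI)
    fix c and x y y' :: 'a assume c: "c < \<tau>" "norm x \<le> c" "norm y \<le> c" "norm y' \<le> c" "c \<le> \<tau> / 2"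
    have c0: "0 \<le> c" using c(2) norm_ge_zero order_trans by blast
    show "norm ((star x y - y) - (star x y' - y')) \<le> ?k * c * norm (y - y')"
    proof (rule differentiable_bound[OF convex_cball[of 0 c], where f' = "\<lambda>y w. D (x, y) (0, w) - w"])
      fix u :: 'a assume u: "u \<in> cball 0 c"
      have xu: "norm x < \<tau>" "norm u < \<tau>" using u c by auto
      show "((\<lambda>y. star x y - y) has_derivative (\<lambda>w. D (x, u) (0, w) - w)) (at u within cball 0 c)"
        by (intro has_derivative_diff has_derivative_at_withinI[OF D] has_derivative_ident xu)
      show "onorm (\<lambda>w. D (x, u) (0, w) - w) \<le> ?k * c"
      proof (rule onorm_le)
        fix w
        have lin: "linear (\<lambda>w. D (x, u) (0, w) - w)"
          using has_derivative_linear[OF D[OF xu]] by (intro linear_compose_sub linear_ident)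
        have "norm (D (x, u) (0, w) - w) \<le> (\<Sum>b\<in>Basis. k b) * norm (x, u) * norm w"
          by (rule norm_le_of_basis[OF lin]) (use k(2)[of "(x, u)"] u c in auto)
        also have "\<dots> \<le> (\<Sum>b\<in>Basis. k b) * (2 * c) * norm w"
          using norm_Pair_le[of x u] u c k0 by (intro mult_right_mono mult_left_mono) auto
        finally show "norm (D (x, u) (0, w) - w) \<le> ?k * c * norm w" by (simp add: mult_ac)
      qed
    qed (use c in auto)
  qed (use k0 in simp)
qed

end


section \<open>Dilations and the global group law\<close>

text \<open>In the application \<open>ka\<close> and \<open>kb\<close> are the least and the largest
  weight. \<open>kc\<close> is there because the norm is not adapted to the weights: even a
  contraction may increase it by a constant factor.\<close>

locale dil_local_lie = local_lie m \<rho> for m :: "'a::euclidean_space \<Rightarrow> 'a \<Rightarrow> 'a" and \<rho> +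
  fixes \<delta> :: "real \<Rightarrow> 'a \<Rightarrow> 'a" and ka kb kc :: real
  assumes dil_linear: "0 < h \<Longrightarrow> linear (\<delta> h)"
    and dil_1: "\<delta> 1 v = v"
    and dil_mult: "0 < h \<Longrightarrow> 0 < s \<Longrightarrow> \<delta> (h * s) v = \<delta> h (\<delta> s v)"
    and ka: "0 < ka" and kc: "0 < kc"
    and dil_small: "0 < h \<Longrightarrow> h \<le> 1 \<Longrightarrow> norm (\<delta> h v) \<le> kc * h powr ka * norm v"
    and dil_big: "1 \<le> h \<Longrightarrow> norm (\<delta> h v) \<le> kc * h powr kb * norm v"
    and dil_br: "0 < h \<Longrightarrow> br (\<delta> h v) (\<delta> h w) = \<delta> h (br v w)"
begin

lemma dil_inverse: "0 < h \<Longrightarrow> \<delta> (1 / h) (\<delta> h v) = v" "0 < h \<Longrightarrow> \<delta> h (\<delta> (1 / h) v) = v"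
  using dil_mult[of "1 / h" h v] dil_mult[of h "1 / h" v] by (simp_all add: dil_1)

lemma br_bound: "norm (br u w) \<le> 2 * K * norm u * norm w"
proof -
  have "norm (br u w) \<le> K * norm u * norm w + K * norm w * norm u"
    unfolding br_def by (intro order_trans[OF norm_triangle_ineq4] add_mono B_bound)
  then show ?thesis by (simp add: mult_ac)
qed

text \<open>Rescaling the iterated bracket to a small argument makes it decay faster than the
  rescaling of its value can grow.\<close>

lemma br_nilpotent: "\<exists>n. \<forall>z w. (br z ^^ n) w = 0"
proof -
  \<comment> \<open>k brackets with z and one w bring k + 1 contractions of order h^ka against a
    single expansion of order h^(- kb). With this k the total exponent is positive, and letting h
    tend to 0 forces the norm to vanish.\<close>
  obtain k :: nat where k: "kb / ka < real k" using reals_Archimedean2 by blast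
  define c where "c = real k * ka + ka - kb"
  have c: "0 < c" using k ka by (simp add: c_def field_simps)
  have "(br z ^^ k) w = 0" for z w
  proof -
    define M where "M = kc * (2 * K * kc * norm z) ^ k * kc * norm w"
    have it: "(br (\<delta> h z) ^^ j) (\<delta> h w) = \<delta> h ((br z ^^ j) w)" if "0 < h" for h j
      by (induction j) (auto simp: dil_br that)
    have bd: "norm ((br u ^^ j) v) \<le> (2 * K * norm u) ^ j * norm v" for u v j
    proof (induction j)
      case (Suc j)
      have "norm (br u ((br u ^^ j) v)) \<le> 2 * K * norm u * norm ((br u ^^ j) v)" by (rule br_bound)
      also have "\<dots> \<le> 2 * K * norm u * ((2 * K * norm u) ^ j * norm v)"
        using Suc K_pos by (intro mult_left_mono) auto
      finally show ?case by (simp add: mult_ac)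
    qed simp
    have est: "norm ((br z ^^ k) w) \<le> M * h powr c" if h: "0 < h" "h \<le> 1" for h
    proof -
      have "norm ((br z ^^ k) w) = norm (\<delta> (1 / h) ((br (\<delta> h z) ^^ k) (\<delta> h w)))"
        using it[OF h(1)] dil_inverse(1)[OF h(1)] by simp
      also have "\<dots> \<le> kc * (1 / h) powr kb * norm ((br (\<delta> h z) ^^ k) (\<delta> h w))"
        using h by (intro dil_big) simp
      also have "\<dots> \<le> kc * (1 / h) powr kb * ((2 * K * norm (\<delta> h z)) ^ k * norm (\<delta> h w))"
        using kc by (intro mult_left_mono bd) auto
      also have "\<dots> \<le> kc * (1 / h) powr kb * ((2 * K * (kc * h powr ka * norm z)) ^ k * (kc * h powr ka * norm w))"
        using kc K_pos h dil_small[OF h]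
        by (intro mult_left_mono mult_mono power_mono) auto
      also have "\<dots> = kc * h powr (- kb) * (2 * K * kc * norm z) ^ k * (h powr ka) ^ k * (kc * h powr ka * norm w)"
        using h by (simp add: powr_minus powr_divide power_mult_distrib field_simps)
      also have "(h powr ka) ^ k = h powr (real k * ka)"
        using h by (simp add: powr_realpow[symmetric] powr_powr mult.commute)
      also have "kc * h powr (- kb) * (2 * K * kc * norm z) ^ k * h powr (real k * ka) * (kc * h powr ka * norm w)
          = M * (h powr (- kb) * h powr (real k * ka) * h powr ka)"
        by (simp add: M_def mult_ac)
      also have "h powr (- kb) * h powr (real k * ka) * h powr ka = h powr c"
        by (simp add: powr_add[symmetric] c_def algebra_simps)
      finally show ?thesis .
    qed
    have "((\<lambda>h. h powr c) \<longlongrightarrow> 0) (at_right 0)"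
      by (rule tendsto_zero_powrI[OF tendsto_ident_at tendsto_const _ c]) (auto simp: eventually_at_filter)
    from tendsto_mult_right_zero[OF this, of M]
    have "norm ((br z ^^ k) w) \<le> 0"
    proof (rule tendsto_lowerbound)
      show "\<forall>\<^sub>F h in at_right 0. norm ((br z ^^ k) w) \<le> M * h powr c"
        unfolding eventually_at_right_field by (intro exI[of _ 1]) (auto intro: est)
    qed simp
    then show ?thesis by simp
  qed
  then show ?thesis by blast
qed

definition deg :: nat where "deg = (SOME n. \<forall>z w. (br z ^^ n) w = 0)"

sublocale nil_local_lie m \<rho> deg
proof
  show "(br z ^^ deg) w = 0" for z w
    using someI_ex[OF br_nilpotent] unfolding deg_def[symmetric] by blast
qed

lemma dil_le: "0 < h \<Longrightarrow> h \<le> 1 \<Longrightarrow> norm (\<delta> h v) \<le> kc * norm v"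
proof -
  assume h: "0 < h" "h \<le> 1"
  have "h powr ka \<le> 1 powr ka" using h ka by (intro powr_mono2) auto
  then have "kc * h powr ka * norm v \<le> kc * 1 * norm v"
    using kc by (intro mult_right_mono mult_left_mono) auto
  then show ?thesis using dil_small[OF h, of v] by simp
qed

lemma dil_shrinks:
  assumes "0 < d"
  shows "\<exists>r0>0. r0 \<le> 1 \<and> (\<forall>h v. 0 < h \<and> h \<le> r0 \<and> norm v \<le> R \<longrightarrow> norm (\<delta> h v) < d)"
proof -
  define R' where "R' = \<bar>R\<bar> + 1"
  define r0 where "r0 = min 1 ((d / (2 * kc * R')) powr (1 / ka))"
  have R': "0 < R'" by (simp add: R'_def add_nonneg_pos)
  have q: "0 < d / (2 * kc * R')" using assms kc R' by simp
  have "norm (\<delta> h v) < d" if "0 < h" "h \<le> r0" "norm v \<le> R" for h v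
  proof -
    have "h powr ka \<le> ((d / (2 * kc * R')) powr (1 / ka)) powr ka"
      using that ka by (intro powr_mono2) (auto simp: r0_def)
    also have "\<dots> = d / (2 * kc * R')"
    proof -
      have "(c powr (1 / ka)) powr ka = c" if "0 < c" for c using that ka by (simp add: powr_powr)
      then show ?thesis using q by blast
    qed
    finally have *: "h powr ka \<le> d / (2 * kc * R')" .
    have "norm (\<delta> h v) \<le> kc * h powr ka * norm v" using that by (intro dil_small) (auto simp: r0_def)
    also have "\<dots> \<le> kc * (d / (2 * kc * R')) * R'"
    proof (rule mult_mono[OF mult_left_mono[OF * less_imp_le[OF kc]]])
      show "norm v \<le> R'" using that by (simp add: R'_def)
      show "0 \<le> kc * (d / (2 * kc * R'))" using q kc by (intro mult_nonneg_nonneg) auto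
    qed simp
    also have "\<dots> = d / 2" using kc R' by simp
    finally show ?thesis using assms by linarith
  qed
  moreover have "0 < r0"
  proof -
    have "0 < (d / (2 * kc * R')) powr (1 / ka)" using q by (metis powr_gt_zero less_irrefl)
    then show ?thesis unfolding r0_def by linarith
  qed
  moreover have "r0 \<le> 1" by (simp add: r0_def)
  ultimately show ?thesis by blast
qed

lemma eta_exists: "\<exists>\<eta>>0. \<eta> \<le> \<tau> \<and> kc * \<eta> \<le> \<tau> \<and>
  (\<forall>x y. norm x < \<eta> \<longrightarrow> norm y < \<eta> \<longrightarrow> kc * norm (star x y) < \<tau> \<and> norm (star x y) < \<tau>)"
proof -
  let ?f = "\<lambda>p. star (fst p) (snd p)" and ?S = "ball (0::'a) \<tau> \<times> ball (0::'a) \<tau>"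
  define d where "d = min \<tau> (\<tau> / kc)"
  have d: "0 < d" using tau(1) kc by (simp add: d_def)
  have "open ?S" "(0, 0) \<in> ?S" using tau(1) by (auto simp: open_Times)
  then have "isCont ?f (0, 0)"
    using smooth_on_imp_continuous_on[OF smooth_star] continuous_on_eq_continuous_at by blast
  then obtain s where s: "s > 0" "\<And>p. dist p (0, 0) < s \<Longrightarrow> dist (?f p) (?f (0, 0)) < d"
    unfolding continuous_at_eps_delta using d by blast
  define \<eta> where "\<eta> = min (s / 2) d"
  have "norm (star x y) < d" if "norm x < \<eta>" "norm y < \<eta>" for x y
  proof -
    have "dist (x, y) (0, 0) < s" using norm_Pair_le[of x y] that by (simp add: \<eta>_def dist_norm)
    then show ?thesis using s(2)[of "(x, y)"] star_0(1)[of 0] tau(1) by simp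
  qed
  moreover have "kc * a < \<tau>" "a < \<tau>" if "a < d" for a
    using that kc by (auto simp: d_def field_simps)
  moreover have "0 < \<eta>" using s d by (simp add: \<eta>_def)
  moreover have "kc * \<eta> \<le> \<tau>" "\<eta> \<le> \<tau>"
  proof -
    have "\<eta> \<le> d" "d \<le> \<tau>" "d \<le> \<tau> / kc" by (auto simp: \<eta>_def d_def)
    then show "\<eta> \<le> \<tau>" by simp
    have "kc * \<eta> \<le> kc * d" using \<open>\<eta> \<le> d\<close> kc by simp
    also have "\<dots> \<le> \<tau>" using \<open>d \<le> \<tau> / kc\<close> kc by (simp add: field_simps)
    finally show "kc * \<eta> \<le> \<tau>" .
  qed
  ultimately show ?thesis by (intro exI[of _ \<eta>]) auto
qed

definition \<eta> :: real where
  "\<eta> = (SOME \<eta>. 0 < \<eta> \<and> \<eta> \<le> \<tau> \<and> kc * \<eta> \<le> \<tau> \<and>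
  (\<forall>x y. norm x < \<eta> \<longrightarrow> norm y < \<eta> \<longrightarrow> kc * norm (star x y) < \<tau> \<and> norm (star x y) < \<tau>))"

lemma eta: "0 < \<eta>" "\<eta> \<le> \<tau>" "kc * \<eta> \<le> \<tau>"
  "norm x < \<eta> \<Longrightarrow> norm y < \<eta> \<Longrightarrow> kc * norm (star x y) < \<tau>"
  "norm x < \<eta> \<Longrightarrow> norm y < \<eta> \<Longrightarrow> norm (star x y) < \<tau>"
  using someI_ex[OF eta_exists] unfolding \<eta>_def[symmetric] by blast+

lemma eta_tau: "norm x < \<eta> \<Longrightarrow> norm x < \<tau>" using eta(2) by linarith

text \<open>A dilation respects the bracket, so \<open>star_automorphism\<close> applies once all
  points stay in range; the radius \<eta> leaves room for the factor \<open>kc\<close>.\<close>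

lemma star_dil:
  assumes "norm x < \<eta>" "norm y < \<eta>" "0 < h" "h \<le> 1"
  shows "\<delta> h (star x y) = star (\<delta> h x) (\<delta> h y)"
proof -
  have small: "norm (\<delta> h v) < \<tau>" if "norm v < \<eta>" for v
  proof -
    have "norm (\<delta> h v) \<le> kc * norm v" by (rule dil_le) fact+
    also have "\<dots> < kc * \<eta>" using that kc by simp
    finally show ?thesis using eta(3) by linarith
  qed
  show ?thesis
  proof (rule star_automorphism)
    fix t :: real assume "t \<in> {0..1}"
    then have "norm (t *\<^sub>R y) \<le> norm y" by (auto intro: mult_left_le_one_le)
    then have "norm (t *\<^sub>R y) < \<eta>" using assms by linarith
    from eta(4)[OF assms(1) this] show "norm (\<delta> h (star x (t *\<^sub>R y))) < \<tau>"
      using dil_le[OF assms(3,4), of "star x (t *\<^sub>R y)"] by linarith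
  qed (use assms small eta_tau dil_linear dil_br in auto)
qed

definition rad :: "real \<Rightarrow> real" where
  "rad R = (SOME r0. 0 < r0 \<and> r0 \<le> 1 \<and> (\<forall>h v. 0 < h \<and> h \<le> r0 \<and> norm v \<le> R \<longrightarrow> norm (\<delta> h v) < \<eta>))"

lemma rad: "0 < rad R" "rad R \<le> 1" "0 < h \<Longrightarrow> h \<le> rad R \<Longrightarrow> norm v \<le> R \<Longrightarrow> norm (\<delta> h v) < \<eta>"
  using someI_ex[OF dil_shrinks[OF eta(1)]] unfolding rad_def[symmetric] by blast+

text \<open>The group law on the whole Lie algebra: contract both factors into the range of
  \<open>star\<close>, multiply, expand back. \<open>rad\<close> merely picks one admissible scale;
  \<open>prd_eq\<close> shows that all give the same result.\<close>

definition prd :: "'a \<Rightarrow> 'a \<Rightarrow> 'a" where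
  "prd x y = (let h = rad (norm x + norm y) in \<delta> (1 / h) (star (\<delta> h x) (\<delta> h y)))"

lemma prd_eq:
  assumes "0 < h" "norm (\<delta> h x) < \<eta>" "norm (\<delta> h y) < \<eta>"
  shows "\<delta> h (prd x y) = star (\<delta> h x) (\<delta> h y)" "prd x y = \<delta> (1 / h) (star (\<delta> h x) (\<delta> h y))"
proof -
  \<comment> \<open>The smaller scale is reached from the larger one by a dilation with factor r1 /
    r2 \<le> 1, which \<open>star\<close> respects.\<close>
  have indep: "\<delta> (1 / r1) (star (\<delta> r1 x) (\<delta> r1 y)) = \<delta> (1 / r2) (star (\<delta> r2 x) (\<delta> r2 y))"
    if "0 < r1" "r1 \<le> r2" "norm (\<delta> r2 x) < \<eta>" "norm (\<delta> r2 y) < \<eta>" for r1 r2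
  proof -
    have r2: "0 < r2" using that by simp
    have eq: "\<delta> r1 v = \<delta> (r1 / r2) (\<delta> r2 v)" "\<delta> (1 / r1) v = \<delta> (1 / r2) (\<delta> (r2 / r1) v)" for v
      using dil_mult[of "r1 / r2" r2 v] dil_mult[of "1 / r2" "r2 / r1" v] that(1) r2 by (auto simp: field_simps)
    have "star (\<delta> r1 x) (\<delta> r1 y) = \<delta> (r1 / r2) (star (\<delta> r2 x) (\<delta> r2 y))"
      unfolding eq(1) by (rule star_dil[symmetric]) (use that r2 in auto)
    then have "\<delta> (r2 / r1) (star (\<delta> r1 x) (\<delta> r1 y)) = star (\<delta> r2 x) (\<delta> r2 y)"
      using dil_inverse(1)[of "r1 / r2"] that(1) r2 by simp
    then show ?thesis by (simp add: eq(2))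
  qed
  let ?s = "rad (norm x + norm y)"
  have s: "0 < ?s" "norm (\<delta> ?s x) < \<eta>" "norm (\<delta> ?s y) < \<eta>" by (auto intro!: rad)
  show eq: "prd x y = \<delta> (1 / h) (star (\<delta> h x) (\<delta> h y))"
  proof (cases "?s \<le> h")
    case True
    show ?thesis unfolding prd_def Let_def by (rule indep[OF s(1) True assms(2,3)])
  next
    case False
    then have "h \<le> ?s" by simp
    from indep[OF assms(1) this s(2,3)] show ?thesis unfolding prd_def Let_def by (rule sym)
  qed
  show "\<delta> h (prd x y) = star (\<delta> h x) (\<delta> h y)"
    unfolding eq by (rule dil_inverse(2)[OF assms(1)])
qed

lemma small_scale:
  obtains h where "0 < h" "h \<le> 1" "\<And>s v. 0 < s \<Longrightarrow> s \<le> h \<Longrightarrow> norm v \<le> R \<Longrightarrow> norm (\<delta> s v) < \<eta>"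
  using rad by blast

lemma prd_star: "norm x < \<eta> \<Longrightarrow> norm y < \<eta> \<Longrightarrow> prd x y = star x y"
  using prd_eq(2)[of 1 x y] by (simp add: dil_1)

lemma prd_line: "prd (s *\<^sub>R v) (t *\<^sub>R v) = (s + t) *\<^sub>R v"
proof -
  obtain h where h: "0 < h" "\<And>q u. 0 < q \<Longrightarrow> q \<le> h \<Longrightarrow>
      norm u \<le> norm (s *\<^sub>R v) + norm (t *\<^sub>R v) + norm ((s + t) *\<^sub>R v) \<Longrightarrow> norm (\<delta> q u) < \<eta>"
    using small_scale by metis
  have sm: "norm (\<delta> h (s *\<^sub>R v)) < \<eta>" "norm (\<delta> h (t *\<^sub>R v)) < \<eta>" "norm (\<delta> h ((s + t) *\<^sub>R v)) < \<eta>"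
    by (rule h(2)[OF h(1) order_refl]; simp)+
  note sc = linear_scale[OF dil_linear[OF h(1)]]
  have "\<delta> h (prd (s *\<^sub>R v) (t *\<^sub>R v)) = star (s *\<^sub>R \<delta> h v) (t *\<^sub>R \<delta> h v)"
    using prd_eq(1)[OF h(1) sm(1,2)] by (simp only: sc)
  also have "\<dots> = (s + t) *\<^sub>R \<delta> h v"
    using sm[THEN eta_tau] unfolding sc by (rule star_line)
  also have "\<dots> = \<delta> h ((s + t) *\<^sub>R v)" by (simp only: sc)
  finally show ?thesis using dil_inverse(1)[OF h(1)] by metis
qed

lemma prd_0 [simp]: "prd x 0 = x" "prd 0 x = x" and prd_minus [simp]: "prd x (- x) = 0" "prd (- x) x = 0"
  using prd_line[of 1 x 0] prd_line[of 0 x 1] prd_line[of 1 x "-1"] prd_line[of "-1" x 1] by auto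

text \<open>One contraction brings the three factors and both partial products into the range where
  \<open>star\<close> is associative.\<close>

lemma prd_assoc: "prd (prd x y) z = prd x (prd y z)"
proof -
  obtain h where h: "0 < h" "\<And>q u. 0 < q \<Longrightarrow> q \<le> h \<Longrightarrow>
      norm u \<le> norm x + norm y + norm z + norm (prd x y) + norm (prd y z) \<Longrightarrow> norm (\<delta> q u) < \<eta>"
    using small_scale by metis
  have sm: "norm (\<delta> h x) < \<eta>" "norm (\<delta> h y) < \<eta>" "norm (\<delta> h z) < \<eta>"
    "norm (\<delta> h (prd x y)) < \<eta>" "norm (\<delta> h (prd y z)) < \<eta>"
    by (rule h(2)[OF h(1) order_refl]; simp add: add_nonneg_nonneg)+
  note eq = prd_eq(1)[OF h(1)]
  have "\<delta> h (prd (prd x y) z) = star (star (\<delta> h x) (\<delta> h y)) (\<delta> h z)"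
    using eq[OF sm(4,3)] eq[OF sm(1,2)] by simp
  also have "\<dots> = star (\<delta> h x) (star (\<delta> h y) (\<delta> h z))"
    using sm[THEN eta_tau] eq[OF sm(1,2)] eq[OF sm(2,3)] by (intro star_assoc) auto
  also have "\<dots> = \<delta> h (prd x (prd y z))"
    using eq[OF sm(1,5)] eq[OF sm(2,3)] by simp
  finally show ?thesis using dil_inverse(1)[OF h(1)] by metis
qed

lemma prd_cancel [simp]: "prd (- x) (prd x y) = y" "prd x (prd (- x) y) = y"
    "prd (prd x y) (- y) = x" "prd (prd x (- y)) y = x"
  by (simp_all flip: prd_assoc) (simp_all add: prd_assoc)

lemma minus_prd: "- prd x y = prd (- y) (- x)"
proof -
  have "prd (prd x y) (prd (- y) (- x)) = 0" by (metis prd_assoc prd_cancel(3) prd_minus(1))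
  then have "prd (- prd x y) (prd (prd x y) (prd (- y) (- x))) = - prd x y" by simp
  then show ?thesis by simp
qed

lemma bounded_linear_dil: "0 < h \<Longrightarrow> bounded_linear (\<delta> h)"
  using dil_linear linear_conv_bounded_linear by blast

text \<open>The scale \<open>rad\<close> varies with the point in an uncontrolled way, but on a
  bounded set one fixed scale serves all points, and there the product is a composition of smooth
  maps.\<close>

lemma smooth_prd: "smooth_on UNIV (\<lambda>p. prd (fst p) (snd p))"
proof (rule smooth_on_local)
  fix p :: "'a \<times> 'a"
  define R where "R = norm (fst p) + norm (snd p) + 1"
  define S where "S = ball (0::'a) R \<times> ball (0::'a) R"
  have S: "open S" by (simp add: S_def open_Times)
  have pS: "p \<in> S" by (cases p) (simp add: S_def R_def add_nonneg_pos)
  obtain h where h: "0 < h" "\<And>q u. 0 < q \<Longrightarrow> q \<le> h \<Longrightarrow> norm u \<le> R \<Longrightarrow> norm (\<delta> q u) < \<eta>"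
    using small_scale by metis
  have sm: "norm (\<delta> h (fst q)) < \<eta>" "norm (\<delta> h (snd q)) < \<eta>" if "q \<in> S" for q
    using that h by (auto simp: S_def)
  have 1: "smooth_on S (\<lambda>q. (\<delta> h (fst q), \<delta> h (snd q)))"
    by (intro smooth_on_Pair S smooth_on_bounded_linear
        bounded_linear_compose[OF bounded_linear_dil[OF h(1)]] bounded_linear_fst bounded_linear_snd)
  have "smooth_on S (\<lambda>q. (\<lambda>p. star (fst p) (snd p)) (\<delta> h (fst q), \<delta> h (snd q)))"
    by (rule smooth_on_compose[OF smooth_star 1 S]) (simp add: sm[THEN eta_tau])
  then have "smooth_on S (\<lambda>q. \<delta> (1 / h) ((\<lambda>p. star (fst p) (snd p)) (\<delta> h (fst q), \<delta> h (snd q))))"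
    by (rule smooth_on_linear_comp[OF bounded_linear_dil S, rotated]) (use h in simp)
  then have "smooth_on S (\<lambda>q. prd (fst q) (snd q))"
    by (rule smooth_on_cong[OF _ S]) (use prd_eq(2)[OF h(1) sm] in simp)
  then show "\<exists>T. open T \<and> p \<in> T \<and> smooth_on T (\<lambda>p. prd (fst p) (snd p))" using S pS by blast
qed

lemma continuous_prd:
  "continuous_on S f \<Longrightarrow> continuous_on S g \<Longrightarrow> continuous_on S (\<lambda>x. prd (f x) (g x))"
  using continuous_on_compose2[OF smooth_on_imp_continuous_on[OF smooth_prd], of S "\<lambda>x. (f x, g x)"]
  by (auto intro: continuous_intros)

lemma smooth_prd_left: "smooth_on UNIV (\<lambda>y. prd x y)"
proof -
  have "smooth_on UNIV (\<lambda>y. (x, y))"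
    by (intro smooth_on_Pair smooth_on_const smooth_on_id open_UNIV)
  from smooth_on_compose[OF smooth_prd this] show ?thesis by simp
qed

end


section \<open>Lebesgue measure and invariance\<close>

text \<open>The set is cut into countably many cubes. A map that differs from the identity by an
  \<epsilon>-Lipschitz one sends a cube with centre c into a cube around g c whose sides are longer
  by the factor 1 + \<epsilon> DIM. The dimension enters when the Euclidean norm is bounded by the
  sum of the coordinates.\<close>

lemma emeasure_image_near_identity:
  fixes g :: "'a::euclidean_space \<Rightarrow> 'a"
  assumes S: "open S" "bounded S" and \<epsilon>: "0 \<le> \<epsilon>"
    and g: "\<And>x y. x \<in> S \<Longrightarrow> y \<in> S \<Longrightarrow> norm ((g x - x) - (g y - y)) \<le> \<epsilon> * norm (x - y)"
  shows "emeasure lborel (g ` S) \<le> ennreal ((1 + \<epsilon> * DIM('a)) ^ DIM('a)) * emeasure lborel S"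
proof -
  let ?n = "real DIM('a)" and ?c = "ennreal ((1 + \<epsilon> * DIM('a)) ^ DIM('a))"
  obtain R where R: "0 < R" "S \<subseteq> cbox (- (R *\<^sub>R One)) (R *\<^sub>R One)"
  proof -
    obtain b where b: "0 < b" "\<And>x. x \<in> S \<Longrightarrow> norm x \<le> b" using S(2) bounded_pos by blast
    have "S \<subseteq> cbox (- (b *\<^sub>R One)) (b *\<^sub>R One)"
    proof
      fix x assume "x \<in> S"
      then have "\<bar>x \<bullet> i\<bar> \<le> b" if "i \<in> Basis" for i
        using b(2) Basis_le_norm[OF that, of x] by fastforce
      then show "x \<in> cbox (- (b *\<^sub>R One)) (b *\<^sub>R One)" by (auto simp: mem_box abs_le_iff) (smt (verit))
    qed
    then show ?thesis using b(1) that by blast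
  qed
  \<comment> \<open>These radii form the gauge: the covering lemma puts each cube into such a ball,
    hence into S.\<close>
  have "\<exists>d>0. x \<in> S \<longrightarrow> ball x d \<subseteq> S" for x
    using S(1) openE by (cases "x \<in> S") (blast, auto intro: exI[of _ 1])
  then obtain d where d: "\<And>x. 0 < d x" "\<And>x. x \<in> S \<Longrightarrow> ball x (d x) \<subseteq> S" by metis
  have gauge: "gauge (\<lambda>x. ball x (d x))" using d(1) by (auto simp: gauge_def)
  have ne: "box (- (R *\<^sub>R One)) (R *\<^sub>R (One::'a)) \<noteq> {}" using R by (simp add: box_ne_empty)
  obtain D where D': "countable D" "\<Union>D \<subseteq> cbox (- (R *\<^sub>R One)) (R *\<^sub>R One)" "\<And>K. K \<in> D \<Longrightarrow> interior K \<noteq> {} \<and> (\<exists>c d. K = cbox c d)"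
    "pairwise (\<lambda>A B. interior A \<inter> interior B = {}) D"
    "\<And>K. K \<in> D \<Longrightarrow> \<exists>x\<in>S \<inter> K. K \<subseteq> ball x (d x)"
    "\<And>u v. cbox u v \<in> D \<Longrightarrow> \<exists>n. \<forall>i\<in>Basis. v \<bullet> i - u \<bullet> i = ((R *\<^sub>R (One::'a)) \<bullet> i - (- (R *\<^sub>R One)) \<bullet> i) / 2 ^ n"
    "S \<subseteq> \<Union>D"
  proof (rule covering_lemma[OF R(2) ne gauge], goal_cases)
    case (1 D)
    show ?case by (rule 1(1)[OF 1(2-8)])
  qed
  note D = D'(1) D'(3-7)
  have KS: "K \<subseteq> S" if "K \<in> D" for K using D(4)[OF that] d(2) by blast
  have cube: "\<exists>Q. Q \<in> sets lborel \<and> g ` K \<subseteq> Q \<and> emeasure lborel Q \<le> ?c * emeasure lborel (interior K)"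
    if K: "K \<in> D" for K
  proof -
    obtain u v where uv: "K = cbox u v" using D(2)[OF K] by blast
    obtain n where n: "\<And>i. i \<in> Basis \<Longrightarrow> v \<bullet> i - u \<bullet> i = ((R *\<^sub>R (One::'a)) \<bullet> i - (- (R *\<^sub>R One)) \<bullet> i) / 2 ^ n"
      using D(5) K uv by blast
    define s where "s = 2 * R / 2 ^ n"
    have s0: "0 < s" using R by (simp add: s_def)
    have s: "v \<bullet> i = u \<bullet> i + s" if "i \<in> Basis" for i using n[OF that] that by (simp add: s_def field_simps)
    define c where "c = (1 / 2) *\<^sub>R (u + v)"
    define h where "h = (1 + \<epsilon> * ?n) * (s / 2)"
    have h0: "0 \<le> h" using \<epsilon> s0 by (simp add: h_def)
    have c: "c \<bullet> i = u \<bullet> i + s / 2" if "i \<in> Basis" for i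
      using s[OF that] by (simp add: c_def inner_add_left field_simps)
    have cK: "c \<in> K" using s0 by (simp add: uv mem_box c s)
    let ?Q = "cbox (g c - h *\<^sub>R One) (g c + h *\<^sub>R One)"
    have "g x \<in> ?Q" if x: "x \<in> K" for x
    proof -
      have xc: "\<bar>(x - c) \<bullet> i\<bar> \<le> s / 2" if "i \<in> Basis" for i
        using x that by (auto simp: uv mem_box c s inner_diff_left abs_le_iff field_simps)
      have "norm (x - c) \<le> (\<Sum>i\<in>Basis. \<bar>(x - c) \<bullet> i\<bar>)" by (rule norm_le_l1)
      also have "\<dots> \<le> ?n * (s / 2)" using sum_bounded_above[of Basis "\<lambda>i. \<bar>(x - c) \<bullet> i\<bar>" "s / 2"] xc by simp
      finally have nxc: "norm (x - c) \<le> ?n * (s / 2)" .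
      have "\<bar>(g x - g c) \<bullet> i\<bar> \<le> h" if i: "i \<in> Basis" for i
      proof -
        have "(g x - g c) \<bullet> i = (x - c) \<bullet> i + ((g x - x) - (g c - c)) \<bullet> i"
          by (simp add: inner_diff_left)
        also have "\<bar>\<dots>\<bar> \<le> \<bar>(x - c) \<bullet> i\<bar> + \<bar>((g x - x) - (g c - c)) \<bullet> i\<bar>" by (rule abs_triangle_ineq)
        also have "\<bar>((g x - x) - (g c - c)) \<bullet> i\<bar> \<le> norm ((g x - x) - (g c - c))" by (rule Basis_le_norm[OF i])
        also have "\<dots> \<le> \<epsilon> * norm (x - c)" using g KS[OF K] x cK by blast
        also have "\<dots> \<le> \<epsilon> * (?n * (s / 2))" using nxc \<epsilon> by (rule mult_left_mono)
        finally show ?thesis using xc[OF i] by (simp add: h_def algebra_simps)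
      qed
      then have "g c \<bullet> i - h \<le> g x \<bullet> i" "g x \<bullet> i \<le> g c \<bullet> i + h" if "i \<in> Basis" for i
        using that unfolding inner_diff_left abs_le_iff by fastforce+
      then show ?thesis by (simp add: mem_box inner_diff_left inner_add_left)
    qed
    then have sub: "g ` K \<subseteq> ?Q" by blast
    have hh: "h + h = (1 + \<epsilon> * ?n) * s" by (simp add: h_def)
    have "emeasure lborel ?Q = ennreal (\<Prod>i\<in>(Basis::'a set). h + h)"
      by (subst emeasure_lborel_cbox) (use h0 in \<open>simp_all add: inner_diff_left inner_add_left\<close>)
    also have "\<dots> = ennreal (\<Prod>i\<in>(Basis::'a set). (1 + \<epsilon> * ?n) * s)" unfolding hh ..
    also have "\<dots> = ?c * ennreal (\<Prod>i\<in>(Basis::'a set). s)"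
      using \<epsilon> s0 by (simp add: power_mult_distrib ennreal_mult)
    also have "ennreal (\<Prod>i\<in>(Basis::'a set). s) = emeasure lborel (interior K)"
      using s0 by (simp add: uv emeasure_lborel_box s inner_diff_left)
    finally have "emeasure lborel ?Q \<le> ?c * emeasure lborel (interior K)" by simp
    then show ?thesis using sub by (intro exI[of _ ?Q]) auto
  qed
  then obtain Q where Q: "\<And>K. K \<in> D \<Longrightarrow> Q K \<in> sets lborel" "\<And>K. K \<in> D \<Longrightarrow> g ` K \<subseteq> Q K"
    "\<And>K. K \<in> D \<Longrightarrow> emeasure lborel (Q K) \<le> ?c * emeasure lborel (interior K)" by metis
  \<comment> \<open>Indexed by natural numbers, with empty sets as padding. Interiors are taken
    because the cubes may share faces, and only disjoint sets can be summed.\<close>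
  define A where "A i = (if i \<in> to_nat_on D ` D then interior (from_nat_into D i) else {})" for i
  define QA where "QA i = (if i \<in> to_nat_on D ` D then Q (from_nat_into D i) else {})" for i
  have fD: "from_nat_into D (to_nat_on D K) = K" if "K \<in> D" for K
    using from_nat_into_to_nat_on[OF D(1) that] .
  have "disjoint_family A"
    unfolding disjoint_family_on_def
  proof (intro ballI impI)
    fix i j :: nat assume "i \<noteq> j"
    then show "A i \<inter> A j = {}"
      using D(3) fD by (auto simp: A_def pairwise_def) (metis disjoint_iff)
  qed
  moreover have "range A \<subseteq> sets lborel" by (auto simp: A_def)
  moreover have "(\<Union>i. A i) \<subseteq> S"
  proof
    fix x assume "x \<in> (\<Union>i. A i)"
    then obtain K where "K \<in> D" "x \<in> interior K" by (auto simp: A_def fD split: if_splits)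
    then show "x \<in> S" using KS interior_subset by blast
  qed
  ultimately have sumA: "(\<Sum>i. emeasure lborel (A i)) \<le> emeasure lborel S"
    using S(1) by (simp add: suminf_emeasure emeasure_mono)
  have rQ: "range QA \<subseteq> sets lborel" using Q(1) fD by (auto simp: QA_def)
  have "g ` S \<subseteq> (\<Union>i. QA i)"
  proof
    fix y assume "y \<in> g ` S"
    then obtain K where "K \<in> D" "y \<in> g ` K" using D(6) by blast
    then have "y \<in> QA (to_nat_on D K)" using Q(2) by (auto simp: QA_def fD)
    then show "y \<in> (\<Union>i. QA i)" by blast
  qed
  then have "emeasure lborel (g ` S) \<le> emeasure lborel (\<Union>i. QA i)"
    by (rule emeasure_mono) (use rQ in auto)
  also have "\<dots> \<le> (\<Sum>i. emeasure lborel (QA i))" by (rule emeasure_subadditive_countably[OF rQ])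
  also have "\<dots> \<le> (\<Sum>i. ?c * emeasure lborel (A i))"
    by (intro suminf_le) (use Q(3) fD in \<open>auto simp: QA_def A_def\<close>)
  also have "\<dots> = ?c * (\<Sum>i. emeasure lborel (A i))" by (rule ennreal_suminf_cmult)
  also have "\<dots> \<le> ?c * emeasure lborel S" using sumA by (rule mult_left_mono) simp
  finally show ?thesis .
qed

lemma lborel_distr_minus: "distr lborel borel uminus = (lborel :: 'a::euclidean_space measure)"
  using lborel_affine[of "-1" "0::'a"] by (simp add: density_1)

text \<open>The classical Fubini argument: the double integral of f(x) g(yx) is evaluated in two
  ways, using that Lebesgue measure is right-invariant and unchanged by y \<mapsto> - y, and that M
  is left-invariant. With g the indicator of the unit cube the constant can be read off.\<close>

lemma haar_unique:
  fixes p :: "'a::euclidean_space \<Rightarrow> 'a \<Rightarrow> 'a"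
  assumes p [measurable]: "(\<lambda>(x, y). p x y) \<in> borel \<Otimes>\<^sub>M borel \<rightarrow>\<^sub>M borel"
    and inv: "\<And>x y. p (- x) (p x y) = y"
    and right: "\<And>x. distr lborel borel (\<lambda>y. p y x) = lborel"
    and M: "sets M = sets borel" "\<And>x. distr M borel (p x) = M"
    and fin: "\<And>K. compact K \<Longrightarrow> emeasure M K < \<infinity>" and nz: "emeasure M UNIV \<noteq> 0"
  shows "\<exists>\<kappa>>0. \<forall>S\<in>sets borel. emeasure M S = ennreal \<kappa> * emeasure lborel S"
proof -
  have sM [measurable_cong]: "sets M = sets borel" by (rule M(1))
  have spM: "space M = UNIV" using M(1) sets_eq_imp_space_eq by fastforce
  interpret M: sigma_finite_measure M
  proof
    let ?A = "range (\<lambda>n::nat. cball (0::'a) (real n))"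
    have "\<Union> ?A = UNIV"
    proof -
      have "\<exists>n::nat. norm x \<le> real n" for x :: 'a by (rule real_arch_simple)
      then show ?thesis by auto
    qed
    moreover have "\<forall>a\<in>?A. emeasure M a \<noteq> \<infinity>" using fin[OF compact_cball] by (auto simp: less_top)
    ultimately show "\<exists>A. countable A \<and> A \<subseteq> sets M \<and> \<Union> A = space M \<and> (\<forall>a\<in>A. emeasure M a \<noteq> \<infinity>)"
      by (intro exI[of _ ?A]) (auto simp: sM spM)
  qed
  interpret P: pair_sigma_finite M "lborel :: 'a measure" ..
  have pm [measurable]: "(\<lambda>y. p y x) \<in> borel \<rightarrow>\<^sub>M borel" "p x \<in> borel \<rightarrow>\<^sub>M borel" for x
    using measurable_compose[OF measurable_Pair1' p, of x] measurable_compose[OF _ p, of "\<lambda>y. (y, x)" borel] by auto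
  have key: "integral\<^sup>N M f * integral\<^sup>N lborel g = integral\<^sup>N M g * integral\<^sup>N lborel f"
    if [measurable]: "f \<in> borel_measurable borel" "g \<in> borel_measurable borel" for f g :: "'a \<Rightarrow> ennreal"
  proof -
    have r: "integral\<^sup>N lborel h = (\<integral>\<^sup>+y. h (p y x) \<partial>lborel)" if [measurable]: "h \<in> borel_measurable borel" for h :: "'a \<Rightarrow> ennreal" and x
      by (subst right[of x, symmetric], subst nn_integral_distr) auto
    have lM: "integral\<^sup>N M h = (\<integral>\<^sup>+y. h (p x y) \<partial>M)" if [measurable]: "h \<in> borel_measurable borel" for h :: "'a \<Rightarrow> ennreal" and x
      by (subst M(2)[of x, symmetric], subst nn_integral_distr) auto
    have u: "integral\<^sup>N lborel h = (\<integral>\<^sup>+y. h (- y) \<partial>lborel)" if [measurable]: "h \<in> borel_measurable borel" for h :: "'a \<Rightarrow> ennreal"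
      by (subst lborel_distr_minus[symmetric], subst nn_integral_distr) auto
    have "integral\<^sup>N M f * integral\<^sup>N lborel g = (\<integral>\<^sup>+x. f x * integral\<^sup>N lborel g \<partial>M)"
      by (simp add: nn_integral_multc)
    also have "\<dots> = (\<integral>\<^sup>+x. (\<integral>\<^sup>+y. f x * g (p y x) \<partial>lborel) \<partial>M)"
    proof (rule nn_integral_cong)
      fix x
      have "(\<integral>\<^sup>+y. f x * g (p y x) \<partial>lborel) = f x * (\<integral>\<^sup>+y. g (p y x) \<partial>lborel)"
        by (rule nn_integral_cmult) measurable
      then show "f x * integral\<^sup>N lborel g = (\<integral>\<^sup>+y. f x * g (p y x) \<partial>lborel)"
        by (simp add: r[of g x])
    qed
    also have "\<dots> = (\<integral>\<^sup>+y. (\<integral>\<^sup>+x. f x * g (p y x) \<partial>M) \<partial>lborel)"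
      by (rule P.Fubini'[symmetric]) measurable
    \<comment> \<open>Left invariance of M: x is replaced by (- y) x, which cancels the y inside
      g.\<close>
    also have "\<dots> = (\<integral>\<^sup>+y. (\<integral>\<^sup>+x. f (p (- y) x) * g (p y (p (- y) x)) \<partial>M) \<partial>lborel)"
      by (intro nn_integral_cong lM) measurable
    also have "\<dots> = (\<integral>\<^sup>+y. (\<integral>\<^sup>+x. f (p (- y) x) * g x \<partial>M) \<partial>lborel)"
      using inv[of "- _"] by simp
    also have "\<dots> = (\<integral>\<^sup>+x. (\<integral>\<^sup>+y. f (p (- y) x) * g x \<partial>lborel) \<partial>M)"
      by (rule P.Fubini') measurable
    also have "\<dots> = (\<integral>\<^sup>+x. integral\<^sup>N lborel f * g x \<partial>M)"
    proof (rule nn_integral_cong)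
      fix x
      have "(\<integral>\<^sup>+y. f (p (- y) x) * g x \<partial>lborel) = (\<integral>\<^sup>+y. f (p (- y) x) \<partial>lborel) * g x"
        by (rule nn_integral_multc) measurable
      also have "(\<integral>\<^sup>+y. f (p (- y) x) \<partial>lborel) = (\<integral>\<^sup>+y. f (p y x) \<partial>lborel)"
        by (rule u[symmetric]) measurable
      also have "\<dots> = integral\<^sup>N lborel f" by (rule r[symmetric]) measurable
      finally show "(\<integral>\<^sup>+y. f (p (- y) x) * g x \<partial>lborel) = integral\<^sup>N lborel f * g x" .
    qed
    also have "\<dots> = integral\<^sup>N M g * integral\<^sup>N lborel f"
      by (subst nn_integral_cmult) (auto simp: mult.commute)
    finally show ?thesis .
  qed
  let ?C = "cbox (0::'a) One"
  have C1: "emeasure lborel ?C = 1" by (subst emeasure_lborel_cbox) auto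
  have eq: "emeasure M S = emeasure M ?C * emeasure lborel S" if S: "S \<in> sets borel" for S
    using key[of "indicator S" "indicator ?C"] S C1 by simp
  have Cf: "emeasure M ?C < \<infinity>" by (rule fin[OF compact_cbox])
  have "emeasure M ?C \<noteq> 0" using eq[of UNIV] nz by auto
  then have "0 < enn2real (emeasure M ?C)" using Cf by (simp add: enn2real_positive_iff less_top zero_less_iff_neq_zero)
  moreover have "emeasure M ?C = ennreal (enn2real (emeasure M ?C))" using Cf by (simp add: less_top)
  ultimately show ?thesis using eq by metis
qed

lemma image_eq_vimage:
  assumes "\<And>x. f (g x) = x" "\<And>x. g (f x) = x"
  shows "f ` S = g -` S"
proof
  show "f ` S \<subseteq> g -` S" using assms(2) by auto
  show "g -` S \<subseteq> f ` S"
  proof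
    fix x assume "x \<in> g -` S"
    then show "x \<in> f ` S" using assms(1)[of x] by (intro image_eqI[of _ _ "g x"]) auto
  qed
qed

lemma emeasure_lborel_diagonal:
  fixes c :: "'a::euclidean_space \<Rightarrow> real"
  assumes c: "\<And>b. b \<in> Basis \<Longrightarrow> 0 < c b" and S: "S \<in> sets borel"
  shows "emeasure lborel ((\<lambda>x. \<Sum>b\<in>Basis. (c b * (x \<bullet> b)) *\<^sub>R b) ` S) = ennreal (\<Prod>b\<in>Basis. c b) * emeasure lborel S"
proof -
  let ?T = "\<lambda>x::'a. \<Sum>b\<in>Basis. (c b * (x \<bullet> b)) *\<^sub>R b" and ?T' = "\<lambda>x::'a. \<Sum>b\<in>Basis. (inverse (c b) * (x \<bullet> b)) *\<^sub>R b"
  have inv: "?T (?T' x) = x" "?T' (?T x) = x" for x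
    by (rule euclidean_eqI; use c in \<open>simp add: less_imp_neq[symmetric]\<close>)+
  have im: "?T ` S = ?T' -` S" by (rule image_eq_vimage[OF inv])
  have [measurable]: "?T \<in> borel \<rightarrow>\<^sub>M borel" "?T' \<in> borel \<rightarrow>\<^sub>M borel"
    by (auto intro!: borel_measurable_continuous_onI continuous_intros)
  have TS: "?T ` S \<in> sets borel" unfolding im using measurable_sets[of ?T' borel borel S] S by simp
  have "emeasure lborel (?T ` S) = emeasure (density (distr lborel borel (\<lambda>x. 0 + ?T x)) (\<lambda>_. \<Prod>b\<in>Basis. \<bar>c b\<bar>)) (?T ` S)"
    by (subst lborel_affine_euclidean[of c 0]) (use c in \<open>auto simp: less_imp_neq[symmetric]\<close>)
  also have "\<dots> = ennreal (\<Prod>b\<in>Basis. \<bar>c b\<bar>) * emeasure (distr lborel borel ?T) (?T ` S)"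
    using TS by (subst emeasure_density) (auto simp: nn_integral_cmult_indicator)
  also have "emeasure (distr lborel borel ?T) (?T ` S) = emeasure lborel (?T -` (?T ` S))"
    using TS by (subst emeasure_distr) auto
  also have "?T -` (?T ` S) = S" unfolding im using inv(2) by (simp add: vimage_def)
  also have "(\<Prod>b\<in>Basis. \<bar>c b\<bar>) = (\<Prod>b\<in>(Basis::'a set). c b)" using c by (intro prod.cong) (auto intro: abs_of_pos)
  finally show ?thesis .
qed

text \<open>A linear change of coordinates multiplies volume by a constant, which cancels in a
  conjugation. That such a constant exists follows from \<open>haar_unique\<close> for vector
  addition, so no determinant is computed.\<close>

lemma emeasure_lborel_conjugate:
  fixes P P' T :: "'a::euclidean_space \<Rightarrow> 'a"
  assumes P: "linear P" "linear P'" "\<And>x. P (P' x) = x" "\<And>x. P' (P x) = x"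
    and T: "\<And>S. S \<in> sets borel \<Longrightarrow> emeasure lborel (T ` S) = c * emeasure lborel S"
    and Tm: "\<And>S. S \<in> sets borel \<Longrightarrow> T ` S \<in> sets borel"
    and S: "S \<in> sets borel"
  shows "emeasure lborel ((\<lambda>x. P (T (P' x))) ` S) = c * emeasure lborel S"
proof -
  have cont: "continuous_on UNIV P" "continuous_on UNIV P'"
    using P linear_continuous_on linear_conv_bounded_linear by blast+
  then have Pm [measurable]: "P \<in> borel \<rightarrow>\<^sub>M borel" "P' \<in> borel \<rightarrow>\<^sub>M borel"
    by (auto intro: borel_measurable_continuous_onI)
  have im: "P ` S = P' -` S" "P' ` S = P -` S" for S
    using image_eq_vimage[of P P'] image_eq_vimage[of P' P] P by auto
  let ?M = "distr lborel borel P"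
  have eM: "emeasure ?M S = emeasure lborel (P' ` S)" if "S \<in> sets borel" for S
    using that by (subst emeasure_distr) (auto simp: im)
  have "\<exists>\<kappa>>0. \<forall>S\<in>sets borel. emeasure ?M S = ennreal \<kappa> * emeasure lborel S"
  proof (rule haar_unique[where p = "(+)"])
    show "distr lborel borel (\<lambda>y. y + x) = lborel" for x :: 'a
    proof -
      have "(\<lambda>y. y + x) = (+) x" by (rule ext) (rule add.commute)
      then show ?thesis using lborel_distr_plus[of x] by metis
    qed
    show "distr ?M borel ((+) x) = ?M" for x
    proof -
      have "distr ?M borel ((+) x) = distr lborel borel ((+) x \<circ> P)"
        by (rule distr_distr) auto
      also have "(+) x \<circ> P = P \<circ> (+) (P' x)" using P by (auto simp: linear_add)
      also have "distr lborel borel (P \<circ> (+) (P' x)) = distr (distr lborel borel ((+) (P' x))) borel P"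
        by (rule distr_distr[symmetric]) auto
      finally show ?thesis by (simp add: lborel_distr_plus)
    qed
    show "emeasure ?M K < \<infinity>" if "compact K" for K
    proof -
      have "compact (P' ` K)" using that cont compact_continuous_image continuous_on_subset by blast
      then show ?thesis using emeasure_bounded_finite[OF compact_imp_bounded] that
        by (subst eM) (auto simp: compact_imp_closed)
    qed
    show "emeasure ?M UNIV \<noteq> 0" by (subst eM) (auto simp: im)
  qed auto
  then obtain \<kappa> where \<kappa>: "0 < \<kappa>" "\<And>S. S \<in> sets borel \<Longrightarrow> emeasure lborel (P' ` S) = ennreal \<kappa> * emeasure lborel S"
    using eM by metis
  have sb: "P ` S \<in> sets borel" "P' ` S \<in> sets borel" if "S \<in> sets borel" for S
    unfolding im using measurable_sets[OF Pm(1)] measurable_sets[OF Pm(2)] that by force+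
  let ?X = "(\<lambda>x. P (T (P' x))) ` S"
  have X: "?X = P ` (T ` (P' ` S))" by auto
  have "?X \<in> sets borel" unfolding X by (intro sb Tm S)
  from \<kappa>(2)[OF this] have "ennreal \<kappa> * emeasure lborel ?X = emeasure lborel (P' ` ?X)" by simp
  also have "P' ` ?X = T ` (P' ` S)" using P by (simp add: image_image)
  also have "emeasure lborel (T ` (P' ` S)) = ennreal \<kappa> * (c * emeasure lborel S)"
    using T[OF sb(2)[OF S]] \<kappa>(2)[OF S] by (simp add: mult_ac)
  finally show ?thesis using \<kappa>(1) by (simp add: ennreal_mult_cancel_left)
qed

section \<open>Lebesgue measure as Haar measure of the global product\<close>

locale dil_measure = dil_local_lie m \<rho> \<delta> ka kb kc
  for m :: "'a::euclidean_space \<Rightarrow> 'a \<Rightarrow> 'a" and \<rho> \<delta> ka kb kc +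
  fixes Q :: real
  assumes dil_lborel: "0 < h \<Longrightarrow> S \<in> sets borel \<Longrightarrow> emeasure lborel (\<delta> h ` S) = ennreal (h powr Q) * emeasure lborel S"
begin

lemma continuous_dil: "0 < h \<Longrightarrow> continuous_on S (\<delta> h)"
  using bounded_linear_dil linear_continuous_on by blast

lemma open_dil: "0 < h \<Longrightarrow> open S \<Longrightarrow> open (\<delta> h ` S)"
proof -
  assume h: "0 < h" and S: "open S"
  have "\<delta> h ` S = \<delta> (1 / h) -` S" by (rule image_eq_vimage) (rule dil_inverse[OF h])+
  then show ?thesis using continuous_open_vimage[OF S, of "\<delta> (1 / h)"] continuous_dil[of "1 / h" UNIV] h
    by (simp add: continuous_on_eq_continuous_at)
qed

lemma open_prd: "open S \<Longrightarrow> open (prd x ` S)"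
proof -
  assume S: "open S"
  have "prd x ` S = prd (- x) -` S" by (rule image_eq_vimage) simp_all
  then show ?thesis using continuous_open_vimage[OF S, of "prd (- x)"] smooth_on_imp_continuous_on[OF smooth_prd_left]
    by (simp add: continuous_on_eq_continuous_at)
qed

text \<open>Conjugation by a strong contraction brings a left translation close to the identity, so its
  Lipschitz constant, and with it its effect on volumes, is arbitrarily close to \<open>1\<close>.\<close>

lemma emeasure_prd_le:
  assumes S: "open S" "bounded S"
  shows "emeasure lborel (prd x ` S) \<le> emeasure lborel S"
proof -
  obtain k where k: "0 \<le> k" "\<And>c x y y'. c < \<tau> \<Longrightarrow> norm x \<le> c \<Longrightarrow> norm y \<le> c \<Longrightarrow> norm y' \<le> c \<Longrightarrow>
     c \<le> \<tau> / 2 \<Longrightarrow> norm ((star x y - y) - (star x y' - y')) \<le> k * c * norm (y - y')"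
    using star_near_identity by metis
  obtain R where R: "\<And>y. y \<in> S \<Longrightarrow> norm y \<le> R" using S(2) bounded_iff by metis
  have fin: "emeasure lborel S < \<infinity>" by (rule emeasure_bounded_finite[OF S(2)])
  define F where "F c = ennreal ((1 + k * c * DIM('a)) ^ DIM('a)) * emeasure lborel S" for c
  have est: "emeasure lborel (prd x ` S) \<le> F c" if c: "0 < c" "c < min (\<tau> / 2) \<eta>" for c
  proof -
    obtain h where h: "0 < h" "\<And>q v. 0 < q \<Longrightarrow> q \<le> h \<Longrightarrow> norm v \<le> norm x + \<bar>R\<bar> \<Longrightarrow> norm (\<delta> q v) < c"
      using dil_shrinks[OF c(1)] by metis
    have hy: "norm (\<delta> h y) < c" if "y \<in> S" for y
    proof (rule h(2)[OF h(1) order_refl])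
      show "norm y \<le> norm x + \<bar>R\<bar>" using R[OF that] norm_ge_zero[of x] by linarith
    qed
    have hx: "norm (\<delta> h x) < c" using h(2)[OF h(1) order_refl, of x] by simp
    have bdd: "bounded (\<delta> h ` S)" using S(2) bounded_linear_dil[OF h(1)] bounded_linear_image by blast
    have ex: "norm (\<delta> h x) < \<eta>" and ey: "norm (\<delta> h y) < \<eta>" if "y \<in> S" for y
      using hx hy[OF that] c by auto
    have "prd x ` S = \<delta> (1 / h) ` (star (\<delta> h x) ` (\<delta> h ` S))"
      unfolding image_image by (rule image_cong[OF refl]) (rule prd_eq(2)[OF h(1) ex ey])
    moreover have "star (\<delta> h x) ` (\<delta> h ` S) = \<delta> h ` (prd x ` S)"
      unfolding image_image by (rule image_cong[OF refl]) (rule prd_eq(1)[OF h(1) ex ey, symmetric])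
    moreover have "\<delta> h ` (prd x ` S) \<in> sets borel" using open_dil[OF h(1) open_prd[OF S(1)]] by simp
    ultimately have eq: "emeasure lborel (prd x ` S) = ennreal ((1 / h) powr Q) * emeasure lborel (star (\<delta> h x) ` (\<delta> h ` S))"
      using dil_lborel[of "1 / h" "star (\<delta> h x) ` (\<delta> h ` S)"] h(1) by (metis zero_less_divide_1_iff)
    have "emeasure lborel (star (\<delta> h x) ` (\<delta> h ` S)) \<le> ennreal ((1 + k * c * DIM('a)) ^ DIM('a)) * emeasure lborel (\<delta> h ` S)"
    proof (rule emeasure_image_near_identity[OF open_dil[OF h(1) S(1)] bdd])
      show "0 \<le> k * c" using k(1) c by simp
      fix a b assume "a \<in> \<delta> h ` S" "b \<in> \<delta> h ` S"
      then have "norm a \<le> c" "norm b \<le> c" using hy by (auto intro: less_imp_le)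
      moreover have "c < \<tau>" "c \<le> \<tau> / 2" using c tau(1) by auto
      ultimately show "norm (star (\<delta> h x) a - a - (star (\<delta> h x) b - b)) \<le> k * c * norm (a - b)"
        using k(2)[OF _ less_imp_le[OF hx]] by blast
    qed
    also have "emeasure lborel (\<delta> h ` S) = ennreal (h powr Q) * emeasure lborel S"
      by (rule dil_lborel[OF h(1)]) (use S in simp)
    finally have "ennreal ((1 / h) powr Q) * emeasure lborel (star (\<delta> h x) ` (\<delta> h ` S))
        \<le> ennreal ((1 / h) powr Q) * (ennreal ((1 + k * c * DIM('a)) ^ DIM('a)) * (ennreal (h powr Q) * emeasure lborel S))"
      by (rule mult_left_mono) simp
    then have "emeasure lborel (prd x ` S) \<le> (ennreal ((1 / h) powr Q) * ennreal (h powr Q)) * F c"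
      unfolding eq by (simp add: F_def mult_ac)
    also have "ennreal ((1 / h) powr Q) * ennreal (h powr Q) = 1"
      using h(1) by (simp add: ennreal_mult[symmetric] powr_mult[symmetric])
    finally show ?thesis by simp
  qed
  have "((\<lambda>c. ennreal ((1 + k * c * DIM('a)) ^ DIM('a))) \<longlongrightarrow> ennreal ((1 + k * 0 * DIM('a)) ^ DIM('a))) (at_right 0)"
    by (intro tendsto_ennrealI tendsto_intros)
  then have "(F \<longlongrightarrow> ennreal ((1 + k * 0 * DIM('a)) ^ DIM('a)) * emeasure lborel S) (at_right 0)"
    unfolding F_def[abs_def] by (intro tendsto_mult_ennreal tendsto_const) (use fin in auto)
  moreover have "\<forall>\<^sub>F c in at_right 0. emeasure lborel (prd x ` S) \<le> F c"
    unfolding eventually_at_right_field using tau(1) eta(1)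
    by (intro exI[of _ "min (\<tau> / 2) \<eta>"]) (auto intro: est)
  ultimately have "emeasure lborel (prd x ` S) \<le> ennreal ((1 + k * 0 * DIM('a)) ^ DIM('a)) * emeasure lborel S"
    by (rule tendsto_lowerbound) simp
  then show ?thesis by simp
qed

lemma bounded_prd: "bounded S \<Longrightarrow> bounded (prd x ` S)"
proof -
  assume "bounded S"
  then have "compact (prd x ` closure S)"
    using smooth_on_imp_continuous_on[OF smooth_prd_left, of x]
    by (intro compact_continuous_image) (auto intro: continuous_on_subset)
  then show ?thesis using closure_subset[of S] by (meson bounded_subset compact_imp_bounded image_mono)
qed

lemma measurable_prd [measurable]: "prd x \<in> borel \<rightarrow>\<^sub>M borel"
  by (rule borel_measurable_continuous_onI[OF smooth_on_imp_continuous_on[OF smooth_prd_left]])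

text \<open>No translation increases the volume of a bounded open set; for x and - x together this
  gives equality on boxes, which determine the measure.\<close>

lemma lborel_prd_left: "distr lborel borel (prd x) = lborel"
proof (rule lborel_eqI[symmetric])
  fix a b :: 'a assume ab: "\<And>i. i \<in> Basis \<Longrightarrow> a \<bullet> i \<le> b \<bullet> i"
  have "emeasure (distr lborel borel (prd x)) (box a b) = emeasure lborel (prd x -` box a b)"
    by (subst emeasure_distr) auto
  also have "prd x -` box a b = prd (- x) ` box a b"
    by (rule image_eq_vimage[symmetric]) (use prd_cancel(1)[of "- x"] in simp_all)
  also have "emeasure lborel (prd (- x) ` box a b) = emeasure lborel (box a b)"
  proof (rule antisym)
    show "emeasure lborel (prd (- x) ` box a b) \<le> emeasure lborel (box a b)"
      by (rule emeasure_prd_le) (auto simp: bounded_box)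
    have "box a b = prd x ` (prd (- x) ` box a b)" by (simp add: image_image)
    then show "emeasure lborel (box a b) \<le> emeasure lborel (prd (- x) ` box a b)"
      using emeasure_prd_le[OF open_prd[OF open_box] bounded_prd[OF bounded_box], of x "- x" a b] by simp
  qed
  finally show "emeasure (distr lborel borel (prd x)) (box a b) = (\<Prod>i\<in>Basis. (b - a) \<bullet> i)"
    using ab by (simp add: emeasure_lborel_box)
qed simp

text \<open>In exponential coordinates inversion is x \<mapsto> - x. It preserves volume and
  exchanges left and right translations, so the group is unimodular.\<close>

lemma lborel_prd_right: "distr lborel borel (\<lambda>y. prd y x) = lborel"
proof -
  have eq: "(\<lambda>y. prd y x) = uminus \<circ> (prd (- x) \<circ> uminus)"
    by (auto simp: fun_eq_iff minus_prd)
  have "distr lborel borel (uminus \<circ> (prd (- x) \<circ> uminus))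
      = distr (distr lborel borel (prd (- x) \<circ> uminus)) borel uminus"
    by (rule distr_distr[symmetric]) auto
  also have "distr lborel borel (prd (- x) \<circ> uminus) = distr (distr lborel borel uminus) borel (prd (- x))"
    by (rule distr_distr[symmetric]) auto
  finally show ?thesis unfolding eq by (simp only: lborel_distr_minus lborel_prd_left)
qed

lemma left_invariant_measure:
  assumes "sets M = sets borel" "\<And>x. distr M borel (prd x) = M"
    "\<And>K. compact K \<Longrightarrow> emeasure M K < \<infinity>" "emeasure M UNIV \<noteq> 0"
  shows "\<exists>\<kappa>>0. \<forall>S\<in>sets borel. emeasure M S = ennreal \<kappa> * emeasure lborel S"
proof (rule haar_unique[OF _ _ lborel_prd_right assms])
  have "(\<lambda>p. prd (fst p) (snd p)) \<in> borel_measurable (borel :: ('a \<times> 'a) measure)"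
    by (rule borel_measurable_continuous_onI[OF smooth_on_imp_continuous_on[OF smooth_prd]])
  then show "(\<lambda>(x, y). prd x y) \<in> borel \<Otimes>\<^sub>M borel \<rightarrow>\<^sub>M borel"
    by (simp add: borel_prod case_prod_beta')
qed simp

end


section \<open>The Rellich inequality in exponential coordinates\<close>

definition compactly_supported :: "('a::euclidean_space \<Rightarrow> 'b::real_normed_vector) \<Rightarrow> bool" where
  "compactly_supported f \<longleftrightarrow> continuous_on UNIV f \<and> (\<exists>K. compact K \<and> (\<forall>x. x \<notin> K \<longrightarrow> f x = 0))"

lemma compactly_supported_integrable:
  fixes f :: "'a::euclidean_space \<Rightarrow> 'b::euclidean_space"
  assumes "compactly_supported f"
  shows "integrable lborel f"
proof -
  obtain K where K: "compact K" "\<And>x. x \<notin> K \<Longrightarrow> f x = 0" using assms by (auto simp: compactly_supported_def)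
  have "integrable lborel (\<lambda>x. indicator K x *\<^sub>R f x)"
    by (rule borel_integrable_compact[OF K(1)]) (use assms continuous_on_subset in \<open>auto simp: compactly_supported_def\<close>)
  moreover have "(\<lambda>x. indicator K x *\<^sub>R f x) = f" using K(2) by (auto simp: indicator_def)
  ultimately show ?thesis by simp
qed

lemma compactly_supported_add: "compactly_supported f \<Longrightarrow> compactly_supported g \<Longrightarrow> compactly_supported (\<lambda>x. f x + g x)"
proof -
  assume f: "compactly_supported f" and g: "compactly_supported g"
  then obtain K L where "compact K" "\<And>x. x \<notin> K \<Longrightarrow> f x = 0" "compact L" "\<And>x. x \<notin> L \<Longrightarrow> g x = 0"
    by (auto simp: compactly_supported_def)
  then have "compact (K \<union> L) \<and> (\<forall>x. x \<notin> K \<union> L \<longrightarrow> f x + g x = 0)" by auto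
  then show ?thesis using f g unfolding compactly_supported_def by (blast intro: continuous_on_add)
qed

lemma compactly_supported_compose:
  fixes G :: "'b::real_normed_vector \<Rightarrow> 'c::real_normed_vector"
  assumes "compactly_supported f" "continuous_on UNIV G" "G 0 = 0"
  shows "compactly_supported (\<lambda>x. G (f x))"
proof -
  have "continuous_on UNIV (\<lambda>x. G (f x))"
    using assms continuous_on_compose2[OF assms(2)] by (auto simp: compactly_supported_def)
  moreover obtain K where "compact K" "\<And>x. x \<notin> K \<Longrightarrow> f x = 0" using assms by (auto simp: compactly_supported_def)
  ultimately show ?thesis using assms(3) by (auto simp: compactly_supported_def intro!: exI[of _ K])
qed

lemma compactly_supported_cmult: "compactly_supported f \<Longrightarrow> compactly_supported (\<lambda>x. (c::'b::real_normed_field) * f x)"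
  by (rule compactly_supported_compose[of f "\<lambda>y. c * y"]) (auto intro: continuous_intros)

lemma compactly_supported_norm_square: "compactly_supported f \<Longrightarrow> compactly_supported (\<lambda>x. (norm (f x))\<^sup>2)"
  by (rule compactly_supported_compose[of f "\<lambda>y. (norm y)\<^sup>2"]) (auto intro!: continuous_intros)

lemma compactly_supported_integral_zero:
  fixes f :: "'a::euclidean_space \<Rightarrow> 'b::euclidean_space"
  assumes f: "compactly_supported f" and z: "(LINT x|lborel. (norm (f x))\<^sup>2) = 0"
  shows "f x = 0"
proof -
  have cont: "continuous_on UNIV f" using f by (simp add: compactly_supported_def)
  have "AE x in lborel. (norm (f x))\<^sup>2 = 0"
    using integral_nonneg_eq_0_iff_AE[OF compactly_supported_integrable[OF compactly_supported_norm_square[OF f]]] z by simp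
  then have "AE x in lborel. f x = 0" by simp
  moreover have op: "open {x. f x \<noteq> 0}"
    by (rule open_Collect_neq[OF cont continuous_on_const])
  ultimately have "{x. f x \<noteq> 0} \<in> null_sets lborel"
    by (subst AE_iff_null_sets) auto
  then have "negligible {x. f x \<noteq> 0}" by (simp add: negligible_iff_null_sets null_sets_completionI)
  then have "{x. f x \<noteq> 0} = {}" using op open_not_negligible by blast
  then show ?thesis by blast
qed

section \<open>The dilation flow, skew-adjointness and the Rellich identity\<close>

locale dil_space =
  fixes \<delta> :: "real \<Rightarrow> 'a::euclidean_space \<Rightarrow> 'a" and A :: "'a \<Rightarrow> 'a" and Q :: real
    and n :: "'a \<Rightarrow> real" and ka kc :: real
  assumes d_linear: "0 < h \<Longrightarrow> linear (\<delta> h)"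
    and d_1: "\<delta> 1 v = v"
    and d_mult: "0 < h \<Longrightarrow> 0 < s \<Longrightarrow> \<delta> (h * s) v = \<delta> h (\<delta> s v)"
    and d_lborel: "0 < h \<Longrightarrow> S \<in> sets borel \<Longrightarrow> emeasure lborel (\<delta> h ` S) = ennreal (h powr Q) * emeasure lborel S"
    and ka_pos: "0 < ka" and kc_pos: "0 < kc"
    and d_small: "0 < h \<Longrightarrow> h \<le> 1 \<Longrightarrow> norm (\<delta> h v) \<le> kc * h powr ka * norm v"
    and d_smooth: "smooth_on UNIV (\<lambda>p. \<delta> (exp (fst p)) (snd p))"
    and A_linear: "linear A"
    and d_deriv: "((\<lambda>t. \<delta> (exp t) v) has_vector_derivative A v) (at 0)"
    and n_cont: "continuous_on UNIV n" and n_nonneg: "0 \<le> n v"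
    and n_hom: "0 < h \<Longrightarrow> n (\<delta> h v) = h * n v" and n_zero: "n v = 0 \<longleftrightarrow> v = 0"
    and Q_gt: "4 < Q"
begin

abbreviation fl :: "real \<Rightarrow> 'a \<Rightarrow> 'a" where "fl t v \<equiv> \<delta> (exp t) v"

declare d_1 [simp]

lemma fl_0: "fl 0 v = v" by simp

lemma fl_add: "fl (s + t) v = fl s (fl t v)" by (simp add: exp_add d_mult)

lemma fl_inv [simp]: "fl (- t) (fl t v) = v" "fl t (fl (- t) v) = v"
  using fl_add[of "- t" t v, symmetric] fl_add[of t "- t" v, symmetric] by simp_all

lemma fl_cont: "continuous_on S f \<Longrightarrow> continuous_on S g \<Longrightarrow> continuous_on S (\<lambda>x. fl (f x) (g x))"
  using continuous_on_compose2[OF smooth_on_imp_continuous_on[OF d_smooth], of S "\<lambda>x. (f x, g x)"]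
  by (auto intro: continuous_intros)

lemma fl_meas [measurable]: "fl t \<in> borel \<rightarrow>\<^sub>M borel"
  by (intro borel_measurable_continuous_onI fl_cont continuous_intros)

lemma n_fl: "n (fl t v) = exp t * n v" by (simp add: n_hom)

lemma n_pos: "v \<noteq> 0 \<Longrightarrow> 0 < n v" using n_nonneg[of v] n_zero[of v] by linarith

lemma lborel_fl: "distr lborel borel (fl t) = density lborel (\<lambda>_. ennreal (exp (- (Q * t))))"
proof (rule measure_eqI)
  fix S assume "S \<in> sets (distr lborel borel (fl t))"
  then have S: "S \<in> sets borel" by simp
  have "emeasure (distr lborel borel (fl t)) S = emeasure lborel (fl t -` S)"
    using S by (subst emeasure_distr) auto
  also have "fl t -` S = fl (- t) ` S" by (rule image_eq_vimage[symmetric]) simp_all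
  also have "emeasure lborel \<dots> = ennreal (exp (- t) powr Q) * emeasure lborel S"
    by (rule d_lborel) (use S in auto)
  also have "exp (- t) powr Q = exp (- (Q * t))" by (simp add: powr_def)
  finally show "emeasure (distr lborel borel (fl t)) S = emeasure (density lborel (\<lambda>_. ennreal (exp (- (Q * t))))) S"
    using S by (simp add: emeasure_density_const)
qed simp

lemma integral_fl:
  fixes f :: "'a \<Rightarrow> real"
  assumes [measurable]: "f \<in> borel_measurable borel"
  shows "(LINT v|lborel. f (fl t v)) = exp (- (Q * t)) * (LINT v|lborel. f v)"
proof -
  have "(LINT v|lborel. f (fl t v)) = (LINT v|distr lborel borel (fl t). f v)"
    by (subst integral_distr) auto
  also have "\<dots> = exp (- (Q * t)) * (LINT v|lborel. f v)"
    unfolding lborel_fl by (subst integral_density) auto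
  finally show ?thesis .
qed

text \<open>Derivatives are asked for along orbits only: \<open>n\<close> is continuous but perhaps
  not differentiable, so a quotient by n^2 may have no derivative in other directions.\<close>

definition flow_deriv :: "('a \<Rightarrow> 'b::real_normed_vector) \<Rightarrow> ('a \<Rightarrow> 'b) \<Rightarrow> bool" where
  "flow_deriv f f1 \<longleftrightarrow> (\<forall>v t. ((\<lambda>t. f (fl t v)) has_vector_derivative f1 (fl t v)) (at t))"

lemma flow_derivI:
  assumes "\<And>v. ((\<lambda>t. f (fl t v)) has_vector_derivative f1 v) (at 0)"
  shows "flow_deriv f f1"
  unfolding flow_deriv_def
proof (intro allI)
  fix v t
  have "((\<lambda>s. f (fl s (fl t v))) \<circ> (\<lambda>x. x - t) has_vector_derivative 1 *\<^sub>R f1 (fl t v)) (at t)"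
    by (intro vector_diff_chain_at) (use assms[of "fl t v"] in \<open>auto intro!: derivative_eq_intros\<close>)
  then show "((\<lambda>t. f (fl t v)) has_vector_derivative f1 (fl t v)) (at t)"
    by (simp add: o_def fl_add[symmetric])
qed

text \<open>The divergence theorem for a field of divergence Q, without differentiating under the
  integral: \<open>h1\<close> is integrated along the flow over unit time and over space. Time
  first, this is the integral of h (fl 1 v) - h v, or (e^(-Q) - 1) times that of h; space first,
  each time s contributes e^(- Q s) times the integral of \<open>h1\<close>.\<close>

lemma flow_integral:
  fixes h h1 :: "'a \<Rightarrow> real"
  assumes h: "compactly_supported h" and h1: "compactly_supported h1" and d: "flow_deriv h h1"
  shows "(LINT v|lborel. h1 v) = - Q * (LINT v|lborel. h v)"
proof -
  obtain K where K: "compact K" "\<And>x. x \<notin> K \<Longrightarrow> h1 x = 0" using h1 by (auto simp: compactly_supported_def)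
  have hm [measurable]: "h \<in> borel_measurable borel" "h1 \<in> borel_measurable borel"
    using h h1 by (auto simp: compactly_supported_def intro: borel_measurable_continuous_onI)
  \<comment> \<open>All points whose orbit meets K within unit time. Cutting off by this compact set
    makes the integrand integrable for Fubini and loses nothing on the unit time interval.\<close>
  define K' where "K' = (\<lambda>p. fl (- fst p) (snd p)) ` ({0..1} \<times> K)"
  have K': "compact K'" unfolding K'_def
    by (intro compact_continuous_image compact_Times K compact_Icc fl_cont continuous_intros)
  define f where "f = (\<lambda>p::real \<times> 'a. indicator ({0..1} \<times> K') p *\<^sub>R h1 (fl (fst p) (snd p)))"
  have ch1: "continuous_on UNIV h1" using h1 by (simp add: compactly_supported_def)
  have "continuous_on ({0..1} \<times> K') (\<lambda>p. h1 (fl (fst p) (snd p)))"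
    by (rule continuous_on_compose2[OF ch1]) (auto intro!: fl_cont continuous_intros)
  then have "integrable lborel f" unfolding f_def
    by (intro borel_integrable_compact compact_Times K' compact_Icc)
  then have int: "integrable (lborel \<Otimes>\<^sub>M lborel) f" by (simp add: lborel_prod)
  have f: "f (s, v) = indicator {0..1} s * h1 (fl s v)" for s v
  proof (cases "fl s v \<in> K \<and> s \<in> {0..1}")
    case True
    then have "v \<in> K'" unfolding K'_def by (intro image_eqI[of _ _ "(s, fl s v)"]) auto
    then show ?thesis using True by (simp add: f_def indicator_def)
  next
    case False
    then show ?thesis using K(2) by (auto simp: f_def indicator_def)
  qed
  have inner: "(LINT s|lborel. f (s, v)) = h (fl 1 v) - h v" for v
  proof -
    have "(\<integral>s. indicator {0..1} s *\<^sub>R h1 (fl s v) \<partial>lborel) = h (fl 1 v) - h (fl 0 v)"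
    proof (rule integral_FTC_Icc)
      show "((\<lambda>s. h (fl s v)) has_vector_derivative h1 (fl s v)) (at s within {0..1})" for s
        using d by (auto simp: flow_deriv_def intro: has_vector_derivative_at_within)
      show "continuous_on {0..1} (\<lambda>s. h1 (fl s v))"
        by (rule continuous_on_compose2[OF ch1]) (auto intro!: fl_cont continuous_intros)
    qed simp
    then show ?thesis by (simp add: f)
  qed
  have inner2: "(LINT v|lborel. f (s, v)) = (indicator {0..1} s * exp (- (Q * s))) * (LINT v|lborel. h1 v)" for s
    unfolding f by (simp add: integral_fl)
  have "(LINT v|lborel. (LINT s|lborel. f (s, v))) = (LINT s|lborel. (LINT v|lborel. f (s, v)))"
    using lborel_pair.Fubini_integral[of "\<lambda>s v. f (s, v)"] int by simp
  also have "\<dots> = (\<integral>s. indicator {0..1} s *\<^sub>R exp (- (Q * s)) \<partial>lborel) * (LINT v|lborel. h1 v)"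
    unfolding inner2 by simp
  also have "(\<integral>s. indicator {0..1} s *\<^sub>R exp (- (Q * s)) \<partial>lborel) = - (exp (- (Q * 1)) / Q) - (- (exp (- (Q * 0)) / Q))"
    by (rule integral_FTC_Icc)
      (use Q_gt in \<open>auto intro!: derivative_eq_intros continuous_intros
        simp: has_real_derivative_iff_has_vector_derivative[symmetric]\<close>)
  also have "(LINT v|lborel. (LINT s|lborel. f (s, v))) = (exp (- Q) - 1) * (LINT v|lborel. h v)"
  proof -
    have "integrable lborel (\<lambda>v. h (fl 1 v))"
    proof (rule compactly_supported_integrable)
      obtain L where L: "compact L" "\<And>x. x \<notin> L \<Longrightarrow> h x = 0" using h by (auto simp: compactly_supported_def)
      have "compact (fl (- 1) ` L)" by (intro compact_continuous_image L fl_cont continuous_intros)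
      moreover have "h (fl 1 v) = 0" if "v \<notin> fl (- 1) ` L" for v
      proof (rule L(2), rule notI)
        assume "fl 1 v \<in> L"
        then have "fl (- 1) (fl 1 v) \<in> fl (- 1) ` L" by blast
        then show False using that by simp
      qed
      moreover have "continuous_on UNIV (\<lambda>v. h (fl 1 v))"
        using h by (auto simp: compactly_supported_def intro!: continuous_on_compose2[of UNIV h] fl_cont continuous_intros)
      ultimately show "compactly_supported (\<lambda>v. h (fl 1 v))" unfolding compactly_supported_def by blast
    qed
    then show ?thesis unfolding inner
      using compactly_supported_integrable[OF h] integral_fl[OF hm(1), of 1] by (simp add: algebra_simps)
  qed
  finally have "(exp (- Q) - 1) * (LINT v|lborel. h v) = (1 - exp (- Q)) / Q * (LINT v|lborel. h1 v)"
    by (simp add: diff_divide_distrib)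
  then have "(1 - exp (- Q)) * ((LINT v|lborel. h1 v) + Q * (LINT v|lborel. h v)) = 0"
    using Q_gt by (simp add: field_simps)
  moreover have "exp (- Q) < 1" using Q_gt by simp
  ultimately show ?thesis by auto
qed

text \<open>\<open>g1\<close> is the derivative of \<open>g\<close> along the dilation flow, whose divergence is \<open>Q\<close>; hence
  \<open>T g = g1 + (Q / 2) g\<close> is a skew-adjoint operator.\<close>

lemma skew_identity:
  fixes g g1 :: "'a \<Rightarrow> complex"
  assumes g: "compactly_supported g" and g1: "compactly_supported g1" and d: "flow_deriv g g1"
  shows "(LINT v|lborel. (cmod (g1 v + of_real (Q / 2) * g v + of_real a * g v))\<^sup>2)
    = (LINT v|lborel. (cmod (g1 v + of_real (Q / 2) * g v))\<^sup>2) + a\<^sup>2 * (LINT v|lborel. (cmod (g v))\<^sup>2)"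
proof -
  define h where "h v = (cmod (g v))\<^sup>2" for v
  define h1 where "h1 v = 2 * (g v \<bullet> g1 v)" for v
  define T where "T v = g1 v + of_real (Q / 2) * g v" for v
  have cT: "compactly_supported T" unfolding T_def by (intro compactly_supported_add g1 compactly_supported_cmult g)
  have h: "compactly_supported h" unfolding h_def by (rule compactly_supported_norm_square[OF g])
  have h1: "compactly_supported h1"
  proof -
    obtain K where "compact K" "\<And>x. x \<notin> K \<Longrightarrow> g x = 0" using g by (auto simp: compactly_supported_def)
    moreover have "continuous_on UNIV h1" unfolding h1_def
      using g g1 by (auto simp: compactly_supported_def intro!: continuous_intros)
    ultimately show ?thesis unfolding compactly_supported_def h1_def by (metis inner_zero_left mult_zero_right)
  qed
  have "flow_deriv h h1"
    unfolding flow_deriv_def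
  proof (intro allI)
    fix v t
    have gt: "((\<lambda>t. g (fl t v)) has_vector_derivative g1 (fl t v)) (at t)"
      using d by (simp add: flow_deriv_def)
    have "((\<lambda>t. g (fl t v) \<bullet> g (fl t v)) has_vector_derivative
        (g (fl t v) \<bullet> g1 (fl t v) + g1 (fl t v) \<bullet> g (fl t v))) (at t)"
      by (rule bounded_bilinear.has_vector_derivative[OF bounded_bilinear_inner gt gt])
    then show "((\<lambda>t. h (fl t v)) has_vector_derivative h1 (fl t v)) (at t)"
      by (simp add: h_def h1_def power2_norm_eq_inner inner_commute)
  qed
  from flow_integral[OF h h1 this] have i0: "(LINT v|lborel. h1 v) + Q * (LINT v|lborel. h v) = 0" by simp
  have cr: "of_real a * g v = a *\<^sub>R g v" "of_real (Q / 2) * g v = (Q / 2) *\<^sub>R g v" for v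
    by (simp_all add: scaleR_conv_of_real)
  \<comment> \<open>The cross term, 2 a times the real inner product of T g and g, equals a (h1 + Q
    h), whose integral is 0 by \<open>flow_integral\<close>.\<close>
  have eq: "(cmod (T v + of_real a * g v))\<^sup>2 = (cmod (T v))\<^sup>2 + a\<^sup>2 * h v + a * (h1 v + Q * h v)" for v
    unfolding cr h_def h1_def T_def power2_norm_eq_inner
    by (simp add: inner_add_left inner_add_right inner_commute algebra_simps power2_eq_square)
  have "(LINT v|lborel. (cmod (T v + of_real a * g v))\<^sup>2)
      = (LINT v|lborel. (cmod (T v))\<^sup>2) + a\<^sup>2 * (LINT v|lborel. h v) + a * ((LINT v|lborel. h1 v) + Q * (LINT v|lborel. h v))"
    unfolding eq using compactly_supported_integrable[OF h] compactly_supported_integrable[OF h1] compactly_supported_integrable[OF compactly_supported_norm_square[OF cT]]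
    by (simp add: algebra_simps)
  then show ?thesis using i0 by (simp add: T_def h_def)
qed

definition euler :: "('a \<Rightarrow> complex) \<Rightarrow> 'a \<Rightarrow> complex" where
  "euler F v = frechet_derivative F (at v) (A v)"

definition test_fun :: "('a \<Rightarrow> complex) \<Rightarrow> bool" where
  "test_fun F \<longleftrightarrow> smooth_on UNIV F \<and> (\<exists>K. compact K \<and> 0 \<notin> K \<and> (\<forall>x. x \<notin> K \<longrightarrow> F x = 0))"

lemma test_fun_euler:
  assumes "test_fun F"
  shows "test_fun (euler F)"
proof -
  have sF: "smooth_on UNIV F" using assms by (simp add: test_fun_def)
  obtain K where K: "compact K" "0 \<notin> K" "\<And>x. x \<notin> K \<Longrightarrow> F x = 0" using assms by (auto simp: test_fun_def)
  have lin: "linear (frechet_derivative F (at v))" for v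
    using smooth_on_has_derivative[OF sF] has_derivative_linear by blast
  have "smooth_on UNIV (\<lambda>v. \<Sum>b\<in>Basis. (A v \<bullet> b) *\<^sub>R frechet_derivative F (at v) b)"
    by (intro smooth_on_sum smooth_on_bilinear[OF bounded_bilinear_scaleR] open_UNIV
        smooth_on_linear_comp[OF bounded_linear_inner_left] smooth_on_frechet_derivative[OF sF]
        smooth_on_bounded_linear) (use A_linear linear_conv_bounded_linear in blast)
  then have "smooth_on UNIV (euler F)"
    unfolding euler_def[abs_def] linear_basis_expansion[OF lin, symmetric] .
  moreover have "euler F v = 0" if "v \<notin> K" for v
  proof -
    have "(F has_derivative (\<lambda>_. 0)) (at v)"
      by (rule has_derivative_transform_within_open[OF has_derivative_const, of "- K"])
        (use K that compact_imp_closed in auto)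
    then have "frechet_derivative F (at v) = (\<lambda>_. 0)" using frechet_derivative_at by metis
    then show ?thesis by (simp add: euler_def)
  qed
  ultimately show ?thesis using K by (auto simp: test_fun_def)
qed

lemma flow_deriv_euler:
  assumes "test_fun F"
  shows "flow_deriv F (euler F)"
proof (rule flow_derivI)
  fix v
  have "(F has_derivative frechet_derivative F (at (fl 0 v))) (at (fl 0 v))"
    using assms by (intro smooth_on_has_derivative[of UNIV]) (auto simp: test_fun_def)
  then have "(F \<circ> (\<lambda>t. fl t v) has_vector_derivative frechet_derivative F (at (fl 0 v)) (A v)) (at 0)"
    using vector_derivative_diff_chain_within[OF d_deriv[of v] has_derivative_at_withinI] by blast
  then show "((\<lambda>t. F (fl t v)) has_vector_derivative euler F v) (at 0)" by (simp add: o_def euler_def)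
qed

definition div_n2 :: "('a \<Rightarrow> complex) \<Rightarrow> 'a \<Rightarrow> complex" where
  "div_n2 F v = F v / of_real ((n v)\<^sup>2)"

lemma compactly_supported_div_n2:
  assumes "test_fun F"
  shows "compactly_supported (div_n2 F)"
proof -
  obtain K where K: "compact K" "0 \<notin> K" "\<And>x. x \<notin> K \<Longrightarrow> F x = 0" using assms by (auto simp: test_fun_def)
  have cF: "continuous_on UNIV F" using assms by (auto simp: test_fun_def intro: smooth_on_imp_continuous_on)
  have 1: "continuous_on (- {0}) (div_n2 F)" unfolding div_n2_def
    by (intro continuous_intros continuous_on_subset[OF cF] continuous_on_subset[OF n_cont]) (auto simp: n_zero)
  have 2: "continuous_on (- K) (div_n2 F)"
    by (rule continuous_on_eq[where f = "\<lambda>_. 0"]) (use K(3) in \<open>auto simp: div_n2_def\<close>)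
  have "open (- {0::'a})" "open (- K)" using K compact_imp_closed by auto
  then have "continuous_on (- {0} \<union> - K) (div_n2 F)" using 1 2 by (rule continuous_on_open_Un)
  moreover have "- {0} \<union> - K = UNIV" using K(2) by auto
  ultimately have "continuous_on UNIV (div_n2 F)" by simp
  moreover have "div_n2 F x = 0" if "x \<notin> K" for x using K(3)[OF that] by (simp add: div_n2_def)
  ultimately show ?thesis using K(1) by (auto simp: compactly_supported_def)
qed

lemma flow_deriv_div_n2:
  assumes "flow_deriv F F1"
  shows "flow_deriv (div_n2 F) (\<lambda>v. div_n2 F1 v - 2 * div_n2 F v)"
proof (rule flow_derivI)
  fix v
  have F: "((\<lambda>t. F (fl t v)) has_vector_derivative F1 (fl 0 v)) (at 0)"
    using assms unfolding flow_deriv_def by blast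
  define c where "c = 1 / (n v)\<^sup>2"
  have e: "((\<lambda>t. exp (- 2 * t) * c) has_vector_derivative - 2 * c) (at 0)"
    by (auto intro!: derivative_eq_intros simp: has_real_derivative_iff_has_vector_derivative[symmetric])
  have "((\<lambda>t. (exp (- 2 * t) * c) *\<^sub>R F (fl t v)) has_vector_derivative
      (exp (- 2 * 0) * c) *\<^sub>R F1 (fl 0 v) + (- 2 * c) *\<^sub>R F (fl 0 v)) (at 0)"
    by (rule bounded_bilinear.has_vector_derivative[OF bounded_bilinear_scaleR e F])
  moreover
  have "(exp (- 2 * t) * c) *\<^sub>R F (fl t v) = div_n2 F (fl t v)" for t
  proof -
    have "(n (fl t v))\<^sup>2 = exp (2 * t) * (n v)\<^sup>2"
      by (simp add: n_fl power_mult_distrib power2_eq_square exp_add[symmetric])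
    then show ?thesis
      by (simp add: div_n2_def c_def exp_minus scaleR_conv_of_real divide_inverse mult_ac)
  qed
  then have "(\<lambda>t. (exp (- 2 * t) * c) *\<^sub>R F (fl t v)) = (\<lambda>t. div_n2 F (fl t v))" by (rule ext)
  ultimately have "((\<lambda>t. div_n2 F (fl t v)) has_vector_derivative
      (exp (- 2 * 0) * c) *\<^sub>R F1 (fl 0 v) + (- 2 * c) *\<^sub>R F (fl 0 v)) (at 0)" by metis
  then show "((\<lambda>t. div_n2 F (fl t v)) has_vector_derivative div_n2 F1 v - 2 * div_n2 F v) (at 0)"
    by (simp add: c_def div_n2_def scaleR_conv_of_real divide_inverse algebra_simps)
qed

text \<open>With \<open>u = F / n\<^sup>2\<close> the right-hand side is \<open>(T - (Q / 2 - 2)) (T + Q / 2) u\<close>.\<close>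

lemma rellich_identity:
  assumes F: "test_fun F"
  defines "Tu \<equiv> (\<lambda>v. div_n2 (euler F) v + of_real (Q / 2 - 2) * div_n2 F v)"
    and "Tg \<equiv> (\<lambda>v. div_n2 (euler (euler F)) v + of_real (3 * Q / 2 - 4) * div_n2 (euler F) v + of_real ((Q - 2) * (Q / 2 - 2)) * div_n2 F v)"
  shows "(LINT v|lborel. (cmod (div_n2 (euler (euler F)) v + of_real (Q - 2) * div_n2 (euler F) v))\<^sup>2)
    = (LINT v|lborel. (cmod (Tg v))\<^sup>2) + (Q / 2 - 2)\<^sup>2 * (LINT v|lborel. (cmod (Tu v))\<^sup>2)
      + (Q * (Q - 4) / 4)\<^sup>2 * (LINT v|lborel. (cmod (div_n2 F v))\<^sup>2)"
proof -
  note F1 = test_fun_euler[OF F] and F2 = test_fun_euler[OF test_fun_euler[OF F]]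
  define u1 where "u1 v = div_n2 (euler F) v - 2 * div_n2 F v" for v
  define u2 where "u2 v = div_n2 (euler (euler F)) v - 4 * div_n2 (euler F) v + 4 * div_n2 F v" for v
  define g where "g v = u1 v + of_real Q * div_n2 F v" for v
  define g1 where "g1 v = u2 v + of_real Q * u1 v" for v
  have du: "flow_deriv (div_n2 F) u1"
    unfolding u1_def by (rule flow_deriv_div_n2[OF flow_deriv_euler[OF F]])
  have du1: "flow_deriv (div_n2 (euler F)) (\<lambda>v. div_n2 (euler (euler F)) v - 2 * div_n2 (euler F) v)"
    by (rule flow_deriv_div_n2[OF flow_deriv_euler[OF F1]])
  have lin: "flow_deriv (\<lambda>v. f v + c * k v) (\<lambda>v. f1 v + c * k1 v)"
    if "flow_deriv f f1" "flow_deriv k k1" for f f1 k k1 :: "'a \<Rightarrow> complex" and c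
    using that unfolding flow_deriv_def
    by (auto intro!: has_vector_derivative_add has_vector_derivative_mult_right)
  have du1': "flow_deriv u1 u2"
    using lin[OF du1 du, of "-2"] by (simp add: u1_def[abs_def] u2_def[abs_def] algebra_simps)
  have dg: "flow_deriv g g1"
    unfolding g_def[abs_def] g1_def[abs_def] by (rule lin[OF du1' du])
  have cu: "compactly_supported (div_n2 F)" by (rule compactly_supported_div_n2[OF F])
  have cu1: "compactly_supported u1" unfolding u1_def
    using compactly_supported_add[OF compactly_supported_div_n2[OF F1] compactly_supported_cmult[OF cu, of "-2"]] by simp
  have cu2: "compactly_supported u2" unfolding u2_def
    using compactly_supported_add[OF compactly_supported_add[OF compactly_supported_div_n2[OF F2] compactly_supported_cmult[OF compactly_supported_div_n2[OF F1], of "-4"]] compactly_supported_cmult[OF cu, of 4]] by simp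
  have cg: "compactly_supported g" unfolding g_def by (rule compactly_supported_add[OF cu1 compactly_supported_cmult[OF cu]])
  have cg1: "compactly_supported g1" unfolding g1_def by (rule compactly_supported_add[OF cu2 compactly_supported_cmult[OF cu1]])
  \<comment> \<open>\<open>g\<close> is (T + Q / 2) u and \<open>Tu\<close> is T u: the skew
    identity for u with a = Q / 2.\<close>
  have e1: "(LINT v|lborel. (cmod (g v))\<^sup>2) = (LINT v|lborel. (cmod (Tu v))\<^sup>2) + (Q / 2)\<^sup>2 * (LINT v|lborel. (cmod (div_n2 F v))\<^sup>2)"
  proof -
    have "u1 v + of_real (Q / 2) * div_n2 F v + of_real (Q / 2) * div_n2 F v = g v" for v
      by (simp add: g_def)
    moreover have "u1 v + of_real (Q / 2) * div_n2 F v = Tu v" for v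
      by (simp add: u1_def Tu_def algebra_simps)
    ultimately show ?thesis using skew_identity[OF cu cu1 du, of "Q / 2"] by (simp only:)
  qed
  \<comment> \<open>The same identity for \<open>g\<close> with a = 2 - Q / 2.\<close>
  have e2: "(LINT v|lborel. (cmod (div_n2 (euler (euler F)) v + of_real (Q - 2) * div_n2 (euler F) v))\<^sup>2)
      = (LINT v|lborel. (cmod (Tg v))\<^sup>2) + (Q / 2 - 2)\<^sup>2 * (LINT v|lborel. (cmod (g v))\<^sup>2)"
  proof -
    have "g1 v + of_real (Q / 2) * g v + of_real (2 - Q / 2) * g v = div_n2 (euler (euler F)) v + of_real (Q - 2) * div_n2 (euler F) v" for v
      by (simp add: g_def g1_def u1_def u2_def algebra_simps)
    moreover have "g1 v + of_real (Q / 2) * g v = Tg v" for v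
      by (simp add: g_def g1_def u1_def u2_def Tg_def field_simps)
    moreover have "(2 - Q / 2)\<^sup>2 = (Q / 2 - 2)\<^sup>2" by (rule power2_commute)
    ultimately show ?thesis using skew_identity[OF cg cg1 dg, of "2 - Q / 2"] by (simp only:)
  qed
  have c: "(Q * (Q - 4) / 4)\<^sup>2 = (Q / 2 - 2)\<^sup>2 * (Q / 2)\<^sup>2"
    unfolding power_mult_distrib[symmetric] by (rule arg_cong[where f = "\<lambda>x. x\<^sup>2"]) (simp add: field_simps)
  show ?thesis unfolding e2 e1 c by (simp only: distrib_left add.assoc mult.assoc)
qed

text \<open>On every orbit exp (Q t / 2) u (fl t v) is constant. Large positive times push a nonzero
  point out of the support, so the constant is 0.\<close>

lemma skew_kernel:
  assumes F: "test_fun F" and z: "\<And>v. div_n2 (euler F) v + of_real (Q / 2 - 2) * div_n2 F v = 0"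
  shows "F v = 0"
proof (cases "v = 0")
  case True
  then show ?thesis using F by (auto simp: test_fun_def)
next
  case False
  have "flow_deriv (div_n2 F) (\<lambda>v. div_n2 (euler F) v - 2 * div_n2 F v)"
    by (rule flow_deriv_div_n2[OF flow_deriv_euler[OF F]])
  moreover have "div_n2 (euler F) w - 2 * div_n2 F w = - of_real (Q / 2) * div_n2 F w" for w
    using z[of w] unfolding eq_neg_iff_add_eq_0[symmetric] by (simp add: algebra_simps)
  ultimately have d: "((\<lambda>t. div_n2 F (fl t v)) has_vector_derivative - of_real (Q / 2) * div_n2 F (fl t v)) (at t)" for t
    unfolding flow_deriv_def by simp
  have "((\<lambda>t. exp (Q / 2 * t) *\<^sub>R div_n2 F (fl t v)) has_vector_derivative 0) (at t)" for t
  proof -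
    have "((\<lambda>t. exp (Q / 2 * t)) has_vector_derivative exp (Q / 2 * t) * (Q / 2)) (at t)"
      by (auto intro!: derivative_eq_intros simp: has_real_derivative_iff_has_vector_derivative[symmetric])
    from bounded_bilinear.has_vector_derivative[OF bounded_bilinear_scaleR this d]
    show ?thesis by (rule has_vector_derivative_eq_rhs) (simp add: scaleR_conv_of_real)
  qed
  then have dc: "((\<lambda>t. exp (Q / 2 * t) *\<^sub>R div_n2 F (fl t v)) has_vector_derivative 0) (at t within UNIV)" for t .
  obtain c where c: "\<And>t. exp (Q / 2 * t) *\<^sub>R div_n2 F (fl t v) = c"
    by (rule has_vector_derivative_zero_constant[OF convex_UNIV dc], rule that) simp_all
  obtain K where K: "compact K" "\<And>x. x \<notin> K \<Longrightarrow> F x = 0" using F by (auto simp: test_fun_def)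
  obtain R where R: "0 < R" "\<And>x. x \<in> K \<Longrightarrow> norm x \<le> R" using compact_imp_bounded[OF K(1)] bounded_pos by blast
  \<comment> \<open>Escape is read off from contraction: were fl t v in K for t = - ln h, shrinking
    it back by h would give |v| \<le> kc h^ka R, and h is chosen to violate this.\<close>
  obtain h where h: "0 < h" "h \<le> 1" "kc * h powr ka * R < norm v"
  proof -
    have "((\<lambda>h. h powr ka) \<longlongrightarrow> 0) (at_right 0)"
      by (rule tendsto_zero_powrI[OF tendsto_ident_at tendsto_const _ ka_pos]) (auto simp: eventually_at_filter)
    then have "((\<lambda>h. kc * h powr ka * R) \<longlongrightarrow> kc * 0 * R) (at_right 0)" by (intro tendsto_intros)
    then have "\<forall>\<^sub>F h in at_right 0. kc * h powr ka * R < norm v"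
      by (rule order_tendstoD) (use False in simp)
    moreover have "\<forall>\<^sub>F h in at_right 0. 0 < h \<and> h \<le> (1::real)"
      unfolding eventually_at_right_field by (intro exI[of _ 1]) auto
    ultimately have "\<forall>\<^sub>F h in at_right 0. 0 < h \<and> h \<le> 1 \<and> kc * h powr ka * R < norm v"
      by eventually_elim auto
    then show ?thesis using eventually_happens[of _ "at_right (0::real)"] that by (auto simp: trivial_limit_at_right_real)
  qed
  define t where "t = - ln h"
  have eh: "exp (- t) = h" using h by (simp add: t_def)
  have "fl t v \<notin> K"
  proof
    assume "fl t v \<in> K"
    then have "norm (fl t v) \<le> R" by (rule R(2))
    moreover have "norm v \<le> kc * h powr ka * norm (fl t v)"
      using d_small[OF h(1,2), of "fl t v"] fl_inv(1)[of t v] unfolding eh by simp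
    ultimately have "norm v \<le> kc * h powr ka * R"
      using kc_pos by (meson mult_left_mono order_trans mult_nonneg_nonneg powr_ge_zero less_imp_le)
    then show False using h by simp
  qed
  then have "c = 0" using c[of t] K(2) by (simp add: div_n2_def)
  then show ?thesis using c[of 0] False by (simp add: div_n2_def n_zero)
qed

end


subsection \<open>Sharpness of the constant\<close>

definition real_deriv :: "(real \<Rightarrow> real) \<Rightarrow> real \<Rightarrow> real" where
  "real_deriv \<theta> t = frechet_derivative \<theta> (at t) 1"

lemma real_deriv:
  assumes "smooth_on UNIV \<theta>"
  shows "smooth_on UNIV (real_deriv \<theta>)" "(\<theta> has_real_derivative real_deriv \<theta> t) (at t)"
proof -
  show "smooth_on UNIV (real_deriv \<theta>)"
    unfolding real_deriv_def[abs_def] by (rule smooth_on_frechet_derivative[OF assms])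
  have d: "(\<theta> has_derivative frechet_derivative \<theta> (at t)) (at t)"
    by (rule smooth_on_has_derivative[OF assms]) simp
  have "frechet_derivative \<theta> (at t) h = real_deriv \<theta> t * h" for h
    using linear_scale[OF has_derivative_linear[OF d], of h 1] by (simp add: real_deriv_def)
  then have "frechet_derivative \<theta> (at t) = (*) (real_deriv \<theta> t)" by (rule ext)
  then show "(\<theta> has_real_derivative real_deriv \<theta> t) (at t)"
    using d by (simp add: has_field_derivative_def)
qed

lemma real_deriv_zero:
  assumes "smooth_on UNIV \<theta>" "open S" "t \<in> S" "\<And>s. s \<in> S \<Longrightarrow> \<theta> s = c"
  shows "real_deriv \<theta> t = 0"
proof -
  have "((\<lambda>_. c) has_real_derivative real_deriv \<theta> t) (at t)"
    by (rule has_field_derivative_transform_within_open[OF real_deriv(2)[OF assms(1)] assms(2,3)]) (rule assms(4))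
  then show ?thesis using DERIV_unique DERIV_const by blast
qed

text \<open>Trial functions need a smooth variable that grows linearly along the flow. As ln n need
  not be smooth, the logarithm of a linear eigencoordinate \<open>ell\<close> of weight
  \<open>wt\<close> takes its place, on the half space where \<open>ell\<close> is positive.\<close>

locale dil_space_coord = dil_space \<delta> A Q n ka kc
  for \<delta> :: "real \<Rightarrow> 'a::euclidean_space \<Rightarrow> 'a" and A Q n ka kc +
  fixes ell :: "'a \<Rightarrow> real" and wt :: real and p :: 'a
  assumes ell_linear: "linear ell" and wt: "0 < wt"
    and ell_dil: "0 < h \<Longrightarrow> ell (\<delta> h v) = h powr wt * ell v"
    and ell_p: "ell p = 1"
begin

definition log_coord :: "'a \<Rightarrow> real" where "log_coord v = ln (ell v) / wt"

lemma ell_fl: "ell (fl t v) = exp (wt * t) * ell v"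
  by (simp add: ell_dil powr_def mult.commute)

lemma ell_fl_pos [simp]: "0 < ell (fl t v) \<longleftrightarrow> 0 < ell v"
  by (simp add: ell_fl zero_less_mult_iff)

lemma log_coord_fl: "0 < ell v \<Longrightarrow> log_coord (fl t v) = log_coord v + t"
  using wt by (simp add: log_coord_def ell_fl ln_mult field_simps)

lemma base_fl: "0 < ell v \<Longrightarrow> fl (- log_coord (fl t v)) (fl t v) = fl (- log_coord v) v"
  by (simp add: log_coord_fl fl_add[symmetric])

lemma open_pos: "open {v. 0 < ell v}"
  using ell_linear linear_continuous_on linear_conv_bounded_linear
  by (intro open_Collect_less continuous_on_const) blast

lemma bump_exists: "\<exists>r \<psi>. 0 < r \<and> cball p r \<subseteq> {v. 0 < ell v} \<and> smooth_on UNIV \<psi> \<and> \<psi> p = (1::real) \<and>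
    (\<forall>x. x \<notin> ball p r \<longrightarrow> \<psi> x = 0)"
proof -
  obtain r where r: "0 < r" "cball p r \<subseteq> {v. 0 < ell v}"
    using open_pos open_contains_cball ell_p by (metis mem_Collect_eq zero_less_one)
  obtain \<psi> :: "'a \<Rightarrow> real" where "smooth_on UNIV \<psi>" "\<And>x. x \<in> ball p (r / 2) \<Longrightarrow> \<psi> x = 1" "\<And>x. x \<notin> ball p r \<Longrightarrow> \<psi> x = 0"
    using bump_function_exists[OF r(1), of p] by metis
  then show ?thesis using r by (intro exI[of _ r] exI[of _ \<psi>]) auto
qed

definition "bump_radius = (SOME r. \<exists>\<psi>. 0 < r \<and> cball p r \<subseteq> {v. 0 < ell v} \<and> smooth_on UNIV \<psi> \<and> \<psi> p = (1::real) \<and>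
    (\<forall>x. x \<notin> ball p r \<longrightarrow> \<psi> x = 0))"
definition "bump = (SOME \<psi>. 0 < bump_radius \<and> cball p bump_radius \<subseteq> {v. 0 < ell v} \<and> smooth_on UNIV \<psi> \<and> \<psi> p = (1::real) \<and>
    (\<forall>x. x \<notin> ball p bump_radius \<longrightarrow> \<psi> x = 0))"

lemma bump: "0 < bump_radius" "cball p bump_radius \<subseteq> {v. 0 < ell v}" "smooth_on UNIV bump" "bump p = 1"
    "x \<notin> ball p bump_radius \<Longrightarrow> bump x = 0"
  using someI_ex[OF someI_ex[OF bump_exists, folded bump_radius_def], folded bump_def] by blast+

text \<open>Up to the cut-off \<open>\<theta>\<close>, the trial function divided by \<open>n\<^sup>2\<close> is homogeneous of degree \<open>- Q / 2\<close>,
  that is, annihilated by \<open>T\<close>.\<close>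

definition trial :: "(real \<Rightarrow> real) \<Rightarrow> 'a \<Rightarrow> complex" where
  "trial \<theta> v = (if 0 < ell v then of_real (exp ((2 - Q / 2) * log_coord v) * \<theta> (log_coord v) * bump (fl (- log_coord v) v)) else 0)"

definition cutoff :: "(real \<Rightarrow> real) \<Rightarrow> bool" where
  "cutoff \<theta> \<longleftrightarrow> smooth_on UNIV \<theta> \<and> (\<exists>a b. \<forall>s. s \<notin> {a..b} \<longrightarrow> \<theta> s = 0)"

lemma test_fun_trial:
  assumes "cutoff \<theta>"
  shows "test_fun (trial \<theta>)"
proof -
  obtain a b where ab: "\<And>s. s \<notin> {a..b} \<Longrightarrow> \<theta> s = 0" and sm: "smooth_on UNIV \<theta>"
    using assms by (auto simp: cutoff_def)
  \<comment> \<open>The orbit segments over times in [a, b] through the ball that carries the bump: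
    a compact subset of the open half space, so the extension by 0 is smooth.\<close>
  define K where "K = (\<lambda>q. fl (fst q) (snd q)) ` ({a..b} \<times> cball p bump_radius)"
  have K: "compact K" unfolding K_def
    by (intro compact_continuous_image compact_Times compact_Icc compact_cball fl_cont continuous_intros)
  have Kpos: "K \<subseteq> {v. 0 < ell v}" using bump(2) by (auto simp: K_def)
  have zero: "trial \<theta> v = 0" if "v \<notin> K" for v
  proof (rule ccontr)
    assume nz: "trial \<theta> v \<noteq> 0"
    then have "\<theta> (log_coord v) \<noteq> 0" "bump (fl (- log_coord v) v) \<noteq> 0" by (auto simp: trial_def split: if_splits)
    then have "log_coord v \<in> {a..b}" "fl (- log_coord v) v \<in> cball p bump_radius" using ab bump(5) by (blast, force)
    moreover have "v = fl (log_coord v) (fl (- log_coord v) v)" by simp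
    ultimately have "v \<in> K" unfolding K_def by (intro image_eqI[of _ _ "(log_coord v, fl (- log_coord v) v)"]) auto
    then show False using that by simp
  qed
  let ?P = "{v. 0 < ell v}"
  have 1: "smooth_on ?P (\<lambda>v. ell v)"
    using ell_linear linear_conv_bounded_linear open_pos by (intro smooth_on_bounded_linear) auto
  have "smooth_on ?P (\<lambda>v. ln (ell v))"
    by (rule smooth_on_compose[OF smooth_on_ln 1 open_pos]) simp
  then have "smooth_on ?P (\<lambda>v. inverse wt * ln (ell v))"
    by (rule smooth_on_linear_comp[OF bounded_linear_mult_right open_pos])
  then have s: "smooth_on ?P log_coord" by (simp add: log_coord_def[abs_def] divide_inverse mult.commute)
  have "smooth_on ?P (\<lambda>v. (2 - Q / 2) * log_coord v)"
    by (rule smooth_on_linear_comp[OF bounded_linear_mult_right open_pos s])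
  from smooth_on_compose[OF smooth_on_exp this open_pos]
  have e: "smooth_on ?P (\<lambda>v. exp ((2 - Q / 2) * log_coord v))" by simp
  have t: "smooth_on ?P (\<lambda>v. \<theta> (log_coord v))" by (rule smooth_on_compose[OF sm s open_pos]) simp
  have "smooth_on ?P (\<lambda>v. (- log_coord v, v))"
    by (intro smooth_on_Pair smooth_on_minus smooth_on_id open_pos s)
  from smooth_on_compose[OF d_smooth this open_pos] have "smooth_on ?P (\<lambda>v. fl (- log_coord v) v)" by simp
  from smooth_on_compose[OF bump(3) this open_pos] have b: "smooth_on ?P (\<lambda>v. bump (fl (- log_coord v) v))" by simp
  have "smooth_on ?P (\<lambda>v. exp ((2 - Q / 2) * log_coord v) * \<theta> (log_coord v) * bump (fl (- log_coord v) v))"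
    by (intro smooth_on_bilinear[OF bounded_bilinear_mult open_pos] e t b)
  then have "smooth_on ?P (\<lambda>v. complex_of_real (exp ((2 - Q / 2) * log_coord v) * \<theta> (log_coord v) * bump (fl (- log_coord v) v)))"
    by (rule smooth_on_linear_comp[OF bounded_linear_of_real open_pos])
  then have P: "smooth_on ?P (trial \<theta>)" by (rule smooth_on_cong[OF _ open_pos]) (simp add: trial_def)
  have oK: "open (- K)" using K compact_imp_closed by auto
  have N: "smooth_on (- K) (trial \<theta>)"
    by (rule smooth_on_cong[OF smooth_on_const[OF oK, of 0] oK]) (simp add: zero)
  have "smooth_on UNIV (trial \<theta>)"
  proof (rule smooth_on_local)
    fix x :: 'a
    show "\<exists>T. open T \<and> x \<in> T \<and> smooth_on T (trial \<theta>)"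
      using P N oK open_pos Kpos by (cases "x \<in> K") blast+
  qed
  moreover have "0 \<notin> K" using Kpos linear_0[OF ell_linear] by auto
  ultimately show ?thesis using K zero by (auto simp: test_fun_def)
qed

lemma trial_lin: "trial (\<lambda>s. a * \<theta> s + b * \<theta>' s) v = of_real a * trial \<theta> v + of_real b * trial \<theta>' v"
  by (simp add: trial_def algebra_simps)

lemma cutoff_lin:
  assumes "cutoff \<theta>" "cutoff \<theta>'"
  shows "cutoff (\<lambda>s. a * \<theta> s + b * \<theta>' s)"
proof -
  obtain c d c' d' where z: "\<And>s. s \<notin> {c..d} \<Longrightarrow> \<theta> s = 0" "\<And>s. s \<notin> {c'..d'} \<Longrightarrow> \<theta>' s = 0"
    using assms by (auto simp: cutoff_def)
  have "a * \<theta> s + b * \<theta>' s = 0" if "s \<notin> {min c c'..max d d'}" for s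
  proof -
    have "s \<notin> {c..d}" "s \<notin> {c'..d'}" using that by (auto simp: min_le_iff_disj le_max_iff_disj)
    then show ?thesis using z by simp
  qed
  moreover have "smooth_on UNIV (\<lambda>s. a * \<theta> s + b * \<theta>' s)"
    using assms by (intro smooth_on_add smooth_on_linear_comp[OF bounded_linear_mult_right] open_UNIV) (auto simp: cutoff_def)
  ultimately show ?thesis unfolding cutoff_def by blast
qed

lemma cutoff_real_deriv:
  assumes "cutoff \<theta>"
  shows "cutoff (real_deriv \<theta>)"
proof -
  obtain a b where ab: "\<And>s. s \<notin> {a..b} \<Longrightarrow> \<theta> s = 0" and sm: "smooth_on UNIV \<theta>"
    using assms by (auto simp: cutoff_def)
  have "real_deriv \<theta> s = 0" if "s \<notin> {a..b}" for s
    by (rule real_deriv_zero[OF sm, of "- {a..b}" s 0]) (use that ab in auto)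
  then show ?thesis using real_deriv(1)[OF sm] by (auto simp: cutoff_def)
qed

lemma cutoff_shift:
  assumes "cutoff \<theta>"
  shows "cutoff (\<lambda>s. \<theta> (s - t))"
proof -
  obtain a b where ab: "\<And>s. s \<notin> {a..b} \<Longrightarrow> \<theta> s = 0" and sm: "smooth_on UNIV \<theta>"
    using assms by (auto simp: cutoff_def)
  have "smooth_on UNIV (\<lambda>s. s - t)" by (intro smooth_on_diff smooth_on_id smooth_on_const open_UNIV)
  from smooth_on_compose[OF sm this] have "smooth_on UNIV (\<lambda>s. \<theta> (s - t))" by simp
  moreover have "\<theta> (s - t) = 0" if "s \<notin> {a + t..b + t}" for s using ab[of "s - t"] that by auto
  ultimately show ?thesis unfolding cutoff_def by blast
qed

text \<open>Along an orbit the bump factor stays fixed and \<open>log_coord\<close> advances with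
  unit speed. Hence the flow derivative acts on the cut-off alone, as d / ds + 2 - Q / 2.\<close>

lemma euler_trial:
  assumes "cutoff \<theta>"
  shows "euler (trial \<theta>) = trial (\<lambda>s. (2 - Q / 2) * \<theta> s + 1 * real_deriv \<theta> s)"
proof
  fix v
  have sm: "smooth_on UNIV \<theta>" using assms by (simp add: cutoff_def)
  have d: "((\<lambda>t. trial \<theta> (fl t v)) has_vector_derivative euler (trial \<theta>) v) (at 0)"
    using flow_deriv_euler[OF test_fun_trial[OF assms]] unfolding flow_deriv_def by (metis fl_0)
  show "euler (trial \<theta>) v = trial (\<lambda>s. (2 - Q / 2) * \<theta> s + 1 * real_deriv \<theta> s) v"
  proof (cases "0 < ell v")
    case True
    define b where "b = bump (fl (- log_coord v) v)"
    have eq: "trial \<theta> (fl t v) = of_real (exp ((2 - Q / 2) * (log_coord v + t)) * \<theta> (log_coord v + t) * b)" for t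
      using True base_fl[OF True, of t] by (simp add: trial_def log_coord_fl b_def)
    have t: "((\<lambda>t. \<theta> (log_coord v + t)) has_real_derivative real_deriv \<theta> (log_coord v + 0)) (at 0)"
      using real_deriv(2)[OF sm, of "log_coord v"] DERIV_shift[of \<theta> "real_deriv \<theta> (log_coord v)" 0 "log_coord v"] by (simp add: add.commute)
    have "((\<lambda>t. exp ((2 - Q / 2) * (log_coord v + t)) * \<theta> (log_coord v + t) * b) has_real_derivative
        exp ((2 - Q / 2) * log_coord v) * ((2 - Q / 2) * \<theta> (log_coord v) + 1 * real_deriv \<theta> (log_coord v)) * b) (at 0)"
      by (rule derivative_eq_intros t refl | simp add: algebra_simps)+
    then have "((\<lambda>t. complex_of_real (exp ((2 - Q / 2) * (log_coord v + t)) * \<theta> (log_coord v + t) * b)) has_vector_derivative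
        of_real (exp ((2 - Q / 2) * log_coord v) * ((2 - Q / 2) * \<theta> (log_coord v) + 1 * real_deriv \<theta> (log_coord v)) * b)) (at 0)"
      unfolding has_real_derivative_iff_has_vector_derivative by (rule bounded_linear.has_vector_derivative[OF bounded_linear_of_real])
    then have "((\<lambda>t. trial \<theta> (fl t v)) has_vector_derivative trial (\<lambda>s. (2 - Q / 2) * \<theta> s + 1 * real_deriv \<theta> s) v) (at 0)"
      unfolding eq using True by (simp add: trial_def b_def)
    then show ?thesis using d by (rule vector_derivative_unique_at[rotated])
  next
    case False
    then have "trial \<theta> (fl t v) = 0" for t by (simp add: trial_def)
    then have "((\<lambda>t. 0) has_vector_derivative euler (trial \<theta>) v) (at 0)" using d by simp
    then have "euler (trial \<theta>) v = 0" using vector_derivative_unique_at has_vector_derivative_const by blast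
    then show ?thesis using False by (simp add: trial_def)
  qed
qed

definition trial_norm :: "(real \<Rightarrow> real) \<Rightarrow> real" where
  "trial_norm \<theta> = (LINT v|lborel. (cmod (div_n2 (trial \<theta>) v))\<^sup>2)"

text \<open>A density independent of the cut-off, so that comparing squares of cut-offs pointwise
  compares the norms.\<close>

definition trial_weight :: "'a \<Rightarrow> real" where
  "trial_weight v = (if 0 < ell v then (exp ((2 - Q / 2) * log_coord v) * bump (fl (- log_coord v) v) / (n v)\<^sup>2)\<^sup>2 else 0)"

lemma trial_weight: "(cmod (div_n2 (trial \<theta>) v))\<^sup>2 = (\<theta> (log_coord v))\<^sup>2 * trial_weight v" "0 \<le> trial_weight v"
proof -
  have "div_n2 (trial \<theta>) v = of_real (if 0 < ell v then \<theta> (log_coord v) * (exp ((2 - Q / 2) * log_coord v) * bump (fl (- log_coord v) v) / (n v)\<^sup>2) else 0)"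
    by (simp add: div_n2_def trial_def)
  then show "(cmod (div_n2 (trial \<theta>) v))\<^sup>2 = (\<theta> (log_coord v))\<^sup>2 * trial_weight v"
    by (simp only: norm_of_real power2_abs) (simp add: trial_weight_def power_mult_distrib[symmetric])
qed (simp add: trial_weight_def)

lemma trial_norm_integrable: "cutoff \<theta> \<Longrightarrow> integrable lborel (\<lambda>v. (\<theta> (log_coord v))\<^sup>2 * trial_weight v)"
  using compactly_supported_integrable[OF compactly_supported_norm_square[OF compactly_supported_div_n2[OF test_fun_trial]]] by (simp add: trial_weight(1))

lemma trial_norm_nonneg: "0 \<le> trial_norm \<theta>" unfolding trial_norm_def by simp

text \<open>Shifting the cut-off amounts to moving along the flow. The homogeneity - Q / 2
  contributes a factor that the change of volume exactly undoes, so the norm is translation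
  invariant in the variable \<open>log_coord\<close>.\<close>

lemma trial_norm_shift:
  assumes "cutoff \<theta>"
  shows "trial_norm (\<lambda>s. \<theta> (s - t)) = trial_norm \<theta>"
proof -
  let ?\<theta> = "\<lambda>s. \<theta> (s - t)"
  have m: "(\<lambda>v. (cmod (div_n2 (trial \<theta>) v))\<^sup>2) \<in> borel_measurable borel"
    using compactly_supported_norm_square[OF compactly_supported_div_n2[OF test_fun_trial[OF assms]]] borel_measurable_continuous_onI by (auto simp: compactly_supported_def)
  have eq: "div_n2 (trial \<theta>) (fl (- t) v) = of_real (exp (Q / 2 * t)) * div_n2 (trial ?\<theta>) v" for v
  proof (cases "0 < ell v")
    case True
    have "(n (fl (- t) v))\<^sup>2 = exp (- (2 * t)) * (n v)\<^sup>2"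
      by (simp add: n_fl power_mult_distrib power2_eq_square exp_add[symmetric])
    moreover have "exp ((2 - Q / 2) * (log_coord v - t)) = exp ((2 - Q / 2) * log_coord v) * (exp (Q / 2 * t) * exp (- (2 * t)))"
      by (simp add: exp_add[symmetric] algebra_simps)
    moreover have "log_coord (fl (- t) v) = log_coord v - t" "fl (- log_coord (fl (- t) v)) (fl (- t) v) = fl (- log_coord v) v"
      using log_coord_fl[OF True, of "- t"] base_fl[OF True, of "- t"] by auto
    moreover have "E * (X * Y) * a * b / (Y * N) = X * (E * a * b / N)" if "Y \<noteq> 0" for E X Y a b N :: real
      using that by (cases "N = 0") (simp_all add: field_simps)
    ultimately have "exp ((2 - Q / 2) * log_coord (fl (- t) v)) * \<theta> (log_coord (fl (- t) v)) * bump (fl (- log_coord (fl (- t) v)) (fl (- t) v)) / (n (fl (- t) v))\<^sup>2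
        = exp (Q / 2 * t) * (exp ((2 - Q / 2) * log_coord v) * \<theta> (log_coord v - t) * bump (fl (- log_coord v) v) / (n v)\<^sup>2)"
      by (metis exp_not_eq_zero)
    then show ?thesis using True
      by (simp only: div_n2_def trial_def ell_fl_pos if_True of_real_mult[symmetric] of_real_divide[symmetric])
  next
    case False
    then show ?thesis using ell_fl_pos[of "- t" v] by (simp add: div_n2_def trial_def)
  qed
  have "exp (Q * t) * trial_norm \<theta> = (LINT v|lborel. (cmod (div_n2 (trial \<theta>) (fl (- t) v)))\<^sup>2)"
    using integral_fl[OF m, of "- t"] by (simp add: trial_norm_def)
  also have "\<dots> = (LINT v|lborel. exp (Q * t) * (cmod (div_n2 (trial ?\<theta>) v))\<^sup>2)"
  proof -
    have "(exp (Q / 2 * t))\<^sup>2 = exp (Q * t)" by (simp add: power2_eq_square exp_add[symmetric])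
    then have "(cmod (of_real (exp (Q / 2 * t)) * z))\<^sup>2 = exp (Q * t) * (cmod z)\<^sup>2" for z
      by (simp only: norm_mult power_mult_distrib norm_of_real power2_abs)
    then show ?thesis unfolding eq by (simp only:)
  qed
  also have "\<dots> = exp (Q * t) * trial_norm ?\<theta>" by (simp add: trial_norm_def)
  finally show ?thesis by simp
qed

lemma trial_norm_le:
  assumes "cutoff \<theta>" "cutoff \<theta>1" "cutoff \<theta>2" "\<And>s. (\<theta> s)\<^sup>2 \<le> 2 * (\<theta>1 s)\<^sup>2 + 2 * (\<theta>2 s)\<^sup>2"
  shows "trial_norm \<theta> \<le> 2 * trial_norm \<theta>1 + 2 * trial_norm \<theta>2"
proof -
  note i = trial_norm_integrable[OF assms(1)] trial_norm_integrable[OF assms(2)] trial_norm_integrable[OF assms(3)]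
  have "trial_norm \<theta> \<le> (LINT v|lborel. 2 * ((\<theta>1 (log_coord v))\<^sup>2 * trial_weight v) + 2 * ((\<theta>2 (log_coord v))\<^sup>2 * trial_weight v))"
    unfolding trial_norm_def trial_weight(1)
  proof (rule integral_mono)
    show "(\<theta> (log_coord v))\<^sup>2 * trial_weight v \<le> 2 * ((\<theta>1 (log_coord v))\<^sup>2 * trial_weight v) + 2 * ((\<theta>2 (log_coord v))\<^sup>2 * trial_weight v)" for v
      using mult_right_mono[OF assms(4) trial_weight(2), of "log_coord v" v] by (simp add: algebra_simps)
  qed (use i in auto)
  also have "\<dots> = 2 * trial_norm \<theta>1 + 2 * trial_norm \<theta>2" unfolding trial_norm_def trial_weight(1) using i by simp
  finally show ?thesis .
qed

lemma trial_norm_sum_le: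
  fixes \<theta>s :: "nat \<Rightarrow> real \<Rightarrow> real"
  assumes "cutoff \<theta>" "\<And>j. cutoff (\<theta>s j)" "\<And>s. (\<Sum>j<k. (\<theta>s j s)\<^sup>2) \<le> (\<theta> s)\<^sup>2"
  shows "(\<Sum>j<k. trial_norm (\<theta>s j)) \<le> trial_norm \<theta>"
proof -
  note i = trial_norm_integrable[OF assms(1)] trial_norm_integrable[OF assms(2)]
  have "(\<Sum>j<k. trial_norm (\<theta>s j)) = (LINT v|lborel. (\<Sum>j<k. (\<theta>s j (log_coord v))\<^sup>2 * trial_weight v))"
    unfolding trial_norm_def trial_weight(1) using i by simp
  also have "\<dots> \<le> trial_norm \<theta>"
    unfolding trial_norm_def trial_weight(1)
  proof (rule integral_mono)
    show "(\<Sum>j<k. (\<theta>s j (log_coord v))\<^sup>2 * trial_weight v) \<le> (\<theta> (log_coord v))\<^sup>2 * trial_weight v" for v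
      using mult_right_mono[OF assms(3) trial_weight(2), of "log_coord v" v] by (simp add: sum_distrib_right)
  qed (use i in auto)
  finally show ?thesis .
qed

text \<open>The cut-off is a plateau of length k. Its norm grows at least linearly in k, because it
  is the sum of k translates of one hump. T differentiates the cut-off, so the terms that the
  inequality discards see only the two edges and stay bounded.\<close>

lemma near_extremal:
  "\<exists>M \<kappa>. 0 \<le> M \<and> 0 < \<kappa> \<and> (\<forall>k. \<exists>F. test_fun F \<and> \<kappa> * real k \<le> (LINT v|lborel. (cmod (div_n2 F v))\<^sup>2) \<and>
    (LINT v|lborel. (cmod (div_n2 (euler (euler F)) v + of_real (Q - 2) * div_n2 (euler F) v))\<^sup>2)
      \<le> M + (Q * (Q - 4) / 4)\<^sup>2 * (LINT v|lborel. (cmod (div_n2 F v))\<^sup>2))"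
proof -
  \<comment> \<open>For t \<ge> 1 this rises on [0, 1], equals 1 up to t and falls on
    [t, t + 1].\<close>
  define \<eta> where "\<eta> t s = 1 * smooth_step s + (-1) * smooth_step (s - t)" for t s
  have sm: "smooth_on UNIV (\<lambda>s. smooth_step (s - t))" for t
    using smooth_on_compose[OF smooth_on_smooth_step smooth_on_diff[OF open_UNIV smooth_on_id smooth_on_const, of t]] by simp
  have smeta: "smooth_on UNIV (\<eta> t)" for t
    unfolding \<eta>_def[abs_def]
    by (intro smooth_on_add smooth_on_linear_comp[OF bounded_linear_mult_right] smooth_on_smooth_step sm open_UNIV)
  have cutoff: "cutoff (\<eta> (real k))" for k
    unfolding cutoff_def
  proof (intro conjI exI allI impI smeta)
    fix s assume "s \<notin> {0..real k + 1}"
    then show "\<eta> (real k) s = 0"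
      using smooth_step_simps(1)[of s] smooth_step_simps(1)[of "s - real k"] smooth_step_simps(2)[of s] smooth_step_simps(2)[of "s - real k"]
      by (cases "s < 0") (auto simp: \<eta>_def)
  qed
  define \<rho>1 where "\<rho>1 = real_deriv smooth_step"
  have sm1: "smooth_on UNIV \<rho>1" unfolding \<rho>1_def by (rule real_deriv(1)[OF smooth_on_smooth_step])
  have adm1: "cutoff \<rho>1"
    unfolding cutoff_def
  proof (intro conjI exI allI impI sm1)
    fix s :: real assume "s \<notin> {0..1}"
    then consider "s < 0" | "s > 1" by force
    then show "\<rho>1 s = 0"
    proof cases
      case 1
      show ?thesis unfolding \<rho>1_def
        by (rule real_deriv_zero[OF smooth_on_smooth_step, of "{..<0}" s 0]) (use 1 smooth_step_simps in auto)
    next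
      case 2
      show ?thesis unfolding \<rho>1_def
        by (rule real_deriv_zero[OF smooth_on_smooth_step, of "{1<..}" s 1]) (use 2 smooth_step_simps in auto)
    qed
  qed
  define \<rho>2 where "\<rho>2 s = 1 * real_deriv \<rho>1 s + (Q / 2) * \<rho>1 s" for s
  have adm2: "cutoff \<rho>2" unfolding \<rho>2_def[abs_def] by (rule cutoff_lin[OF cutoff_real_deriv[OF adm1] adm1])
  have shd: "((\<lambda>s. f (s - t)) has_real_derivative f') (at s)" if "(f has_real_derivative f') (at (s - t))" for f f' t s
    using that DERIV_shift[of f f' s "- t"] by simp
  have deta: "real_deriv (\<eta> t) s = \<rho>1 s - \<rho>1 (s - t)" for t s
  proof (rule DERIV_unique[OF real_deriv(2)[OF smeta]])
    show "(\<eta> t has_real_derivative \<rho>1 s - \<rho>1 (s - t)) (at s)"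
      unfolding \<eta>_def \<rho>1_def
      by (rule derivative_eq_intros real_deriv(2)[OF smooth_on_smooth_step] shd[OF real_deriv(2)[OF smooth_on_smooth_step]] refl | simp)+
  qed
  have ddeta: "real_deriv (real_deriv (\<eta> t)) s = real_deriv \<rho>1 s - real_deriv \<rho>1 (s - t)" for t s
  proof (rule DERIV_unique[OF real_deriv(2)[OF real_deriv(1)[OF smeta]]])
    show "(real_deriv (\<eta> t) has_real_derivative real_deriv \<rho>1 s - real_deriv \<rho>1 (s - t)) (at s)"
      unfolding deta
      by (rule derivative_eq_intros real_deriv(2)[OF sm1] shd[OF real_deriv(2)[OF sm1]] refl | simp)+
  qed
  have sq: "(x - y)\<^sup>2 \<le> 2 * x\<^sup>2 + 2 * y\<^sup>2" for x y :: real
    using zero_le_power2[of "x + y"] by (simp add: power2_eq_square algebra_simps)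
  \<comment> \<open>Each edge is a translate of one profile, and (x - y)^2 \<le> 2 x^2 + 2 y^2 turns
    the two edges into the factor 4.\<close>
  define M where "M = 4 * trial_norm \<rho>2 + (Q / 2 - 2)\<^sup>2 * (4 * trial_norm \<rho>1)"
  have M: "0 \<le> M" using trial_norm_nonneg by (simp add: M_def)
  define \<beta> where "\<beta> = \<eta> (real 1)"
  have admb: "cutoff \<beta>" unfolding \<beta>_def by (rule cutoff)
  have bnn: "0 \<le> \<beta> s" for s
  proof (cases "s \<le> 1")
    case True then show ?thesis using smooth_step_simps(1)[of "s - 1"] smooth_step_simps(3)[of s] by (simp add: \<beta>_def \<eta>_def)
  next
    case False then show ?thesis using smooth_step_simps(2)[of s] smooth_step_simps(4)[of "s - 1"] by (simp add: \<beta>_def \<eta>_def)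
  qed
  have Jb: "0 < trial_norm \<beta>"
  proof (rule ccontr)
    assume "\<not> 0 < trial_norm \<beta>"
    then have "trial_norm \<beta> = 0" using trial_norm_nonneg[of \<beta>] by simp
    then have z: "div_n2 (trial \<beta>) v = 0" for v
      using compactly_supported_integral_zero[OF compactly_supported_div_n2[OF test_fun_trial[OF cutoff[of 1]]]] by (simp add: trial_norm_def \<beta>_def)
    have "log_coord p = 0" "0 < ell p" by (simp_all add: log_coord_def ell_p)
    then have "log_coord (fl 1 p) = 1" "fl (- log_coord (fl 1 p)) (fl 1 p) = p" "0 < ell (fl 1 p)"
      using log_coord_fl[of p 1] base_fl[of p 1] by auto
    moreover have "\<beta> 1 = 1" using smooth_step_simps(1)[of 0] smooth_step_simps(2)[of 1] by (simp add: \<beta>_def \<eta>_def)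
    ultimately have "trial \<beta> (fl 1 p) \<noteq> 0" using bump(4) by (simp add: trial_def)
    moreover have "fl 1 p \<noteq> 0" using \<open>0 < ell (fl 1 p)\<close> linear_0[OF ell_linear] by (metis less_irrefl)
    then have "n (fl 1 p) \<noteq> 0" using n_zero by blast
    ultimately show False using z[of "fl 1 p"] by (simp add: div_n2_def)
  qed
  have main: "\<exists>F. test_fun F \<and> trial_norm \<beta> * real k \<le> (LINT v|lborel. (cmod (div_n2 F v))\<^sup>2) \<and>
      (LINT v|lborel. (cmod (div_n2 (euler (euler F)) v + of_real (Q - 2) * div_n2 (euler F) v))\<^sup>2)
      \<le> M + (Q * (Q - 4) / 4)\<^sup>2 * (LINT v|lborel. (cmod (div_n2 F v))\<^sup>2)" for k
  proof -
    define \<theta> where "\<theta> = \<eta> (real k)"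
    have a: "cutoff \<theta>" unfolding \<theta>_def by (rule cutoff)
    note a1 = cutoff_real_deriv[OF a]
    \<comment> \<open>The unit humps telescope to the plateau. They are nonnegative, so the sum of
      their squares is at most the square of their sum.\<close>
    have sum: "(\<Sum>j<k. \<beta> (s - real j)) = \<theta> s" for s
      unfolding \<theta>_def by (induction k) (auto simp: \<beta>_def \<eta>_def algebra_simps)
    have "(\<Sum>j<k. (\<beta> (s - real j))\<^sup>2) \<le> (\<theta> s)\<^sup>2" for s
    proof -
      have "(\<Sum>j<k. (\<beta> (s - real j))\<^sup>2) \<le> (\<Sum>j<k. \<beta> (s - real j))\<^sup>2"
      proof (induction k)
        case (Suc k)
        have "0 \<le> (\<Sum>j<k. \<beta> (s - real j)) * \<beta> (s - real k)" by (intro mult_nonneg_nonneg sum_nonneg bnn)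
        then show ?case using Suc by (simp add: power2_sum)
      qed simp
      then show ?thesis by (simp only: sum)
    qed
    then have "(\<Sum>j<k. trial_norm (\<lambda>s. \<beta> (s - real j))) \<le> trial_norm \<theta>"
      by (intro trial_norm_sum_le a cutoff_shift admb)
    moreover have "trial_norm (\<lambda>s. \<beta> (s - real j)) = trial_norm \<beta>" for j
      unfolding \<beta>_def by (rule trial_norm_shift[OF cutoff])
    ultimately have low: "trial_norm \<beta> * real k \<le> trial_norm \<theta>" by (simp add: mult.commute)
    have J1: "trial_norm (real_deriv \<theta>) \<le> 4 * trial_norm \<rho>1"
      using trial_norm_le[OF a1 adm1 cutoff_shift[OF adm1, of "real k"]] trial_norm_shift[OF adm1, of "real k"] sq
      unfolding \<theta>_def deta by simp
    \<comment> \<open>T acts on cut-offs as d / ds, so T (T + Q / 2) u belongs to \<theta>'' + (Q /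
      2) \<theta>'.\<close>
    define \<theta>2 where "\<theta>2 s = 1 * real_deriv (real_deriv \<theta>) s + (Q / 2) * real_deriv \<theta> s" for s
    have a2: "cutoff \<theta>2" unfolding \<theta>2_def[abs_def] by (rule cutoff_lin[OF cutoff_real_deriv[OF a1] a1])
    have "\<theta>2 s = \<rho>2 s - \<rho>2 (s - real k)" for s
      unfolding \<theta>2_def \<rho>2_def \<theta>_def ddeta deta by (simp add: algebra_simps)
    then have J2: "trial_norm \<theta>2 \<le> 4 * trial_norm \<rho>2"
      using trial_norm_le[OF a2 adm2 cutoff_shift[OF adm2, of "real k"]] trial_norm_shift[OF adm2, of "real k"] sq by simp
    let ?F = "trial \<theta>" and ?c = "2 - Q / 2"
    have E1: "euler ?F v = of_real ?c * trial \<theta> v + trial (real_deriv \<theta>) v" for v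
      unfolding euler_trial[OF a] trial_lin by simp
    have am: "cutoff (\<lambda>s. ?c * \<theta> s + 1 * real_deriv \<theta> s)" by (rule cutoff_lin[OF a a1])
    have E2: "euler (euler ?F) v = of_real ?c * (of_real ?c * trial \<theta> v + trial (real_deriv \<theta>) v)
        + (of_real ?c * trial (real_deriv \<theta>) v + trial (real_deriv (real_deriv \<theta>)) v)" for v
    proof -
      have "euler (trial (\<lambda>s. ?c * \<theta> s + 1 * real_deriv \<theta> s)) v
          = of_real ?c * euler ?F v + euler (trial (real_deriv \<theta>)) v"
      proof -
        have d: "flow_deriv (trial (\<lambda>s. ?c * \<theta> s + 1 * real_deriv \<theta> s)) (\<lambda>v. of_real ?c * euler ?F v + euler (trial (real_deriv \<theta>)) v)"
          using flow_deriv_euler[OF test_fun_trial[OF a]] flow_deriv_euler[OF test_fun_trial[OF a1]]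
          unfolding flow_deriv_def trial_lin
          by (auto intro!: has_vector_derivative_add has_vector_derivative_mult_right)
        show ?thesis
          using vector_derivative_unique_at[OF
              flow_deriv_euler[OF test_fun_trial[OF am], unfolded flow_deriv_def, THEN spec, of v, THEN spec, of 0]
              d[unfolded flow_deriv_def, THEN spec, of v, THEN spec, of 0]]
          unfolding fl_0 .
      qed
      then show ?thesis unfolding euler_trial[OF a, symmetric] E1 euler_trial[OF a1] trial_lin by simp
    qed
    have Tu: "div_n2 (euler ?F) v + of_real (Q / 2 - 2) * div_n2 ?F v = div_n2 (trial (real_deriv \<theta>)) v" for v
    proof -
      have "euler ?F v + of_real (Q / 2 - 2) * ?F v = trial (real_deriv \<theta>) v"
        unfolding E1 by (simp add: algebra_simps)
      then show ?thesis unfolding div_n2_def by (metis add_divide_distrib times_divide_eq_right)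
    qed
    have Tg: "div_n2 (euler (euler ?F)) v + of_real (3 * Q / 2 - 4) * div_n2 (euler ?F) v + of_real ((Q - 2) * (Q / 2 - 2)) * div_n2 ?F v = div_n2 (trial \<theta>2) v" for v
    proof -
      have "euler (euler ?F) v + of_real (3 * Q / 2 - 4) * euler ?F v + of_real ((Q - 2) * (Q / 2 - 2)) * ?F v = trial \<theta>2 v"
        unfolding E2 E1 \<theta>2_def[abs_def] trial_lin by (simp add: field_simps)
      then show ?thesis unfolding div_n2_def by (metis add_divide_distrib times_divide_eq_right)
    qed
    have "(LINT v|lborel. (cmod (div_n2 (euler (euler ?F)) v + of_real (Q - 2) * div_n2 (euler ?F) v))\<^sup>2)
        = trial_norm \<theta>2 + (Q / 2 - 2)\<^sup>2 * trial_norm (real_deriv \<theta>) + (Q * (Q - 4) / 4)\<^sup>2 * (LINT v|lborel. (cmod (div_n2 ?F v))\<^sup>2)"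
      using rellich_identity[OF test_fun_trial[OF a]] unfolding Tu Tg trial_norm_def by simp
    also have "\<dots> \<le> M + (Q * (Q - 4) / 4)\<^sup>2 * (LINT v|lborel. (cmod (div_n2 ?F v))\<^sup>2)"
      using J2 mult_left_mono[OF J1 zero_le_power2[of "Q / 2 - 2"]] by (simp add: M_def)
    finally show ?thesis
      using test_fun_trial[OF a] low by (intro exI[of _ ?F]) (simp add: trial_norm_def)
  qed
  then show ?thesis using M Jb by blast
qed

text \<open>Let x be the squared left-hand norm of a near-extremal function. A constant with C q < 1
  would give x \<le> C^2 (M + q^2 x) and so bound x, while x can be made arbitrarily large.\<close>

lemma rellich_sharp:
  assumes C: "\<And>F. test_fun F \<Longrightarrow> sqrt (LINT v|lborel. (cmod (div_n2 F v))\<^sup>2)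
    \<le> C * sqrt (LINT v|lborel. (cmod (div_n2 (euler (euler F)) v + of_real (Q - 2) * div_n2 (euler F) v))\<^sup>2)"
  shows "4 / (Q * (Q - 4)) \<le> C"
proof (rule ccontr)
  assume less: "\<not> 4 / (Q * (Q - 4)) \<le> C"
  obtain M \<kappa> where M: "0 \<le> M" "0 < \<kappa>" "\<And>k. \<exists>F. test_fun F \<and> \<kappa> * real k \<le> (LINT v|lborel. (cmod (div_n2 F v))\<^sup>2) \<and>
    (LINT v|lborel. (cmod (div_n2 (euler (euler F)) v + of_real (Q - 2) * div_n2 (euler F) v))\<^sup>2)
      \<le> M + (Q * (Q - 4) / 4)\<^sup>2 * (LINT v|lborel. (cmod (div_n2 F v))\<^sup>2)"
    using near_extremal by blast
  define q where "q = Q * (Q - 4) / 4"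
  have q: "0 < q" using Q_gt by (simp add: q_def)
  have Cq: "C * q < 1" using less q by (simp add: q_def field_simps not_le)
  have key: "0 \<le> C \<and> x \<le> C\<^sup>2 * (M + q\<^sup>2 * x)" if x: "0 < x" "sqrt x \<le> C * sqrt y" "0 \<le> y" "y \<le> M + q\<^sup>2 * x" for x y
  proof -
    \<comment> \<open>C is any real number at this point; its sign has to be settled before the
      inequality is squared.\<close>
    have "0 < C * sqrt y" using x(1,2) by (smt (verit) real_sqrt_gt_zero)
    then have C0: "0 \<le> C" using x(3) by (smt (verit) mult_nonpos_nonneg real_sqrt_ge_zero)
    have "x = (sqrt x)\<^sup>2" using x(1) by simp
    also have "\<dots> \<le> (C * sqrt y)\<^sup>2" using x by (intro power_mono) auto
    also have "\<dots> = C\<^sup>2 * y" using x(3) by (simp add: power_mult_distrib)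
    also have "\<dots> \<le> C\<^sup>2 * (M + q\<^sup>2 * x)" using x(4) by (intro mult_left_mono) auto
    finally show ?thesis using C0 by simp
  qed
  have bound: "\<exists>x. \<kappa> * real k \<le> x \<and> 0 \<le> C \<and> x \<le> C\<^sup>2 * (M + q\<^sup>2 * x)" if k: "0 < k" for k
  proof -
    obtain F where F: "test_fun F" "\<kappa> * real k \<le> (LINT v|lborel. (cmod (div_n2 F v))\<^sup>2)"
      "(LINT v|lborel. (cmod (div_n2 (euler (euler F)) v + of_real (Q - 2) * div_n2 (euler F) v))\<^sup>2)
      \<le> M + q\<^sup>2 * (LINT v|lborel. (cmod (div_n2 F v))\<^sup>2)" using M(3)[of k] unfolding q_def by blast
    have "0 < \<kappa> * real k" using M(2) k by simp
    then have "0 < (LINT v|lborel. (cmod (div_n2 F v))\<^sup>2)" using F(2) by linarith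
    from key[OF this C[OF F(1)] _ F(3)] show ?thesis using F(2) by auto
  qed
  have C0: "0 \<le> C" using bound[of 1] by auto
  then have "(C * q)\<^sup>2 < 1" using Cq q by (simp add: abs_square_less_1)
  then have pos: "0 < 1 - C\<^sup>2 * q\<^sup>2" by (simp add: power_mult_distrib)
  obtain k where k: "C\<^sup>2 * M / ((1 - C\<^sup>2 * q\<^sup>2) * \<kappa>) < real k" using reals_Archimedean2 by blast
  have "0 \<le> C\<^sup>2 * M / ((1 - C\<^sup>2 * q\<^sup>2) * \<kappa>)" using M pos by simp
  then have "0 < k" using k by simp
  then obtain x where x: "\<kappa> * real k \<le> x" "x \<le> C\<^sup>2 * (M + q\<^sup>2 * x)" using bound by blast
  have "(1 - C\<^sup>2 * q\<^sup>2) * x \<le> C\<^sup>2 * M" using x(2) by (simp add: algebra_simps)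
  moreover have "(1 - C\<^sup>2 * q\<^sup>2) * (\<kappa> * real k) \<le> (1 - C\<^sup>2 * q\<^sup>2) * x" using x(1) pos by simp
  moreover have "C\<^sup>2 * M < (1 - C\<^sup>2 * q\<^sup>2) * (\<kappa> * real k)" using k pos M(2) by (simp add: field_simps)
  ultimately show False by linarith
qed

end


section \<open>From the Lie group to a local group in a chart\<close>

locale lie_chart =
  fixes \<A> :: "('g::{topological_group_add, t2_space, second_countable_topology},
                'a::euclidean_space) chart set" and c :: "('g, 'a) chart"
  assumes lie: "lie_group \<A>" and cA: "c \<in> \<A>" and c0: "0 \<in> chart_dom c"
begin

lemma chart:
  assumes "d \<in> \<A>"
  shows "open (chart_dom d)" "open (chart_im d)"
    "z \<in> chart_im d \<Longrightarrow> chart_map d (chart_inv d z) = z" "z \<in> chart_im d \<Longrightarrow> chart_inv d z \<in> chart_dom d"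
    "x \<in> chart_dom d \<Longrightarrow> chart_inv d (chart_map d x) = x" "x \<in> chart_dom d \<Longrightarrow> chart_map d x \<in> chart_im d"
    "continuous_on (chart_dom d) (chart_map d)" "continuous_on (chart_im d) (chart_inv d)"
proof -
  have "is_chart d" using lie assms by (auto simp: lie_group_def smooth_atlas_def)
  then show "open (chart_dom d)" "open (chart_im d)"
    "z \<in> chart_im d \<Longrightarrow> chart_map d (chart_inv d z) = z" "z \<in> chart_im d \<Longrightarrow> chart_inv d z \<in> chart_dom d"
    "x \<in> chart_dom d \<Longrightarrow> chart_inv d (chart_map d x) = x" "x \<in> chart_dom d \<Longrightarrow> chart_map d x \<in> chart_im d"
    "continuous_on (chart_dom d) (chart_map d)" "continuous_on (chart_im d) (chart_inv d)"
    by (auto simp: is_chart_def homeomorphism_def)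
qed

lemma chart_around: "\<exists>d\<in>\<A>. x \<in> chart_dom d"
  using lie by (auto simp: lie_group_def smooth_atlas_def)

lemma smooth_mult:
  assumes "d \<in> \<A>" "d' \<in> \<A>" "d'' \<in> \<A>"
  shows "smooth_on {p \<in> chart_im d \<times> chart_im d'. chart_inv d (fst p) + chart_inv d' (snd p) \<in> chart_dom d''}
          (\<lambda>p. chart_map d'' (chart_inv d (fst p) + chart_inv d' (snd p)))"
  using lie assms unfolding lie_group_def by blast

lemma open_preimage_chart:
  assumes "d \<in> \<A>" "open S" "continuous_on (chart_im d) f"
  shows "open {z \<in> chart_im d. f z \<in> S}"
proof -
  have "open (chart_im d \<inter> f -` S)" by (rule continuous_open_preimage[OF assms(3) chart(2)[OF assms(1)] assms(2)])
  then show ?thesis by (simp add: vimage_def Int_def)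
qed

lemma translate_smooth:
  assumes d: "d \<in> \<A>" "d' \<in> \<A>"
  shows "open {z \<in> chart_im d. a + chart_inv d z \<in> chart_dom d'}"
    "smooth_on {z \<in> chart_im d. a + chart_inv d z \<in> chart_dom d'} (\<lambda>z. chart_map d' (a + chart_inv d z))"
proof -
  let ?T = "{z \<in> chart_im d. a + chart_inv d z \<in> chart_dom d'}"
  show o: "open ?T"
    by (rule open_preimage_chart[OF d(1) chart(1)[OF d(2)]])
      (intro continuous_on_add continuous_on_const chart(8)[OF d(1)])
  obtain b where b: "b \<in> \<A>" "a \<in> chart_dom b" using chart_around by blast
  have "smooth_on ?T (\<lambda>z. (chart_map b a, z))"
    by (intro smooth_on_Pair smooth_on_const smooth_on_id o)
  from smooth_on_compose[OF smooth_mult[OF b(1) d] this o]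
  show "smooth_on ?T (\<lambda>z. chart_map d' (a + chart_inv d z))"
    using chart(5,6)[OF b] by simp
qed

definition ori :: 'a where "ori = chart_map c 0"
definition kap :: "'a \<Rightarrow> 'g" where "kap y = chart_inv c (ori + y)"
definition kinv :: "'g \<Rightarrow> 'a" where "kinv x = chart_map c x - ori"

lemma ori_im: "ori \<in> chart_im c" unfolding ori_def by (rule chart(6)[OF cA c0])

lemma kap_0 [simp]: "kap 0 = 0" using chart(5)[OF cA c0] by (simp add: kap_def ori_def)

lemma kap_kinv: "x \<in> chart_dom c \<Longrightarrow> kap (kinv x) = x"
  using chart(5)[OF cA] by (simp add: kap_def kinv_def)

lemma kinv_kap: "ori + y \<in> chart_im c \<Longrightarrow> kinv (kap y) = y"
  using chart(3)[OF cA] by (simp add: kap_def kinv_def)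

lemma continuous_kap: "continuous_on {y. ori + y \<in> chart_im c} kap"
  unfolding kap_def[abs_def]
  by (rule continuous_on_compose2[OF chart(8)[OF cA]]) (auto intro!: continuous_intros)

lemma open_kap_dom: "open {y. ori + y \<in> chart_im c}"
  using open_vimage[OF chart(2)[OF cA], of "\<lambda>y. ori + y"] by (simp add: vimage_def continuous_intros)

definition mm :: "'a \<Rightarrow> 'a \<Rightarrow> 'a" where "mm x y = kinv (kap x + kap y)"

lemma rho_exists: "\<exists>\<rho>>0. \<forall>x y. norm x < \<rho> \<longrightarrow> norm y < \<rho> \<longrightarrow>
    ori + x \<in> chart_im c \<and> kap x + kap y \<in> chart_dom c"
proof -
  let ?S = "{y. ori + y \<in> chart_im c}"
  have "continuous_on (?S \<times> ?S) (\<lambda>p. kap (fst p) + kap (snd p))"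
    by (intro continuous_on_add continuous_on_compose2[OF continuous_kap])
      (auto intro!: continuous_intros)
  then have o: "open ((?S \<times> ?S) \<inter> (\<lambda>p. kap (fst p) + kap (snd p)) -` chart_dom c)"
    by (rule continuous_open_preimage) (auto intro: open_Times open_kap_dom chart(1)[OF cA])
  have i: "(0, 0) \<in> (?S \<times> ?S) \<inter> (\<lambda>p. kap (fst p) + kap (snd p)) -` chart_dom c"
    using ori_im c0 by simp
  obtain A A' where A: "open A" "open A'" "(0, 0) \<in> A \<times> A'"
    "A \<times> A' \<subseteq> (?S \<times> ?S) \<inter> (\<lambda>p. kap (fst p) + kap (snd p)) -` chart_dom c"
    by (rule open_prod_elim[OF o i])
  have "open (A \<inter> A')" "0 \<in> A \<inter> A'" using A by auto
  then obtain d where d: "d > 0" "ball 0 d \<subseteq> A \<inter> A'" using openE by blast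
  show ?thesis
  proof (intro exI[of _ d] conjI allI impI d(1))
    fix x y :: 'a assume "norm x < d" "norm y < d"
    then have "(x, y) \<in> A \<times> A'" using d by auto
    then show "ori + x \<in> chart_im c" "kap x + kap y \<in> chart_dom c" using A(4) by auto
  qed
qed

definition rho0 :: real where
  "rho0 = (SOME \<rho>. 0 < \<rho> \<and> (\<forall>x y. norm x < \<rho> \<longrightarrow> norm y < \<rho> \<longrightarrow>
    ori + x \<in> chart_im c \<and> kap x + kap y \<in> chart_dom c))"

lemma rho0: "0 < rho0" "norm x < rho0 \<Longrightarrow> ori + x \<in> chart_im c"
  "norm x < rho0 \<Longrightarrow> norm y < rho0 \<Longrightarrow> kap x + kap y \<in> chart_dom c"
  using someI_ex[OF rho_exists] unfolding rho0_def[symmetric] by blast+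

lemma kap_mm: "norm x < rho0 \<Longrightarrow> norm y < rho0 \<Longrightarrow> kap (mm x y) = kap x + kap y"
  unfolding mm_def by (rule kap_kinv[OF rho0(3)])

sublocale local_lie mm rho0
proof
  show "0 < rho0" by (rule rho0)
  let ?S = "ball (0::'a) rho0 \<times> ball (0::'a) rho0"
  have o: "open ?S" by (simp add: open_Times)
  have "smooth_on ?S (\<lambda>p. (ori + fst p, ori + snd p))"
    by (intro smooth_on_Pair smooth_on_add smooth_on_const smooth_on_bounded_linear
        bounded_linear_fst bounded_linear_snd o)
  from smooth_on_compose[OF smooth_mult[OF cA cA cA] this o]
  have "smooth_on ?S (\<lambda>p. chart_map c (kap (fst p) + kap (snd p)))"
    using rho0(2,3) by (auto simp: kap_def)
  then show "smooth_on ?S (\<lambda>p. mm (fst p) (snd p))"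
    unfolding mm_def kinv_def by (intro smooth_on_diff smooth_on_const o)
  show "mm x 0 = x" "mm 0 x = x" if "x \<in> ball 0 rho0" for x
    using kinv_kap rho0(2) that by (auto simp: mm_def)
  show "mm (mm x y) z = mm x (mm y z)"
    if "x \<in> ball 0 rho0" "y \<in> ball 0 rho0" "z \<in> ball 0 rho0" for x y z
    using that by (simp add: mm_def[of "mm x y"] mm_def[of x "mm y z"] kap_mm add.assoc)
qed

lemma kap_e: 
  assumes "norm x \<le> \<sigma>" "norm y \<le> \<sigma>"
  shows "kap (mm (e x) (e y)) = kap (e x) + kap (e y)"
  using e_in_U[OF assms(1)] e_in_U[OF assms(2)] by (simp add: kap_mm)

lemma kinv_kap_e: "norm x \<le> \<sigma> \<Longrightarrow> kinv (kap (e x)) = e x"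
  using e_in_U[of x] rho0(2) by (simp add: kinv_kap)

subsection \<open>One-parameter subgroups\<close>

text \<open>Multiplication by 2^k in additive notation, that is, the power of exponent 2^k in the
  group.\<close>

definition double :: "nat \<Rightarrow> 'g \<Rightarrow> 'g" where "double k = ((\<lambda>x. x + x) ^^ k)"

lemma double_0 [simp]: "double 0 x = x" and double_Suc: "double (Suc k) x = double k x + double k x"
  by (simp_all add: double_def)

lemma double_Suc': "double (Suc k) x = double k (x + x)"
  unfolding double_def by (subst funpow_Suc_right) simp

lemma double_commute:
  assumes "a + b = b + a"
  shows "double k a + double k b = double k b + double k a \<and> double k (a + b) = double k a + double k b"
proof (induction k)
  case (Suc k)
  then have cm: "double k a + double k b = double k b + double k a" by simp
  have "double k a + double k a + (double k b + double k b) = double k a + (double k a + double k b) + double k b" by (simp only: add.assoc)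
  also have "\<dots> = double k a + (double k b + double k a) + double k b" by (simp only: cm)
  also have "\<dots> = (double k a + double k b) + (double k a + double k b)" by (simp only: add.assoc)
  finally have 1: "double (Suc k) a + double (Suc k) b = (double k a + double k b) + (double k a + double k b)" by (simp only: double_Suc)
  have "double k b + double k b + (double k a + double k a) = double k b + (double k b + double k a) + double k a" by (simp only: add.assoc)
  also have "\<dots> = double k b + (double k a + double k b) + double k a" by (simp only: cm)
  also have "\<dots> = (double k b + double k a) + (double k b + double k a)" by (simp only: add.assoc)
  finally have 2: "double (Suc k) b + double (Suc k) a = (double k a + double k b) + (double k a + double k b)" by (simp only: double_Suc cm)
  show ?case using Suc 1 2 by (simp add: double_Suc)
qed (use assms in simp)

lemma continuous_double: "continuous_on S f \<Longrightarrow> continuous_on S (\<lambda>x. double k (f x))"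
  by (induction k) (auto simp: double_Suc intro: continuous_on_add)

definition halve :: "nat \<Rightarrow> 'a \<Rightarrow> 'a" where "halve k v = (1 / 2 ^ k) *\<^sub>R v"

text \<open>exp v is the power of exponent 2^k of exp (v / 2^k), which for large k lies in the range
  of the local exponential map. Completeness of invariant fields is thereby bypassed; by
  \<open>expG_eq\<close> the choice of k is immaterial.\<close>

definition expG :: "'a \<Rightarrow> 'g" where
  "expG v = (let k = (SOME k. norm (halve k v) < \<sigma>) in double k (kap (e (halve k v))))"

lemma norm_halve: "norm (halve k v) = norm v / 2 ^ k" by (simp add: halve_def)

lemma halve_small: "\<exists>k. \<forall>j\<ge>k. \<forall>v. norm v \<le> R \<longrightarrow> norm (halve j v) < \<sigma>"
proof -
  obtain k where k: "\<bar>R\<bar> / \<sigma> < 2 ^ k" using real_arch_pow[of 2 "\<bar>R\<bar> / \<sigma>"] by auto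
  have "norm (halve j v) < \<sigma>" if "k \<le> j" "norm v \<le> R" for j v
  proof -
    have "(2::real) ^ k \<le> 2 ^ j" by (rule power_increasing[OF that(1)]) simp
    then have "\<bar>R\<bar> / \<sigma> < 2 ^ j" using k by (rule less_le_trans[rotated])
    then have "\<bar>R\<bar> < \<sigma> * 2 ^ j" using sigma_pos by (simp add: field_simps)
    then have "norm v < \<sigma> * 2 ^ j" using that by linarith
    then show ?thesis by (simp add: norm_halve field_simps)
  qed
  then show ?thesis by blast
qed

lemma double_small:
  assumes "norm (halve k v) < \<sigma>" "k \<le> j"
  shows "double j (kap (e (halve j v))) = double k (kap (e (halve k v)))"
  using assms(2)
proof (induction rule: dec_induct)
  case (step i)
  have half: "halve i v = halve (Suc i) v + halve (Suc i) v"
    unfolding halve_def scaleR_left_distrib[symmetric] by (simp add: field_simps)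
  have "norm v / 2 ^ i \<le> norm v / 2 ^ k" using step(1) by (intro divide_left_mono power_increasing) auto
  then have i: "norm (halve i v) < \<sigma>" using assms(1) by (simp add: norm_halve)
  have "norm (halve (Suc i) v) = norm (halve i v) / 2" by (simp add: norm_halve)
  then have i2: "norm (halve (Suc i) v) < \<sigma>" using i norm_ge_zero[of "halve i v"] by linarith
  have "mm (e (halve (Suc i) v)) (e (halve (Suc i) v)) = e (halve i v)"
    using e_one_parameter[of 1 "halve (Suc i) v" 1] i i2 half by (simp add: scaleR_2)
  then have "kap (e (halve (Suc i) v)) + kap (e (halve (Suc i) v)) = kap (e (halve i v))"
    using kap_e i2 by (metis less_imp_le)
  then show ?case using step(3) by (simp add: double_Suc')
qed simp

lemma expG_eq:
  assumes "norm (halve k v) < \<sigma>"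
  shows "expG v = double k (kap (e (halve k v)))"
proof -
  define j where "j = (SOME k. norm (halve k v) < \<sigma>)"
  have j: "norm (halve j v) < \<sigma>" unfolding j_def by (rule someI[where P = "\<lambda>k. norm (halve k v) < \<sigma>", OF assms])
  have "expG v = double j (kap (e (halve j v)))" by (simp add: expG_def j_def Let_def)
  then show ?thesis using double_small[OF j, of k] double_small[OF assms, of j] by (cases "k \<le> j") auto
qed

lemma expG_small: "norm v < \<sigma> \<Longrightarrow> expG v = kap (e v)"
  using expG_eq[of 0 v] by (simp add: halve_def)

lemma expG_0 [simp]: "expG 0 = 0" using expG_small[of 0] sigma_pos by simp

text \<open>For large k the elements exp (s v / 2^k) and exp (t v / 2^k) are in the local range and
  commute, and the power of a product of commuting elements is the product of their powers.\<close>

lemma expG_add: "expG ((s + t) *\<^sub>R v) = expG (s *\<^sub>R v) + expG (t *\<^sub>R v)"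
proof -
  obtain k where k: "\<And>w. norm w \<le> norm (s *\<^sub>R v) + norm (t *\<^sub>R v) + norm ((s + t) *\<^sub>R v) \<Longrightarrow> norm (halve k w) < \<sigma>"
    using halve_small by (metis order_refl)
  have n: "norm (halve k (s *\<^sub>R v)) < \<sigma>" "norm (halve k (t *\<^sub>R v)) < \<sigma>" "norm (halve k ((s + t) *\<^sub>R v)) < \<sigma>"
    by (rule k; simp add: add_nonneg_nonneg)+
  define u where "u = halve k v"
  have u: "halve k (a *\<^sub>R v) = a *\<^sub>R u" for a by (simp add: u_def halve_def)
  note n' = n[unfolded u]
  have n'': "norm ((t + s) *\<^sub>R u) < \<sigma>" using n'(3) by (simp add: add.commute)
  have 1: "kap (e (s *\<^sub>R u)) + kap (e (t *\<^sub>R u)) = kap (e ((s + t) *\<^sub>R u))"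
    using e_one_parameter[OF n'] kap_e[OF less_imp_le[OF n'(1)] less_imp_le[OF n'(2)]] by simp
  have 2: "kap (e (t *\<^sub>R u)) + kap (e (s *\<^sub>R u)) = kap (e ((s + t) *\<^sub>R u))"
    using e_one_parameter[OF n'(2,1) n''] kap_e[OF less_imp_le[OF n'(2)] less_imp_le[OF n'(1)]] by (simp add: add.commute)
  have "kap (e (s *\<^sub>R u)) + kap (e (t *\<^sub>R u)) = kap (e (t *\<^sub>R u)) + kap (e (s *\<^sub>R u))" using 1 2 by simp
  from double_commute[OF this, of k] show ?thesis
    using expG_eq[OF n(1)] expG_eq[OF n(2)] expG_eq[OF n(3)] 1 unfolding u by simp
qed

lemma expG_minus: "expG (- v) = - expG v"
proof -
  have "expG v + expG (- v) = 0" using expG_add[of 1 "-1" v] by simp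
  then show ?thesis by (metis add.inverse_unique)
qed

lemma continuous_expG_line: "continuous_on UNIV (\<lambda>t. expG (t *\<^sub>R v))"
proof -
  have "continuous_on (ball 0 R) (\<lambda>t. expG (t *\<^sub>R v))" for R :: real
  proof -
    obtain k where k: "\<And>w. norm w \<le> R * norm v \<Longrightarrow> norm (halve k w) < \<sigma>" using halve_small by (metis order_refl)
    have small: "norm (t *\<^sub>R halve k v) < \<sigma>" if "t \<in> ball 0 R" for t
    proof -
      have "norm (t *\<^sub>R v) \<le> R * norm v" using that by (auto intro: mult_right_mono)
      from k[OF this] show ?thesis by (simp add: halve_def)
    qed
    have 1: "continuous_on (ball 0 R) (\<lambda>t. e (t *\<^sub>R halve k v))"
      by (intro continuous_at_imp_continuous_on ballI has_vector_derivative_continuous[OF e_deriv] small)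
    have 2: "continuous_on (ball 0 R) (\<lambda>t. kap (e (t *\<^sub>R halve k v)))"
      by (rule continuous_on_compose2[OF continuous_kap 1])
        (use small e_in_U rho0(2) in \<open>force intro: less_imp_le\<close>)
    have 3: "continuous_on (ball 0 R) (\<lambda>t. double k (kap (e (t *\<^sub>R halve k v))))" by (rule continuous_double[OF 2])
    have eq: "double k (kap (e (t *\<^sub>R halve k v))) = expG (t *\<^sub>R v)" if "t \<in> ball 0 R" for t
      using expG_eq[of k "t *\<^sub>R v"] small[OF that] by (simp add: halve_def)
    show ?thesis by (rule continuous_on_eq[OF 3 eq])
  qed
  then have "isCont (\<lambda>t. expG (t *\<^sub>R v)) t" for t
    using continuous_on_interior[of "ball 0 (\<bar>t\<bar> + 1)" "\<lambda>t. expG (t *\<^sub>R v)" t] by auto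
  then show ?thesis by (simp add: continuous_at_imp_continuous_on)
qed

text \<open>\<gamma> is assumed differentiable at 0 only; the homomorphism law spreads this to a
  neighbourhood and yields the left-invariant equation there. Uniqueness identifies \<gamma> with
  the local exponential at time 1 / 2^k, and k doublings reach time 1.\<close>

lemma one_parameter_unique:
  fixes \<gamma> :: "real \<Rightarrow> 'g"
  assumes cont: "continuous_on UNIV \<gamma>" and hom: "\<And>s t. \<gamma> (s + t) = \<gamma> s + \<gamma> t"
    and der: "((\<lambda>t. chart_map c (\<gamma> t)) has_vector_derivative v) (at 0)"
  shows "\<gamma> 1 = expG v"
proof -
  have "\<gamma> 0 + \<gamma> 0 = \<gamma> 0 + 0" using hom[of 0 0] by simp
  then have g0: "\<gamma> 0 = 0" by (rule add_left_imp_eq)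
  define y where "y t = kinv (\<gamma> t)" for t
  have y0: "y 0 = 0" by (simp add: y_def g0 kinv_def ori_def)
  have dy: "(y has_vector_derivative v) (at 0)"
    unfolding y_def kinv_def using has_vector_derivative_diff[OF der has_vector_derivative_const] by simp
  let ?S = "\<gamma> -` chart_dom c"
  have oS: "open ?S" using open_vimage[OF chart(1)[OF cA] cont] .
  have cy: "continuous_on ?S y" unfolding y_def kinv_def
    by (intro continuous_on_diff continuous_on_const continuous_on_compose2[OF chart(7)[OF cA]] continuous_on_subset[OF cont]) auto
  have o: "open (?S \<inter> y -` ball 0 r)" by (rule continuous_open_preimage[OF cy oS open_ball])
  have "0 \<in> ?S \<inter> y -` ball 0 r" using y0 g0 c0 r_pos by simp
  then obtain d0 where d0: "d0 > 0" "ball 0 d0 \<subseteq> ?S \<inter> y -` ball 0 r" using o openE by blast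
  have yd: "\<gamma> t \<in> chart_dom c" "norm (y t) < r" if "\<bar>t\<bar> < d0" for t
    using d0 that by (auto simp: subset_iff dist_real_def)
  have yU: "y t \<in> U" if "\<bar>t\<bar> < d0" for t using yd(2)[OF that] cball_r(2)[of "y t"] by simp
  have ode: "(y has_vector_derivative V (y t) v) (at t)" if t: "\<bar>t\<bar> < d0" for t
  proof -
    define d1 where "d1 = d0 - \<bar>t\<bar>"
    have d1: "0 < d1" using t by (simp add: d1_def)
    have "((\<lambda>h. mm (y t) (y h)) has_vector_derivative dm (y t) (y 0) (0, v)) (at 0)"
      by (intro m_curve dy has_vector_derivative_const yU t) (use d0 in simp)
    then have "((\<lambda>h. mm (y t) (y h)) has_vector_derivative V (y t) v) (at 0)" by (simp add: y0 V_def)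
    then have "((\<lambda>h. y (t + h)) has_vector_derivative V (y t) v) (at 0)"
    proof (rule has_vector_derivative_transform_within_open[of _ _ _ "ball 0 d1"])
      fix h :: real assume "h \<in> ball 0 d1"
      then have h: "\<bar>h\<bar> < d0" "\<bar>t + h\<bar> < d0" by (auto simp: d1_def dist_real_def)
      have "kap (y t) = \<gamma> t" "kap (y h) = \<gamma> h" using kap_kinv yd(1) t h by (auto simp: y_def)
      then show "mm (y t) (y h) = y (t + h)" by (simp add: mm_def y_def hom)
    qed (use d1 in auto)
    then have "(((\<lambda>h. y (t + h)) \<circ> (\<lambda>s. s - t)) has_vector_derivative 1 *\<^sub>R V (y t) v) (at t)"
      by (intro vector_diff_chain_at) (auto intro!: derivative_eq_intros)
    then show ?thesis by (simp add: o_def)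
  qed
  obtain k :: nat where k: "norm (halve k v) < \<sigma>" "1 / 2 ^ k < d0"
  proof -
    obtain k1 where k1: "\<And>j. k1 \<le> j \<Longrightarrow> norm (halve j v) < \<sigma>" using halve_small by (metis order_refl)
    obtain k2 where k2: "1 / d0 < 2 ^ k2" using real_arch_pow[of 2 "1 / d0"] by auto
    have "2 ^ k2 \<le> (2::real) ^ (max k1 k2)" by (intro power_increasing) auto
    then have "1 / d0 < 2 ^ max k1 k2" using k2 by linarith
    then have "1 / 2 ^ max k1 k2 < d0" using d0 by (simp add: field_simps)
    then show ?thesis using k1[of "max k1 k2"] that by auto
  qed
  define q where "q = 1 / (2::real) ^ k"
  have q: "0 < q" "q < d0" "halve k v = q *\<^sub>R v" using k by (auto simp: q_def halve_def)
  have "y (1 * q) = e (1 *\<^sub>R (q *\<^sub>R v))"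
  proof (rule ode_unique[where v = "q *\<^sub>R v" and f = "\<lambda>s. y (s * q)" and g = "\<lambda>s. e (s *\<^sub>R (q *\<^sub>R v))"])
    fix s :: real assume s: "s \<in> {0..1}"
    have "s * q \<le> 1 * q" "0 \<le> s * q" using s q by (auto intro!: mult_right_mono)
    then have sq: "\<bar>s * q\<bar> < d0" using q by linarith
    have sv: "norm (s *\<^sub>R (q *\<^sub>R v)) < \<sigma>"
    proof -
      have "\<bar>s\<bar> * norm (q *\<^sub>R v) \<le> 1 * norm (q *\<^sub>R v)" using s by (intro mult_right_mono) auto
      then have "norm (s *\<^sub>R (q *\<^sub>R v)) \<le> norm (q *\<^sub>R v)" by (metis mult_1 norm_scaleR)
      also have "norm (q *\<^sub>R v) < \<sigma>" using k(1) q(3) by simp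
      finally show ?thesis .
    qed
    have "(y \<circ> (\<lambda>s. s * q) has_vector_derivative q *\<^sub>R V (y (s * q)) v) (at s)"
      by (intro vector_diff_chain_at ode sq)
        (auto intro!: derivative_eq_intros simp: has_real_derivative_iff_has_vector_derivative[symmetric])
    moreover have "V (y (s * q)) (q *\<^sub>R v) = q *\<^sub>R V (y (s * q)) v"
      by (rule linear_scale[OF linear_V[OF yU[OF sq]]])
    ultimately show "((\<lambda>s. y (s * q)) has_vector_derivative V (y (s * q)) (q *\<^sub>R v)) (at s within {0..1})"
      by (auto simp: o_def intro: has_vector_derivative_at_within)
    show "((\<lambda>s. e (s *\<^sub>R (q *\<^sub>R v))) has_vector_derivative V (e (s *\<^sub>R (q *\<^sub>R v))) (q *\<^sub>R v)) (at s within {0..1})"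
      by (rule has_vector_derivative_at_within[OF e_deriv[OF sv]])
    show "norm (y (s * q)) \<le> r" using yd(2)[OF sq] by simp
    show "norm (e (s *\<^sub>R (q *\<^sub>R v))) \<le> r" by (rule norm_e_r[OF less_imp_le[OF sv]])
  qed (use y0 in auto)
  then have "kap (y q) = kap (e (halve k v))" using q by simp
  moreover have "kap (y q) = \<gamma> q" using kap_kinv yd(1)[of q] q by (simp add: y_def)
  ultimately have gq: "\<gamma> (1 / 2 ^ k) = kap (e (halve k v))" by (simp add: q_def)
  have "double j (\<gamma> (t / 2 ^ j)) = \<gamma> t" for j t
  proof (induction j arbitrary: t)
    case (Suc j)
    have "\<gamma> (t / 2 ^ Suc j) + \<gamma> (t / 2 ^ Suc j) = \<gamma> (t / 2 ^ j)" by (simp add: hom[symmetric])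
    then show ?case using Suc by (simp add: double_Suc')
  qed simp
  from this[of k 1] show ?thesis using gq expG_eq[OF k(1)] by simp
qed

lemma lie_exp_eq: "lie_exp c v = expG v"
  unfolding lie_exp_def
proof (rule the_equality)
  let ?g = "\<lambda>t. expG (t *\<^sub>R v)"
  have "continuous_on UNIV ?g"
    by (rule continuous_expG_line)
  moreover have "((\<lambda>t. chart_map c (?g t)) has_vector_derivative v) (at 0)"
  proof -
    have o: "open {t. norm (t *\<^sub>R v) < \<sigma>}" by (intro open_Collect_less continuous_intros)
    have "((\<lambda>t. ori + e (t *\<^sub>R v)) has_vector_derivative 0 + V (e (0 *\<^sub>R v)) v) (at 0)"
      by (intro has_vector_derivative_add has_vector_derivative_const e_deriv) (simp add: sigma_pos)
    then have "((\<lambda>t. ori + e (t *\<^sub>R v)) has_vector_derivative v) (at 0)" by simp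
    then show ?thesis
    proof (rule has_vector_derivative_transform_within_open[OF _ o])
      fix t assume "t \<in> {t. norm (t *\<^sub>R v) < \<sigma>}"
      then have t: "norm (t *\<^sub>R v) < \<sigma>" by blast
      show "ori + e (t *\<^sub>R v) = chart_map c (?g t)"
        using kinv_kap_e[OF less_imp_le[OF t]] expG_small[OF t]
        by (metis kinv_def diff_add_cancel add.commute)
    qed (simp add: sigma_pos)
  qed
  ultimately show "\<exists>\<gamma>. continuous_on UNIV \<gamma> \<and> (\<forall>s t. \<gamma> (s + t) = \<gamma> s + \<gamma> t) \<and>
    ((\<lambda>t. chart_map c (\<gamma> t)) has_vector_derivative v) (at 0) \<and> expG v = \<gamma> 1"
    using expG_add by (intro exI[of _ ?g]) auto
next
  fix x assume "\<exists>\<gamma>. continuous_on UNIV \<gamma> \<and> (\<forall>s t. \<gamma> (s + t) = \<gamma> s + \<gamma> t) \<and>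
    ((\<lambda>t. chart_map c (\<gamma> t)) has_vector_derivative v) (at 0) \<and> x = \<gamma> 1"
  then show "x = expG v" using one_parameter_unique by blast
qed

subsection \<open>The Lie bracket in the chart\<close>

definition pull :: "('g \<Rightarrow> 'b::real_normed_vector) \<Rightarrow> 'g \<Rightarrow> 'a \<Rightarrow> 'b" where
  "pull f x y = f (x + kap y)"

lemma pull_smooth:
  assumes f: "smooth_fun \<A> f"
  shows "\<exists>T. open T \<and> 0 \<in> T \<and> T \<subseteq> U \<and> smooth_on T (pull f x)"
proof -
  obtain d where d: "d \<in> \<A>" "x \<in> chart_dom d" using chart_around by blast
  let ?P = "{z \<in> chart_im c. x + chart_inv c z \<in> chart_dom d}"
  define T where "T = U \<inter> (\<lambda>y. ori + y) -` ?P"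
  have oT: "open T" unfolding T_def
    by (intro open_Int open_ball open_vimage translate_smooth(1)[OF cA d(1)] continuous_intros)
  have T0: "0 \<in> T" using ori_im d(2) kap_0 by (simp add: T_def kap_def)
  have 1: "smooth_on T (\<lambda>y. ori + y)" by (intro smooth_on_add smooth_on_const smooth_on_id oT)
  have 2: "smooth_on T (\<lambda>y. chart_map d (x + chart_inv c (ori + y)))"
    by (rule smooth_on_compose[OF translate_smooth(2)[OF cA d(1)] 1 oT]) (auto simp: T_def)
  have 3: "smooth_on (chart_im d) (f \<circ> chart_inv d)" using f d(1) by (simp add: smooth_fun_def)
  have "smooth_on T (\<lambda>y. (f \<circ> chart_inv d) (chart_map d (x + chart_inv c (ori + y))))"
    by (rule smooth_on_compose[OF 3 2 oT]) (auto simp: T_def intro: chart(6)[OF d(1)])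
  then have "smooth_on T (pull f x)"
    by (rule smooth_on_cong[OF _ oT]) (auto simp: T_def pull_def kap_def chart(5)[OF d(1)])
  then show ?thesis using oT T0 by (intro exI[of _ T]) (auto simp: T_def)
qed

lemma left_inv_field_eq:
  assumes T: "open T" "T \<subseteq> U" "smooth_on T (pull f x)" and y: "y \<in> T"
  shows "left_inv_field c w f (x + kap y) = frechet_derivative (pull f x) (at y) (V y w)"
proof -
  have yU: "y \<in> U" using T y by blast
  have "((\<lambda>t. mm y (t *\<^sub>R w)) has_vector_derivative dm y (0 *\<^sub>R w) (0, w)) (at 0)"
    by (intro m_curve has_vector_derivative_const yU) (auto intro!: derivative_eq_intros)
  then have c1: "((\<lambda>t. mm y (t *\<^sub>R w)) has_vector_derivative V y w) (at 0)" by (simp add: V_def)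
  have m0: "mm y (0 *\<^sub>R w) = y" using m_0_right[OF yU] by simp
  have "(pull f x has_derivative frechet_derivative (pull f x) (at y)) (at (mm y (0 *\<^sub>R w)))"
    unfolding m0 by (rule smooth_on_has_derivative[OF T(3) y])
  then have "(pull f x \<circ> (\<lambda>t. mm y (t *\<^sub>R w)) has_vector_derivative frechet_derivative (pull f x) (at y) (V y w)) (at 0)"
    using vector_derivative_diff_chain_within[OF c1 has_derivative_at_withinI] by blast
  then have "((\<lambda>t. pull f x (mm y (t *\<^sub>R w))) has_vector_derivative frechet_derivative (pull f x) (at y) (V y w)) (at 0)"
    by (simp add: o_def)
  moreover have o: "open {t. norm (t *\<^sub>R w) < rho0}" by (intro open_Collect_less continuous_intros)
  ultimately have "((\<lambda>t. f (x + kap y + chart_inv c (chart_map c 0 + t *\<^sub>R w))) has_vector_derivative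
      frechet_derivative (pull f x) (at y) (V y w)) (at 0)"
  proof (rule has_vector_derivative_transform_within_open)
    fix t assume "t \<in> {t. norm (t *\<^sub>R w) < rho0}"
    then show "pull f x (mm y (t *\<^sub>R w)) = f (x + kap y + chart_inv c (chart_map c 0 + t *\<^sub>R w))"
      using kap_mm[of y "t *\<^sub>R w"] yU by (simp add: pull_def add.assoc kap_def ori_def)
  qed simp
  then show ?thesis unfolding left_inv_field_def by (rule vector_derivative_at)
qed

text \<open>Each iterated derivative consists of the Hessian of the pulled-back function and its
  first derivative along \<open>B v w\<close>. The Hessian is symmetric and drops out of the
  commutator, which leaves B v w - B w v.\<close>

lemma bracket_formula:
  fixes f :: "'g \<Rightarrow> real"
  assumes f: "smooth_fun \<A> f"
  shows "left_inv_field c (br v w) f x = left_inv_field c v (left_inv_field c w f) x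
      - left_inv_field c w (left_inv_field c v f) x"
proof -
  obtain T where T: "open T" "0 \<in> T" "T \<subseteq> U" "smooth_on T (pull f x)" using pull_smooth[OF f] by blast
  let ?F = "pull f x"
  let ?D = "\<lambda>y. frechet_derivative ?F (at y)"
  define H where "H a b = frechet_derivative (\<lambda>y. ?D y b) (at 0) a" for a b
  have lD: "linear (?D y)" if "y \<in> T" for y
    using smooth_on_has_derivative[OF T(4) that] has_derivative_linear by blast
  have dH: "((\<lambda>y. ?D y b) has_derivative (\<lambda>a. H a b)) (at 0)" for b
    unfolding H_def by (rule smooth_on_has_derivative[OF smooth_on_frechet_derivative[OF T(4)] T(2)])
  have sym: "H a b = H b a" for a b
    unfolding H_def by (rule second_derivative_symmetric[OF T(4,1,2)])
  have lH: "linear (\<lambda>a. H a b)" for b using dH has_derivative_linear by blast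
  \<comment> \<open>The Hessian form, expanded in its second argument because \<open>H\<close> is
    linear by construction in the first.\<close>
  define S where "S a b = (\<Sum>i\<in>Basis. (b \<bullet> i) * H a i)" for a b
  have S_sym: "S a b = S b a" for a b
  proof -
    have ex: "S a b = (\<Sum>i\<in>Basis. \<Sum>j\<in>Basis. (b \<bullet> i) * ((a \<bullet> j) * H j i))" for a b
      unfolding S_def by (subst linear_basis_expansion[OF lH, of a]) (simp add: sum_distrib_left)
    show ?thesis unfolding ex[of a b] ex[of b a]
      by (subst sum.swap) (simp add: mult_ac sym)
  qed
  have second: "left_inv_field c v (left_inv_field c w f) x = S v w + ?D 0 (B v w)" for v w
  proof -
    have dV: "((\<lambda>t. V (t *\<^sub>R v) w) has_vector_derivative B v w) (at 0)"
    proof -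
      have "((\<lambda>t. t *\<^sub>R v) has_vector_derivative v) (at 0)" by (auto intro!: derivative_eq_intros)
      from vector_derivative_diff_chain_within[OF this has_derivative_at_withinI, of "\<lambda>x. V x w" "\<lambda>u. B u w"]
      show ?thesis using V_derivative by (simp add: o_def)
    qed
    have dD: "((\<lambda>t. ?D (t *\<^sub>R v) b) has_vector_derivative H v b) (at 0)" for b
    proof -
      have "((\<lambda>t. t *\<^sub>R v) has_vector_derivative v) (at 0)" by (auto intro!: derivative_eq_intros)
      from vector_derivative_diff_chain_within[OF this has_derivative_at_withinI, of "\<lambda>y. ?D y b" "\<lambda>a. H a b"]
      show ?thesis using dH by (simp add: o_def)
    qed
    have "((\<lambda>t. \<Sum>b\<in>Basis. (V (t *\<^sub>R v) w \<bullet> b) * ?D (t *\<^sub>R v) b) has_vector_derivative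
        (\<Sum>b\<in>Basis. (V (0 *\<^sub>R v) w \<bullet> b) * H v b + (B v w \<bullet> b) * ?D (0 *\<^sub>R v) b)) (at 0)"
      by (intro has_vector_derivative_sum bounded_bilinear.has_vector_derivative[OF bounded_bilinear_mult]
          bounded_linear.has_vector_derivative[OF bounded_linear_inner_left] dV dD)
    moreover have "(\<Sum>b\<in>Basis. (V (0 *\<^sub>R v) w \<bullet> b) * H v b + (B v w \<bullet> b) * ?D (0 *\<^sub>R v) b) = S v w + ?D 0 (B v w)"
      using linear_basis_expansion[OF lD[OF T(2)], of "B v w"] by (simp add: S_def sum.distrib)
    ultimately have d: "((\<lambda>t. \<Sum>b\<in>Basis. (V (t *\<^sub>R v) w \<bullet> b) * ?D (t *\<^sub>R v) b) has_vector_derivative S v w + ?D 0 (B v w)) (at 0)"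
      by simp
    have o: "open ((\<lambda>t. t *\<^sub>R v) -` T)" by (intro open_vimage T(1) continuous_intros)
    have "((\<lambda>t. left_inv_field c w f (x + chart_inv c (chart_map c 0 + t *\<^sub>R v))) has_vector_derivative S v w + ?D 0 (B v w)) (at 0)"
    proof (rule has_vector_derivative_transform_within_open[OF d o])
      fix t assume "t \<in> (\<lambda>t. t *\<^sub>R v) -` T"
      then have t: "t *\<^sub>R v \<in> T" by simp
      show "(\<Sum>b\<in>Basis. (V (t *\<^sub>R v) w \<bullet> b) * ?D (t *\<^sub>R v) b) = left_inv_field c w f (x + chart_inv c (chart_map c 0 + t *\<^sub>R v))"
        using left_inv_field_eq[OF T(1,3,4) t, of w] linear_basis_expansion[OF lD[OF t], of "V (t *\<^sub>R v) w"]
        by (simp add: kap_def ori_def)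
    qed (use T in simp)
    then show ?thesis unfolding left_inv_field_def[of c v] by (rule vector_derivative_at)
  qed
  have "left_inv_field c (br v w) f x = ?D 0 (br v w)"
    using left_inv_field_eq[OF T(1,3,4,2), of "br v w"] by simp
  then show ?thesis unfolding second br_def using S_sym[of v w] by (simp add: linear_diff[OF lD[OF T(2)]])
qed

text \<open>\<open>lie_bracket\<close> tests against functions that are smooth on the whole group,
  so chart coordinates have to be cut off and extended by 0. They separate tangent vectors at the
  identity and make the description of the bracket unique.\<close>

lemma coordinate_function:
  assumes b: "b \<in> Basis"
  shows "\<exists>f :: 'g \<Rightarrow> real. smooth_fun \<A> f \<and> (\<forall>u. left_inv_field c u f 0 = u \<bullet> b)"
proof -
  define s where "s = rho0 / 2"
  have s: "0 < s" "\<And>y. y \<in> cball 0 s \<Longrightarrow> ori + y \<in> chart_im c"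
  proof -
    show "0 < s" using rho0(1) by (simp add: s_def)
    fix y :: 'a assume "y \<in> cball 0 s"
    then have "norm y \<le> rho0 / 2" by (simp add: s_def)
    then have "norm y < rho0" using rho0(1) by linarith
    then show "ori + y \<in> chart_im c" by (rule rho0(2))
  qed
  obtain \<psi> :: "'a \<Rightarrow> real" where \<psi>: "smooth_on UNIV \<psi>" "\<And>x. x \<in> ball 0 (s / 2) \<Longrightarrow> \<psi> x = 1" "\<And>x. x \<notin> ball 0 s \<Longrightarrow> \<psi> x = 0"
    using bump_function_exists[OF s(1), of 0] by metis
  define F where "F y = \<psi> y * (y \<bullet> b)" for y
  have sF: "smooth_on UNIV F" unfolding F_def
    by (intro smooth_on_bilinear[OF bounded_bilinear_mult] \<psi> smooth_on_bounded_linear bounded_linear_inner_left open_UNIV)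
  define f where "f x = (if x \<in> chart_dom c then F (kinv x) else 0)" for x
  let ?K = "kap ` cball 0 s"
  have "compact ?K"
    by (intro compact_continuous_image continuous_on_subset[OF continuous_kap]) (use s in auto)
  \<comment> \<open>Closedness in the whole group, from compactness and the Hausdorff property, is
    what makes the extension by 0 smooth in every other chart.\<close>
  then have cK: "closed ?K" by (rule compact_imp_closed)
  have fz: "f x = 0" if "x \<notin> ?K" for x
  proof (rule ccontr)
    assume "f x \<noteq> 0"
    then have x: "x \<in> chart_dom c" "\<psi> (kinv x) \<noteq> 0" by (auto simp: f_def F_def split: if_splits)
    then have "kinv x \<in> cball 0 s" using \<psi>(3)[of "kinv x"] by force
    then show False using that kap_kinv[OF x(1)] by (metis imageI)
  qed
  have "smooth_fun \<A> f"
    unfolding smooth_fun_def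
  proof (intro ballI smooth_on_local)
    fix d z assume d: "d \<in> \<A>" and z: "z \<in> chart_im d"
    show "\<exists>T. open T \<and> z \<in> T \<and> smooth_on T (f \<circ> chart_inv d)"
    proof (cases "chart_inv d z \<in> chart_dom c")
      case True
      let ?T = "{z \<in> chart_im d. 0 + chart_inv d z \<in> chart_dom c}"
      note tr = translate_smooth[OF d cA, of 0]
      have "smooth_on ?T (\<lambda>z. chart_map c (0 + chart_inv d z) - ori)"
        by (intro smooth_on_diff smooth_on_const tr)
      from smooth_on_compose[OF sF this tr(1)]
      have "smooth_on ?T (\<lambda>z. F (chart_map c (0 + chart_inv d z) - ori))" by simp
      then have "smooth_on ?T (f \<circ> chart_inv d)"
        by (rule smooth_on_cong[OF _ tr(1)]) (simp add: f_def kinv_def)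
      then show ?thesis using tr(1) True z by (intro exI[of _ ?T]) simp
    next
      case False
      let ?T = "{z \<in> chart_im d. chart_inv d z \<in> - ?K}"
      have o: "open ?T" by (rule open_preimage_chart[OF d _ chart(8)[OF d]]) (use cK in auto)
      have "smooth_on ?T (f \<circ> chart_inv d)"
        by (rule smooth_on_cong[OF smooth_on_const[OF o, of 0] o]) (simp add: fz)
      moreover have "chart_inv d z \<notin> ?K"
        using False s(2) chart(4)[OF cA] by (auto simp: kap_def)
      ultimately show ?thesis using o z by (intro exI[of _ ?T]) simp
    qed
  qed
  moreover have "left_inv_field c u f 0 = u \<bullet> b" for u
  proof -
    have o: "open {t. norm (t *\<^sub>R u) < s / 2}" by (intro open_Collect_less continuous_intros)
    have "((\<lambda>t. t * (u \<bullet> b)) has_vector_derivative u \<bullet> b) (at 0)"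
      by (auto intro!: derivative_eq_intros simp: has_real_derivative_iff_has_vector_derivative[symmetric])
    then have "((\<lambda>t. f (0 + chart_inv c (chart_map c 0 + t *\<^sub>R u))) has_vector_derivative u \<bullet> b) (at 0)"
    proof (rule has_vector_derivative_transform_within_open[OF _ o])
      fix t assume "t \<in> {t. norm (t *\<^sub>R u) < s / 2}"
      then have n: "norm (t *\<^sub>R u) < s / 2" by blast
      then have "norm (t *\<^sub>R u) \<le> s" using s(1) by linarith
      then have t: "t *\<^sub>R u \<in> ball 0 (s / 2)" "t *\<^sub>R u \<in> cball 0 s" using n by simp_all
      have im: "ori + t *\<^sub>R u \<in> chart_im c" using s(2) t by blast
      then have "f (kap (t *\<^sub>R u)) = F (t *\<^sub>R u)"
        using chart(4)[OF cA im] kinv_kap[OF im] by (simp add: f_def kap_def)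
      then show "t * (u \<bullet> b) = f (0 + chart_inv c (chart_map c 0 + t *\<^sub>R u))"
        using \<psi>(2)[OF t(1)] by (simp add: F_def kap_def ori_def)
    qed (use s in simp)
    then show ?thesis unfolding left_inv_field_def by (rule vector_derivative_at)
  qed
  ultimately show ?thesis by (intro exI[of _ f] conjI allI)
qed

lemma lie_bracket_eq: "lie_bracket \<A> c v w = br v w"
  unfolding lie_bracket_def
proof (rule the_equality)
  show "\<forall>f. smooth_fun \<A> f \<longrightarrow> (\<forall>x. left_inv_field c (br v w) f x =
      left_inv_field c v (left_inv_field c w f) x - left_inv_field c w (left_inv_field c v f) x)"
    by (intro allI impI bracket_formula)
  fix u assume u: "\<forall>f. smooth_fun \<A> f \<longrightarrow> (\<forall>x. left_inv_field c u f x =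
      left_inv_field c v (left_inv_field c w f) x - left_inv_field c w (left_inv_field c v f) x)"
  show "u = br v w"
  proof (rule euclidean_eqI)
    fix b :: 'a assume b: "b \<in> Basis"
    from coordinate_function[OF b] show "u \<bullet> b = br v w \<bullet> b"
    proof (elim exE conjE)
      fix f :: "'g \<Rightarrow> real"
      assume f: "smooth_fun \<A> f" and fu: "\<forall>u. left_inv_field c u f 0 = u \<bullet> b"
      note 1 = spec[OF mp[OF spec[OF u, of f] f], of 0]
      note 2 = bracket_formula[OF f, of v w 0]
      show ?thesis using trans[OF 1 2[symmetric]] fu by simp
    qed
  qed
qed

end


section \<open>Dilations of the Lie algebra\<close>

text \<open>Coordinates in which A is diagonal: P sends the standard basis to eigenvectors, which
  need not be orthogonal.\<close>

locale eigen_basis =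
  fixes A P P' :: "'a::euclidean_space \<Rightarrow> 'a" and wt :: "'a \<Rightarrow> real"
  assumes A_lin: "linear A" and P_linear: "linear P" and P'_linear: "linear P'"
    and P_P' [simp]: "P (P' v) = v" and P'_P [simp]: "P' (P v) = v"
    and wt_pos: "b \<in> Basis \<Longrightarrow> 0 < wt b" and A_P: "b \<in> Basis \<Longrightarrow> A (P b) = wt b *\<^sub>R P b"

lemma eigen_basis_exists:
  assumes "diagonalisable_pos A"
  shows "\<exists>P P' wt. eigen_basis A P P' wt"
proof -
  obtain B where lA: "linear A" and B: "independent B" "span B = UNIV" "\<forall>b\<in>B. \<exists>\<nu>>0. A b = \<nu> *\<^sub>R b"
    using assms by (auto simp: diagonalisable_pos_def)
  have card: "card B = DIM('a)" using B dim_eq_card[of B UNIV] by (simp add: dim_UNIV)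
  have "\<exists>f::'a \<Rightarrow> 'a. linear f \<and> f ` Basis = B \<and> f ` UNIV = UNIV \<and> inj_on f UNIV"
    by (rule basis_to_basis_subspace_isomorphism) (use B card in \<open>auto simp: independent_Basis dim_UNIV\<close>)
  then obtain P :: "'a \<Rightarrow> 'a" where P: "linear P" "P ` Basis = B" "inj P" "surj P" by blast
  obtain \<nu> where \<nu>: "\<And>b. b \<in> B \<Longrightarrow> 0 < \<nu> b \<and> A b = \<nu> b *\<^sub>R b" using bchoice[OF B(3)] by blast
  have "eigen_basis A P (inv P) (\<lambda>b. \<nu> (P b))"
  proof (rule eigen_basis.intro)
    show "linear (inv P)" by (rule inj_linear_imp_inv_linear[OF P(1,3)])
    show "P (inv P v) = v" "inv P (P v) = v" for v using P by (simp_all add: surj_f_inv_f)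
    show "0 < \<nu> (P b)" "A (P b) = \<nu> (P b) *\<^sub>R P b" if "b \<in> Basis" for b
      using \<nu>[of "P b"] P(2) that by auto
  qed (rule lA P)+
  then show ?thesis by blast
qed

context eigen_basis
begin

lemma expand: "v = (\<Sum>b\<in>Basis. (P' v \<bullet> b) *\<^sub>R P b)"
  using linear_basis_expansion[OF P_linear, of "P' v"] by simp

lemma A_power: "(A ^^ k) v = (\<Sum>b\<in>Basis. (wt b ^ k * (P' v \<bullet> b)) *\<^sub>R P b)"
proof (induction k)
  case 0
  show ?case using expand[of v] by simp
next
  case (Suc k)
  show ?case
    by (simp add: Suc linear_sum[OF A_lin] linear_scale[OF A_lin] A_P mult_ac)
qed

lemma dilation_eq: "0 < h \<Longrightarrow> dilation_alg A h v = (\<Sum>b\<in>Basis. (h powr wt b * (P' v \<bullet> b)) *\<^sub>R P b)"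
proof -
  assume h: "0 < h"
  have "(\<lambda>k. \<Sum>b\<in>Basis. ((ln h * wt b) ^ k /\<^sub>R fact k) *\<^sub>R ((P' v \<bullet> b) *\<^sub>R P b)) sums
      (\<Sum>b\<in>Basis. exp (ln h * wt b) *\<^sub>R ((P' v \<bullet> b) *\<^sub>R P b))"
    by (intro sums_sum bounded_linear.sums[OF bounded_linear_scaleR_left] exp_converges)
  then have "(\<lambda>k. (ln h ^ k / fact k) *\<^sub>R (A ^^ k) v) sums
      (\<Sum>b\<in>Basis. (h powr wt b * (P' v \<bullet> b)) *\<^sub>R P b)"
    using h by (simp add: A_power scaleR_sum_right power_mult_distrib powr_def field_simps)
  then show ?thesis by (simp add: dilation_alg_def sums_iff)
qed

lemma P_sum: "P (\<Sum>b\<in>Basis. f b *\<^sub>R b) = (\<Sum>b\<in>Basis. f b *\<^sub>R P b)"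
  by (simp add: linear_sum[OF P_linear] linear_scale[OF P_linear])

lemma P'_dilation: "0 < h \<Longrightarrow> b \<in> Basis \<Longrightarrow> P' (dilation_alg A h v) \<bullet> b = h powr wt b * (P' v \<bullet> b)"
  by (simp add: dilation_eq P_sum[symmetric])

lemma eq_by_coords: "(\<And>b. b \<in> Basis \<Longrightarrow> P' v \<bullet> b = P' w \<bullet> b) \<Longrightarrow> v = w"
  by (metis P_P' euclidean_eqI)

lemma dilation_linear: "0 < h \<Longrightarrow> linear (dilation_alg A h)"
proof (rule linearI)
  assume h: "0 < h"
  show "dilation_alg A h (v + w) = dilation_alg A h v + dilation_alg A h w" for v w
    by (rule eq_by_coords) (simp add: h P'_dilation linear_add[OF P'_linear] inner_left_distrib distrib_left)
  show "dilation_alg A h (s *\<^sub>R v) = s *\<^sub>R dilation_alg A h v" for s v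
    by (rule eq_by_coords) (simp add: h P'_dilation linear_scale[OF P'_linear])
qed

lemma dilation_1: "dilation_alg A 1 v = v"
  by (rule eq_by_coords) (simp add: P'_dilation)

lemma dilation_mult: "0 < h \<Longrightarrow> 0 < s \<Longrightarrow> dilation_alg A (h * s) v = dilation_alg A h (dilation_alg A s v)"
  by (rule eq_by_coords) (simp add: P'_dilation powr_mult)

definition wmin :: real where "wmin = Min (wt ` Basis)"
definition wmax :: real where "wmax = Max (wt ` Basis)"

lemma wmin_pos: "0 < wmin" and wmin_le: "b \<in> Basis \<Longrightarrow> wmin \<le> wt b" and le_wmax: "b \<in> Basis \<Longrightarrow> wt b \<le> wmax"
  using wt_pos by (auto simp: wmin_def wmax_def)

text \<open>Bounds the passage to eigencoordinates and back; the summand 1 makes it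
  positive.\<close>

definition wconst :: real where
  "wconst = onorm P' * (\<Sum>b\<in>Basis. norm (P b)) + 1"

lemma wconst_pos: "0 < wconst"
  unfolding wconst_def
  by (intro add_nonneg_pos mult_nonneg_nonneg onorm_pos_le sum_nonneg)
    (use P'_linear linear_linear in \<open>auto simp: linear_conv_bounded_linear\<close>)

lemma dilation_bound:
  assumes h: "0 < h" and k: "\<And>b. b \<in> Basis \<Longrightarrow> h powr wt b \<le> k"
  shows "norm (dilation_alg A h v) \<le> wconst * k * norm v"
proof -
  have bl: "bounded_linear P'" using P'_linear linear_conv_bounded_linear by blast
  obtain b0 :: 'a where b0: "b0 \<in> Basis" using nonempty_Basis by blast
  have k0: "0 \<le> k" using k[OF b0] powr_ge_zero[of h "wt b0"] by linarith
  have "norm (dilation_alg A h v) \<le> (\<Sum>b\<in>Basis. k * (onorm P' * norm v) * norm (P b))"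
    unfolding dilation_eq[OF h]
  proof (rule sum_norm_le)
    fix b :: 'a assume b: "b \<in> Basis"
    have "\<bar>P' v \<bullet> b\<bar> \<le> onorm P' * norm v"
      using Basis_le_norm[OF b, of "P' v"] onorm[OF bl, of v] by linarith
    then have "h powr wt b * \<bar>P' v \<bullet> b\<bar> * norm (P b) \<le> k * (onorm P' * norm v) * norm (P b)"
      using k[OF b] k0 by (intro mult_right_mono mult_mono) auto
    then show "norm ((h powr wt b * (P' v \<bullet> b)) *\<^sub>R P b) \<le> k * (onorm P' * norm v) * norm (P b)"
      by (simp add: abs_mult)
  qed
  moreover have "(\<Sum>b\<in>Basis. k * (onorm P' * norm v) * norm (P b)) = (wconst - 1) * k * norm v"
    by (simp add: wconst_def sum_distrib_left[symmetric] mult_ac)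
  moreover have "(wconst - 1) * k * norm v \<le> wconst * k * norm v"
    using k0 by (intro mult_right_mono) auto
  ultimately show ?thesis by linarith
qed

lemma dilation_small: "0 < h \<Longrightarrow> h \<le> 1 \<Longrightarrow> norm (dilation_alg A h v) \<le> wconst * h powr wmin * norm v"
  by (intro dilation_bound powr_mono') (auto intro: wmin_le)

lemma dilation_big: "1 \<le> h \<Longrightarrow> norm (dilation_alg A h v) \<le> wconst * h powr wmax * norm v"
  by (intro dilation_bound powr_mono) (auto intro: le_wmax)

lemma dilation_exp: "dilation_alg A (exp t) v = (\<Sum>b\<in>Basis. (exp (wt b * t) * (P' v \<bullet> b)) *\<^sub>R P b)"
  by (simp add: dilation_eq powr_def)

lemma dilation_smooth: "smooth_on UNIV (\<lambda>p. dilation_alg A (exp (fst p)) (snd p))"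
proof -
  have 1: "smooth_on UNIV (\<lambda>p::real \<times> 'a. exp (wt b * fst p))" for b
    by (rule smooth_on_compose[OF smooth_on_exp])
      (auto intro!: smooth_on_bounded_linear bounded_linear_mult_right[THEN bounded_linear_compose] bounded_linear_fst)
  have "linear (\<lambda>p::real \<times> 'a. P' (snd p) \<bullet> b)" for b
    by (rule linearI) (simp_all add: linear_add[OF P'_linear] linear_scale[OF P'_linear] inner_left_distrib)
  then have 2: "smooth_on UNIV (\<lambda>p::real \<times> 'a. P' (snd p) \<bullet> b)" for b
    by (intro smooth_on_bounded_linear) (simp_all add: linear_conv_bounded_linear)
  show ?thesis
    unfolding dilation_exp
    by (intro smooth_on_sum smooth_on_bilinear[OF bounded_bilinear_scaleR] smooth_on_bilinear[OF bounded_bilinear_mult]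
        smooth_on_const 1 2 open_UNIV finite_Basis)
qed

lemma dilation_deriv: "((\<lambda>t. dilation_alg A (exp t) v) has_vector_derivative A v) (at 0)"
proof -
  have "((\<lambda>t. exp (wt b * t) * (P' v \<bullet> b)) has_real_derivative wt b * (P' v \<bullet> b)) (at 0)" for b
    by (auto intro!: derivative_eq_intros)
  then have "((\<lambda>t. \<Sum>b\<in>Basis. (exp (wt b * t) * (P' v \<bullet> b)) *\<^sub>R P b) has_vector_derivative
      (\<Sum>b\<in>Basis. (wt b * (P' v \<bullet> b)) *\<^sub>R P b)) (at 0)"
    by (intro has_vector_derivative_sum bounded_linear.has_vector_derivative[OF bounded_linear_scaleR_left])
      (simp add: has_real_derivative_iff_has_vector_derivative)
  then show ?thesis using A_power[of 1 v] by (simp add: dilation_exp)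
qed

lemma homogeneous_dim_eq: "homogeneous_dim A = (\<Sum>b\<in>Basis. wt b)"
proof -
  have "homogeneous_dim A = (\<Sum>b\<in>Basis. \<Sum>i\<in>Basis. wt i * ((P i \<bullet> b) * (P' b \<bullet> i)))"
    using A_power[of 1] by (simp add: homogeneous_dim_def inner_sum_left mult_ac)
  also have "\<dots> = (\<Sum>i\<in>Basis. wt i * (\<Sum>b\<in>Basis. (P i \<bullet> b) * (P' b \<bullet> i)))"
    by (subst sum.swap) (simp add: sum_distrib_left)
  also have "\<dots> = (\<Sum>i\<in>Basis. wt i)"
  proof (rule sum.cong)
    fix i :: 'a assume i: "i \<in> Basis"
    have "P' (P i) \<bullet> i = (\<Sum>b\<in>Basis. (P i \<bullet> b) * (P' b \<bullet> i))"
      by (subst linear_basis_expansion[OF P'_linear]) (simp add: inner_sum_left)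
    then show "wt i * (\<Sum>b\<in>Basis. (P i \<bullet> b) * (P' b \<bullet> i)) = wt i" using i by simp
  qed simp
  finally show ?thesis .
qed

text \<open>In eigencoordinates the dilation is diagonal and its volume factor is the product of the
  powers h^wt, whose exponents add up to the trace; conjugation by P keeps this factor.\<close>

lemma dilation_lborel:
  assumes h: "0 < h" and S: "S \<in> sets borel"
  shows "emeasure lborel (dilation_alg A h ` S) = ennreal (h powr homogeneous_dim A) * emeasure lborel S"
proof -
  define T where "T h x = (\<Sum>b\<in>Basis. (h powr wt b * (x \<bullet> b)) *\<^sub>R b)" for h and x :: 'a
  have D: "dilation_alg A h = (\<lambda>v. P (T h (P' v)))"
    using h by (auto simp: T_def P_sum dilation_eq)
  have inv: "T h (T (1 / h) x) = x" "T (1 / h) (T h x) = x" for x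
    by (rule euclidean_eqI; use h in \<open>simp add: T_def powr_divide\<close>)+
  have meas: "T h \<in> borel_measurable borel" for h
    unfolding T_def by (intro borel_measurable_continuous_onI continuous_intros)
  have Tm: "T h ` S \<in> sets borel" if "S \<in> sets borel" for S
    using measurable_sets[OF meas that, of "1 / h"] image_eq_vimage[OF inv] by simp
  have T: "emeasure lborel (T h ` S) = ennreal (\<Prod>b\<in>Basis. h powr wt b) * emeasure lborel S"
    if "S \<in> sets borel" for S
    unfolding T_def by (rule emeasure_lborel_diagonal[OF _ that]) (rule powr_gt_zero[THEN iffD2, OF less_imp_neq[OF h, symmetric]])
  have "(\<Prod>b\<in>(Basis::'a set). h powr wt b) = h powr homogeneous_dim A"
    using h by (simp add: homogeneous_dim_eq powr_sum)
  then show ?thesis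
    unfolding D using emeasure_lborel_conjugate[OF P_linear P'_linear P_P' P'_P T Tm S] by (simp only:)
qed

end


section \<open>The global exponential map\<close>

locale homogeneous_chart = lie_chart \<A> c + eigen_basis A P P' wt
  for \<A> :: "('g::{topological_group_add, t2_space, second_countable_topology},
                'a::euclidean_space) chart set" and c :: "('g, 'a) chart"
    and A P P' :: "'a \<Rightarrow> 'a" and wt :: "'a \<Rightarrow> real" +
  assumes conn: "connected (UNIV :: 'g set)" and sconn: "simply_connected (UNIV :: 'g set)"
    and morphism: "0 < h \<Longrightarrow> lie_algebra_morphism \<A> c (dilation_alg A h)"
begin

abbreviation "\<delta> \<equiv> dilation_alg A"

sublocale dil_measure mm rho0 \<delta> wmin wmax wconst "homogeneous_dim A"
proof (unfold_locales)
  show "br (\<delta> h v) (\<delta> h w) = \<delta> h (br v w)" if "0 < h" for h v w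
    using morphism[OF that] by (simp add: lie_algebra_morphism_def lie_bracket_eq)
qed (simp_all add: linear_add[OF dilation_linear] linear_scale[OF dilation_linear] dilation_1 dilation_mult
    wmin_pos wconst_pos dilation_small dilation_big dilation_lborel)

lemma expG_prd_small:
  assumes "norm x < \<eta>" "norm y < \<eta>"
  shows "expG (prd x y) = expG x + expG y"
proof -
  have t: "norm x < \<tau>" "norm y < \<tau>" using assms eta_tau by auto
  then have s: "norm x < \<sigma>" "norm y < \<sigma>" using tau_sigma by auto
  have "norm (star x y) < \<sigma>" by (rule logset_norm[OF e_star(2)[OF t]])
  then show ?thesis
    using prd_star[OF assms] e_star(1)[OF t] kap_e[of x y] s by (simp add: expG_small)
qed

lemma continuous_expG: "continuous_on S expG"
proof -
  have "isCont expG w" for w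
  proof -
    define R where "R = norm w + 1"
    obtain k where k: "\<And>w. norm w \<le> R \<Longrightarrow> norm (halve k w) < \<sigma>" using halve_small by (metis order_refl)
    have 1: "continuous_on (ball 0 R) (\<lambda>w. e (halve k w))"
      by (rule continuous_on_compose2[OF smooth_on_imp_continuous_on[OF smooth_e]])
        (use k in \<open>auto simp: halve_def intro!: continuous_intros\<close>)
    have 2: "continuous_on (ball 0 R) (\<lambda>w. kap (e (halve k w)))"
      by (rule continuous_on_compose2[OF continuous_kap 1])
        (use k e_in_U rho0(2) in \<open>force intro: less_imp_le\<close>)
    have 3: "continuous_on (ball 0 R) (\<lambda>w. double k (kap (e (halve k w))))" by (rule continuous_double[OF 2])
    have eq: "double k (kap (e (halve k w))) = expG w" if "w \<in> ball 0 R" for w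
      by (rule expG_eq[symmetric, OF k]) (use that in simp)
    have "continuous_on (ball 0 R) expG" by (rule continuous_on_eq[OF 3 eq])
    then show ?thesis using continuous_on_interior[of "ball 0 R" expG w] by (simp add: R_def)
  qed
  then show ?thesis by (simp add: continuous_at_imp_continuous_on)
qed

text \<open>The path \<open>(- s z) (s (z u))\<close> from \<open>0\<close> to \<open>u\<close> stays where \<open>exp\<close> is known to be multiplicative.\<close>

lemma expG_prd_path:
  assumes \<mu>: "\<mu> \<le> \<eta>" "\<And>x y. norm x < \<mu> \<Longrightarrow> norm y < \<mu> \<Longrightarrow> norm (prd x y) < \<eta>"
    and small: "\<And>s. s \<in> {0..1} \<Longrightarrow> norm (prd (- (s *\<^sub>R z)) (s *\<^sub>R prd z u)) < \<mu>"
  shows "expG (prd z u) = expG z + expG u"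
proof -
  define w where "w = prd z u"
  have "norm (prd (- (0 *\<^sub>R z)) (0 *\<^sub>R prd z u)) < \<mu>" by (rule small) simp
  then have mu: "0 < \<mu>" by simp
  obtain n :: nat where n: "(norm z + norm w) / \<mu> < real n" using reals_Archimedean2 by blast
  have "0 \<le> (norm z + norm w) / \<mu>" using mu by simp
  then have n0: "0 < real n" using n by linarith
  have nn: "norm z + norm w < \<mu> * real n" using n mu by (simp add: field_simps)
  define h where "h = 1 / real n"
  have h: "0 < h" "real n * h = 1" using n0 by (auto simp: h_def)
  have hs: "norm z * h < \<mu>" "norm w * h < \<mu>"
    using nn n0 norm_ge_zero[of z] norm_ge_zero[of w] by (auto simp: h_def field_simps intro: le_less_trans[rotated])
  have hz: "norm (- (h *\<^sub>R z)) < \<mu>" and hw: "norm (h *\<^sub>R w) < \<mu>" using hs h by (auto simp: mult.commute)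
  define q where "q s = prd (- (s *\<^sub>R z)) (s *\<^sub>R w)" for s
  have q: "norm (q s) < \<mu>" if "s \<in> {0..1}" for s using small[OF that] by (simp add: q_def w_def)
  \<comment> \<open>Advancing by h inserts one small factor on each side, so two uses of the local
    multiplicativity of exp suffice.\<close>
  have step: "q (s + h) = prd (prd (- (h *\<^sub>R z)) (q s)) (h *\<^sub>R w)" for s
  proof -
    have 1: "- ((s + h) *\<^sub>R z) = prd (- (h *\<^sub>R z)) (- (s *\<^sub>R z))"
      using prd_line[of "- h" z "- s"] by (simp add: scaleR_left_distrib scaleR_left_diff_distrib)
    have 2: "(s + h) *\<^sub>R w = prd (s *\<^sub>R w) (h *\<^sub>R w)" by (simp add: prd_line)
    show ?thesis unfolding q_def 1 2 by (simp add: prd_assoc)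
  qed
  have "expG (q (real j * h)) = - expG ((real j * h) *\<^sub>R z) + expG ((real j * h) *\<^sub>R w)" if "j \<le> n" for j
    using that
  proof (induction j)
    case (Suc j)
    define s where "s = real j * h"
    have "real j * h \<le> real n * h" using Suc(2) h(1) by (intro mult_right_mono) auto
    then have s01: "s \<in> {0..1}" using h by (simp add: s_def)
    have a: "norm (prd (- (h *\<^sub>R z)) (q s)) < \<eta>" by (rule \<mu>(2)[OF hz q[OF s01]])
    have b: "norm (h *\<^sub>R w) < \<eta>" "norm (- (h *\<^sub>R z)) < \<eta>" "norm (q s) < \<eta>" using hw hz q[OF s01] \<mu>(1) by auto
    have "expG (q (s + h)) = expG (- (h *\<^sub>R z)) + expG (q s) + expG (h *\<^sub>R w)"
      unfolding step expG_prd_small[OF a b(1)] expG_prd_small[OF b(2,3)] by (rule refl)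
    also have "\<dots> = (- expG (h *\<^sub>R z) + - expG (s *\<^sub>R z)) + (expG (s *\<^sub>R w) + expG (h *\<^sub>R w))"
      using Suc by (simp add: expG_minus s_def add.assoc diff_conv_add_uminus del: add_uminus_conv_diff)
    also have "- expG (h *\<^sub>R z) + - expG (s *\<^sub>R z) = - expG ((s + h) *\<^sub>R z)"
      unfolding expG_add minus_add ..
    also have "expG (s *\<^sub>R w) + expG (h *\<^sub>R w) = expG ((s + h) *\<^sub>R w)" by (rule expG_add[symmetric])
    finally show ?case by (simp add: s_def distrib_right add.commute)
  qed (simp add: q_def)
  from this[of n] have "expG (q 1) = - expG z + expG w" using h(2) by simp
  moreover have "q 1 = u" by (simp add: q_def w_def)
  ultimately have "expG z + expG u = expG z + (- expG z + expG w)" by simp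
  then show ?thesis by (simp add: w_def add.assoc[symmetric])
qed

lemma product_ball_exists: "\<exists>\<mu>>0. \<mu> \<le> \<eta> \<and> (\<forall>x y. norm x < \<mu> \<longrightarrow> norm y < \<mu> \<longrightarrow> norm (prd x y) < \<eta>)"
proof -
  have "isCont (\<lambda>p. prd (fst p) (snd p)) (0, 0)"
    using smooth_on_imp_continuous_on[OF smooth_prd] by (simp add: continuous_on_eq_continuous_at)
  then obtain d where d: "0 < d" "\<And>p. dist p (0, 0) < d \<Longrightarrow> dist (prd (fst p) (snd p)) (prd 0 0) < \<eta>"
    unfolding continuous_at_eps_delta using eta(1) by (metis fst_conv snd_conv)
  show ?thesis
  proof (intro exI[of _ "min \<eta> (d / 2)"] conjI allI impI)
    fix x y :: 'a assume "norm x < min \<eta> (d / 2)" "norm y < min \<eta> (d / 2)"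
    then have "norm x + norm y < d" by simp
    then have "norm (x, y) < d" using norm_Pair_le[of x y] by linarith
    then show "norm (prd x y) < \<eta>" using d(2)[of "(x, y)"] by (simp add: dist_norm)
  qed (use d eta in auto)
qed

text \<open>The product x y is reached from x by n right factors (1 / n) y. To each of them
  \<open>expG_prd_path\<close> applies, with a step size that compactness makes uniform.\<close>

lemma expG_prd: "expG (prd x y) = expG x + expG y"
proof -
  obtain \<mu> where \<mu>: "0 < \<mu>" "\<mu> \<le> \<eta>" "\<And>x y. norm x < \<mu> \<Longrightarrow> norm y < \<mu> \<Longrightarrow> norm (prd x y) < \<eta>"
    using product_ball_exists by blast
  define X where "X t = prd x (t *\<^sub>R y)" for t
  define G where "G q = prd (- (fst (snd q) *\<^sub>R X (fst q))) (fst (snd q) *\<^sub>R prd (X (fst q)) (snd (snd q) *\<^sub>R y))"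
    for q :: "real \<times> real \<times> real"
  have "continuous_on UNIV G" unfolding G_def X_def
    by (intro continuous_prd continuous_intros)
  then have o: "open (G -` ball 0 \<mu>)" by (rule open_vimage[OF open_ball])
  have c: "compact ({0..1::real} \<times> {0..1::real} \<times> {0::real})" by (intro compact_Times) auto
  \<comment> \<open>When the third coordinate is 0 the path in question is constantly 0, so a whole
    neighbourhood of this compact set is mapped into the ball.\<close>
  have "{0..1::real} \<times> {0..1::real} \<times> {0::real} \<subseteq> G -` ball 0 \<mu>" using \<mu> by (auto simp: G_def)
  from compact_subset_open_imp_ball_epsilon_subset[OF c o this]
  obtain \<epsilon> where \<epsilon>: "0 < \<epsilon>" "(\<Union>q\<in>{0..1::real} \<times> {0..1::real} \<times> {0::real}. ball q \<epsilon>) \<subseteq> G -` ball 0 \<mu>" by blast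
  have step: "expG (prd (X t) (h *\<^sub>R y)) = expG (X t) + expG (h *\<^sub>R y)" if "t \<in> {0..1}" "\<bar>h\<bar> < \<epsilon>" for t h
  proof (rule expG_prd_path[OF \<mu>(2,3)])
    fix s :: real assume s: "s \<in> {0..1}"
    have "(t, s, h) \<in> ball (t, s, 0) \<epsilon>" using that by (simp add: dist_Pair_Pair)
    then have "(t, s, h) \<in> G -` ball 0 \<mu>" using \<epsilon>(2) that(1) s by blast
    then show "norm (prd (- (s *\<^sub>R X t)) (s *\<^sub>R prd (X t) (h *\<^sub>R y))) < \<mu>" by (simp add: G_def)
  qed
  obtain n :: nat where n: "1 / \<epsilon> < real n" using reals_Archimedean2 by blast
  have "0 < 1 / \<epsilon>" using \<epsilon> by simp
  then have n0: "0 < real n" using n by linarith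
  define h where "h = 1 / real n"
  have h: "0 < h" "real n * h = 1" "\<bar>h\<bar> < \<epsilon>" using n0 n \<epsilon>(1) by (auto simp: h_def field_simps)
  have "expG (X (real j * h)) = expG x + expG ((real j * h) *\<^sub>R y)" if "j \<le> n" for j
    using that
  proof (induction j)
    case (Suc j)
    have "real j * h \<le> real n * h" using Suc(2) h(1) by (intro mult_right_mono) auto
    then have s01: "real j * h \<in> {0..1}" using h by simp
    have e: "real (Suc j) * h = real j * h + h" by (simp add: distrib_right)
    have "X (real (Suc j) * h) = prd (X (real j * h)) (h *\<^sub>R y)"
      unfolding X_def e prd_line[symmetric] by (rule prd_assoc[symmetric])
    then have "expG (X (real (Suc j) * h)) = expG x + expG ((real j * h) *\<^sub>R y) + expG (h *\<^sub>R y)"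
      using step[OF s01 h(3)] Suc by simp
    also have "\<dots> = expG x + expG ((real (Suc j) * h) *\<^sub>R y)" unfolding e expG_add by (rule add.assoc)
    finally show ?case by simp
  qed (simp add: X_def)
  from this[of n] show ?thesis using h by (simp add: X_def)
qed

subsection \<open>Surjectivity\<close>

text \<open>A logarithm near the identity of the group, available before exp is known to be
  injective.\<close>

definition loc :: "'g \<Rightarrow> 'a" where "loc x = l (kinv x)"
definition W :: "'g set" where "W = {x \<in> chart_dom c. kinv x \<in> e ` logset}"

lemma e_logset_im: "y \<in> e ` logset \<Longrightarrow> ori + y \<in> chart_im c"
  using e_in_U logset_norm rho0(2) by (force intro: less_imp_le)

lemma open_W: "open W"
proof -
  have "continuous_on (chart_dom c) kinv"
    unfolding kinv_def by (intro continuous_on_diff chart(7)[OF cA] continuous_on_const)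
  then have "open (chart_dom c \<inter> kinv -` (e ` logset))"
    by (rule continuous_open_preimage[OF _ chart(1)[OF cA] logset(4)])
  then show ?thesis by (simp add: W_def vimage_def Int_def)
qed

lemma loc: "x \<in> W \<Longrightarrow> loc x \<in> logset" "x \<in> W \<Longrightarrow> expG (loc x) = x"
proof -
  assume x: "x \<in> W"
  then show 1: "loc x \<in> logset" by (auto simp: W_def loc_def intro: e_l)
  have "expG (loc x) = kap (e (loc x))" by (rule expG_small[OF logset_norm[OF 1]])
  also have "e (loc x) = kinv x" using x by (auto simp: W_def loc_def intro: e_l)
  finally show "expG (loc x) = x" using kap_kinv x by (simp add: W_def)
qed

lemma loc_expG: "v \<in> logset \<Longrightarrow> expG v \<in> W" "v \<in> logset \<Longrightarrow> loc (expG v) = v"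
proof -
  assume v: "v \<in> logset"
  have E: "expG v = kap (e v)" by (rule expG_small[OF logset_norm[OF v]])
  have im: "ori + e v \<in> chart_im c" using e_logset_im v by blast
  have kk: "kinv (kap (e v)) = e v" by (rule kinv_kap[OF im])
  show "expG v \<in> W" using v kk chart(4)[OF cA im] by (simp add: W_def E kap_def)
  show "loc (expG v) = v" using kk l_e[OF v] by (simp add: E loc_def)
qed

lemma zero_W: "0 \<in> W" and loc_0: "loc 0 = 0"
  using loc_expG[OF logset(2)] by simp_all

lemma continuous_loc: "continuous_on W loc"
  unfolding loc_def
proof (rule continuous_on_compose2[OF smooth_on_imp_continuous_on[OF smooth_l]])
  show "continuous_on W kinv"
    unfolding kinv_def
    by (intro continuous_on_diff continuous_on_subset[OF chart(7)[OF cA]] continuous_on_const) (auto simp: W_def)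
qed (auto simp: W_def)

lemma continuous_translate: "continuous_on S (\<lambda>x::'g. a + x)"
  by (intro continuous_on_add continuous_on_const continuous_on_id)

text \<open>The image is a subgroup containing the neighbourhood \<open>W\<close> of the identity,
  hence open; its complement is a union of cosets and open as well. Connectedness does the
  rest.\<close>

lemma surj_expG: "surj expG"
proof -
  let ?H = "range expG"
  have add: "x + y \<in> ?H" if "x \<in> ?H" "y \<in> ?H" for x y
    using that by (elim rangeE) (simp only: expG_prd[symmetric] rangeI)
  have neg: "- x \<in> ?H" if "x \<in> ?H" for x
    using that by (elim rangeE) (simp only: expG_minus[symmetric] rangeI)
  have WH: "W \<subseteq> ?H" using loc(2) by (metis rangeI subsetI)
  have o: "open ((\<lambda>y. - x + y) -` W)" for x :: 'g by (rule open_vimage[OF open_W continuous_translate])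
  have in_x: "x \<in> (\<lambda>y. - x + y) -` W" for x using zero_W by simp
  have "open ?H"
  proof (rule open_subopen[THEN iffD2, rule_format])
    fix x assume x: "x \<in> ?H"
    have "(\<lambda>y. - x + y) -` W \<subseteq> ?H"
    proof
      fix y assume "y \<in> (\<lambda>y. - x + y) -` W"
      then have "- x + y \<in> ?H" using WH by blast
      then have "x + (- x + y) \<in> ?H" by (rule add[OF x])
      then show "y \<in> ?H" by (simp add: add.assoc[symmetric])
    qed
    then show "\<exists>T. open T \<and> x \<in> T \<and> T \<subseteq> ?H" by (intro exI conjI) (rule o in_x | assumption)+
  qed
  moreover have "open (- ?H)"
  proof (rule open_subopen[THEN iffD2, rule_format])
    fix x assume x: "x \<in> - ?H"
    have "(\<lambda>y. - x + y) -` W \<subseteq> - ?H"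
    proof
      fix y assume y: "y \<in> (\<lambda>y. - x + y) -` W"
      show "y \<in> - ?H"
      proof
        assume yH: "y \<in> ?H"
        have "- x + y \<in> ?H" using WH y by blast
        then have "- (- x + y) \<in> ?H" by (rule neg)
        then have "y + - (- x + y) \<in> ?H" by (rule add[OF yH])
        moreover have "y + - (- x + y) = x" by (simp only: minus_add add.assoc[symmetric]) simp
        ultimately show False using x by simp
      qed
    qed
    then show "\<exists>T. open T \<and> x \<in> T \<and> T \<subseteq> - ?H" by (intro exI conjI) (rule o in_x | assumption)+
  qed
  ultimately have "closedin (top_of_set UNIV) ?H" "openin (top_of_set UNIV) ?H"
    by (simp_all add: closed_def flip: closed_closedin)
  with conn[unfolded connected_clopen, rule_format, of ?H] have "?H = {} \<or> ?H = UNIV" by blast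
  then show ?thesis by simp
qed

subsection \<open>Injectivity\<close>

primrec iprd :: "(nat \<Rightarrow> 'a) \<Rightarrow> nat \<Rightarrow> 'a" where
  "iprd f 0 = 0"
| "iprd f (Suc n) = prd (iprd f n) (f n)"

lemma continuous_iprd:
  "(\<And>j. j < n \<Longrightarrow> continuous_on S (\<lambda>t. f t j)) \<Longrightarrow> continuous_on S (\<lambda>t. iprd (f t) n)"
  by (induction n) (auto intro: continuous_prd)

lemma iprd_cong: "(\<And>j. j < n \<Longrightarrow> f j = g j) \<Longrightarrow> iprd f n = iprd g n"
  by (induction n) auto

lemma iprd_line: "iprd (\<lambda>_. s *\<^sub>R v) n = (real n * s) *\<^sub>R v"
  by (induction n) (auto simp: prd_line distrib_right add.commute)

text \<open>Discreteness of the kernel, which the lifting argument turns into constancy of end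
  points.\<close>

lemma expG_small_kernel: "norm v < \<tau> \<Longrightarrow> expG v = 0 \<Longrightarrow> v = 0"
  using loc_expG(2)[OF tau(3)] loc_0 by metis

text \<open>A null homotopy of the loop \<open>s \<mapsto> exp (s v)\<close>, made to fix the base point, is lifted slice by
  slice as a product of small logarithms. The end points of the slices lie in the discrete kernel of
  \<open>exp\<close>, hence \<open>v\<close>, the end point of the first slice, agrees with \<open>0\<close>, that of the last one.\<close>

lemma expG_kernel:
  assumes "expG v = 0"
  shows "v = 0"
proof -
  define p where "p s = expG (s *\<^sub>R v)" for s
  have pp: "path p" "path (\<lambda>_::real. 0::'g)" "pathfinish p = pathstart p"
    unfolding path_def p_def using continuous_expG_line[of v] continuous_on_subset assms
    by (auto simp: pathfinish_def pathstart_def)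
  have "homotopic_loops UNIV p (\<lambda>_. 0)"
    using sconn pp unfolding simply_connected_def by (auto simp: pathfinish_def pathstart_def)
  then obtain h where h: "continuous_on ({0..1::real} \<times> {0..1}) h" "\<And>x. x \<in> {0..1} \<Longrightarrow> h (0, x) = p x"
    "\<And>x. x \<in> {0..1} \<Longrightarrow> h (1, x) = 0" "\<And>t. t \<in> {0..1} \<Longrightarrow> h (t, 1) = h (t, 0)"
    unfolding homotopic_loops by (auto simp: pathfinish_def pathstart_def)
  \<comment> \<open>Clamping to [0, 1] extends the homotopy continuously to the plane, so that
    preimages of open sets are open without restriction.\<close>
  define cl where "cl t = max 0 (min 1 t)" for t :: real
  have cl: "cl t \<in> {0..1}" "t \<in> {0..1} \<Longrightarrow> cl t = t" for t by (auto simp: cl_def)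
  \<comment> \<open>A homotopy of loops may move the base point; each slice is translated back by
    it.\<close>
  define H where "H t s = - h (cl t, 0) + h (cl t, cl s)" for t s
  have H: "H t 0 = 0" "H t 1 = 0" for t using h(4)[OF cl(1)] by (simp_all add: H_def cl(2))
  have H01: "H 0 s = expG (s *\<^sub>R v)" "H 1 s = 0" if "s \<in> {0..1}" for s
    using that h(2)[of 0] h(2)[of s] h(3) by (simp_all add: H_def cl p_def)
  define D where "D q = - H (fst q) (fst (snd q)) + H (fst q) (snd (snd q))" for q :: "real \<times> real \<times> real"
  have ccl: "continuous_on S cl" for S unfolding cl_def by (intro continuous_intros)
  have cH: "continuous_on UNIV (\<lambda>q. H (f q) (g q))" if "continuous_on UNIV f" "continuous_on UNIV g"
    for f g :: "real \<times> real \<times> real \<Rightarrow> real"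
    unfolding H_def
    by (intro continuous_on_add continuous_on_minus continuous_on_compose2[OF h(1)] continuous_on_Pair
        continuous_on_compose2[OF ccl] that continuous_on_const) (use cl in auto)
  have cD: "continuous_on UNIV D" unfolding D_def
    by (intro continuous_on_add continuous_on_minus cH continuous_on_fst continuous_on_snd continuous_on_id)
  have o: "open (D -` W)" by (rule open_vimage[OF open_W cD])
  let ?A = "(\<lambda>q. (fst q, snd q, snd q)) ` ({0..1::real} \<times> {0..1::real})"
  have A: "compact ?A" by (intro compact_continuous_image compact_Times continuous_intros) auto
  \<comment> \<open>\<open>D\<close> is an increment along a slice and vanishes on the diagonal;
    compactness gives one mesh size for all slices.\<close>
  have "?A \<subseteq> D -` W" using zero_W by (auto simp: D_def)
  from compact_subset_open_imp_ball_epsilon_subset[OF A o this]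
  obtain \<epsilon> where \<epsilon>: "0 < \<epsilon>" "(\<Union>q\<in>?A. ball q \<epsilon>) \<subseteq> D -` W" by blast
  \<comment> \<open>The first summand makes the mesh finer than \<epsilon>. The second makes v / n
    small enough for \<open>loc\<close> to recover it, so that the first slice lifts exactly to
    v.\<close>
  obtain n :: nat where n: "1 / \<epsilon> + norm v / \<tau> < real n" using reals_Archimedean2 by blast
  have "0 < 1 / \<epsilon>" "0 \<le> norm v / \<tau>" using \<epsilon> tau(1) by auto
  then have n': "0 < real n" "1 / \<epsilon> < real n" "norm v / \<tau> < real n" using n by linarith+
  define k where "k = 1 / real n"
  have k: "0 < k" "real n * k = 1" "k < \<epsilon>" "norm (k *\<^sub>R v) < \<tau>"
    using n' \<epsilon>(1) tau(1) by (auto simp: k_def field_simps)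
  have jk: "real j * k \<in> {0..1}" if "j \<le> n" for j
  proof -
    have "real j * k \<le> real n * k" using that k(1) by (intro mult_right_mono) auto
    then show ?thesis using k by simp
  qed
  define f where "f t j = loc (D (t, real j * k, real (Suc j) * k))" for t j
  have DW: "D (t, real j * k, real (Suc j) * k) \<in> W" if "t \<in> {0..1}" "j < n" for t j
  proof -
    have 1: "(t, real j * k, real j * k) \<in> ?A"
      by (rule image_eqI[of _ _ "(t, real j * k)"]) (use that jk[of j] in auto)
    have 2: "(t, real j * k, real (Suc j) * k) \<in> ball (t, real j * k, real j * k) \<epsilon>"
      using k by (simp add: dist_Pair_Pair dist_real_def distrib_right)
    show ?thesis by (rule vimageD, rule subsetD[OF \<epsilon>(2)], rule UN_I[OF 1], rule 2)
  qed
  define L where "L t = iprd (f t) n" for t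
  have EL: "expG (iprd (f t) j) = H t (real j * k)" if t: "t \<in> {0..1}" and "j \<le> n" for t j
    using that(2)
  proof (induction j)
    case (Suc j)
    have "expG (iprd (f t) (Suc j)) = H t (real j * k) + (- H t (real j * k) + H t (real (Suc j) * k))"
    proof -
      have "expG (f t j) = - H t (real j * k) + H t (real (Suc j) * k)"
        using Suc(2) loc(2)[OF DW[OF t, of j]] by (simp add: f_def D_def del: of_nat_Suc)
      moreover have "expG (iprd (f t) j) = H t (real j * k)" by (rule Suc.IH) (use Suc(2) in simp)
      ultimately show ?thesis by (simp add: expG_prd del: of_nat_Suc)
    qed
    then show ?case by (simp add: add.assoc[symmetric] del: of_nat_Suc)
  qed (simp add: H)
  have kernel: "expG (L t) = 0" if "t \<in> {0..1}" for t
    using EL[OF that, of n] by (simp add: L_def k H)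
  have "continuous_on {0..1} (\<lambda>t. f t j)" if "j < n" for j
    unfolding f_def
  proof (rule continuous_on_compose2[OF continuous_loc])
    show "continuous_on {0..1} (\<lambda>t. D (t, real j * k, real (Suc j) * k))"
      by (rule continuous_on_compose2[OF cD]) (auto intro!: continuous_intros)
  qed (use DW that in auto)
  then have "continuous_on {0..1} L" unfolding L_def by (rule continuous_iprd)
  then have cN: "continuous_on {0..1} (\<lambda>t. norm (L t))" by (rule continuous_on_norm)
  have "L 1 = iprd (\<lambda>_. 0 *\<^sub>R v) n" unfolding L_def
  proof (rule iprd_cong)
    fix j assume j: "j < n"
    show "f 1 j = 0 *\<^sub>R v"
      using H01(2)[OF jk[of j]] H01(2)[OF jk[of "Suc j"]] j by (simp add: f_def D_def loc_0 del: of_nat_Suc)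
  qed
  then have L1: "L 1 = 0" by (simp only: iprd_line) simp
  have "L 0 = iprd (\<lambda>_. k *\<^sub>R v) n" unfolding L_def
  proof (rule iprd_cong)
    fix j assume j: "j < n"
    have "D (0, real j * k, real (Suc j) * k) = - expG ((real j * k) *\<^sub>R v) + expG ((real j * k + k) *\<^sub>R v)"
      using H01(1)[OF jk[of j]] H01(1)[OF jk[of "Suc j"]] j by (simp add: D_def distrib_right add.commute)
    also have "\<dots> = expG (k *\<^sub>R v)" unfolding expG_add by (simp add: add.assoc[symmetric])
    finally show "f 0 j = k *\<^sub>R v" using loc_expG(2)[OF tau(3)[OF k(4)]] by (simp add: f_def del: of_nat_Suc)
  qed
  then have L0: "L 0 = v" using k by (simp add: iprd_line)
  have zero: "L t = 0" if "t \<in> {0..1}" "norm (L t) < \<tau>" for t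
    using expG_small_kernel[OF that(2) kernel[OF that(1)]] .
  show ?thesis
  proof (rule ccontr)
    assume "v \<noteq> 0"
    then have "\<not> norm (L 0) < \<tau>" using zero[of 0] L0 by auto
    then have "norm (L 1) \<le> \<tau> / 2" "\<tau> / 2 \<le> norm (L 0)" using L1 tau(1) by auto
    \<comment> \<open>On the way from |v| to 0 the norm of L t would take the value \<tau> / 2,
      which no element of the kernel has.\<close>
    from IVT2'[OF this _ cN] obtain t where "0 \<le> t" "t \<le> 1" "norm (L t) = \<tau> / 2" by auto
    then show False using zero[of t] tau(1) by auto
  qed
qed

lemma inj_expG: "inj expG"
proof (rule injI)
  fix x y assume "expG x = expG y"
  then have "expG (prd (- x) y) = 0" by (simp add: expG_prd expG_minus)
  then have "prd (- x) y = 0" by (rule expG_kernel)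
  then have "prd x (prd (- x) y) = x" by simp
  then show "x = y" by simp
qed

definition logG :: "'g \<Rightarrow> 'a" where "logG = inv expG"

lemma expG_logG [simp]: "expG (logG x) = x" unfolding logG_def by (rule surj_f_inv_f[OF surj_expG])
lemma logG_expG [simp]: "logG (expG v) = v" unfolding logG_def by (rule inv_f_f[OF inj_expG])

lemma logG_0 [simp]: "logG 0 = 0" using logG_expG[of 0] by simp

text \<open>Carries the local logarithm to an arbitrary point; continuity and smoothness of the
  global one are inherited through this formula.\<close>

lemma logG_local: "- a + x \<in> W \<Longrightarrow> logG x = prd (logG a) (loc (- a + x))"
proof -
  assume "- a + x \<in> W"
  then have "expG (prd (logG a) (loc (- a + x))) = x" by (simp add: expG_prd loc add.assoc[symmetric])
  then show ?thesis by (metis logG_expG)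
qed

lemma continuous_logG: "continuous_on S logG"
proof -
  have "isCont logG a" for a
  proof -
    let ?T = "(\<lambda>x. - a + x) -` W"
    have o: "open ?T" by (rule open_vimage[OF open_W continuous_translate])
    have 2: "continuous_on ?T (\<lambda>x. loc (- a + x))"
      by (rule continuous_on_compose2[OF continuous_loc continuous_translate]) auto
    have 1: "continuous_on ?T (\<lambda>x. prd (logG a) (loc (- a + x)))"
      by (rule continuous_prd[OF continuous_on_const 2])
    have "continuous_on ?T logG"
      by (rule continuous_on_eq[OF 1]) (rule logG_local[symmetric], simp)
    then have "\<forall>x\<in>?T. isCont logG x" by (rule continuous_on_eq_continuous_at[OF o, THEN iffD1])
    moreover have "a \<in> ?T" using zero_W by simp
    ultimately show ?thesis by blast
  qed
  then show ?thesis by (simp add: continuous_at_imp_continuous_on)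
qed

end


section \<open>Transfer to the Lie algebra\<close>

context homogeneous_chart
begin

lemma lie_exp_expG: "lie_exp c = expG"
  by (rule ext) (rule lie_exp_eq)

lemma dilation_group: "dilation c A h x = expG (\<delta> h (logG x))"
  by (simp add: dilation_def lie_exp_expG logG_def)

text \<open>Near a, exp v is exp a times exp ((- a) v), and the second factor stays in the range of
  the chart, where the translate of f is smooth.\<close>

lemma smooth_comp_expG:
  assumes f: "smooth_fun \<A> f"
  shows "smooth_on UNIV (\<lambda>v. f (expG v))"
proof (rule smooth_on_local)
  fix a :: 'a
  obtain T where T: "open T" "0 \<in> T" "smooth_on T (pull f (expG a))" using pull_smooth[OF f] by blast
  have oS: "open (prd (- a) -` ball 0 \<sigma>)"
    by (rule open_vimage[OF open_ball smooth_on_imp_continuous_on[OF smooth_prd_left]])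
  have s1: "smooth_on (prd (- a) -` ball 0 \<sigma>) (\<lambda>v. e (prd (- a) v))"
    by (rule smooth_on_compose[OF smooth_e smooth_on_subset[OF smooth_prd_left subset_UNIV] oS]) simp
  define O' where "O' = prd (- a) -` ball 0 \<sigma> \<inter> (\<lambda>v. e (prd (- a) v)) -` T"
  have oO: "open O'" unfolding O'_def
    by (rule continuous_open_preimage[OF smooth_on_imp_continuous_on[OF s1] oS T(1)])
  have aO: "a \<in> O'" using T(2) sigma_pos by (simp add: O'_def)
  have s2: "smooth_on O' (\<lambda>v. pull f (expG a) (e (prd (- a) v)))"
    by (rule smooth_on_compose[OF T(3) smooth_on_subset[OF s1] oO]) (auto simp: O'_def)
  have "pull f (expG a) (e (prd (- a) v)) = f (expG v)" if "v \<in> O'" for v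
  proof -
    have "expG (prd (- a) v) = kap (e (prd (- a) v))" by (rule expG_small) (use that in \<open>simp add: O'_def\<close>)
    then have "expG a + kap (e (prd (- a) v)) = expG (prd a (prd (- a) v))" by (simp only: expG_prd)
    then show ?thesis by (simp add: pull_def)
  qed
  then have "smooth_on O' (\<lambda>v. f (expG v))" by (rule smooth_on_cong[OF s2 oO])
  then show "\<exists>T. open T \<and> a \<in> T \<and> smooth_on T (\<lambda>v. f (expG v))" using oO aO by blast
qed

lemma smooth_comp_logG:
  assumes F: "smooth_on UNIV F"
  shows "smooth_fun \<A> (\<lambda>x. F (logG x))"
  unfolding smooth_fun_def
proof (intro ballI smooth_on_local)
  fix d z assume d: "d \<in> \<A>" and z: "z \<in> chart_im d"
  define a where "a = chart_inv d z"
  let ?T = "{z \<in> chart_im d. - a + chart_inv d z \<in> chart_dom c}"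
  note tr = translate_smooth[OF d cA, of "- a"]
  have s1: "smooth_on ?T (\<lambda>z. kinv (- a + chart_inv d z))"
    unfolding kinv_def by (intro smooth_on_diff smooth_on_const tr)
  define O' where "O' = ?T \<inter> (\<lambda>z. kinv (- a + chart_inv d z)) -` (e ` logset)"
  have oO: "open O'" unfolding O'_def
    by (rule continuous_open_preimage[OF smooth_on_imp_continuous_on[OF s1] tr(1) logset(4)])
  have OW: "- a + chart_inv d y \<in> W" if "y \<in> O'" for y using that by (simp add: O'_def W_def)
  have "z \<in> O'" using zero_W z by (simp add: O'_def W_def a_def)
  have s2: "smooth_on O' (\<lambda>z. loc (- a + chart_inv d z))"
    unfolding loc_def
    by (rule smooth_on_compose[OF smooth_l smooth_on_subset[OF s1] oO]) (auto simp: O'_def)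
  have s3: "smooth_on O' (\<lambda>z. prd (logG a) (loc (- a + chart_inv d z)))"
    by (rule smooth_on_compose[OF smooth_prd_left s2 oO]) simp
  have s4: "smooth_on O' (\<lambda>z. F (prd (logG a) (loc (- a + chart_inv d z))))"
    by (rule smooth_on_compose[OF F s3 oO]) simp
  have "smooth_on O' ((\<lambda>x. F (logG x)) \<circ> chart_inv d)"
    by (rule smooth_on_cong[OF s4 oO]) (simp add: logG_local[OF OW])
  then show "\<exists>T. open T \<and> z \<in> T \<and> smooth_on T ((\<lambda>x. F (logG x)) \<circ> chart_inv d)"
    using oO \<open>z \<in> O'\<close> by blast
qed

text \<open>The image of Haar measure under the logarithm is left-invariant for \<open>prd\<close>,
  hence a multiple of Lebesgue measure. The two integrands are compared off 0 because radial
  derivatives carry no meaning at 0, and a point is a null set.\<close>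

lemma haar_transfer:
  assumes "haar_measure \<mu>"
  shows "\<exists>\<kappa>>0. \<forall>h :: 'g \<Rightarrow> real. \<forall>g. g \<in> borel_measurable borel \<longrightarrow> (\<forall>v. v \<noteq> 0 \<longrightarrow> h (expG v) = g v) \<longrightarrow>
    (LINT x|\<mu>. h x) = \<kappa> * (LINT v|lborel. g v)"
proof -
  have sets: "sets \<mu> = sets borel" and nz: "emeasure \<mu> UNIV \<noteq> 0"
    and fin: "\<And>K. compact K \<Longrightarrow> emeasure \<mu> K < \<infinity>"
    and inv: "\<And>a E. E \<in> sets borel \<Longrightarrow> emeasure \<mu> ((\<lambda>x. a + x) ` E) = emeasure \<mu> E"
    using assms by (auto simp: haar_measure_def)
  have sp: "space \<mu> = UNIV" using sets_eq_imp_space_eq[OF sets] by simp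
  have ml: "logG \<in> measurable \<mu> borel"
    using borel_measurable_continuous_onI[OF continuous_logG] measurable_cong_sets[OF sets refl] by blast
  have me: "expG \<in> borel \<rightarrow>\<^sub>M borel" by (rule borel_measurable_continuous_onI[OF continuous_expG])
  have mp: "prd x \<in> borel \<rightarrow>\<^sub>M borel" for x
    by (rule borel_measurable_continuous_onI[OF smooth_on_imp_continuous_on[OF smooth_prd_left]])
  define M where "M = distr \<mu> borel logG"
  have img: "expG ` S = logG -` S" for S by (rule image_eq_vimage) simp_all
  have img': "prd x ` S = prd (- x) -` S" for x S by (rule image_eq_vimage) simp_all
  have M: "emeasure M S = emeasure \<mu> (expG ` S)" if "S \<in> sets borel" for S
    unfolding M_def using that ml by (subst emeasure_distr) (auto simp: img sp)
  have sM: "sets M = sets borel" by (simp add: M_def)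
  have M_inv: "distr M borel (prd x) = M" for x
  proof (rule measure_eqI)
    fix S assume "S \<in> sets (distr M borel (prd x))"
    then have S: "S \<in> sets borel" by simp
    have v: "prd x -` S \<in> sets borel" using measurable_sets[OF mp S] by simp
    have eS: "expG ` S \<in> sets borel" unfolding img
      using measurable_sets[OF borel_measurable_continuous_onI[OF continuous_logG] S] by simp
    have "emeasure (distr M borel (prd x)) S = emeasure M (prd x -` S)"
      using S mp sM by (subst emeasure_distr) (auto simp: M_def)
    also have "\<dots> = emeasure \<mu> (expG ` (prd x -` S))" by (rule M[OF v])
    also have "expG ` (prd x -` S) = (\<lambda>y. - expG x + y) ` (expG ` S)"
    proof -
      have "expG ` (prd x -` S) = expG ` (prd (- x) ` S)" using img'[of "- x" S] by (simp only: minus_minus)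
      also have "\<dots> = (\<lambda>y. - expG x + y) ` (expG ` S)" by (simp only: image_image expG_prd expG_minus)
      finally show ?thesis .
    qed
    also have "emeasure \<mu> \<dots> = emeasure \<mu> (expG ` S)" by (rule inv[OF eS])
    finally show "emeasure (distr M borel (prd x)) S = emeasure M S" by (simp add: M[OF S])
  qed (simp add: sM)
  have "\<exists>\<kappa>>0. \<forall>S\<in>sets borel. emeasure M S = ennreal \<kappa> * emeasure lborel S"
  proof (rule left_invariant_measure[OF sM M_inv])
    fix K :: "'a set" assume K: "compact K"
    show "emeasure M K < \<infinity>"
      unfolding M[OF borel_compact[OF K]] by (rule fin[OF compact_continuous_image[OF continuous_expG K]])
  next
    show "emeasure M UNIV \<noteq> 0" using nz by (simp add: M surj_expG)
  qed
  then obtain \<kappa> where \<kappa>: "0 < \<kappa>" "\<And>S. S \<in> sets borel \<Longrightarrow> emeasure M S = ennreal \<kappa> * emeasure lborel S"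
    by (elim exE conjE) (rule that, simp_all)
  have Md: "M = density lborel (\<lambda>_. ennreal \<kappa>)"
    by (rule measure_eqI) (use \<kappa> in \<open>auto simp: sM emeasure_density_const\<close>)
  show ?thesis
  proof (intro exI[of _ \<kappa>] conjI allI impI \<kappa>(1))
    fix h :: "'g \<Rightarrow> real" and g :: "'a \<Rightarrow> real"
    assume g [measurable]: "g \<in> borel_measurable borel" and hg: "\<forall>v. v \<noteq> 0 \<longrightarrow> h (expG v) = g v"
    \<comment> \<open>Nothing is assumed about h at 0; its measurability is recovered from that of g
      by a case distinction at this one point.\<close>
    have hE: "(\<lambda>v. h (expG v)) = (\<lambda>v. if v = 0 then h 0 else g v)" using hg by auto
    have mh [measurable]: "(\<lambda>v. h (expG v)) \<in> borel_measurable borel"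
      unfolding hE by measurable
    have "(LINT x|\<mu>. h x) = (LINT x|\<mu>. h (expG (logG x)))" by simp
    also have "\<dots> = (LINT v|M. h (expG v))" unfolding M_def by (rule integral_distr[OF ml mh, symmetric])
    also have "\<dots> = (LINT v|lborel. \<kappa> *\<^sub>R h (expG v))"
      unfolding Md by (rule integral_density) (use \<kappa>(1) in auto)
    also have "\<dots> = (LINT v|lborel. \<kappa> * g v)"
    proof (rule integral_cong_AE)
      show "AE v in lborel. \<kappa> *\<^sub>R h (expG v) = \<kappa> * g v"
        using AE_lborel_singleton[of 0] by eventually_elim (simp add: hg)
    qed measurable
    finally show "(LINT x|\<mu>. h x) = \<kappa> * (LINT v|lborel. g v)" by simp
  qed
qed

end

section \<open>Radial derivatives and norms in exponential coordinates\<close>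

locale homogeneous_norm = homogeneous_chart \<A> c A P P' wt
  for \<A> :: "('g::{topological_group_add, t2_space, second_countable_topology},
                'a::euclidean_space) chart set" and c :: "('g, 'a) chart"
    and A P P' :: "'a \<Rightarrow> 'a" and wt :: "'a \<Rightarrow> real" +
  fixes N :: "'g \<Rightarrow> real" and Q :: real
  assumes N: "homogeneous_quasi_norm c A N" and Q: "Q = homogeneous_dim A" and Q4: "4 < Q"
begin

definition b0 :: 'a where "b0 = (SOME b. b \<in> Basis)"

lemma b0: "b0 \<in> Basis" unfolding b0_def by (rule someI_ex) (use nonempty_Basis in blast)

abbreviation "n \<equiv> \<lambda>v. N (expG v)"

sublocale ds: dil_space_coord \<delta> A Q n wmin wconst "\<lambda>v. P' v \<bullet> b0" "wt b0" "P b0"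
proof (rule dil_space_coord.intro[OF dil_space.intro dil_space_coord_axioms.intro])
  show "continuous_on UNIV n"
    by (rule continuous_on_compose2[OF _ continuous_expG]) (use N in \<open>auto simp: homogeneous_quasi_norm_def\<close>)
  show "0 \<le> n v" for v using N by (simp add: homogeneous_quasi_norm_def)
  show "n (\<delta> h v) = h * n v" if "0 < h" for h v
  proof -
    have "N (dilation c A h (expG v)) = h * N (expG v)" using N that by (simp add: homogeneous_quasi_norm_def)
    then show ?thesis by (simp add: dilation_group)
  qed
  show "n v = 0 \<longleftrightarrow> v = 0" for v
  proof -
    have "n v = 0 \<longleftrightarrow> expG v = expG 0" using N by (simp add: homogeneous_quasi_norm_def)
    then show ?thesis using inj_expG by (metis injD)
  qed
  show "emeasure lborel (\<delta> h ` S) = ennreal (h powr Q) * emeasure lborel S" if "0 < h" "S \<in> sets borel" for h S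
    unfolding Q by (rule dilation_lborel[OF that])
  show "linear (\<lambda>v. P' v \<bullet> b0)"
    by (rule linearI) (simp_all add: linear_add[OF P'_linear] linear_scale[OF P'_linear] inner_left_distrib)
  show "P' (P b0) \<bullet> b0 = 1" using b0 by simp
qed (rule dilation_linear dilation_1 dilation_mult wmin_pos wconst_pos dilation_small dilation_smooth A_lin
    dilation_deriv Q4 wt_pos[OF b0] P'_dilation[OF _ b0]; assumption?)+

text \<open>On an orbit r = e^t, so d / dr is 1 / r times the flow derivative, and r = n v at the
  point in question. Agreement of f and F off 0 is all that can be asked when f is itself a radial
  derivative.\<close>

lemma radial_deriv_eq:
  assumes v: "v \<noteq> 0" and F: "ds.flow_deriv F F1" and f: "\<And>v. v \<noteq> 0 \<Longrightarrow> f (expG v) = F v"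
  shows "radial_deriv c A N f (expG v) = F1 v / of_real (n v)"
proof -
  define w where "w = \<delta> (1 / n v) v"
  have nv: "0 < n v" by (rule ds.n_pos[OF v])
  have nw: "n w = 1" using nv by (simp add: w_def ds.n_hom)
  then have w0: "w \<noteq> 0" using ds.n_zero[of w] by force
  have vw: "\<delta> (n v) w = v" unfolding w_def by (rule dil_inverse(2)[OF nv])
  have "(THE y. expG v = dilation c A (n v) y \<and> N y = 1) = expG w"
  proof (rule the_equality)
    show "expG v = dilation c A (n v) (expG w) \<and> N (expG w) = 1" using vw nw by (simp add: dilation_group)
    fix y assume y: "expG v = dilation c A (n v) y \<and> N y = 1"
    then have "logG (expG v) = logG (expG (\<delta> (n v) (logG y)))" by (simp only: dilation_group)
    then have "v = \<delta> (n v) (logG y)" by (simp only: logG_expG)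
    then have "w = logG y" unfolding w_def using dil_inverse(1)[OF nv] by metis
    then show "y = expG w" by simp
  qed
  then have 1: "radial_deriv c A N f (expG v) = vector_derivative (\<lambda>h. f (expG (\<delta> h w))) (at (n v))"
    by (simp add: radial_deriv_def dilation_group)
  have "((\<lambda>t. F (ds.fl t w)) has_vector_derivative F1 (ds.fl (ln (n v)) w)) (at (ln (n v)))"
    using F unfolding ds.flow_deriv_def by blast
  then have d: "((\<lambda>t. F (ds.fl t w)) has_vector_derivative F1 v) (at (ln (n v)))" using nv vw by simp
  have l: "(ln has_vector_derivative inverse (n v)) (at (n v))"
    using DERIV_ln[OF nv] by (simp add: has_real_derivative_iff_has_vector_derivative)
  have "((\<lambda>t. F (ds.fl t w)) \<circ> ln has_vector_derivative inverse (n v) *\<^sub>R F1 v) (at (n v))"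
    by (rule vector_diff_chain_at[OF l d])
  then have "((\<lambda>h. f (expG (\<delta> h w))) has_vector_derivative inverse (n v) *\<^sub>R F1 v) (at (n v))"
  proof (rule has_vector_derivative_transform_within_open[of _ _ _ "{0<..}"])
    fix h :: real assume "h \<in> {0<..}"
    then have h: "0 < h" by simp
    have "\<delta> h w \<noteq> 0" using ds.n_hom[OF h, of w] nw h ds.n_zero[of "\<delta> h w"] by force
    then show "((\<lambda>t. F (ds.fl t w)) \<circ> ln) h = f (expG (\<delta> h w))" using f h by simp
  qed (use nv in auto)
  then show ?thesis unfolding 1
    by (subst vector_derivative_at) (auto simp: scaleR_conv_of_real field_simps)
qed

lemma test_functions_pull: "f \<in> test_functions \<A> \<Longrightarrow> ds.test_fun (\<lambda>v. f (expG v))"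
proof -
  assume f: "f \<in> test_functions \<A>"
  let ?C = "closure {x. f x \<noteq> 0}"
  have C: "smooth_fun \<A> f" "compact ?C" "0 \<notin> ?C" using f by (auto simp: test_functions_def)
  have "compact (logG ` ?C)" by (rule compact_continuous_image[OF continuous_logG C(2)])
  moreover have "0 \<notin> logG ` ?C"
  proof
    assume "0 \<in> logG ` ?C"
    then obtain x where x: "x \<in> ?C" "logG x = 0" by auto
    then have "x = 0" using expG_logG[of x] by (simp only: expG_0)
    then show False using x C by simp
  qed
  moreover have "f (expG v) = 0" if "v \<notin> logG ` ?C" for v
  proof (rule ccontr)
    assume "f (expG v) \<noteq> 0"
    then have "expG v \<in> ?C" by (intro subsetD[OF closure_subset]) simp
    from imageI[OF this, of logG] show False using that by (simp only: logG_expG)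
  qed
  ultimately show ?thesis using smooth_comp_expG[OF C(1)] unfolding ds.test_fun_def by blast
qed

lemma test_functions_push: "ds.test_fun F \<Longrightarrow> (\<lambda>x. F (logG x)) \<in> test_functions \<A>"
proof -
  assume F: "ds.test_fun F"
  then obtain K where K: "smooth_on UNIV F" "compact K" "0 \<notin> K" "\<And>x. x \<notin> K \<Longrightarrow> F x = 0" by (auto simp: ds.test_fun_def)
  let ?S = "{x. F (logG x) \<noteq> 0}"
  have cK: "compact (expG ` K)" by (rule compact_continuous_image[OF continuous_expG K(2)])
  have "x \<in> expG ` K" if "x \<in> ?S" for x
  proof -
    have "logG x \<in> K" using that K(4) by auto
    then show ?thesis by (metis expG_logG imageI)
  qed
  then have sub: "closure ?S \<subseteq> expG ` K" by (intro closure_minimal compact_imp_closed[OF cK]) blast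
  have "compact (closure ?S)"
    using compact_Int_closed[OF cK closed_closure[of ?S]] sub by (simp add: Int_absorb1)
  moreover have "0 \<notin> closure ?S"
  proof
    assume "0 \<in> closure ?S"
    then obtain v where "v \<in> K" "expG v = 0" using sub by auto
    then show False using K(3) expG_kernel by blast
  qed
  ultimately show ?thesis using smooth_comp_logG[OF K(1)] by (simp add: test_functions_def)
qed

lemma rellich_lhs_eq: "rellich_lhs N f (expG v) = ds.div_n2 (\<lambda>v. f (expG v)) v"
  by (simp add: rellich_lhs_def ds.div_n2_def)

text \<open>With E the flow derivative, R = E / n, and E (1 / n) = - 1 / n because n is homogeneous
  of degree 1. So R^2 f is (E^2 - E) F / n^2, and the first order term adds (Q - 1) E F /
  n^2.\<close>

lemma rellich_rhs_eq:
  assumes f: "f \<in> test_functions \<A>" and v: "v \<noteq> 0"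
  defines "F \<equiv> \<lambda>v. f (expG v)"
  shows "rellich_rhs c A N f (expG v) = ds.div_n2 (ds.euler (ds.euler F)) v + of_real (Q - 2) * ds.div_n2 (ds.euler F) v"
proof -
  have F: "ds.test_fun F" unfolding F_def by (rule test_functions_pull[OF f])
  note F1 = ds.flow_deriv_euler[OF F] and F2 = ds.flow_deriv_euler[OF ds.test_fun_euler[OF F]]
  have R1: "radial_deriv c A N f (expG v) = ds.euler F v / of_real (n v)" if "v \<noteq> 0" for v
    by (rule radial_deriv_eq[OF that F1]) (simp add: F_def)
  define G where "G v = ds.euler F v / of_real (n v)" for v
  define G1 where "G1 v = (ds.euler (ds.euler F) v - ds.euler F v) / of_real (n v)" for v
  have "ds.flow_deriv G G1"
  proof (rule ds.flow_derivI)
    fix v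
    have E: "((\<lambda>t. ds.euler F (ds.fl t v)) has_vector_derivative ds.euler (ds.euler F) (ds.fl 0 v)) (at 0)"
      using F2 unfolding ds.flow_deriv_def by blast
    have x: "((\<lambda>t. exp (- t)) has_real_derivative - 1) (at 0)" by (auto intro!: derivative_eq_intros)
    have "((\<lambda>t. exp (- t) *\<^sub>R ds.euler F (ds.fl t v)) has_vector_derivative
        exp (- 0) *\<^sub>R ds.euler (ds.euler F) (ds.fl 0 v) + (- 1) *\<^sub>R ds.euler F (ds.fl 0 v)) (at 0)"
      by (rule has_vector_derivative_scaleR[OF x E])
    then have "((\<lambda>t. (exp (- t) *\<^sub>R ds.euler F (ds.fl t v)) / of_real (n v)) has_vector_derivative G1 v) (at 0)"
      using has_vector_derivative_divide[of _ _ _ "of_real (n v)"] by (fastforce simp: G1_def)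
    then show "((\<lambda>t. G (ds.fl t v)) has_vector_derivative G1 v) (at 0)"
      by (simp add: G_def ds.n_fl exp_minus scaleR_conv_of_real divide_inverse inverse_mult_distrib mult_ac)
  qed
  from radial_deriv_eq[OF v this, of "radial_deriv c A N f"]
  have R2: "radial_deriv c A N (radial_deriv c A N f) (expG v) = G1 v / of_real (n v)"
    using R1 by (simp add: G_def)
  show ?thesis
    unfolding rellich_rhs_def R1[OF v] R2 Q[symmetric]
    using ds.n_pos[OF v] by (simp add: G1_def ds.div_n2_def power2_eq_square field_simps)
qed

lemma L2_norm_transfer:
  assumes "haar_measure \<mu>"
  shows "\<exists>\<kappa>>0. \<forall>f\<in>test_functions \<A>.
    L2_norm \<mu> (rellich_lhs N f) = \<kappa> * sqrt (LINT v|lborel. (cmod (ds.div_n2 (\<lambda>v. f (expG v)) v))\<^sup>2) \<and>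
    L2_norm \<mu> (rellich_rhs c A N f) = \<kappa> * sqrt (LINT v|lborel. (cmod (ds.div_n2 (ds.euler (ds.euler (\<lambda>v. f (expG v)))) v
      + of_real (Q - 2) * ds.div_n2 (ds.euler (\<lambda>v. f (expG v))) v))\<^sup>2)"
proof -
  obtain \<kappa> where \<kappa>: "0 < \<kappa>" "\<And>(h :: 'g \<Rightarrow> real) g. g \<in> borel_measurable borel \<Longrightarrow>
      (\<And>v. v \<noteq> 0 \<Longrightarrow> h (expG v) = g v) \<Longrightarrow> (LINT x|\<mu>. h x) = \<kappa> * (LINT v|lborel. g v)"
    using haar_transfer[OF assms] by blast
  have m: "ds.div_n2 F \<in> borel_measurable borel" if "ds.test_fun F" for F
    using ds.compactly_supported_div_n2[OF that] by (auto simp: compactly_supported_def intro: borel_measurable_continuous_onI)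
  show ?thesis
  proof (intro exI[of _ "sqrt \<kappa>"] conjI ballI)
    show "0 < sqrt \<kappa>" using \<kappa>(1) by simp
    fix f assume f: "f \<in> test_functions \<A>"
    define F where "F = (\<lambda>v. f (expG v))"
    have F: "ds.test_fun F" unfolding F_def by (rule test_functions_pull[OF f])
    note [measurable] = m[OF F] m[OF ds.test_fun_euler[OF F]] m[OF ds.test_fun_euler[OF ds.test_fun_euler[OF F]]]
    have 1: "(LINT x|\<mu>. (cmod (rellich_lhs N f x))\<^sup>2) = \<kappa> * (LINT v|lborel. (cmod (ds.div_n2 F v))\<^sup>2)"
    proof (rule \<kappa>(2))
      show "(\<lambda>v. (cmod (ds.div_n2 F v))\<^sup>2) \<in> borel_measurable borel" by measurable
      show "(cmod (rellich_lhs N f (expG v)))\<^sup>2 = (cmod (ds.div_n2 F v))\<^sup>2" for v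
        unfolding F_def rellich_lhs_eq ..
    qed
    have 2: "(LINT x|\<mu>. (cmod (rellich_rhs c A N f x))\<^sup>2) =
        \<kappa> * (LINT v|lborel. (cmod (ds.div_n2 (ds.euler (ds.euler F)) v + of_real (Q - 2) * ds.div_n2 (ds.euler F) v))\<^sup>2)"
    proof (rule \<kappa>(2))
      show "(\<lambda>v. (cmod (ds.div_n2 (ds.euler (ds.euler F)) v + of_real (Q - 2) * ds.div_n2 (ds.euler F) v))\<^sup>2) \<in> borel_measurable borel"
        by measurable
      show "(cmod (rellich_rhs c A N f (expG v)))\<^sup>2
          = (cmod (ds.div_n2 (ds.euler (ds.euler F)) v + of_real (Q - 2) * ds.div_n2 (ds.euler F) v))\<^sup>2" if "v \<noteq> 0" for v
        unfolding F_def rellich_rhs_eq[OF f that] ..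
    qed
    show "L2_norm \<mu> (rellich_lhs N f) = sqrt \<kappa> * sqrt (LINT v|lborel. (cmod (ds.div_n2 (\<lambda>v. f (expG v)) v))\<^sup>2)"
      unfolding L2_norm_def 1[unfolded F_def] by (rule real_sqrt_mult)
    show "L2_norm \<mu> (rellich_rhs c A N f) = sqrt \<kappa> * sqrt (LINT v|lborel. (cmod (ds.div_n2 (ds.euler (ds.euler (\<lambda>v. f (expG v)))) v
      + of_real (Q - 2) * ds.div_n2 (ds.euler (\<lambda>v. f (expG v))) v))\<^sup>2)"
      unfolding L2_norm_def 2[unfolded F_def] by (rule real_sqrt_mult)
  qed
qed

end


section \<open>Inequality, sharpness and equality case carried back to the group\<close>

context homogeneous_norm
begin

lemma rellich_group:
  assumes "haar_measure \<mu>"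
  shows "(\<forall>f\<in>test_functions \<A>.
            L2_norm \<mu> (rellich_lhs N f) \<le> 4 / (Q * (Q - 4)) * L2_norm \<mu> (rellich_rhs c A N f))
       \<and> (\<forall>C. (\<forall>f\<in>test_functions \<A>.
                 L2_norm \<mu> (rellich_lhs N f) \<le> C * L2_norm \<mu> (rellich_rhs c A N f))
               \<longrightarrow> 4 / (Q * (Q - 4)) \<le> C)
       \<and> (\<forall>f\<in>test_functions \<A>.
            L2_norm \<mu> (rellich_lhs N f) = 4 / (Q * (Q - 4)) * L2_norm \<mu> (rellich_rhs c A N f)
            \<longleftrightarrow> f = (\<lambda>_. 0))"
proof -
  define a where "a F = (LINT v|lborel. (cmod (ds.div_n2 F v))\<^sup>2)" for F
  define b where "b F = (LINT v|lborel. (cmod (ds.div_n2 (ds.euler (ds.euler F)) v + of_real (Q - 2) * ds.div_n2 (ds.euler F) v))\<^sup>2)" for F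
  have "\<exists>\<kappa>>0. \<forall>f\<in>test_functions \<A>. L2_norm \<mu> (rellich_lhs N f) = \<kappa> * sqrt (a (\<lambda>v. f (expG v))) \<and>
      L2_norm \<mu> (rellich_rhs c A N f) = \<kappa> * sqrt (b (\<lambda>v. f (expG v)))"
    unfolding a_def b_def by (rule L2_norm_transfer[OF assms])
  then obtain \<kappa> where \<kappa>: "0 < \<kappa>"
    "\<And>f. f \<in> test_functions \<A> \<Longrightarrow> L2_norm \<mu> (rellich_lhs N f) = \<kappa> * sqrt (a (\<lambda>v. f (expG v)))"
    "\<And>f. f \<in> test_functions \<A> \<Longrightarrow> L2_norm \<mu> (rellich_rhs c A N f) = \<kappa> * sqrt (b (\<lambda>v. f (expG v)))"
    by blast
  define k where "k = Q * (Q - 4) / 4"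
  have k: "0 < k" "4 / (Q * (Q - 4)) = 1 / k" using Q4 by (simp_all add: k_def)
  have a0: "0 \<le> a F" and b0: "0 \<le> b F" for F by (simp_all add: a_def b_def)
  define Tu where "Tu F v = ds.div_n2 (ds.euler F) v + of_real (Q / 2 - 2) * ds.div_n2 F v" for F v
  \<comment> \<open>Of the two nonnegative terms in the Rellich identity, that of T g is dropped and
    that of T u is kept for the equality case.\<close>
  have est: "(Q / 2 - 2)\<^sup>2 * (LINT v|lborel. (cmod (Tu F v))\<^sup>2) + k\<^sup>2 * a F \<le> b F" if "ds.test_fun F" for F
    unfolding a_def b_def k_def Tu_def ds.rellich_identity[OF that] by simp
  have tu0: "0 \<le> (Q / 2 - 2)\<^sup>2 * (LINT v|lborel. (cmod (Tu F v))\<^sup>2)" for F by simp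
  have le: "sqrt (a F) \<le> 1 / k * sqrt (b F)" if "ds.test_fun F" for F
  proof -
    have "k\<^sup>2 * a F \<le> b F" using est[OF that] tu0[of F] by linarith
    then have "sqrt (k\<^sup>2 * a F) \<le> sqrt (b F)" by (rule real_sqrt_le_mono)
    then show ?thesis using k(1) by (simp add: real_sqrt_mult field_simps)
  qed
  \<comment> \<open>Equality leaves no room for the term of T u, whose coefficient (Q / 2 - 2)^2 is
    positive; so u lies in the kernel of T.\<close>
  have eq: "F v = 0" if F: "ds.test_fun F" and e: "sqrt (a F) = 1 / k * sqrt (b F)" for F v
  proof (rule ds.skew_kernel[OF F])
    fix v
    have "sqrt (k\<^sup>2 * a F) = sqrt (b F)" using e k(1) by (simp add: real_sqrt_mult)
    then have "k\<^sup>2 * a F = b F" by simp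
    then have "(Q / 2 - 2)\<^sup>2 * (LINT v|lborel. (cmod (Tu F v))\<^sup>2) = 0" using est[OF F] tu0[of F] by linarith
    then have z: "(LINT v|lborel. (cmod (Tu F v))\<^sup>2) = 0" using Q4 by simp
    have "compactly_supported (Tu F)" unfolding Tu_def
      by (intro compactly_supported_add compactly_supported_cmult ds.compactly_supported_div_n2 ds.test_fun_euler F)
    from compactly_supported_integral_zero[OF this z] show "ds.div_n2 (ds.euler F) v + of_real (Q / 2 - 2) * ds.div_n2 F v = 0" by (simp add: Tu_def)
  qed
  show ?thesis
    unfolding k(2)
  proof (intro conjI ballI allI impI)
    fix f assume f: "f \<in> test_functions \<A>"
    note F = test_functions_pull[OF f]
    show "L2_norm \<mu> (rellich_lhs N f) \<le> 1 / k * L2_norm \<mu> (rellich_rhs c A N f)"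
      using mult_left_mono[OF le[OF F] less_imp_le[OF \<kappa>(1)]] unfolding \<kappa>(2,3)[OF f] by (simp add: mult_ac)
    show "L2_norm \<mu> (rellich_lhs N f) = 1 / k * L2_norm \<mu> (rellich_rhs c A N f) \<longleftrightarrow> f = (\<lambda>_. 0)"
    proof
      assume "L2_norm \<mu> (rellich_lhs N f) = 1 / k * L2_norm \<mu> (rellich_rhs c A N f)"
      then have "\<kappa> * sqrt (a (\<lambda>v. f (expG v))) = \<kappa> * (1 / k * sqrt (b (\<lambda>v. f (expG v))))"
        unfolding \<kappa>(2,3)[OF f] by (simp only: mult.left_commute)
      then have "sqrt (a (\<lambda>v. f (expG v))) = 1 / k * sqrt (b (\<lambda>v. f (expG v)))"
        using \<kappa>(1) mult_left_cancel[of \<kappa>] by blast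
      note z = eq[OF F this]
      show "f = (\<lambda>_. 0)" by (rule ext) (use z[of "logG _"] in \<open>simp only: expG_logG\<close>)
    next
      assume z: "f = (\<lambda>_. 0)"
      have E0: "ds.euler (\<lambda>v. 0) = (\<lambda>v. 0)" by (rule ext) (simp add: ds.euler_def)
      have "a (\<lambda>v. f (expG v)) = 0" "b (\<lambda>v. f (expG v)) = 0" by (simp_all add: a_def b_def z E0 ds.div_n2_def)
      then show "L2_norm \<mu> (rellich_lhs N f) = 1 / k * L2_norm \<mu> (rellich_rhs c A N f)"
        unfolding \<kappa>(2,3)[OF f] by simp
    qed
  next
    fix C assume C: "\<forall>f\<in>test_functions \<A>. L2_norm \<mu> (rellich_lhs N f) \<le> C * L2_norm \<mu> (rellich_rhs c A N f)"
    show "1 / k \<le> C"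
      unfolding k(2)[symmetric]
    proof (rule ds.rellich_sharp)
      fix F assume F: "ds.test_fun F"
      \<comment> \<open>Every test function on the Lie algebra comes from one on the group, so a
        constant valid on the group is subject to the bound found there.\<close>
      note f = test_functions_push[OF F]
      have "\<kappa> * sqrt (a F) \<le> C * (\<kappa> * sqrt (b F))"
        using bspec[OF C f] unfolding \<kappa>(2,3)[OF f] by (simp only: logG_expG)
      then have "\<kappa> * sqrt (a F) \<le> \<kappa> * (C * sqrt (b F))" by (simp only: mult.left_commute)
      then have "sqrt (a F) \<le> C * sqrt (b F)" using \<kappa>(1) mult_le_cancel_left_pos by blast
      then show "sqrt (LINT v|lborel. (cmod (ds.div_n2 F v))\<^sup>2)
        \<le> C * sqrt (LINT v|lborel. (cmod (ds.div_n2 (ds.euler (ds.euler F)) v + of_real (Q - 2) * ds.div_n2 (ds.euler F) v))\<^sup>2)"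
        by (simp only: a_def b_def)
    qed
  qed
qed

end

theorem corollary5p2:
  fixes \<A> :: "('g::{topological_group_add, t2_space, second_countable_topology},
                'a::euclidean_space) chart set"
    and c :: "('g, 'a) chart" and A :: "'a \<Rightarrow> 'a"
    and N :: "'g \<Rightarrow> real" and \<mu> :: "'g measure" and Q :: real
  assumes "homogeneous_group \<A> c A"
    and "Q = homogeneous_dim A" and "Q \<ge> 5"
    and "homogeneous_quasi_norm c A N"
    and "haar_measure \<mu>"
  shows "(\<forall>f\<in>test_functions \<A>.
            L2_norm \<mu> (rellich_lhs N f) \<le> 4 / (Q * (Q - 4)) * L2_norm \<mu> (rellich_rhs c A N f))
       \<and> (\<forall>C. (\<forall>f\<in>test_functions \<A>.
                 L2_norm \<mu> (rellich_lhs N f) \<le> C * L2_norm \<mu> (rellich_rhs c A N f))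
               \<longrightarrow> 4 / (Q * (Q - 4)) \<le> C)
       \<and> (\<forall>f\<in>test_functions \<A>.
            L2_norm \<mu> (rellich_lhs N f) = 4 / (Q * (Q - 4)) * L2_norm \<mu> (rellich_rhs c A N f)
            \<longleftrightarrow> f = (\<lambda>_. 0))"
  proof -
  have H: "lie_group \<A>" "connected (UNIV :: 'g set)" "simply_connected (UNIV :: 'g set)"
    "c \<in> \<A>" "0 \<in> chart_dom c" "diagonalisable_pos A"
    and D: "\<And>h. 0 < h \<Longrightarrow> lie_algebra_morphism \<A> c (dilation_alg A h)"
    using assms(1) unfolding homogeneous_group_def by blast+
  obtain P P' wt where "eigen_basis A P P' wt" using eigen_basis_exists[OF H(6)] by blast
  then have "homogeneous_chart \<A> c A P P' wt"
    by (intro homogeneous_chart.intro lie_chart.intro homogeneous_chart_axioms.intro H D)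
  then have "homogeneous_norm \<A> c A P P' wt N Q"
    by (rule homogeneous_norm.intro) (rule homogeneous_norm_axioms.intro, use assms(2-4) in simp_all)
  then show ?thesis by (rule homogeneous_norm.rellich_group[OF _ assms(5)])
qed

end
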